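(* Let $d=3$ and let $\varepsilon$ run through a sequence of positive numbers tending to $0$ with $\varepsilon^{-1}\in\mathbb{N}$. Let $a^\varepsilon$ be the conductivity of the fiber-reinforced structure defined in the context, with radius parameter $r_\varepsilon$ and fiber conductivity $\beta_\varepsilon$ satisfying $\lim_{\varepsilon\to0}\beta_\varepsilon r_\varepsilon^2=\infty$, and assume that $$\lim_{\varepsilon\to 0}\left(\frac{1}{2\pi\,\varepsilon^2|\ln r_\varepsilon|}\right)=\gamma\in(0,\infty).$$ Then the first Bloch eigenvalue $\lambda_1^\varepsilon(\eta)$ associated with $a^\varepsilon$ satisfies, for any $\eta=(\eta_1,\eta_2,\eta_3)\in\mathbb{R}^3$ with $\eta_3\notin\mathbb{Z}$, $$\lim_{\varepsilon\to 0}\lambda_1^\varepsilon(\eta)=\gamma+\min\left\{\int_Y|\nabla\psi|^2\,dx\;:\;\psi\in H^1_\eta(Y;\mathbb{C})\text{ and }\int_Y|\psi|^2\,dx=1\right\},$$ and for $|\eta|\le\frac12$ with $\eta_3\ne0$, $$\lim_{\varepsilon\to 0}\lambda_1^\varepsilon(\eta)=\gamma+|\eta|^2.$$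
   Context: Notation. $Y:=(0,2\pi)^3$, $(e_1,e_2,e_3)$ is the canonical basis of $\mathbb{R}^3$. $H^1_\sharp(Y;\mathbb{C})$ is the space of $Y$-periodic (i.e. $2\pi$-periodic in each variable) functions in $H^1_{\rm loc}(\mathbb{R}^3;\mathbb{C})$. For $\eta\in\mathbb{R}^3$, $H^1_\eta(Y;\mathbb{C})$ is the space of functions $\psi$ such that $x\mapsto e^{-i\,x\cdot\eta}\psi(x)$ belongs to $H^1_\sharp(Y;\mathbb{C})$. Fiber structure. $\omega^\varepsilon\subset Y$ is the $\varepsilon Y$-periodic lattice composed of $\varepsilon^{-2}$ circular cylinders of axes $$\big(2\pi k_1\varepsilon+\pi\varepsilon,\,2\pi k_2\varepsilon+\pi\varepsilon,\,0\big)+\mathbb{R}\,e_3,\qquad (k_1,k_2)\in\{0,\dots,\varepsilon^{-1}-1\}^2,$$ of length $2\pi$ (i.e. restricted to $0<x_3<2\pi$), and of radius $\varepsilon r_\varepsilon$, where $0<r_\varepsilon<\pi$ (so that the cylinders are disjoint and contained in $Y$). Conductivity. $a^\varepsilon$ is the isotropic (scalar) function $$a^\varepsilon(x):=\beta_\varepsilon\ \text{ if }x\in\omega^\varepsilon,\qquad a^\varepsilon(x):=1\ \text{ if }x\in Y\setminus\omega^\varepsilon,$$ extended periodically, where $\beta_\varepsilon>0$ and $\beta_\varepsilon r_\varepsilon^2\to\infty$ as $\varepsilon\to0$. First Bloch eigenvalue. For $\eta\in\mathbb{R}^3$, $$\lambda_1^\varepsilon(\eta):=\min\left\{\int_Y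 a^\varepsilon\nabla\psi\cdot\nabla\overline\psi\,dx\;:\;\psi\in H^1_\eta(Y;\mathbb{C}),\ \int_Y|\psi|^2dx=1\right\}.$$ *)

theory Defs
  imports "HOL-Analysis.Analysis"
begin

definition cell :: "(real^3) set" where
  "cell = {x. \<forall>i. 0 < x $ i \<and> x $ i < 2 * pi}"

definition partial_deriv :: "3 \<Rightarrow> (real^3 \<Rightarrow> real) \<Rightarrow> real^3 \<Rightarrow> real" where
  "partial_deriv j \<phi> = (\<lambda>x. frechet_derivative \<phi> (at x) (axis j 1))"

primrec cont_diff :: "nat \<Rightarrow> (real^3 \<Rightarrow> real) \<Rightarrow> bool" where
  "cont_diff 0 \<phi> \<longleftrightarrow> continuous_on UNIV \<phi>"
| "cont_diff (Suc k) \<phi> \<longleftrightarrow>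
     (\<forall>x. \<phi> differentiable (at x)) \<and> (\<forall>j. cont_diff k (partial_deriv j \<phi>))"

definition test_function :: "(real^3 \<Rightarrow> real) \<Rightarrow> bool" where
  "test_function \<phi> \<longleftrightarrow> (\<forall>k. cont_diff k \<phi>) \<and> compact (closure {x. \<phi> x \<noteq> 0})"

text \<open>
  Elements of Lebesgue and Sobolev spaces are represented by Borel functions
  on the whole space; they are not quotiented by equality almost everywhere.
\<close>

definition L2_loc :: "(real^3 \<Rightarrow> 'b::real_normed_vector) set" where
  "L2_loc = {f. f \<in> borel_measurable borel \<and>
     (\<forall>K. compact K \<longrightarrow> set_integrable lborel K (\<lambda>x. (norm (f x))\<^sup>2))}"

text \<open>
  Real-valued test functions suffice, the integration by parts formula being
  linear in \<open>\<phi>\<close>. The field \<open>g\<close> is determined by \<open>f\<close> up to a null set.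
\<close>

definition has_weak_gradient :: "(real^3 \<Rightarrow> complex) \<Rightarrow> (real^3 \<Rightarrow> complex^3) \<Rightarrow> bool" where
  "has_weak_gradient f g \<longleftrightarrow> f \<in> L2_loc \<and> g \<in> L2_loc \<and>
     (\<forall>\<phi> j. test_function \<phi> \<longrightarrow>
        (LINT x|lborel. of_real (partial_deriv j \<phi> x) * f x) =
        - (LINT x|lborel. of_real (\<phi> x) * (g x $ j)))"

definition H1_loc :: "(real^3 \<Rightarrow> complex) set" where
  "H1_loc = {f. \<exists>g. has_weak_gradient f g}"

definition H1_per :: "(real^3 \<Rightarrow> complex) set" where
  "H1_per = {f \<in> H1_loc. \<forall>j. AE x in lborel. f (x + axis j (2 * pi)) = f x}"

definition H1_Bloch :: "real^3 \<Rightarrow> (real^3 \<Rightarrow> complex) set" where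
  "H1_Bloch \<eta> = {\<psi>. (\<lambda>x. exp (- \<i> * of_real (x \<bullet> \<eta>)) * \<psi> x) \<in> H1_per}"

definition fibers :: "real \<Rightarrow> real \<Rightarrow> (real^3) set" where
  "fibers \<epsilon> \<rho> = {x \<in> cell. \<exists>k1 k2 :: nat. real k1 \<le> 1 / \<epsilon> - 1 \<and> real k2 \<le> 1 / \<epsilon> - 1 \<and>
     (x $ 1 - (2 * pi * real k1 * \<epsilon> + pi * \<epsilon>))\<^sup>2 +
     (x $ 2 - (2 * pi * real k2 * \<epsilon> + pi * \<epsilon>))\<^sup>2 \<le> (\<epsilon> * \<rho>)\<^sup>2}"

text \<open>
  The periodic extension from the open cell is completed by the value 1 on the
  null set formed by the translated faces of the cell.
\<close>

definition conductivity :: "real \<Rightarrow> real \<Rightarrow> real \<Rightarrow> real^3 \<Rightarrow> real" where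
  "conductivity \<epsilon> \<rho> b x =
     (if \<exists>k :: int^3. x - (\<chi> i. 2 * pi * of_int (k $ i)) \<in> fibers \<epsilon> \<rho> then b else 1)"

text \<open>
  Minima are rendered by \<open>LEAST\<close>, which on the reals is a meaningful value only if the
  minimum is attained. The squared norm of \<open>g x\<close> in \<open>complex^3\<close> is the Hermitian one.
\<close>

definition Bloch_eigenvalue1 :: "(real^3 \<Rightarrow> real) \<Rightarrow> real^3 \<Rightarrow> real" where
  "Bloch_eigenvalue1 a \<eta> =
     (LEAST m. m \<in> {(LINT x:cell|lborel. a x * (norm (g x))\<^sup>2) | \<psi> g.
        \<psi> \<in> H1_Bloch \<eta> \<and> has_weak_gradient \<psi> g \<and>
        (LINT x:cell|lborel. (cmod (\<psi> x))\<^sup>2) = 1})"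

end

theory Submission
  imports Defs "HOL-Real_Asymp.Real_Asymp" "HOL-Library.Diagonal_Subsequence"
begin

text \<open>
  Functions in \<open>H\<^sup>1\<^sub>\<eta>\<close> are described by their coefficients along the plane waves with wave vectors
  \<open>\<eta> + k\<close>, the weak derivative in direction \<open>j\<close> being multiplication by \<open>\<i> (\<eta> + k)\<^sub>j\<close>. The homogeneous minimum
  is thus the least value of \<open>\<bar>\<eta> + k\<bar>\<^sup>2\<close>, and the embedding into \<open>L\<^sup>2\<close> is compact.

  With \<open>N = 1 / \<epsilon>\<close>, the function \<open>\<sigma> = 4 + 2 cos (N x\<^sub>1) + 2 cos (N x\<^sub>2)\<close> vanishes exactly on the fiber axes
  and behaves near them like the square of \<open>N\<close> times the distance. Hence
  \<open>w = ln (max \<sigma> \<rho>\<^sup>2 / \<rho>\<^sup>2) / (2 \<bar>ln \<rho>\<bar>)\<close> is an explicit substitute for the capacitary potential of the fibers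
  if \<open>\<rho>\<close> is comparable with \<open>r\<close>. A plane wave multiplied by \<open>w\<close> vanishes on the fibers, and the
  energy of \<open>w\<close> supplies the additional term \<open>\<gamma>\<close> of the upper bound.

  For the lower bound, bounded energy makes \<open>\<beta>\<close> times the squared norm of \<open>\<partial>\<^sub>3 \<psi>\<close> on the fibers bounded. As \<open>\<eta>\<^sub>3\<close> is
  not an integer, a Poincare inequality along the axes makes \<open>\<psi>\<close> small there, because \<open>\<beta> r\<^sup>2\<close> tends
  to infinity. The divergence of the flux \<open>p\<close> (the gradient of \<open>w\<close>, extended into the tubes by a Lipschitz field) is a density
  concentrated on tubes inside the fibers, where \<open>\<psi>\<close> is negligible, minus an oscillating density of
  mean \<open>\<gamma>\<close>. Bounding the energy from below by its tangent at \<open>\<nabla>\<phi> + p \<phi>\<close>, for a partial Fourier sum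
  \<open>\<phi>\<close> of the limit, therefore gives the energy of \<open>\<phi>\<close> plus \<open>\<gamma>\<close> times its squared norm.
\<close>

section \<open>Test functions and smooth windows\<close>

text \<open>The choice of \<sigma> rests on an algebraic identity. With
  \<open>a = 2 + 2 cos (N x1)\<close> and \<open>b = 2 + 2 cos (N x2)\<close> one has
  \<open>\<sigma> = a + b\<close>, and off the axes the Laplacian of \<open>ln \<sigma>\<close> is
  \<open>- 2 N^2 a b / \<sigma>^2\<close>, at most \<open>N^2 / 2\<close> in modulus however close
  to the axes. A globally periodic logarithm thus replaces the usual potential, glued from a
  logarithm in an annulus and a constant, and no interface inside the microscopic cell arises except
  the tube itself. Divided by \<open>|ln \<rho>|\<close>, the Laplacian keeps the order of
  \<open>N^2 / |ln \<rho>|\<close>, whose limit is \<open>2 * pi * \<gamma>\<close>. Only the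
  logarithm of \<rho> enters the limit, so \<rho> may differ from \<open>r\<close> by a factor: it
  exceeds \<open>r\<close> in the upper bound, so that trial functions vanish on the fibers, and is
  below \<open>r / 3\<close> in the lower bound, so that the tubes lie inside the fibers. Off the
  level set \<open>\<sigma> = \<rho>^2\<close> the truncation has explicit derivatives; a generic
  \<rho> makes that set null. Two features of the definitions shape the preparations: periodicity is
  imposed on a Bloch function but not on its weak gradient, and \<open>LEAST\<close> requires minima
  to be attained.\<close>

lemma cont_diff_Suc_imp: "cont_diff (Suc k) \<phi> \<Longrightarrow> cont_diff k \<phi>"
proof (induction k arbitrary: \<phi>)
  case 0
  then show ?case
    by (auto simp: continuous_on_eq_continuous_at differentiable_imp_continuous_within)
next
  case (Suc k)
  then show ?case by auto
qed

lemma partial_deriv_add: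
  assumes "\<And>x. f differentiable (at x)" "\<And>x. g differentiable (at x)"
  shows "partial_deriv j (\<lambda>x. f x + g x) = (\<lambda>x. partial_deriv j f x + partial_deriv j g x)"
proof
  fix x
  have "((\<lambda>x. f x + g x) has_derivative
      (\<lambda>h. frechet_derivative f (at x) h + frechet_derivative g (at x) h)) (at x)"
    using assms[of x] by (intro has_derivative_add) (simp_all add: frechet_derivative_works)
  then show "partial_deriv j (\<lambda>x. f x + g x) x = partial_deriv j f x + partial_deriv j g x"
    unfolding partial_deriv_def by (subst frechet_derivative_at[symmetric], assumption) simp
qed

lemma partial_deriv_mult:
  assumes "\<And>x. f differentiable (at x)" "\<And>x. g differentiable (at x)"
  shows "partial_deriv j (\<lambda>x. f x * g x) = (\<lambda>x. partial_deriv j f x * g x + f x * partial_deriv j g x)"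
proof
  fix x
  have "((\<lambda>x. f x * g x) has_derivative
      (\<lambda>h. f x * frechet_derivative g (at x) h + frechet_derivative f (at x) h * g x)) (at x)"
    using assms[of x] by (intro has_derivative_mult) (simp_all add: frechet_derivative_works)
  then show "partial_deriv j (\<lambda>x. f x * g x) x = partial_deriv j f x * g x + f x * partial_deriv j g x"
    unfolding partial_deriv_def by (subst frechet_derivative_at[symmetric], assumption) simp
qed

lemma cont_diff_add: "cont_diff k f \<Longrightarrow> cont_diff k g \<Longrightarrow> cont_diff k (\<lambda>x. f x + g x)"
proof (induction k arbitrary: f g)
  case 0
  then show ?case by (auto intro: continuous_intros)
next
  case (Suc k)
  then show ?case by (auto simp: partial_deriv_add)
qed

lemma cont_diff_mult: "cont_diff k f \<Longrightarrow> cont_diff k g \<Longrightarrow> cont_diff k (\<lambda>x. f x * g x)"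
proof (induction k arbitrary: f g)
  case 0
  then show ?case by (auto intro: continuous_intros)
next
  case (Suc k)
  have fg: "cont_diff k f" "cont_diff k g"
    using Suc.prems by (blast intro: cont_diff_Suc_imp)+
  show ?case using Suc.prems fg
    by (auto simp: partial_deriv_mult intro!: cont_diff_add Suc.IH)
qed

lemma partial_deriv_eqI:
  "((\<lambda>x. f x) has_derivative f') (at x) \<Longrightarrow> partial_deriv j f x = f' (axis j 1)"
  unfolding partial_deriv_def by (subst frechet_derivative_at[symmetric]) auto

lemma cont_diff_const: "cont_diff k (\<lambda>x. c)"
proof (induction k arbitrary: c)
  case 0
  then show ?case by simp
next
  case (Suc k)
  have "partial_deriv j (\<lambda>x. c) = (\<lambda>x. 0)" for j
    by (rule ext, subst partial_deriv_eqI[where f'="\<lambda>_. 0"]) auto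
  then show ?case using Suc by auto
qed

lemma cont_diff_cos_sin:
  fixes \<kappa> :: "real^3"
  shows "cont_diff k (\<lambda>x. cos (x \<bullet> \<kappa>)) \<and> cont_diff k (\<lambda>x. sin (x \<bullet> \<kappa>))"
proof (induction k)
  case 0
  then show ?case by (auto intro!: continuous_intros)
next
  case (Suc k)
  have dc: "((\<lambda>x. cos (x \<bullet> \<kappa>)) has_derivative (\<lambda>h. - sin (x \<bullet> \<kappa>) * (h \<bullet> \<kappa>))) (at x)" for x
    by (auto intro!: derivative_eq_intros)
  have ds: "((\<lambda>x. sin (x \<bullet> \<kappa>)) has_derivative (\<lambda>h. cos (x \<bullet> \<kappa>) * (h \<bullet> \<kappa>))) (at x)" for x
    by (auto intro!: derivative_eq_intros)
  have pc: "partial_deriv j (\<lambda>x. cos (x \<bullet> \<kappa>)) = (\<lambda>x. (- \<kappa> $ j) * sin (x \<bullet> \<kappa>))" for j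
    by (rule ext, subst partial_deriv_eqI[OF dc]) (simp add: inner_axis' mult.commute)
  have ps: "partial_deriv j (\<lambda>x. sin (x \<bullet> \<kappa>)) = (\<lambda>x. (\<kappa> $ j) * cos (x \<bullet> \<kappa>))" for j
    by (rule ext, subst partial_deriv_eqI[OF ds]) (simp add: inner_axis' mult.commute)
  show ?case
    unfolding cont_diff.simps pc ps using dc ds Suc
    by (intro conjI allI cont_diff_mult cont_diff_const) (auto simp: differentiable_def)
qed

section \<open>Smooth functions of one real variable\<close>

primrec smooth1_upto :: "nat \<Rightarrow> (real \<Rightarrow> real) \<Rightarrow> bool" where
  "smooth1_upto 0 s \<longleftrightarrow> True"
| "smooth1_upto (Suc k) s \<longleftrightarrow>
     (\<exists>s'. (\<forall>t. (s has_real_derivative s' t) (at t)) \<and> smooth1_upto k s')"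

definition smooth1 :: "(real \<Rightarrow> real) \<Rightarrow> bool" where
  "smooth1 s \<longleftrightarrow> (\<forall>k. smooth1_upto k s)"

lemma smooth1_upto_Suc_imp: "smooth1_upto (Suc k) s \<Longrightarrow> smooth1_upto k s"
proof (induction k arbitrary: s)
  case (Suc k)
  then show ?case by (metis smooth1_upto.simps(2))
qed simp

text \<open>Each order supplies its own derivative; uniqueness of derivatives identifies them, so
  that one and the same derivative is smooth to all orders.\<close>

lemma smooth1_deriv:
  assumes "smooth1 s"
  obtains s' where "\<And>t. (s has_real_derivative s' t) (at t)" "smooth1 s'"
proof -
  have *: "\<exists>s'. (\<forall>t. (s has_real_derivative s' t) (at t)) \<and> smooth1_upto k s'" for k
    using assms unfolding smooth1_def by (metis smooth1_upto.simps(2))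
  obtain s' where s': "\<forall>t. (s has_real_derivative s' t) (at t)"
    using *[of 0] by blast
  have "smooth1_upto k s'" for k
  proof -
    obtain u where u: "\<forall>t. (s has_real_derivative u t) (at t)" "smooth1_upto k u"
      using *[of k] by blast
    then have "u = s'" using s' DERIV_unique by blast
    then show ?thesis using u by simp
  qed
  then show thesis using s' by (intro that) (auto simp: smooth1_def)
qed

lemma smooth1_upto_const: "smooth1_upto k (\<lambda>t. c)"
proof (induction k arbitrary: c)
  case (Suc k)
  show ?case using Suc[of 0] by (auto intro!: exI[of _ "\<lambda>_. 0"])
qed simp

lemma smooth1_upto_add: "smooth1_upto k f \<Longrightarrow> smooth1_upto k g \<Longrightarrow> smooth1_upto k (\<lambda>t. f t + g t)"
proof (induction k arbitrary: f g)
  case (Suc k)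
  obtain f' g' where "\<forall>t. (f has_real_derivative f' t) (at t)" "smooth1_upto k f'"
    "\<forall>t. (g has_real_derivative g' t) (at t)" "smooth1_upto k g'"
    using Suc.prems by auto
  then show ?case using Suc.IH[of f' g']
    by (auto intro!: exI[of _ "\<lambda>t. f' t + g' t"] derivative_eq_intros)
qed simp

lemma smooth1_upto_mult: "smooth1_upto k f \<Longrightarrow> smooth1_upto k g \<Longrightarrow> smooth1_upto k (\<lambda>t. f t * g t)"
proof (induction k arbitrary: f g)
  case (Suc k)
  obtain f' g' where *: "\<forall>t. (f has_real_derivative f' t) (at t)" "smooth1_upto k f'"
    "\<forall>t. (g has_real_derivative g' t) (at t)" "smooth1_upto k g'"
    using Suc.prems by auto
  have "smooth1_upto k (\<lambda>t. f' t * g t + f t * g' t)"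
    using * Suc.prems[THEN smooth1_upto_Suc_imp] by (intro smooth1_upto_add Suc.IH)
  then show ?case using *
    by (auto intro!: exI[of _ "\<lambda>t. f' t * g t + f t * g' t"] derivative_eq_intros)
qed simp

lemma smooth1_upto_inverse:
  "smooth1_upto k f \<Longrightarrow> (\<And>t. f t \<noteq> 0) \<Longrightarrow> smooth1_upto k (\<lambda>t. inverse (f t))"
proof (induction k arbitrary: f)
  case (Suc k)
  obtain f' where *: "\<forall>t. (f has_real_derivative f' t) (at t)" "smooth1_upto k f'"
    using Suc.prems by auto
  have "smooth1_upto k (\<lambda>t. (- 1) * (f' t * (inverse (f t) * inverse (f t))))"
    using * Suc.prems(2) Suc.prems(1)[THEN smooth1_upto_Suc_imp]
    by (intro smooth1_upto_mult Suc.IH smooth1_upto_const)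
  then show ?case using * Suc.prems(2)
    by (auto intro!: exI[of _ "\<lambda>t. - (f' t * (inverse (f t) * inverse (f t)))"] derivative_eq_intros)
qed simp

lemma smooth1_upto_affine: "smooth1_upto k s \<Longrightarrow> smooth1_upto k (\<lambda>t. s (a * t + b))"
proof (induction k arbitrary: s)
  case (Suc k)
  obtain s' where *: "\<forall>t. (s has_real_derivative s' t) (at t)" "smooth1_upto k s'"
    using Suc.prems by auto
  have "smooth1_upto k (\<lambda>t. s' (a * t + b) * a)"
    by (rule smooth1_upto_mult[OF Suc.IH[OF *(2)] smooth1_upto_const])
  moreover have "((\<lambda>t. s (a * t + b)) has_real_derivative s' (a * t + b) * a) (at t)" for t
    by (rule DERIV_chain2[where f=s]) (use * in \<open>auto intro!: derivative_eq_intros\<close>)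
  ultimately show ?case by (auto intro!: exI[of _ "\<lambda>t. s' (a * t + b) * a"])
qed simp

lemma tendsto_poly_times_exp_neg:
  "((\<lambda>u. poly p u * exp (- u)) \<longlongrightarrow> (0::real)) at_top"
proof -
  have "((\<lambda>u. \<Sum>i\<le>degree p. coeff p i * (u ^ i / exp u)) \<longlongrightarrow> (\<Sum>i\<le>degree p. coeff p i * 0)) at_top"
    by (intro tendsto_sum tendsto_mult tendsto_const tendsto_power_div_exp_0)
  then show ?thesis
    by (simp add: poly_altdef exp_minus sum_distrib_right divide_inverse mult.assoc)
qed

text \<open>The classical flat function is the case \<open>p = 1\<close>. Carrying a polynomial in
  \<open>1 / t\<close> makes the family closed under differentiation, so that smoothness becomes an
  induction on the order.\<close>

definition flat_exp :: "real poly \<Rightarrow> real \<Rightarrow> real" where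
  "flat_exp p t = (if t > 0 then poly p (1 / t) * exp (- (1 / t)) else 0)"

text \<open>With \<open>u = 1 / t\<close> and \<open>du/dt = - u^2\<close>, the derivative of
  \<open>p(u) exp (- u)\<close> is \<open>u^2 (p - p')(u) exp (- u)\<close>.\<close>

lemma flat_exp_deriv:
  "(flat_exp p has_real_derivative flat_exp ([:0, 0, 1:] * (p - pderiv p)) t) (at t)"
proof -
  consider "t > 0" | "t < 0" | "t = 0" by linarith
  then show ?thesis
  proof cases
    case 1
    have "((\<lambda>t. poly p (1 / t) * exp (- (1 / t))) has_real_derivative
        flat_exp ([:0, 0, 1:] * (p - pderiv p)) t) (at t)"
      using 1 by (auto intro!: derivative_eq_intros DERIV_chain2[OF poly_DERIV]
          simp: flat_exp_def power2_eq_square field_simps)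
    then show ?thesis
      by (rule has_field_derivative_transform_within_open[where S="{0<..}"])
        (use 1 in \<open>auto simp: flat_exp_def\<close>)
  next
    case 2
    have "((\<lambda>t. 0) has_real_derivative flat_exp ([:0, 0, 1:] * (p - pderiv p)) t) (at t)"
      using 2 by (simp add: flat_exp_def)
    then show ?thesis
      by (rule has_field_derivative_transform_within_open[where S="{..<0}"])
        (use 2 in \<open>auto simp: flat_exp_def\<close>)
  next
    case 3
    have "((\<lambda>h. flat_exp p h / h) \<longlongrightarrow> 0) (at_right 0)"
    proof -
      \<comment> \<open>The difference quotient at 0 equals \<open>u p(u) exp (- u)\<close> with
        \<open>u = 1 / h\<close>, and the exponential beats the polynomial.\<close>
      have "((\<lambda>h. poly ([:0, 1:] * p) (inverse h) * exp (- inverse h)) \<longlongrightarrow> 0) (at_right 0)"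
        by (rule filterlim_compose[OF tendsto_poly_times_exp_neg filterlim_inverse_at_top_right])
      then show ?thesis
        by (rule Lim_transform_eventually)
          (auto simp: flat_exp_def eventually_at_filter divide_inverse)
    qed
    moreover have "((\<lambda>h. flat_exp p h / h) \<longlongrightarrow> 0) (at_left 0)"
      by (rule Lim_transform_eventually[OF tendsto_const])
        (auto simp: flat_exp_def eventually_at_filter)
    ultimately show ?thesis
      using 3 by (auto simp: DERIV_def flat_exp_def filterlim_split_at)
  qed
qed

lemma smooth1_flat_exp: "smooth1_upto k (flat_exp p)"
proof (induction k arbitrary: p)
  case (Suc k)
  then show ?case using flat_exp_deriv by auto
qed simp

text \<open>A smooth step across the unit interval; the denominator is positive because
  \<open>t\<close> and \<open>1 - t\<close> are never both nonpositive. The form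
  \<open>(- 1) * t + 1\<close> is that of \<open>smooth1_upto_affine\<close>.\<close>

definition smooth_step :: "real \<Rightarrow> real" where
  "smooth_step t = flat_exp 1 t * inverse (flat_exp 1 t + flat_exp 1 ((- 1) * t + 1))"

lemma flat_exp_1_nonneg: "flat_exp 1 t \<ge> 0"
  by (simp add: flat_exp_def)

lemma smooth_step_denom_pos: "flat_exp 1 t + flat_exp 1 ((- 1) * t + 1) > 0"
  by (cases "t > 0") (auto simp: flat_exp_def add_pos_pos)

lemma smooth1_smooth_step: "smooth1_upto k smooth_step"
proof -
  have "smooth1_upto k (\<lambda>t. flat_exp 1 t * inverse (flat_exp 1 t + flat_exp 1 ((- 1) * t + 1)))"
    by (rule smooth1_upto_mult[OF smooth1_flat_exp smooth1_upto_inverse[OF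
          smooth1_upto_add[OF smooth1_flat_exp smooth1_upto_affine[OF smooth1_flat_exp]]
          less_imp_neq[OF smooth_step_denom_pos, symmetric]]])
  then show ?thesis by (simp add: smooth_step_def[abs_def])
qed

lemma smooth_step_0: "t \<le> 0 \<Longrightarrow> smooth_step t = 0"
  by (simp add: smooth_step_def flat_exp_def)

lemma smooth_step_1: "t \<ge> 1 \<Longrightarrow> smooth_step t = 1"
  by (simp add: smooth_step_def flat_exp_def)

lemma smooth_step_bounds: "0 \<le> smooth_step t" "smooth_step t \<le> 1"
  using smooth_step_denom_pos[of t] flat_exp_1_nonneg[of t] flat_exp_1_nonneg[of "(- 1) * t + 1"]
  by (simp_all add: smooth_step_def field_simps)

lemma cont_diff_coord: "smooth1 s \<Longrightarrow> cont_diff k (\<lambda>x. s (x $ i))"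
proof (induction k arbitrary: s)
  case 0
  obtain s' where s': "\<And>t. (s has_real_derivative s' t) (at t)"
    using smooth1_deriv[OF 0] by blast
  have "continuous_on UNIV s"
    using s' by (auto simp: continuous_on_eq_continuous_at intro: DERIV_isCont)
  then show ?case
    by (auto intro!: continuous_on_compose2[of UNIV s] continuous_intros)
next
  case (Suc k)
  obtain s' where s': "\<And>t. (s has_real_derivative s' t) (at t)" "smooth1 s'"
    using smooth1_deriv[OF Suc.prems] by blast
  have d: "((\<lambda>x::real^3. s (x $ i)) has_derivative (\<lambda>h. s' (x $ i) * h $ i)) (at x)" for x
    by (rule has_derivative_compose[where g=s and g'="(*) (s' (x $ i))" and f="\<lambda>x. x $ i"])
      (use s'(1)[of "x $ i"] in \<open>auto simp: has_field_derivative_def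
        intro!: bounded_linear_imp_has_derivative bounded_linear_vec_nth\<close>)
  have p: "partial_deriv j (\<lambda>x. s (x $ i)) = (\<lambda>x. (if i = j then 1 else 0) * s' (x $ i))" for j
    by (rule ext, subst partial_deriv_eqI[OF d]) (auto simp: axis_def)
  show ?case
    unfolding cont_diff.simps p using d Suc.IH[OF s'(2)]
    by (intro conjI allI cont_diff_mult cont_diff_const) (auto simp: differentiable_def)
qed

lemma test_function_mult:
  assumes "test_function \<phi>" "\<And>k. cont_diff k f"
  shows "test_function (\<lambda>x. \<phi> x * f x)"
  unfolding test_function_def
proof (intro conjI allI)
  show "cont_diff k (\<lambda>x. \<phi> x * f x)" for k
    using assms by (auto simp: test_function_def intro: cont_diff_mult)
  have "closure {x. \<phi> x * f x \<noteq> 0} \<subseteq> closure {x. \<phi> x \<noteq> 0}"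
    by (rule closure_mono) auto
  then show "compact (closure {x. \<phi> x * f x \<noteq> 0})"
    using assms(1) unfolding test_function_def
    by (meson bounded_subset closure_subset compact_closure compact_imp_bounded order_trans)
qed

lemma test_function_continuous: "test_function \<phi> \<Longrightarrow> continuous_on UNIV \<phi>"
  unfolding test_function_def by (metis cont_diff.simps(1))

lemma test_function_differentiable: "test_function \<phi> \<Longrightarrow> \<phi> differentiable (at x)"
  unfolding test_function_def by (metis cont_diff.simps(2))

lemma test_function_partial_continuous: "test_function \<phi> \<Longrightarrow> continuous_on UNIV (partial_deriv j \<phi>)"
  unfolding test_function_def by (metis cont_diff.simps)

text \<open>A difference of two steep steps one period apart: its translates by the periods
  telescope to 1, and it converges to the indicator of a half-open period. It stands in for the
  indicator of the cell, which is not an admissible test function.\<close>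

definition window1 :: "nat \<Rightarrow> real \<Rightarrow> real" where
  "window1 n t = smooth_step (real (Suc n) * t) - smooth_step (real (Suc n) * (t - 2 * pi))"

definition window :: "nat \<Rightarrow> real^3 \<Rightarrow> real" where
  "window n x = window1 n (x $ 1) * window1 n (x $ 2) * window1 n (x $ 3)"

lemma smooth1_window1: "smooth1 (window1 n)"
proof -
  have "smooth1_upto k (\<lambda>t. smooth_step (real (Suc n) * t + 0) +
      (- 1) * smooth_step (real (Suc n) * t + (- (real (Suc n) * (2 * pi)))))" for k
    by (rule smooth1_upto_add[OF smooth1_upto_affine[OF smooth1_smooth_step]
          smooth1_upto_mult[OF smooth1_upto_const smooth1_upto_affine[OF smooth1_smooth_step]]])
  moreover have "(\<lambda>t. smooth_step (real (Suc n) * t + 0) +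
      (- 1) * smooth_step (real (Suc n) * t + (- (real (Suc n) * (2 * pi))))) = window1 n"
    by (auto simp: window1_def fun_eq_iff algebra_simps)
  ultimately show ?thesis by (simp add: smooth1_def)
qed

lemma window1_eq_0: "t \<le> 0 \<or> t \<ge> 4 * pi \<Longrightarrow> window1 n t = 0"
proof (elim disjE)
  assume t: "t \<le> 0"
  then have "real (Suc n) * t \<le> 0" "real (Suc n) * (t - 2 * pi) \<le> 0"
    using pi_gt3 by (intro mult_nonneg_nonpos; simp)+
  then show ?thesis by (simp add: window1_def smooth_step_0)
next
  assume t: "t \<ge> 4 * pi"
  have "t - 2 * pi \<ge> 1" "t \<ge> 1" using t pi_gt3 by auto
  then have "real (Suc n) * t \<ge> 1" "real (Suc n) * (t - 2 * pi) \<ge> 1"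
    using mult_mono[of 1 "real (Suc n)" 1 t] mult_mono[of 1 "real (Suc n)" 1 "t - 2 * pi"] by auto
  then show ?thesis by (simp add: window1_def smooth_step_1)
qed

lemma window1_bound: "\<bar>window1 n t\<bar> \<le> 1"
  using smooth_step_bounds[of "real (Suc n) * t"] smooth_step_bounds[of "real (Suc n) * (t - 2 * pi)"]
  unfolding window1_def by linarith

lemma window1_tendsto:
  "(\<lambda>n. window1 n t) \<longlonglongrightarrow> indicator {0<..2 * pi} t"
proof -
  have st: "(\<lambda>n. smooth_step (real (Suc n) * u)) \<longlonglongrightarrow> (if u > 0 then 1 else 0)" for u
  proof (cases "u > 0")
    case True
    have "eventually (\<lambda>n. real (Suc n) * u \<ge> 1) sequentially"
      using True by real_asymp
    then show ?thesis using True
      by (auto intro!: Lim_transform_eventually[OF tendsto_const] elim!: eventually_mono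
          simp: smooth_step_1)
  next
    case False
    then have "real (Suc n) * u \<le> 0" for n by (intro mult_nonneg_nonpos) auto
    then show ?thesis using False by (simp add: smooth_step_0)
  qed
  show ?thesis
    unfolding window1_def using tendsto_diff[OF st[of t] st[of "t - 2 * pi"]] pi_gt_zero
    by (cases "t > 0"; cases "t > 2 * pi") (auto simp: indicator_def split: if_splits)
qed

lemma int_interval_pm2: "{-2..2::int} = {-2, -1, 0, 1, 2}"
  by auto

text \<open>After telescoping there remains the step at \<open>t + 4 * pi\<close>, equal to 1, minus
  the step at \<open>t - 6 * pi\<close>, equal to 0; five translates therefore suffice.\<close>

lemma window1_sum:
  assumes "-1 < t" "t < 2 * pi + 1"
  shows "(\<Sum>m\<in>{-2..2::int}. window1 n (t + 2 * pi * of_int m)) = 1"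
proof -
  have "1 \<le> real (Suc n) * (t + 4 * pi)"
    using mult_mono[of 1 "real (Suc n)" 1 "t + 4 * pi"] assms pi_gt3 by auto
  moreover have "real (Suc n) * (t - 6 * pi) \<le> 0"
    using assms pi_gt3 by (intro mult_nonneg_nonpos) auto
  moreover have "(\<Sum>m\<in>{-2..2::int}. window1 n (t + 2 * pi * of_int m)) =
      smooth_step (real (Suc n) * (t + 4 * pi)) - smooth_step (real (Suc n) * (t - 6 * pi))"
    unfolding int_interval_pm2 by (simp add: window1_def algebra_simps)
  ultimately show ?thesis by (simp add: smooth_step_0 smooth_step_1)
qed

text \<open>The telescoped identity differentiated. Consequently the derivative of a window
  integrates to zero against every periodic function.\<close>

lemma window1_deriv_sum:
  assumes d: "\<And>t. (window1 n has_real_derivative w' t) (at t)" and t: "0 < t" "t < 2 * pi"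
  shows "(\<Sum>m\<in>{-2..2::int}. w' (t + 2 * pi * of_int m)) = 0"
proof -
  have "((\<lambda>t. \<Sum>m\<in>{-2..2::int}. window1 n (t + 2 * pi * of_int m)) has_real_derivative
      (\<Sum>m\<in>{-2..2::int}. w' (t + 2 * pi * of_int m) * 1)) (at t)"
    by (intro DERIV_sum DERIV_chain2[OF d]) (auto intro!: derivative_eq_intros)
  moreover have "((\<lambda>t. \<Sum>m\<in>{-2..2::int}. window1 n (t + 2 * pi * of_int m)) has_real_derivative 0) (at t)"
    by (rule has_field_derivative_transform_within_open[OF DERIV_const[of 1], where S="{-1<..<2 * pi + 1}"])
      (use t window1_sum in auto)
  ultimately show ?thesis by (auto dest: DERIV_unique)
qed

lemma window_nonzero: "window n x \<noteq> 0 \<Longrightarrow> 0 < x $ i \<and> x $ i < 4 * pi"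
proof -
  assume "window n x \<noteq> 0"
  then have "\<forall>i. window1 n (x $ i) \<noteq> 0"
    by (auto simp: window_def forall_3)
  then show ?thesis using window1_eq_0[of "x $ i" n] by force
qed

lemma test_function_window: "test_function (window n)"
  unfolding test_function_def
proof (intro conjI allI)
  show "cont_diff k (window n)" for k
    unfolding window_def[abs_def] by (intro cont_diff_mult cont_diff_coord smooth1_window1)
  have "{x. window n x \<noteq> 0} \<subseteq> cbox 0 (\<chi> i. 4 * pi)"
    using window_nonzero by (auto simp: mem_box_cart less_imp_le)
  then show "compact (closure {x. window n x \<noteq> 0})"
    by (meson bounded_cbox bounded_subset compact_closure)
qed

lemma prod_UNIV_3: "prod f (UNIV :: 3 set) = f 1 * f 2 * f 3"
  unfolding UNIV_3 by (simp add: ac_simps)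

lemma partial_deriv_window:
  assumes d: "\<And>t. (window1 n has_real_derivative w' t) (at t)"
  shows "partial_deriv j (window n) x =
    (\<Prod>i\<in>UNIV. if i = j then w' (x $ i) else window1 n (x $ i))"
proof -
  have d1: "((\<lambda>x. window1 n (x $ i)) has_derivative (\<lambda>h. w' (x $ i) * h $ i)) (at x)" for i
    by (rule has_derivative_compose[where g="window1 n" and g'="(*) (w' (x $ i))" and f="\<lambda>x. x $ i"])
      (use d[of "x $ i"] in \<open>auto simp: has_field_derivative_def
        intro!: bounded_linear_imp_has_derivative bounded_linear_vec_nth\<close>)
  have "(window n has_derivative (\<lambda>h.
     (window1 n (x $ 1) * window1 n (x $ 2)) * (w' (x $ 3) * h $ 3) +
     (window1 n (x $ 1) * (w' (x $ 2) * h $ 2) + (w' (x $ 1) * h $ 1) * window1 n (x $ 2)) *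
       window1 n (x $ 3))) (at x)"
    unfolding window_def[abs_def] by (intro has_derivative_mult d1)
  from partial_deriv_eqI[OF this, of j] show ?thesis
    using exhaust_3[of j] unfolding prod_UNIV_3 by (elim disjE) (simp_all add: axis_def)
qed

section \<open>Integration over the cell\<close>

text \<open>A density rather than a restricted space, so that the sigma-algebra remains
  \<open>borel\<close> and measurability facts carry over unchanged.\<close>

definition cell_measure :: "(real^3) measure" where
  "cell_measure = density lborel (\<lambda>x. ennreal (indicator cell x))"

lemma cell_eq_box: "cell = box 0 (\<chi> i. 2 * pi)"
  by (auto simp: cell_def mem_box_cart)

lemma cell_borel [measurable]: "cell \<in> sets borel"
  by (simp add: cell_eq_box)

lemma sets_cell_measure [simp, measurable_cong]: "sets cell_measure = sets borel"
  by (simp add: cell_measure_def)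

lemma space_cell_measure [simp]: "space cell_measure = UNIV"
  by (simp add: cell_measure_def)

lemma measurable_cell_measure [simp]: "measurable cell_measure N = measurable borel N"
  by (rule measurable_cong_sets) auto

lemma integral_cell:
  fixes f :: "real^3 \<Rightarrow> 'b::{banach, second_countable_topology}"
  assumes "f \<in> borel_measurable borel"
  shows "integral\<^sup>L cell_measure f = (LINT x:cell|lborel. f x)"
  unfolding cell_measure_def set_lebesgue_integral_def
  by (rule integral_density) (use assms in auto)

lemma integrable_cell:
  fixes f :: "real^3 \<Rightarrow> 'b::{banach, second_countable_topology}"
  assumes "f \<in> borel_measurable borel"
  shows "integrable cell_measure f \<longleftrightarrow> integrable lborel (\<lambda>x. indicator cell x *\<^sub>R f x)"
  unfolding cell_measure_def
  by (rule integrable_density) (use assms in auto)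

lemma AE_cell_measure_iff: "(AE x in cell_measure. P x) \<longleftrightarrow> (AE x in lborel. x \<in> cell \<longrightarrow> P x)"
  unfolding cell_measure_def by (subst AE_density) (auto simp: indicator_def)

lemma AE_in_cell: "AE x in cell_measure. x \<in> cell"
  by (simp add: AE_cell_measure_iff)

lemma emeasure_cell_measure: "emeasure cell_measure UNIV = ennreal ((2 * pi) ^ 3)"
proof -
  have "emeasure cell_measure UNIV = emeasure lborel cell"
    unfolding cell_measure_def by (subst emeasure_density) (auto simp: ennreal_indicator)
  also have "\<dots> = ennreal ((2 * pi) ^ 3)"
  proof -
    have inner: "((\<chi> i. 2 * pi) :: real^3) \<bullet> b = 2 * pi" if "b \<in> Basis" for b
      using that by (auto simp: Basis_vec_def inner_axis)
    then have "(\<Prod>b\<in>Basis. (((\<chi> i. 2 * pi) :: real^3) - 0) \<bullet> b) = (\<Prod>b\<in>(Basis :: (real^3) set). 2 * pi)"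
      by (intro prod.cong) auto
    then show ?thesis
      unfolding cell_eq_box by (subst emeasure_lborel_box) (auto simp: inner)
  qed
  finally show ?thesis .
qed

lemma finite_measure_cell: "finite_measure cell_measure"
  by (rule finite_measureI) (simp add: emeasure_cell_measure)

interpretation cellM: finite_measure cell_measure
  by (rule finite_measure_cell)

lemma measure_cell_measure: "measure cell_measure UNIV = (2 * pi) ^ 3"
  by (simp add: measure_def emeasure_cell_measure)

section \<open>Lattice translates and integrals of periodic functions\<close>

definition shift :: "int^3 \<Rightarrow> real^3" where
  "shift m = (\<chi> i. 2 * pi * of_int (m $ i))"

lemma shift_nth [simp]: "shift m $ i = 2 * pi * of_int (m $ i)"
  by (simp add: shift_def)

definition ibox :: "nat \<Rightarrow> (int^3) set" where
  "ibox K = {m. \<forall>i. \<bar>m $ i\<bar> \<le> int K}"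

lemma finite_ibox [simp]: "finite (ibox K)"
proof -
  have "ibox K \<subseteq> vec_lambda ` (UNIV \<rightarrow> {- int K..int K})"
  proof
    fix m assume "m \<in> ibox K"
    then have "m = vec_lambda (\<lambda>i. m $ i)" "(\<lambda>i. m $ i) \<in> UNIV \<rightarrow> {- int K..int K}"
      by (auto simp: ibox_def abs_le_iff) (metis minus_le_iff)
    then show "m \<in> vec_lambda ` (UNIV \<rightarrow> {- int K..int K})" by blast
  qed
  moreover have "finite ((UNIV :: 3 set) \<rightarrow> {- int K..int K})"
    using finite_PiE[of "UNIV :: 3 set" "\<lambda>_. {- int K..int K}"] by (simp add: PiE_def)
  ultimately show ?thesis by (meson finite_imageI finite_subset)
qed

lemma AE_lborel_translate:
  fixes c :: "'a::euclidean_space"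
  assumes "AE x in lborel. P x"
  shows "AE x in lborel. P (x + c)"
proof -
  have "AE x in distr lborel borel ((+) c). P x"
    unfolding lborel_distr_plus by (rule assms)
  then have "AE x in lborel. P (c + x)"
    by (rule AE_distrD[rotated]) simp
  then show ?thesis by (simp add: add.commute)
qed

lemma lborel_integral_translate:
  fixes f :: "'a::euclidean_space \<Rightarrow> 'b::{banach, second_countable_topology}"
  assumes [measurable]: "f \<in> borel_measurable borel"
  shows "(\<integral>x. f (x + c) \<partial>lborel) = integral\<^sup>L lborel f"
    "integrable lborel (\<lambda>x. f (x + c)) \<longleftrightarrow> integrable lborel f"
proof -
  have "integral\<^sup>L (distr lborel borel ((+) c)) f = (\<integral>x. f (c + x) \<partial>lborel)"
    by (rule integral_distr) auto
  then show "(\<integral>x. f (x + c) \<partial>lborel) = integral\<^sup>L lborel f"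
    by (simp add: lborel_distr_plus add.commute)
  have "integrable (distr lborel borel ((+) c)) f = integrable lborel (\<lambda>x. f (c + x))"
    by (rule integrable_distr_eq) auto
  then show "integrable lborel (\<lambda>x. f (x + c)) \<longleftrightarrow> integrable lborel f"
    by (simp add: lborel_distr_plus add.commute)
qed

definition periodic_AE :: "(real^3 \<Rightarrow> 'b) \<Rightarrow> bool" where
  "periodic_AE F \<longleftrightarrow> (\<forall>j. AE x in lborel. F (x + axis j (2 * pi)) = F x)"

lemma periodic_AE_shift:
  assumes "periodic_AE F"
  shows "AE x in lborel. F (x + shift m) = F x"
proof -
  \<comment> \<open>The almost everywhere periods form an additive group because Lebesgue measure is
    translation invariant; the three axis periods generate every \<open>shift m\<close>.\<close>
  define G where "G = {v. AE x in lborel. F (x + v) = F x}"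
  have G_add: "v + w \<in> G" if "v \<in> G" "w \<in> G" for v w
  proof -
    have "AE x in lborel. F (x + v) = F x" using that by (simp add: G_def)
    from AE_lborel_translate[OF this, of w] have "AE x in lborel. F ((x + w) + v) = F (x + w)"
      by simp
    moreover have "AE x in lborel. F (x + w) = F x" using that by (simp add: G_def)
    ultimately have "AE x in lborel. F (x + (v + w)) = F x"
      by eventually_elim (simp add: add_ac)
    then show ?thesis by (simp add: G_def)
  qed
  have G_neg: "- v \<in> G" if "v \<in> G" for v
  proof -
    have "AE x in lborel. F (x + v) = F x" using that by (simp add: G_def)
    from AE_lborel_translate[OF this, of "- v"] have "AE x in lborel. F (x + (- v)) = F x"
      by eventually_elim simp
    then show ?thesis by (simp add: G_def)
  qed
  have G_0: "0 \<in> G" by (simp add: G_def)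
  have G_int: "of_int n *\<^sub>R v \<in> G" if v: "v \<in> G" for v n
  proof -
    have nat: "real k *\<^sub>R v \<in> G" for k
      by (induction k) (auto simp: G_0 scaleR_add_left intro!: G_add v)
    show ?thesis
    proof (cases "n \<ge> 0")
      case True
      then show ?thesis using nat[of "nat n"] by simp
    next
      case False
      then show ?thesis using G_neg[OF nat[of "nat (- n)"]] by simp
    qed
  qed
  have ax: "axis j (2 * pi) \<in> G" for j
    using assms by (simp add: periodic_AE_def G_def)
  have "shift m = of_int (m $ 1) *\<^sub>R axis 1 (2 * pi) + of_int (m $ 2) *\<^sub>R axis 2 (2 * pi)
      + of_int (m $ 3) *\<^sub>R axis 3 (2 * pi)"
    by (simp add: vec_eq_iff forall_3 axis_def)
  also have "\<dots> \<in> G" by (intro G_add G_int ax)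
  finally show ?thesis by (simp add: G_def)
qed

lemma AE_coord_neq: "AE x in lborel. (x :: real^3) $ i \<noteq> c"
proof -
  have "negligible {x :: real^3. x $ i = c}"
    using negligible_standard_hyperplane[of "axis i 1 :: real^3" c] by (simp add: inner_axis axis_in_Basis_iff)
  moreover have "{x :: real^3. x $ i = c} \<in> sets borel"
    by (intro borel_closed closed_Collect_eq continuous_intros)
  ultimately have "{x :: real^3. x $ i = c} \<in> null_sets lborel"
    by (auto simp: negligible_iff_null_sets null_sets_completion_iff)
  then show ?thesis by (rule AE_I') auto
qed

text \<open>The translates of the open cell miss exactly the excluded points.\<close>

lemma AE_off_faces: "AE x in lborel. \<forall>i n. (x :: real^3) $ i \<noteq> 2 * pi * of_int n"
proof -
  have "AE x in lborel. \<forall>n. (x :: real^3) $ i \<noteq> 2 * pi * of_int n" for i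
    unfolding AE_all_countable by (intro allI AE_coord_neq)
  then have "AE x in lborel. \<forall>i\<in>UNIV. \<forall>n. (x :: real^3) $ i \<noteq> 2 * pi * of_int n"
    by (intro AE_finite_allI) auto
  then show ?thesis by simp
qed

definition cell_index :: "real^3 \<Rightarrow> int^3" where
  "cell_index x = (\<chi> i. \<lfloor>x $ i / (2 * pi)\<rfloor>)"

lemma mem_cell_shift_iff:
  assumes "\<forall>i n. (x :: real^3) $ i \<noteq> 2 * pi * of_int n"
  shows "x - shift m \<in> cell \<longleftrightarrow> m = cell_index x"
proof
  assume *: "x - shift m \<in> cell"
  have "\<lfloor>x $ i / (2 * pi)\<rfloor> = m $ i" for i
  proof (rule floor_unique)
    have "0 < x $ i - 2 * pi * of_int (m $ i)" "x $ i - 2 * pi * of_int (m $ i) < 2 * pi"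
      using * by (auto simp: cell_def)
    then show "of_int (m $ i) \<le> x $ i / (2 * pi)" "x $ i / (2 * pi) < of_int (m $ i) + 1"
      by (auto simp: field_simps)
  qed
  then show "m = cell_index x" by (simp add: cell_index_def vec_eq_iff)
next
  assume m: "m = cell_index x"
  have "0 < x $ i - 2 * pi * of_int (m $ i) \<and> x $ i - 2 * pi * of_int (m $ i) < 2 * pi" for i
  proof -
    have "of_int (m $ i) \<le> x $ i / (2 * pi)" "x $ i / (2 * pi) < of_int (m $ i) + 1"
      by (auto simp: m cell_index_def)
    then have "2 * pi * of_int (m $ i) \<le> x $ i" "x $ i < 2 * pi * (of_int (m $ i) + 1)"
      by (auto simp: field_simps)
    moreover have "x $ i \<noteq> 2 * pi * of_int (m $ i)" using assms by blast
    ultimately show ?thesis by (simp add: algebra_simps)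
  qed
  then show "x - shift m \<in> cell" by (simp add: cell_def)
qed

text \<open>Unfolding: cut space into translated cells and move each piece back to the cell, where
  the translates of \<open>\<theta>\<close> add up to the constant \<open>c\<close>. Windows, their
  derivatives, translated cells and dilated cells all occur as \<open>\<theta>\<close>.\<close>

lemma periodic_integral_window:
  fixes F :: "real^3 \<Rightarrow> 'b::{banach, second_countable_topology}" and \<theta> :: "real^3 \<Rightarrow> real"
  assumes F [measurable]: "F \<in> borel_measurable borel" and per: "periodic_AE F"
    and int: "integrable cell_measure F"
    and \<theta> [measurable]: "\<theta> \<in> borel_measurable borel" and bd: "\<And>x. \<bar>\<theta> x\<bar> \<le> B"
    and supp: "\<And>x i. \<theta> x \<noteq> 0 \<Longrightarrow> \<bar>x $ i\<bar> \<le> 2 * pi * real K"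
    and sum: "AE y in cell_measure. (\<Sum>m\<in>ibox K. \<theta> (y + shift m)) = c"
  shows "integrable lborel (\<lambda>x. \<theta> x *\<^sub>R F x)"
    and "(\<integral>x. \<theta> x *\<^sub>R F x \<partial>lborel) = c *\<^sub>R integral\<^sup>L cell_measure F"
proof -
  define G where "G m x = (indicator cell (x - shift m) * \<theta> x) *\<^sub>R F x" for m x
  have G_meas [measurable]: "G m \<in> borel_measurable borel" for m
    unfolding G_def by measurable
  \<comment> \<open>Off the faces exactly one translated cell contains \<open>x\<close>, and the
    support of \<open>\<theta>\<close> keeps its index in \<open>ibox K\<close>.\<close>
  have G_sum: "AE x in lborel. \<theta> x *\<^sub>R F x = (\<Sum>m\<in>ibox K. G m x)"
    using AE_off_faces
  proof eventually_elim
    case (elim x)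
    have "(\<Sum>m\<in>ibox K. G m x) = (\<Sum>m\<in>ibox K. if m = cell_index x then \<theta> x *\<^sub>R F x else 0)"
      using mem_cell_shift_iff[of x] elim by (intro sum.cong) (auto simp: G_def indicator_def)
    also have "\<dots> = (if cell_index x \<in> ibox K then \<theta> x *\<^sub>R F x else 0)"
      by simp
    also have "\<dots> = \<theta> x *\<^sub>R F x"
    proof (cases "\<theta> x = 0")
      case False
      have "\<bar>\<lfloor>x $ i / (2 * pi)\<rfloor>\<bar> \<le> int K" for i
      proof -
        have "- real K \<le> x $ i / (2 * pi)" "x $ i / (2 * pi) \<le> real K"
          using supp[OF False, of i] by (auto simp: field_simps abs_le_iff)
        then show ?thesis by (simp add: abs_le_iff le_floor_iff floor_le_iff minus_le_iff)
      qed
      then show ?thesis by (simp add: ibox_def cell_index_def)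
    qed simp
    finally show ?case by simp
  qed
  have trans: "AE x in lborel. G m (x + shift m) = indicator cell x *\<^sub>R (\<theta> (x + shift m) *\<^sub>R F x)" for m
    using periodic_AE_shift[OF per, of m] by eventually_elim (simp add: G_def)
  have B0: "B \<ge> 0" using bd[of 0] by (rule order_trans[OF abs_ge_zero])
  have int_c: "integrable cell_measure (\<lambda>x. \<theta> (x + shift m) *\<^sub>R F x)" for m
    by (rule Bochner_Integration.integrable_bound[of _ "\<lambda>x. B * norm (F x)"])
      (use int B0 in \<open>auto simp: abs_mult intro!: AE_I2 mult_right_mono bd\<close>)
  have int_t: "integrable lborel (\<lambda>x. indicator cell x *\<^sub>R (\<theta> (x + shift m) *\<^sub>R F x))" for m
    using int_c[of m] by (subst (asm) integrable_cell) auto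
  have "integrable lborel (\<lambda>x. G m (x + shift m))" for m
    using int_t[of m] trans[of m] by (subst integrable_cong_AE) (auto simp: eventually_mono)
  then have G_int: "integrable lborel (G m)" for m
    using lborel_integral_translate(2)[OF G_meas] by blast
  have "integrable lborel (\<lambda>x. \<Sum>m\<in>ibox K. G m x)"
    using G_int by (intro Bochner_Integration.integrable_sum)
  then show "integrable lborel (\<lambda>x. \<theta> x *\<^sub>R F x)"
    using G_sum by (subst integrable_cong_AE) auto
  have "(\<integral>x. \<theta> x *\<^sub>R F x \<partial>lborel) = (\<integral>x. (\<Sum>m\<in>ibox K. G m x) \<partial>lborel)"
    using G_sum by (intro integral_cong_AE) auto
  also have "\<dots> = (\<Sum>m\<in>ibox K. \<integral>x. G m x \<partial>lborel)"
    using G_int by (intro Bochner_Integration.integral_sum) auto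
  also have "\<dots> = (\<Sum>m\<in>ibox K. \<integral>x. G m (x + shift m) \<partial>lborel)"
    by (intro sum.cong refl lborel_integral_translate(1)[symmetric]) auto
  also have "\<dots> = (\<Sum>m\<in>ibox K. \<integral>x. indicator cell x *\<^sub>R (\<theta> (x + shift m) *\<^sub>R F x) \<partial>lborel)"
    using trans by (intro sum.cong integral_cong_AE) auto
  also have "\<dots> = (\<Sum>m\<in>ibox K. integral\<^sup>L cell_measure (\<lambda>x. \<theta> (x + shift m) *\<^sub>R F x))"
    by (intro sum.cong refl, subst integral_cell) (auto simp: set_lebesgue_integral_def)
  also have "\<dots> = integral\<^sup>L cell_measure (\<lambda>x. \<Sum>m\<in>ibox K. \<theta> (x + shift m) *\<^sub>R F x)"
    using int_c by (intro Bochner_Integration.integral_sum[symmetric]) auto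
  also have "\<dots> = integral\<^sup>L cell_measure (\<lambda>x. c *\<^sub>R F x)"
  proof (rule integral_cong_AE)
    show "AE x in cell_measure. (\<Sum>m\<in>ibox K. \<theta> (x + shift m) *\<^sub>R F x) = c *\<^sub>R F x"
      using sum by eventually_elim (simp flip: scaleR_sum_left)
  qed auto
  also have "\<dots> = c *\<^sub>R integral\<^sup>L cell_measure F" by simp
  finally show "(\<integral>x. \<theta> x *\<^sub>R F x \<partial>lborel) = c *\<^sub>R integral\<^sup>L cell_measure F" .
qed

lemma AE_sum_indicator_cell:
  assumes K: "\<And>y. y \<in> cell \<Longrightarrow> - cell_index (y - t) \<in> ibox K"
  shows "AE y in cell_measure. (\<Sum>m\<in>ibox K. indicator cell (y + shift m - t) :: real) = 1"
proof -
  have "AE y in lborel. \<forall>i n. (y - t) $ i \<noteq> 2 * pi * of_int n"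
    using AE_lborel_translate[OF AE_off_faces, of "- t"] by simp
  then show ?thesis
    unfolding AE_cell_measure_iff
  proof eventually_elim
    case (elim y)
    show ?case
    proof
      assume y: "y \<in> cell"
      have "y + shift m - t \<in> cell \<longleftrightarrow> m = - cell_index (y - t)" for m
      proof -
        have "y + shift m - t = (y - t) - shift (- m)" by (simp add: vec_eq_iff)
        then show ?thesis using mem_cell_shift_iff[OF elim, of "- m"] by (metis minus_minus)
      qed
      then have "(\<Sum>m\<in>ibox K. indicator cell (y + shift m - t) :: real)
          = (\<Sum>m\<in>ibox K. if m = - cell_index (y - t) then 1 else 0)"
        by (intro sum.cong) (auto simp: indicator_def)
      then show "(\<Sum>m\<in>ibox K. indicator cell (y + shift m - t) :: real) = 1"
        using K[OF y] by simp
    qed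
  qed
qed

text \<open>The translated cell is another fundamental domain: the lattice translates of its
  indicator sum to 1 almost everywhere.\<close>

lemma periodic_integral_translate:
  fixes F :: "real^3 \<Rightarrow> 'b::{banach, second_countable_topology}"
  assumes F [measurable]: "F \<in> borel_measurable borel" and per: "periodic_AE F"
    and int: "integrable cell_measure F"
  shows "integral\<^sup>L cell_measure (\<lambda>x. F (x + t)) = integral\<^sup>L cell_measure F"
    and "integrable cell_measure (\<lambda>x. F (x + t))"
proof -
  obtain K :: nat where K: "K \<ge> 1 + norm t" by (meson real_arch_simple)
  have tK: "\<bar>t $ i\<bar> \<le> real K - 1" for i
    using component_le_norm_cart[of t i] K by linarith
  have le: "z \<le> 2 * pi * z" if "z \<ge> 0" for z
    using that mult_right_mono[of 1 "2 * pi" z] pi_gt3 by simp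
  note * = periodic_integral_window[OF F per int, of "\<lambda>x. indicator cell (x - t)" 1 K 1]
  have supp: "\<bar>x $ i\<bar> \<le> 2 * pi * real K" if "indicator cell (x - t) \<noteq> (0::real)" for x i
  proof -
    have "0 < x $ i - t $ i" "x $ i - t $ i < 2 * pi"
      using that by (auto simp: cell_def indicator_def split: if_splits)
    then have "\<bar>x $ i\<bar> \<le> 2 * pi + (real K - 1)"
      using tK[of i] by linarith
    also have "\<dots> \<le> 2 * pi + 2 * pi * (real K - 1)"
      using le[of "real K - 1"] K norm_ge_zero[of t] by auto
    also have "\<dots> = 2 * pi * real K" by (simp add: algebra_simps)
    finally show ?thesis .
  qed
  have "- cell_index (y - t) \<in> ibox K" if "y \<in> cell" for y
  proof -
    have "\<bar>\<lfloor>(y $ i - t $ i) / (2 * pi)\<rfloor>\<bar> \<le> int K" for i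
    proof -
      have y: "0 < y $ i" "y $ i < 2 * pi" using that by (auto simp: cell_def)
      then have "y $ i - t $ i < 2 * pi + 2 * pi * (real K - 1)"
        using tK[of i] le[of "real K - 1"] K norm_ge_zero[of t] by linarith
      moreover have "y $ i - t $ i \<ge> - (2 * pi * real K)"
        using y tK[of i] le[of "real K"] by linarith
      ultimately have "- real K \<le> (y $ i - t $ i) / (2 * pi)" "(y $ i - t $ i) / (2 * pi) \<le> real K"
        by (auto simp: field_simps)
      then show ?thesis by (simp add: abs_le_iff le_floor_iff floor_le_iff minus_le_iff)
    qed
    then show ?thesis by (simp add: ibox_def cell_index_def)
  qed
  note ** = AE_sum_indicator_cell[OF this]
  have i: "integrable lborel (\<lambda>x. (indicator cell (x - t) :: real) *\<^sub>R F x)"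
    and e: "(\<integral>x. (indicator cell (x - t) :: real) *\<^sub>R F x \<partial>lborel) = integral\<^sup>L cell_measure F"
    using * supp ** by (auto simp: indicator_def)
  have "(\<integral>x. (indicator cell (x - t) :: real) *\<^sub>R F x \<partial>lborel) =
      (\<integral>x. (indicator cell x :: real) *\<^sub>R F (x + t) \<partial>lborel)"
    by (subst lborel_integral_translate(1)[where c=t, symmetric]) auto
  then show "integral\<^sup>L cell_measure (\<lambda>x. F (x + t)) = integral\<^sup>L cell_measure F"
    using e by (subst integral_cell) (auto simp: set_lebesgue_integral_def)
  have "integrable lborel (\<lambda>x. (indicator cell x :: real) *\<^sub>R F (x + t))"
    using i by (subst (asm) lborel_integral_translate(2)[where c=t, symmetric]) auto
  then show "integrable cell_measure (\<lambda>x. F (x + t))"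
    by (subst integrable_cell) auto
qed

text \<open>The dilated cell is, up to faces, a union of lattice translates of the cell; the
  Jacobian \<open>N^3\<close> cancels against their number.\<close>

lemma periodic_integral_scale:
  fixes F :: "real^3 \<Rightarrow> 'b::{banach, second_countable_topology}"
  assumes F [measurable]: "F \<in> borel_measurable borel" and per: "periodic_AE F"
    and int: "integrable cell_measure F" and N: "N \<ge> 1"
  shows "integral\<^sup>L cell_measure (\<lambda>x. F (real N *\<^sub>R x)) = integral\<^sup>L cell_measure F"
proof -
  define c :: real where "c = real (card {m \<in> ibox N. \<forall>i. 0 \<le> m $ i \<and> m $ i < int N})"
  have N0: "real N > 0" using N by simp
  have main: "integral\<^sup>L cell_measure (\<lambda>x. G (real N *\<^sub>R x)) = (c / real N ^ 3) *\<^sub>R integral\<^sup>L cell_measure G"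
    if G [measurable]: "G \<in> borel_measurable borel" and per: "periodic_AE G"
      and int: "integrable cell_measure G" for G :: "real^3 \<Rightarrow> 'c::{banach, second_countable_topology}"
  proof -
    have supp: "\<bar>x $ i\<bar> \<le> 2 * pi * real N" if "indicator cell ((1 / real N) *\<^sub>R x) \<noteq> (0::real)"
      for x :: "real^3" and i
    proof -
      have "0 < x $ i \<and> x $ i < 2 * pi * real N"
        using that N0 by (auto simp: cell_def indicator_def field_simps split: if_splits)
      then show ?thesis by simp
    qed
    have "AE y in cell_measure. (\<Sum>m\<in>ibox N. indicator cell ((1 / real N) *\<^sub>R (y + shift m)) :: real) = c"
      using AE_in_cell
    proof eventually_elim
      case (elim y)
      have "(1 / real N) *\<^sub>R (y + shift m) \<in> cell \<longleftrightarrow> (\<forall>i. 0 \<le> m $ i \<and> m $ i < int N)" for m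
      proof -
        have "0 < y $ i + 2 * pi * of_int (m $ i) \<and> y $ i + 2 * pi * of_int (m $ i) < 2 * pi * real N
            \<longleftrightarrow> 0 \<le> m $ i \<and> m $ i < int N" for i
        proof -
          have y: "0 < y $ i" "y $ i < 2 * pi" using elim by (auto simp: cell_def)
          show ?thesis
          proof
            assume a: "0 < y $ i + 2 * pi * of_int (m $ i) \<and> y $ i + 2 * pi * of_int (m $ i) < 2 * pi * real N"
            have "2 * pi * (- 1) < 2 * pi * of_int (m $ i)" "2 * pi * of_int (m $ i) < 2 * pi * real N"
              using a y by linarith+
            moreover have "2 * pi > 0" by simp
            ultimately have "(- 1 :: real) < of_int (m $ i)" "of_int (m $ i) < real N"
              by (metis mult_less_cancel_left_pos)+
            then show "0 \<le> m $ i \<and> m $ i < int N" by linarith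
          next
            assume a: "0 \<le> m $ i \<and> m $ i < int N"
            then have "0 \<le> 2 * pi * of_int (m $ i)" by simp
            moreover have "2 * pi * (of_int (m $ i) + 1) \<le> 2 * pi * real N"
              using a by (intro mult_left_mono) (linarith, simp)
            ultimately show "0 < y $ i + 2 * pi * of_int (m $ i) \<and> y $ i + 2 * pi * of_int (m $ i) < 2 * pi * real N"
              using y by (auto simp: algebra_simps)
          qed
        qed
        then show ?thesis using N0 by (auto simp: cell_def field_simps)
      qed
      then have "(\<Sum>m\<in>ibox N. indicator cell ((1 / real N) *\<^sub>R (y + shift m)) :: real) =
          (\<Sum>m\<in>ibox N. if (\<forall>i. 0 \<le> m $ i \<and> m $ i < int N) then 1 else 0)"
        by (intro sum.cong) (auto simp: indicator_def)
      then show ?case by (simp add: c_def sum.If_cases Int_def)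
    qed
    then have e: "(\<integral>x. (indicator cell ((1 / real N) *\<^sub>R x) :: real) *\<^sub>R G x \<partial>lborel) = c *\<^sub>R integral\<^sup>L cell_measure G"
      using supp by (intro periodic_integral_window(2)[OF G per int, where B=1 and K=N]) (auto simp: indicator_def)
    have "(\<integral>x. (indicator cell ((1 / real N) *\<^sub>R x) :: real) *\<^sub>R G x \<partial>lborel)
        = (\<integral>x. (indicator cell ((1 / real N) *\<^sub>R x) :: real) *\<^sub>R G x
            \<partial>density (distr lborel borel (\<lambda>x. 0 + real N *\<^sub>R x)) (\<lambda>_. ennreal (\<bar>real N\<bar> ^ DIM(real^3))))"
      using N0 by (subst lborel_affine[of "real N" 0, symmetric]) auto
    also have "\<dots> = (\<integral>x. real N ^ 3 *\<^sub>R ((indicator cell x :: real) *\<^sub>R G (real N *\<^sub>R x)) \<partial>lborel)"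
      using N0 by (subst integral_density) (auto simp: integral_distr)
    also have "\<dots> = real N ^ 3 *\<^sub>R integral\<^sup>L cell_measure (\<lambda>x. G (real N *\<^sub>R x))"
      by (subst integral_cell) (auto simp: set_lebesgue_integral_def simp del: scaleR_scaleR)
    finally have "real N ^ 3 *\<^sub>R integral\<^sup>L cell_measure (\<lambda>x. G (real N *\<^sub>R x)) = c *\<^sub>R integral\<^sup>L cell_measure G"
      using e by simp
    then have "(1 / real N ^ 3) *\<^sub>R (real N ^ 3 *\<^sub>R integral\<^sup>L cell_measure (\<lambda>x. G (real N *\<^sub>R x)))
        = (1 / real N ^ 3) *\<^sub>R (c *\<^sub>R integral\<^sup>L cell_measure G)" by simp
    then show ?thesis using N0 by simp
  qed
  \<comment> \<open>Taking \<open>G = 1\<close> in the same identity evaluates \<open>c\<close>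
    without counting lattice points.\<close>
  have "c / real N ^ 3 = 1"
    using main[of "\<lambda>_. 1 :: real"] N0
    by (auto simp: periodic_AE_def measure_cell_measure field_simps)
  then show ?thesis unfolding main[OF F per int] by (simp only: scaleR_one)
qed

section \<open>Square integrable functions on the cell\<close>

definition cell_L2 :: "(real^3 \<Rightarrow> complex) set" where
  "cell_L2 = {f. f \<in> borel_measurable borel \<and> integrable cell_measure (\<lambda>x. (cmod (f x))\<^sup>2)}"

definition ip :: "(real^3 \<Rightarrow> complex) \<Rightarrow> (real^3 \<Rightarrow> complex) \<Rightarrow> complex" where
  "ip f h = (\<integral>x. f x * cnj (h x) \<partial>cell_measure)"

definition nrm2 :: "(real^3 \<Rightarrow> complex) \<Rightarrow> real" where
  "nrm2 f = (\<integral>x. (cmod (f x))\<^sup>2 \<partial>cell_measure)"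

lemma cell_L2_measurable [measurable_dest]: "f \<in> cell_L2 \<Longrightarrow> f \<in> borel_measurable borel"
  by (simp add: cell_L2_def)

lemma cell_L2_integrable: "f \<in> cell_L2 \<Longrightarrow> integrable cell_measure (\<lambda>x. (cmod (f x))\<^sup>2)"
  by (simp add: cell_L2_def)

lemma cmod_add_sq_le: "(cmod (a + b))\<^sup>2 \<le> 2 * (cmod a)\<^sup>2 + 2 * (cmod b)\<^sup>2"
proof -
  have "(cmod (a + b))\<^sup>2 \<le> (cmod a + cmod b)\<^sup>2"
    by (intro power_mono norm_triangle_ineq) auto
  also have "\<dots> \<le> 2 * (cmod a)\<^sup>2 + 2 * (cmod b)\<^sup>2"
    using sum_squares_bound[of "cmod a" "cmod b"] by (simp add: power2_sum)
  finally show ?thesis .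
qed

lemma cell_L2_add:
  assumes f: "f \<in> cell_L2" and h: "h \<in> cell_L2"
  shows "(\<lambda>x. f x + h x) \<in> cell_L2"
proof -
  have [measurable]: "f \<in> borel_measurable borel" "h \<in> borel_measurable borel"
    using f h by (auto simp: cell_L2_def)
  have "integrable cell_measure (\<lambda>x. 2 * (cmod (f x))\<^sup>2 + 2 * (cmod (h x))\<^sup>2)"
    using f h by (auto simp: cell_L2_def)
  then have "integrable cell_measure (\<lambda>x. (cmod (f x + h x))\<^sup>2)"
    by (rule Bochner_Integration.integrable_bound) (auto simp: cmod_add_sq_le)
  then show ?thesis by (simp add: cell_L2_def)
qed

lemma cell_L2_mult_bounded:
  assumes "f \<in> cell_L2" "h \<in> borel_measurable borel" "\<And>x. cmod (h x) \<le> B"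
  shows "(\<lambda>x. h x * f x) \<in> cell_L2"
proof -
  have "(cmod (h x * f x))\<^sup>2 \<le> \<bar>B\<^sup>2 * (cmod (f x))\<^sup>2\<bar>" for x
    using assms(3)[of x]
    by (auto simp: norm_mult power_mult_distrib intro!: mult_right_mono power_mono)
  note bound = this
  have [measurable]: "f \<in> borel_measurable borel" "h \<in> borel_measurable borel"
    using assms by (auto simp: cell_L2_def)
  have "integrable cell_measure (\<lambda>x. B\<^sup>2 * (cmod (f x))\<^sup>2)"
    using assms(1) by (simp add: cell_L2_def)
  then have "integrable cell_measure (\<lambda>x. (cmod (h x * f x))\<^sup>2)"
    by (rule Bochner_Integration.integrable_bound) (use bound in auto)
  then show ?thesis by (simp add: cell_L2_def)
qed

lemma cell_L2_const: "(\<lambda>_. c) \<in> cell_L2"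
  by (simp add: cell_L2_def)

lemma cell_L2_bounded: "f \<in> borel_measurable borel \<Longrightarrow> (\<And>x. cmod (f x) \<le> B) \<Longrightarrow> f \<in> cell_L2"
  using cell_L2_mult_bounded[OF cell_L2_const[of 1], of f B] by simp

lemma cell_L2_scale: "f \<in> cell_L2 \<Longrightarrow> (\<lambda>x. c * f x) \<in> cell_L2"
  by (rule cell_L2_mult_bounded[of f "\<lambda>_. c" "cmod c"]) auto

lemma cell_L2_uminus: "f \<in> cell_L2 \<Longrightarrow> (\<lambda>x. - f x) \<in> cell_L2"
  by (auto simp: cell_L2_def)

lemma cell_L2_diff: "f \<in> cell_L2 \<Longrightarrow> h \<in> cell_L2 \<Longrightarrow> (\<lambda>x. f x - h x) \<in> cell_L2"
  using cell_L2_add[OF _ cell_L2_uminus, of f h] by simp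

lemma cell_L2_sum: "(\<And>i. i \<in> A \<Longrightarrow> f i \<in> cell_L2) \<Longrightarrow> (\<lambda>x. \<Sum>i\<in>A. f i x) \<in> cell_L2"
  by (induction A rule: infinite_finite_induct) (simp_all add: cell_L2_add cell_L2_const)

lemma borel_measurable_cnj [measurable (raw)]:
  "f \<in> borel_measurable M \<Longrightarrow> (\<lambda>x. cnj (f x)) \<in> borel_measurable M"
  by (rule measurable_compose[of f M borel cnj])
    (auto intro!: borel_measurable_continuous_onI linear_continuous_on bounded_linear_cnj)

lemma amgm_sq: "2 * (a * b) \<le> s * a\<^sup>2 + b\<^sup>2 / s" if "s > (0::real)"
proof -
  have "0 \<le> (s * a - b)\<^sup>2 / s" using that by simp
  also have "\<dots> = s * a\<^sup>2 + b\<^sup>2 / s - 2 * (a * b)"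
    using that by (simp add: power2_diff field_simps power2_eq_square)
  finally show ?thesis by simp
qed

lemma ip_integrable: "f \<in> cell_L2 \<Longrightarrow> h \<in> cell_L2 \<Longrightarrow> integrable cell_measure (\<lambda>x. f x * cnj (h x))"
proof -
  assume f: "f \<in> cell_L2" and h: "h \<in> cell_L2"
  have b: "cmod (f x * cnj (h x)) \<le> norm ((cmod (f x))\<^sup>2 + (cmod (h x))\<^sup>2)" for x
  proof -
    have "0 \<le> cmod (f x) * cmod (h x)" by simp
    with amgm_sq[of 1 "cmod (f x)" "cmod (h x)"]
    have "cmod (f x) * cmod (h x) \<le> (cmod (f x))\<^sup>2 + (cmod (h x))\<^sup>2" by linarith
    then show ?thesis by (simp add: norm_mult)
  qed
  have [measurable]: "f \<in> borel_measurable borel" "h \<in> borel_measurable borel"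
    using f h by (auto simp: cell_L2_def)
  have "integrable cell_measure (\<lambda>x. (cmod (f x))\<^sup>2 + (cmod (h x))\<^sup>2)"
    using f h by (auto simp: cell_L2_def)
  then show ?thesis
    by (rule Bochner_Integration.integrable_bound) (use b in auto)
qed

lemma cell_L2_integrable1: "f \<in> cell_L2 \<Longrightarrow> integrable cell_measure f"
  using ip_integrable[OF _ cell_L2_const[of 1], of f] by simp

lemma ip_add_left: "f \<in> cell_L2 \<Longrightarrow> g \<in> cell_L2 \<Longrightarrow> h \<in> cell_L2 \<Longrightarrow>
    ip (\<lambda>x. f x + g x) h = ip f h + ip g h"
  unfolding ip_def by (simp add: ip_integrable ring_distribs)

lemma ip_diff_left: "f \<in> cell_L2 \<Longrightarrow> g \<in> cell_L2 \<Longrightarrow> h \<in> cell_L2 \<Longrightarrow>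
    ip (\<lambda>x. f x - g x) h = ip f h - ip g h"
  unfolding ip_def by (simp add: ip_integrable ring_distribs)

lemma ip_scale_left: "ip (\<lambda>x. c * f x) h = c * ip f h"
  unfolding ip_def by (simp add: mult.assoc)

lemma ip_cnj: "ip h f = cnj (ip f h)"
  unfolding ip_def
  by (subst Bochner_Integration.integral_cnj[symmetric], rule Bochner_Integration.integral_cong) (simp_all add: mult.commute)

lemma ip_add_right: "f \<in> cell_L2 \<Longrightarrow> g \<in> cell_L2 \<Longrightarrow> h \<in> cell_L2 \<Longrightarrow>
    ip h (\<lambda>x. f x + g x) = ip h f + ip h g"
  unfolding ip_def by (simp add: ip_integrable ring_distribs)

lemma ip_diff_right: "f \<in> cell_L2 \<Longrightarrow> g \<in> cell_L2 \<Longrightarrow> h \<in> cell_L2 \<Longrightarrow>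
    ip h (\<lambda>x. f x - g x) = ip h f - ip h g"
  unfolding ip_def by (simp add: ip_integrable ring_distribs)

lemma ip_scale_right: "ip h (\<lambda>x. c * f x) = cnj c * ip h f"
  unfolding ip_def by (simp add: mult.left_commute)

lemma ip_sum_left:
  assumes "\<And>i. i \<in> A \<Longrightarrow> f i \<in> cell_L2" "h \<in> cell_L2"
  shows "ip (\<lambda>x. \<Sum>i\<in>A. f i x) h = (\<Sum>i\<in>A. ip (f i) h)"
  unfolding ip_def sum_distrib_right
  using assms by (intro Bochner_Integration.integral_sum) (auto intro: ip_integrable)

lemma ip_sum_right:
  assumes "\<And>i. i \<in> A \<Longrightarrow> f i \<in> cell_L2" "h \<in> cell_L2"
  shows "ip h (\<lambda>x. \<Sum>i\<in>A. f i x) = (\<Sum>i\<in>A. ip h (f i))"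
  by (subst ip_cnj, subst ip_sum_left[OF assms]) (simp_all add: ip_cnj[of h])

lemma ip_self: "ip f f = of_real (nrm2 f)"
  unfolding ip_def nrm2_def complex_norm_square[symmetric] by (simp flip: of_real_power)

lemma nrm2_nonneg [simp]: "nrm2 f \<ge> 0"
  by (simp add: nrm2_def)

lemma nrm2_scale: "nrm2 (\<lambda>x. c * f x) = (cmod c)\<^sup>2 * nrm2 f"
  by (simp add: nrm2_def norm_mult power_mult_distrib)

lemma nrm2_minus_commute: "nrm2 (\<lambda>x. f x - h x) = nrm2 (\<lambda>x. h x - f x)"
  by (simp add: nrm2_def norm_minus_commute)

lemma nrm2_add:
  assumes "f \<in> cell_L2" "h \<in> cell_L2"
  shows "nrm2 (\<lambda>x. f x + h x) = nrm2 f + 2 * Re (ip f h) + nrm2 h"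
proof -
  have "complex_of_real (nrm2 (\<lambda>x. f x + h x)) = ip f f + ip f h + (ip h f + ip h h)"
    unfolding ip_self[symmetric] using assms by (simp add: ip_add_left ip_add_right cell_L2_add)
  then show ?thesis
    by (simp add: complex_eq_iff ip_self ip_cnj[of h f])
qed

lemma nrm2_diff:
  assumes "f \<in> cell_L2" "h \<in> cell_L2"
  shows "nrm2 (\<lambda>x. f x - h x) = nrm2 f - 2 * Re (ip f h) + nrm2 h"
  using nrm2_add[OF assms(1) cell_L2_scale[OF assms(2), of "-1"]]
  by (simp add: ip_scale_right[of f "-1" h, simplified] nrm2_scale[of "-1" h, simplified])

lemma nrm2_eq_0_AE: "f \<in> cell_L2 \<Longrightarrow> nrm2 f = 0 \<Longrightarrow> AE x in cell_measure. f x = 0"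
  unfolding nrm2_def
  by (subst (asm) integral_nonneg_eq_0_iff_AE) (auto simp: cell_L2_def)

lemma nrm2_cong_AE:
  assumes "AE x in cell_measure. f x = h x" "f \<in> cell_L2" "h \<in> cell_L2"
  shows "nrm2 f = nrm2 h"
  unfolding nrm2_def
proof (rule integral_cong_AE)
  show "AE x in cell_measure. (cmod (f x))\<^sup>2 = (cmod (h x))\<^sup>2"
    using assms(1) by eventually_elim simp
qed (use assms(2,3) in measurable)

lemma ip_cong_AE:
  assumes "AE x in cell_measure. f x = f' x" "AE x in cell_measure. h x = h' x"
    and "f \<in> cell_L2" "h \<in> cell_L2" "f' \<in> cell_L2" "h' \<in> cell_L2"
  shows "ip f h = ip f' h'"
  unfolding ip_def
proof (rule integral_cong_AE)
  show "AE x in cell_measure. f x * cnj (h x) = f' x * cnj (h' x)"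
    using assms(1,2) by eventually_elim simp
qed (use assms(3-) in measurable)

lemma Cauchy_Schwarz_ip:
  assumes f: "f \<in> cell_L2" and h: "h \<in> cell_L2"
  shows "cmod (ip f h) \<le> sqrt (nrm2 f) * sqrt (nrm2 h)"
proof (cases "nrm2 h = 0")
  case True
  have "ip f h = ip f (\<lambda>_. 0)"
    using nrm2_eq_0_AE[OF h True] f h by (intro ip_cong_AE) (auto simp: cell_L2_const)
  then show ?thesis by (simp add: ip_def)
next
  case False
  then have pos: "nrm2 h > 0" using nrm2_nonneg[of h] by linarith
  define t where "t = ip f h / nrm2 h"
  have "0 \<le> nrm2 (\<lambda>x. f x - t * h x)" by simp
  also have "\<dots> = nrm2 f - 2 * Re (cnj t * ip f h) + (cmod t)\<^sup>2 * nrm2 h"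
    using nrm2_diff[OF f cell_L2_scale[OF h, of t]] by (simp add: ip_scale_right nrm2_scale)
  also have "cnj t * ip f h = of_real ((cmod (ip f h))\<^sup>2 / nrm2 h)"
    unfolding t_def of_real_divide complex_norm_square by (simp add: mult.commute)
  also have "(cmod t)\<^sup>2 * nrm2 h = (cmod (ip f h))\<^sup>2 / nrm2 h"
    using pos by (simp add: t_def norm_divide power_divide power2_eq_square)
  finally have "(cmod (ip f h))\<^sup>2 \<le> nrm2 f * nrm2 h"
    using pos by (simp add: field_simps)
  then have "cmod (ip f h) \<le> sqrt (nrm2 f * nrm2 h)" by (rule real_le_rsqrt)
  then show ?thesis by (simp add: real_sqrt_mult)
qed

lemma nrm2_add_le:
  assumes f: "f \<in> cell_L2" and h: "h \<in> cell_L2"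
  shows "nrm2 (\<lambda>x. f x + h x) \<le> 2 * nrm2 f + 2 * nrm2 h"
  using nrm2_add[OF f h] nrm2_diff[OF f h] nrm2_nonneg[of "\<lambda>x. f x - h x"] by linarith

lemma ip_tendsto_left:
  assumes "\<And>n. f n \<in> cell_L2" "g \<in> cell_L2" "h \<in> cell_L2" "(\<lambda>n. nrm2 (\<lambda>x. f n x - g x)) \<longlonglongrightarrow> 0"
  shows "(\<lambda>n. ip (f n) h) \<longlonglongrightarrow> ip g h"
proof (rule LIM_zero_cancel, rule Lim_null_comparison)
  show "\<forall>\<^sub>F n in sequentially. norm (ip (f n) h - ip g h) \<le> sqrt (nrm2 (\<lambda>x. f n x - g x)) * sqrt (nrm2 h)"
    using assms(1-3) by (auto simp: ip_diff_left[symmetric] intro!: Cauchy_Schwarz_ip cell_L2_diff always_eventually)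
  show "(\<lambda>n. sqrt (nrm2 (\<lambda>x. f n x - g x)) * sqrt (nrm2 h)) \<longlonglongrightarrow> 0"
    using tendsto_mult[OF tendsto_real_sqrt[OF assms(4)] tendsto_const[of "sqrt (nrm2 h)"]] by simp
qed

lemma nrm2_tendsto:
  assumes f: "\<And>n. f n \<in> cell_L2" and g: "g \<in> cell_L2" and lim: "(\<lambda>n. nrm2 (\<lambda>x. f n x - g x)) \<longlonglongrightarrow> 0"
  shows "(\<lambda>n. nrm2 (f n)) \<longlonglongrightarrow> nrm2 g"
proof -
  have "nrm2 (f n) = nrm2 (\<lambda>x. f n x - g x) + 2 * Re (ip (f n) g) - nrm2 g" for n
    using nrm2_diff[OF f[of n] g] by simp
  moreover have "(\<lambda>n. nrm2 (\<lambda>x. f n x - g x) + 2 * Re (ip (f n) g) - nrm2 g) \<longlonglongrightarrow> 0 + 2 * Re (ip g g) - nrm2 g"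
    by (intro tendsto_intros lim ip_tendsto_left[OF f g g lim])
  ultimately show ?thesis by (simp add: ip_self)
qed

text \<open>A subsequence with geometrically decaying increments converges almost everywhere;
  Fatou's lemma then turns the Cauchy condition into convergence of the whole sequence to that
  limit.\<close>

theorem Riesz_Fischer_cell:
  assumes f: "\<And>n. f n \<in> cell_L2"
    and Cauchy: "\<And>e. e > 0 \<Longrightarrow> \<exists>N. \<forall>m\<ge>N. \<forall>n\<ge>N. nrm2 (\<lambda>x. f m x - f n x) < e"
  obtains g where "g \<in> cell_L2" "(\<lambda>n. nrm2 (\<lambda>x. f n x - g x)) \<longlonglongrightarrow> 0"
proof -
  have [measurable]: "f n \<in> borel_measurable borel" for n using f by (rule cell_L2_measurable)
  have "\<forall>k. \<exists>N. \<forall>m\<ge>N. \<forall>n\<ge>N. nrm2 (\<lambda>x. f m x - f n x) < (1/4) ^ k"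
    by (intro allI Cauchy) simp
  then obtain N where N: "\<And>k m n. m \<ge> N k \<Longrightarrow> n \<ge> N k \<Longrightarrow> nrm2 (\<lambda>x. f m x - f n x) < (1/4) ^ k"
    by metis
  \<comment> \<open>The partial sums make \<open>s k\<close> at least \<open>N k\<close>, and the
    summand \<open>k\<close> makes \<open>s\<close> strictly increasing.\<close>
  define s where "s k = (\<Sum>i\<le>k. N i) + k" for k
  have s_mono: "strict_mono s" by (simp add: strict_mono_Suc_iff s_def)
  have s_ge: "s k \<ge> N k" for k
    unfolding s_def using member_le_sum[of k "{..k}" N] by auto
  define d where "d k x = f (s (Suc k)) x - f (s k) x" for k x
  have d_L2: "d k \<in> cell_L2" for k unfolding d_def by (intro cell_L2_diff f)
  have [measurable]: "d k \<in> borel_measurable borel" for k using d_L2 by (rule cell_L2_measurable)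
  have d_nrm: "nrm2 (d k) < (1/4) ^ k" for k
    unfolding d_def using strict_monoD[OF s_mono, of k "Suc k"] s_ge[of k] by (intro N) auto
  define V where "V = measure cell_measure UNIV"
  have d_int: "(\<integral>x. cmod (d k x) \<partial>cell_measure) \<le> (1/2) ^ k * (1 + V)" for k
  proof -
    \<comment> \<open>Young's inequality with weight \<open>2 ^ k\<close>: as
      \<open>nrm2 (d k) < (1/4) ^ k\<close>, both terms are of order \<open>(1/2) ^ k\<close> and
      hence summable.\<close>
    have "(\<integral>x. cmod (d k x) \<partial>cell_measure) \<le> (\<integral>x. 2 ^ k * (cmod (d k x))\<^sup>2 + 1 / 2 ^ k \<partial>cell_measure)"
    proof (rule integral_mono)
      show "cmod (d k x) \<le> 2 ^ k * (cmod (d k x))\<^sup>2 + 1 / 2 ^ k" for x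
      proof -
        have "2 * (cmod (d k x) * 1) \<le> 2 ^ k * (cmod (d k x))\<^sup>2 + 1\<^sup>2 / 2 ^ k"
          by (rule amgm_sq) simp
        then show ?thesis using norm_ge_zero[of "d k x"] by (simp only: power_one mult_1_right)
      qed
    qed (use cell_L2_integrable1[OF d_L2] cell_L2_integrable[OF d_L2] in auto)
    also have "\<dots> = 2 ^ k * nrm2 (d k) + V / 2 ^ k"
      using cell_L2_integrable[OF d_L2[of k]] by (simp add: nrm2_def V_def)
    also have "\<dots> \<le> 2 ^ k * (1/4) ^ k + V / 2 ^ k"
      using d_nrm[of k] by (intro add_right_mono mult_left_mono) auto
    also have "\<dots> = (1/2) ^ k * (1 + V)"
      by (simp add: field_simps flip: power_mult_distrib)
    finally show ?thesis .
  qed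
  have "(\<integral>\<^sup>+x. (\<Sum>k. ennreal (cmod (d k x))) \<partial>cell_measure) = (\<Sum>k. \<integral>\<^sup>+x. ennreal (cmod (d k x)) \<partial>cell_measure)"
    by (rule nn_integral_suminf) auto
  also have "\<dots> = (\<Sum>k. ennreal (\<integral>x. cmod (d k x) \<partial>cell_measure))"
    using cell_L2_integrable1[OF d_L2] by (intro suminf_cong nn_integral_eq_integral) auto
  also have "\<dots> \<le> (\<Sum>k. ennreal ((1/2) ^ k * (1 + V)))"
    by (intro suminf_le ennreal_leI d_int) auto
  also have "\<dots> < \<infinity>"
  proof -
    have "summable (\<lambda>k. (1/2) ^ k * (1 + V))" by (intro summable_mult2 summable_geometric) auto
    then have "(\<Sum>k. ennreal ((1/2) ^ k * (1 + V))) = ennreal (\<Sum>k. (1/2) ^ k * (1 + V))"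
      by (intro suminf_ennreal2) (auto simp: V_def intro: mult_nonneg_nonneg add_nonneg_nonneg)
    then show ?thesis by simp
  qed
  finally have "AE x in cell_measure. (\<Sum>k. ennreal (cmod (d k x))) \<noteq> \<infinity>"
    by (intro nn_integral_noteq_infinite) auto
  then have conv: "AE x in cell_measure. convergent (\<lambda>k. f (s k) x)"
  proof eventually_elim
    case (elim x)
    have "summable (\<lambda>k. cmod (d k x))"
      by (rule summable_suminf_not_top) (use elim in auto)
    then have "summable (\<lambda>k. d k x)" by (rule summable_norm_cancel)
    then have "convergent (\<lambda>n. \<Sum>k<n. d k x)" by (simp add: summable_iff_convergent)
    then have "convergent (\<lambda>n. (\<Sum>k<n. d k x) + f (s 0) x)"
      by (intro convergent_add convergent_const)
    moreover have "(\<Sum>k<n. d k x) + f (s 0) x = f (s n) x" for n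
      unfolding d_def by (subst sum_lessThan_telescope) simp
    ultimately show ?case by simp
  qed
  define g where "g x = lim (\<lambda>k. f (s k) x)" for x
  have g_meas [measurable]: "g \<in> borel_measurable borel"
    unfolding g_def by (rule borel_measurable_lim_metric) auto
  have lim: "AE x in cell_measure. (\<lambda>k. f (s k) x) \<longlonglongrightarrow> g x"
    using conv by eventually_elim (simp add: g_def convergent_LIMSEQ_iff)
  \<comment> \<open>The second index of the Cauchy bound is sent to infinity along the subsequence;
    integrability of the limit comes out at the same time.\<close>
  have fatou: "integrable cell_measure (\<lambda>x. (cmod (f m x - g x))\<^sup>2) \<and> nrm2 (\<lambda>x. f m x - g x) \<le> e"
    if e: "e > 0" and m: "\<And>n. n \<ge> M \<Longrightarrow> nrm2 (\<lambda>x. f m x - f n x) < e" for m e M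
  proof -
    have "(\<integral>\<^sup>+x. ennreal ((cmod (f m x - g x))\<^sup>2) \<partial>cell_measure)
        = (\<integral>\<^sup>+x. liminf (\<lambda>k. ennreal ((cmod (f m x - f (s k) x))\<^sup>2)) \<partial>cell_measure)"
    proof (rule nn_integral_cong_AE)
      show "AE x in cell_measure. ennreal ((cmod (f m x - g x))\<^sup>2) =
          liminf (\<lambda>k. ennreal ((cmod (f m x - f (s k) x))\<^sup>2))"
        using lim
      proof eventually_elim
        case (elim x)
        have "(\<lambda>k. ennreal ((cmod (f m x - f (s k) x))\<^sup>2)) \<longlonglongrightarrow> ennreal ((cmod (f m x - g x))\<^sup>2)"
          by (intro tendsto_intros tendsto_ennrealI elim)
        from lim_imp_Liminf[OF trivial_limit_sequentially this] show ?case by (rule sym)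
      qed
    qed
    also have "\<dots> \<le> liminf (\<lambda>k. \<integral>\<^sup>+x. ennreal ((cmod (f m x - f (s k) x))\<^sup>2) \<partial>cell_measure)"
      by (rule nn_integral_liminf) auto
    also have "\<dots> \<le> liminf (\<lambda>k. ennreal e)"
    proof (rule Liminf_mono)
      show "\<forall>\<^sub>F k in sequentially. (\<integral>\<^sup>+x. ennreal ((cmod (f m x - f (s k) x))\<^sup>2) \<partial>cell_measure) \<le> ennreal e"
        using eventually_ge_at_top[of M]
      proof eventually_elim
        case (elim k)
        have "s k \<ge> M" using elim seq_suble[OF s_mono, of k] by simp
        then have "nrm2 (\<lambda>x. f m x - f (s k) x) \<le> e" using m[of "s k"] by simp
        moreover have "(\<integral>\<^sup>+x. ennreal ((cmod (f m x - f (s k) x))\<^sup>2) \<partial>cell_measure) = ennreal (nrm2 (\<lambda>x. f m x - f (s k) x))"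
          unfolding nrm2_def
          by (rule nn_integral_eq_integral) (auto intro!: cell_L2_integrable cell_L2_diff f)
        ultimately show ?case by (simp add: ennreal_leI)
      qed
    qed
    finally have *: "(\<integral>\<^sup>+x. ennreal ((cmod (f m x - g x))\<^sup>2) \<partial>cell_measure) \<le> ennreal e"
      by (simp add: Liminf_const)
    then have int: "integrable cell_measure (\<lambda>x. (cmod (f m x - g x))\<^sup>2)"
      by (intro integrableI_bounded) (auto intro: le_less_trans)
    have "ennreal (nrm2 (\<lambda>x. f m x - g x)) \<le> ennreal e"
      using * int unfolding nrm2_def by (subst nn_integral_eq_integral[symmetric]) auto
    then show ?thesis using int e by (simp add: ennreal_le_iff)
  qed
  obtain M where M: "\<forall>m\<ge>M. \<forall>n\<ge>M. nrm2 (\<lambda>x. f m x - f n x) < 1" using Cauchy[of 1] by auto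
  have "(\<lambda>x. f M x - g x) \<in> cell_L2"
    using fatou[of 1 M M] M by (simp add: cell_L2_def)
  then have "(\<lambda>x. f M x - (f M x - g x)) \<in> cell_L2" by (rule cell_L2_diff[OF f])
  then have g: "g \<in> cell_L2" by simp
  have "(\<lambda>n. nrm2 (\<lambda>x. f n x - g x)) \<longlonglongrightarrow> 0"
  proof (rule LIMSEQ_I)
    fix e :: real assume e: "e > 0"
    obtain M where M: "\<forall>m\<ge>M. \<forall>n\<ge>M. nrm2 (\<lambda>x. f m x - f n x) < e / 2" using Cauchy[of "e / 2"] e by auto
    have "norm (nrm2 (\<lambda>x. f n x - g x) - 0) < e" if "n \<ge> M" for n
      using fatou[of "e / 2" M n] M that e by auto
    then show "\<exists>no. \<forall>n\<ge>no. norm (nrm2 (\<lambda>x. f n x - g x) - 0) < e" by blast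
  qed
  with g show thesis by (rule that)
qed

section \<open>Fourier series on the cell\<close>

definition ivec :: "int^3 \<Rightarrow> real^3" where
  "ivec k = (\<chi> i. of_int (k $ i))"

definition pexp :: "real^3 \<Rightarrow> real^3 \<Rightarrow> complex" where
  "pexp \<kappa> x = exp (\<i> * of_real (x \<bullet> \<kappa>))"

text \<open>The orthonormal basis of plane waves adapted to the Bloch condition; the constant is the
  inverse square root of the volume of the cell.\<close>

definition ek :: "real^3 \<Rightarrow> int^3 \<Rightarrow> real^3 \<Rightarrow> complex" where
  "ek \<eta> k x = of_real (1 / sqrt ((2 * pi) ^ 3)) * pexp (\<eta> + ivec k) x"

lemma ivec_nth [simp]: "ivec k $ i = of_int (k $ i)"
  by (simp add: ivec_def)

lemma ivec_diff: "ivec (k - l) = ivec k - ivec l"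
  by (simp add: vec_eq_iff)

lemma ivec_add: "ivec (k + l) = ivec k + ivec l"
  by (simp add: vec_eq_iff)

lemma cmod_pexp [simp]: "cmod (pexp \<kappa> x) = 1"
  by (simp add: pexp_def norm_exp_i_times)

lemma pexp_continuous [continuous_intros]: "continuous_on S (pexp \<kappa>)"
  unfolding pexp_def[abs_def] by (intro continuous_intros)

lemma pexp_measurable [measurable]: "pexp \<kappa> \<in> borel_measurable borel"
  by (intro borel_measurable_continuous_onI pexp_continuous)

lemma pexp_add_left: "pexp (\<kappa> + \<kappa>') x = pexp \<kappa> x * pexp \<kappa>' x"
  by (simp add: pexp_def inner_add_right ring_distribs exp_add)

lemma pexp_add_right: "pexp \<kappa> (x + y) = pexp \<kappa> x * pexp \<kappa> y"
  by (simp add: pexp_def inner_add_left ring_distribs exp_add)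

lemma pexp_0 [simp]: "pexp 0 x = 1" "pexp \<kappa> 0 = 1"
  by (simp_all add: pexp_def)

lemma cnj_pexp: "cnj (pexp \<kappa> x) = pexp (- \<kappa>) x"
  by (simp add: pexp_def exp_cnj)

lemma pexp_minus_mult: "pexp \<kappa> x * pexp (- \<kappa>) x = 1"
  by (simp flip: pexp_add_left)

lemma pexp_ivec_shift: "pexp (ivec k) (shift m) = 1"
proof -
  define n where "n = m $ 1 * k $ 1 + m $ 2 * k $ 2 + m $ 3 * k $ 3"
  have "shift m \<bullet> ivec k = 2 * of_int n * pi"
    unfolding inner_vec_def sum_3 by (simp add: n_def algebra_simps)
  then have "pexp (ivec k) (shift m) = exp ((2 * of_int n * of_real pi) * \<i>)"
    by (simp add: pexp_def mult.commute)
  also have "\<dots> = 1" using exp_integer_2pi[of "of_int n"] by (simp add: mult.commute mult.left_commute)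
  finally show ?thesis .
qed

lemma axis_eq_shift: "axis j (2 * pi) = shift (axis j 1)"
  by (simp add: vec_eq_iff axis_def)

lemma pexp_ivec_periodic: "pexp (ivec k) (x + axis j (2 * pi)) = pexp (ivec k) x"
  by (simp add: axis_eq_shift pexp_add_right pexp_ivec_shift)

lemma cell_volume_pos: "(2 * pi) ^ 3 > 0"
  by simp

lemma ek_measurable [measurable]: "ek \<eta> k \<in> borel_measurable borel"
  unfolding ek_def[abs_def] by measurable

lemma cmod_ek: "cmod (ek \<eta> k x) = 1 / sqrt ((2 * pi) ^ 3)"
  unfolding ek_def norm_mult by (simp del: of_real_divide)

lemma ek_L2 [simp]: "ek \<eta> k \<in> cell_L2"
  by (rule cell_L2_bounded) (auto simp: cmod_ek)

lemma ek_mult_cnj: "ek \<eta> k x * cnj (ek \<eta> l x) = of_real (1 / (2 * pi) ^ 3) * pexp (ivec (k - l)) x"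
proof -
  have e: "pexp (\<eta> + ivec k) x * pexp (- (\<eta> + ivec l)) x = pexp (ivec (k - l)) x"
    unfolding pexp_add_left[symmetric] by (simp add: ivec_diff)
  have c: "complex_of_real (1 / sqrt ((2 * pi) ^ 3)) * of_real (1 / sqrt ((2 * pi) ^ 3))
      = of_real (1 / (2 * pi) ^ 3)"
    unfolding of_real_mult[symmetric] by simp
  have m: "(c * a) * (c * b) = (c * c) * (a * b)" for a b c :: complex
    by (simp only: mult_ac)
  show ?thesis
    unfolding ek_def complex_cnj_mult cnj_pexp complex_cnj_complex_of_real by (subst m) (simp only: c e)
qed

text \<open>Translation by \<open>t\<close> preserves the integral but multiplies the integrand by
  the phase \<open>pexp (ivec m) t\<close>; a phase other than 1 forces the integral to vanish.
  Orthogonality of the basis and the averaging of microscopic weights both come from this.\<close>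

lemma oscillation:
  assumes [measurable]: "u \<in> borel_measurable borel" and bd: "\<And>x. cmod (u x) \<le> B"
    and per: "\<And>x j. u (x + axis j (2 * pi)) = u x"
    and inv: "\<And>x. u (x + t) = u x" and ne: "pexp (ivec m) t \<noteq> 1"
  shows "(\<integral>x. u x * pexp (ivec m) x \<partial>cell_measure) = 0"
proof -
  let ?F = "\<lambda>x. u x * pexp (ivec m) x"
  have int: "integrable cell_measure ?F"
    by (rule cell_L2_integrable1, rule cell_L2_bounded[where B=B]) (auto simp: norm_mult bd)
  have "(\<integral>x. ?F x \<partial>cell_measure) = (\<integral>x. ?F (x + t) \<partial>cell_measure)"
    by (rule periodic_integral_translate(1)[symmetric])
      (use int in \<open>auto simp: periodic_AE_def per pexp_ivec_periodic\<close>)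
  also have "\<dots> = pexp (ivec m) t * (\<integral>x. ?F x \<partial>cell_measure)"
    by (subst Bochner_Integration.integral_mult_right_zero[symmetric], rule Bochner_Integration.integral_cong)
      (auto simp: inv pexp_add_right)
  finally have "(1 - pexp (ivec m) t) * (\<integral>x. ?F x \<partial>cell_measure) = 0"
    by (simp add: algebra_simps)
  then show ?thesis using ne by simp
qed

lemma integral_pexp: "m \<noteq> 0 \<Longrightarrow> (\<integral>x. pexp (ivec m) x \<partial>cell_measure) = 0"
proof -
  assume "m \<noteq> 0"
  then obtain j where j: "m $ j \<noteq> 0" by (auto simp: vec_eq_iff)
  \<comment> \<open>Half a wavelength along the axis gives the phase -1.\<close>
  have "pexp (ivec m) (axis j (pi / of_int (m $ j))) = exp (\<i> * of_real pi)"
    using j by (simp add: pexp_def inner_axis' )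
  then have "pexp (ivec m) (axis j (pi / of_int (m $ j))) \<noteq> 1"
    by (simp add: exp_pi_i')
  from oscillation[of "\<lambda>_. 1" 1, OF _ _ _ _ this] show ?thesis by simp
qed

lemma ip_ek_ek: "ip (ek \<eta> k) (ek \<eta> l) = (if k = l then 1 else 0)"
proof (cases "k = l")
  case True
  have "ivec 0 = 0" by (simp add: vec_eq_iff)
  then show ?thesis using True
    by (simp add: ip_def ek_mult_cnj measure_cell_measure scaleR_conv_of_real)
next
  case False
  then show ?thesis using integral_pexp[of "k - l"] by (simp add: ip_def ek_mult_cnj)
qed

text \<open>Realises the quotient by the period lattice inside the compact set \<open>torus\<close>
  in \<open>complex^3\<close>, to which the Stone-Weierstrass theorem applies.\<close>

definition torus_map :: "real^3 \<Rightarrow> complex^3" where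
  "torus_map x = (\<chi> i. exp (\<i> * of_real (x $ i)))"

lemma torus_map_continuous: "continuous_on UNIV torus_map"
  unfolding torus_map_def[abs_def] by (intro continuous_intros)

lemma torus_map_measurable [measurable]: "torus_map \<in> borel_measurable borel"
  by (intro borel_measurable_continuous_onI torus_map_continuous)

definition torus :: "(complex^3) set" where
  "torus = {z. \<forall>i. cmod (z $ i) = 1}"

lemma torus_map_in_torus: "torus_map x \<in> torus"
  by (simp add: torus_map_def torus_def norm_exp_i_times)

lemma compact_torus: "compact torus"
  unfolding compact_eq_bounded_closed
proof
  have "norm z \<le> 3" if "z \<in> torus" for z
    using that L2_set_le_sum[of UNIV "\<lambda>i. norm (z $ i)"] by (simp add: torus_def norm_vec_def)
  then show "bounded torus" by (auto simp: bounded_iff)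
  show "closed torus"
    unfolding torus_def by (intro closed_Collect_all closed_Collect_eq continuous_intros)
qed

inductive trig_poly :: "(real^3 \<Rightarrow> complex) \<Rightarrow> bool" where
  exp: "trig_poly (pexp (ivec k))"
| add: "trig_poly f \<Longrightarrow> trig_poly g \<Longrightarrow> trig_poly (\<lambda>x. f x + g x)"
| scale: "trig_poly f \<Longrightarrow> trig_poly (\<lambda>x. c * f x)"

lemma trig_poly_const: "trig_poly (\<lambda>x. c)"
  using trig_poly.scale[OF trig_poly.exp[of 0], of c] by (simp add: ivec_def zero_vec_def[symmetric] cong: if_cong)

lemma trig_poly_sum: "finite A \<Longrightarrow> (\<And>i. i \<in> A \<Longrightarrow> trig_poly (f i)) \<Longrightarrow> trig_poly (\<lambda>x. \<Sum>i\<in>A. f i x)"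
  by (induction A rule: finite_induct) (auto intro: trig_poly.add trig_poly_const)

lemma trig_poly_mult_exp: "trig_poly g \<Longrightarrow> trig_poly (\<lambda>x. pexp (ivec k) x * g x)"
proof (induction rule: trig_poly.induct)
  case (exp l)
  have "pexp (ivec (k + l)) = (\<lambda>x. pexp (ivec k) x * pexp (ivec l) x)"
    by (simp add: fun_eq_iff ivec_add pexp_add_left)
  then show ?case using trig_poly.exp[of "k + l"] by simp
next
  case (add f g)
  then show ?case by (simp add: ring_distribs trig_poly.add)
next
  case (scale f c)
  then show ?case using trig_poly.scale[OF scale.IH, of c] by (simp add: mult.left_commute)
qed

lemma trig_poly_mult: "trig_poly f \<Longrightarrow> trig_poly g \<Longrightarrow> trig_poly (\<lambda>x. f x * g x)"
proof (induction rule: trig_poly.induct)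
  case (exp l)
  then show ?case by (rule trig_poly_mult_exp)
next
  case (add f h)
  then show ?case by (simp add: ring_distribs trig_poly.add)
next
  case (scale f c)
  then show ?case using trig_poly.scale[OF scale.IH[OF scale.prems], of c] by (simp add: mult.assoc)
qed

lemma trig_poly_continuous: "trig_poly f \<Longrightarrow> continuous_on UNIV f"
  by (induction rule: trig_poly.induct) (auto intro!: continuous_intros)

lemma trig_poly_bounded: "trig_poly f \<Longrightarrow> \<exists>B. \<forall>x. cmod (f x) \<le> B"
proof (induction rule: trig_poly.induct)
  case (exp k)
  show ?case by (rule exI[of _ 1]) simp
next
  case (add f g)
  then obtain B C where "\<forall>x. cmod (f x) \<le> B" "\<forall>x. cmod (g x) \<le> C" by blast
  then show ?case by (intro exI[of _ "B + C"] allI norm_triangle_le add_mono) auto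
next
  case (scale f c)
  then obtain B where "\<forall>x. cmod (f x) \<le> B" by blast
  then show ?case by (intro exI[of _ "cmod c * B"]) (auto simp: norm_mult intro: mult_left_mono)
qed

lemma trig_poly_component:
  assumes "b \<in> Basis"
  shows "trig_poly (\<lambda>x. of_real (torus_map x \<bullet> b))"
proof -
  obtain i u where b: "b = axis i u" "u \<in> (Basis :: complex set)"
    using assms by (auto simp: Basis_vec_def)
  have e: "pexp (ivec (axis i n)) x = exp (\<i> * of_real (of_int n * x $ i))" for n x
  proof -
    have "ivec (axis i n) = axis i (of_int n)" by (simp add: vec_eq_iff axis_def)
    then show ?thesis by (simp add: pexp_def inner_axis mult.commute)
  qed
  have c: "complex_of_real (Re (exp (\<i> * of_real (x $ i)))) = (1 / 2) * pexp (ivec (axis i 1)) x + (1 / 2) * pexp (ivec (axis i (-1))) x"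
    "complex_of_real (Im (exp (\<i> * of_real (x $ i)))) = (1 / (2 * \<i>)) * pexp (ivec (axis i 1)) x + (- (1 / (2 * \<i>))) * pexp (ivec (axis i (-1))) x"
    for x
    unfolding e by (simp_all add: complex_eq_iff Re_exp Im_exp)
  have t: "trig_poly (\<lambda>x. c * pexp (ivec (axis i 1)) x + d * pexp (ivec (axis i (-1))) x)" for c d
    by (intro trig_poly.add trig_poly.scale trig_poly.exp)
  from b(2) consider "u = 1" | "u = \<i>" by (auto simp: Basis_complex_def)
  then show ?thesis
  proof cases
    case 1
    then show ?thesis
      using t[of "1 / 2" "1 / 2"] unfolding c[symmetric] by (simp add: b inner_axis torus_map_def inner_complex_def)
  next
    case 2
    then show ?thesis
      using t[of "1 / (2 * \<i>)" "- (1 / (2 * \<i>))"] unfolding c[symmetric] by (simp add: b inner_axis torus_map_def inner_complex_def)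
  qed
qed

text \<open>The real coordinates on the torus are cosines and sines, that is, combinations of two
  opposite characters; sums and products stay trigonometric.\<close>

lemma trig_poly_of_polynomial:
  "real_polynomial_function q \<Longrightarrow> trig_poly (\<lambda>x. of_real (q (torus_map x)))"
proof (induction rule: real_polynomial_function.induct)
  case (linear q)
  interpret bounded_linear q by fact
  have q: "q z = (\<Sum>b\<in>Basis. (z \<bullet> b) * q b)" for z
  proof -
    have "q z = q (\<Sum>b\<in>Basis. (z \<bullet> b) *\<^sub>R b)" by (simp add: euclidean_representation)
    then show ?thesis by (simp add: sum scaleR)
  qed
  have "trig_poly (\<lambda>x. \<Sum>b\<in>Basis. of_real (q b) * of_real (torus_map x \<bullet> b))"
    by (intro trig_poly_sum trig_poly.scale trig_poly_component) auto
  then show ?case by (subst q) (simp add: mult.commute)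
next
  case (const c)
  show ?case by (rule trig_poly_const)
next
  case (add f g)
  then show ?case by (simp add: trig_poly.add)
next
  case (mult f g)
  then show ?case by (simp add: trig_poly_mult)
qed

section \<open>Functions orthogonal to all characters\<close>

context
  fixes h :: "real^3 \<Rightarrow> complex"
  assumes h: "h \<in> cell_L2" and orth: "\<And>k. (\<integral>x. h x * pexp (ivec k) x \<partial>cell_measure) = 0"
begin

lemma integrable_mult_bounded:
  assumes [measurable]: "p \<in> borel_measurable borel" and bd: "\<And>x. cmod (p x) \<le> B"
  shows "integrable cell_measure (\<lambda>x. h x * p x)"
  using cell_L2_integrable1[OF cell_L2_mult_bounded[OF h assms]] by (simp add: mult.commute)

lemma orth_trig_poly: "trig_poly p \<Longrightarrow> (\<integral>x. h x * p x \<partial>cell_measure) = 0"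
proof (induction rule: trig_poly.induct)
  case (exp k)
  show ?case by (rule orth)
next
  case (add f g)
  have "integrable cell_measure (\<lambda>x. h x * f x)" "integrable cell_measure (\<lambda>x. h x * g x)"
    using add.hyps trig_poly_bounded borel_measurable_continuous_onI[OF trig_poly_continuous]
    by (metis integrable_mult_bounded)+
  then show ?case using add.IH by (simp add: ring_distribs)
next
  case (scale f c)
  then show ?case by (simp add: mult.left_commute)
qed

text \<open>On the compact torus a continuous function is uniformly close to a polynomial, against
  which \<open>h\<close> integrates to zero.\<close>

lemma orth_continuous:
  fixes F :: "complex^3 \<Rightarrow> real"
  assumes F: "continuous_on UNIV F"
  shows "(\<integral>x. h x * of_real (F (torus_map x)) \<partial>cell_measure) = 0"
proof -
  have [measurable]: "F \<in> borel_measurable borel" by (rule borel_measurable_continuous_onI[OF F])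
  have [measurable]: "h \<in> borel_measurable borel" by (rule cell_L2_measurable[OF h])
  define I where "I = (\<integral>x. cmod (h x) \<partial>cell_measure)"
  have I: "I \<ge> 0" by (simp add: I_def)
  have "cmod (\<integral>x. h x * of_real (F (torus_map x)) \<partial>cell_measure) \<le> e * I" if e: "e > 0" for e
  proof -
    obtain q where q: "real_polynomial_function q" "\<And>z. z \<in> torus \<Longrightarrow> \<bar>F z - q z\<bar> < e"
      using Stone_Weierstrass_real_polynomial_function[OF compact_torus continuous_on_subset[OF F] e]
      by (metis subset_UNIV)
    note tq = trig_poly_of_polynomial[OF q(1)]
    obtain B where B: "\<And>x. cmod (of_real (q (torus_map x))) \<le> B" using trig_poly_bounded[OF tq] by blast
    have m [measurable]: "(\<lambda>x. complex_of_real (q (torus_map x))) \<in> borel_measurable borel"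
      by (rule borel_measurable_continuous_onI[OF trig_poly_continuous[OF tq]])
    have bd: "cmod (of_real (F (torus_map x))) \<le> B + e" for x
      using q(2)[OF torus_map_in_torus[of x]] B[of x] by auto
    have i1: "integrable cell_measure (\<lambda>x. h x * of_real (F (torus_map x)))"
      by (rule integrable_mult_bounded[OF _ bd]) measurable
    have i2: "integrable cell_measure (\<lambda>x. h x * of_real (q (torus_map x)))"
      by (rule integrable_mult_bounded[OF m B])
    have "(\<integral>x. h x * of_real (F (torus_map x)) \<partial>cell_measure) =
        (\<integral>x. h x * of_real (F (torus_map x)) - h x * of_real (q (torus_map x)) \<partial>cell_measure)"
      using i1 i2 orth_trig_poly[OF tq] by simp
    also have "cmod \<dots> \<le> (\<integral>x. cmod (h x * of_real (F (torus_map x)) - h x * of_real (q (torus_map x))) \<partial>cell_measure)"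
      by (rule integral_norm_bound)
    also have "\<dots> \<le> (\<integral>x. cmod (h x) * e \<partial>cell_measure)"
    proof (rule integral_mono)
      show "cmod (h x * of_real (F (torus_map x)) - h x * of_real (q (torus_map x))) \<le> cmod (h x) * e" for x
        using q(2)[OF torus_map_in_torus[of x]]
        by (auto simp: norm_mult simp flip: right_diff_distrib of_real_diff intro!: mult_left_mono)
    qed (use i1 i2 cell_L2_integrable1[OF h] in auto)
    also have "\<dots> = e * I" by (simp add: I_def)
    finally show ?thesis .
  qed
  note bound = this
  have "cmod (\<integral>x. h x * of_real (F (torus_map x)) \<partial>cell_measure) \<le> 0"
  proof (rule field_le_epsilon)
    fix e :: real assume e: "0 < e"
    have "cmod (\<integral>x. h x * of_real (F (torus_map x)) \<partial>cell_measure) \<le> e / (I + 1) * I"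
      using I e by (intro bound) auto
    also have "\<dots> \<le> 0 + e" using I e by (simp add: field_simps)
    finally show "cmod (\<integral>x. h x * of_real (F (torus_map x)) \<partial>cell_measure) \<le> 0 + e" .
  qed
  then show ?thesis by simp
qed

text \<open>The indicator of a closed set is the pointwise limit of the continuous cut-offs
  \<open>F n\<close>, which are dominated by 1.\<close>

lemma orth_closed:
  assumes K: "closed K"
  shows "(\<integral>x. h x * indicator K (torus_map x) \<partial>cell_measure) = 0"
proof (cases "K = {}")
  case False
  have [measurable]: "h \<in> borel_measurable borel" by (rule cell_L2_measurable[OF h])
  have [measurable]: "K \<in> sets borel" using K by simp
  define F where "F n z = max 0 (1 - real n * infdist z K)" for n z
  have F_cont: "continuous_on UNIV (F n)" for n
    unfolding F_def by (intro continuous_intros)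
  have [measurable]: "F n \<in> borel_measurable borel" for n
    by (rule borel_measurable_continuous_onI[OF F_cont])
  have F_lim: "(\<lambda>n. F n z) \<longlonglongrightarrow> indicator K z" for z
  proof (cases "z \<in> K")
    case True
    then have "F n z = 1" for n by (simp add: F_def)
    then show ?thesis using True by simp
  next
    case z: False
    have pos: "infdist z K > 0"
      using in_closed_iff_infdist_zero[OF K False, of z] z infdist_nonneg[of z K] by linarith
    have "\<forall>\<^sub>F n in sequentially. F n z = 0"
      using eventually_ge_at_top[of "nat \<lceil>1 / infdist z K\<rceil>"]
    proof eventually_elim
      case (elim n)
      then have "real n \<ge> 1 / infdist z K" by linarith
      then show ?case using pos by (simp add: F_def field_simps)
    qed
    then show ?thesis using z by (simp add: tendsto_eventually)
  qed
  have "(\<lambda>n. \<integral>x. h x * of_real (F n (torus_map x)) \<partial>cell_measure) \<longlonglongrightarrow>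
      (\<integral>x. h x * indicator K (torus_map x) \<partial>cell_measure)"
  proof (rule integral_dominated_convergence[where w="\<lambda>x. cmod (h x)"])
    show "AE x in cell_measure. (\<lambda>n. h x * of_real (F n (torus_map x))) \<longlonglongrightarrow> h x * indicator K (torus_map x)"
    proof (rule AE_I2)
      fix x
      have "(\<lambda>n. h x * complex_of_real (F n (torus_map x))) \<longlonglongrightarrow> h x * of_real (indicator K (torus_map x))"
        by (intro tendsto_intros F_lim)
      then show "(\<lambda>n. h x * of_real (F n (torus_map x))) \<longlonglongrightarrow> h x * indicator K (torus_map x)"
        by (cases "torus_map x \<in> K") simp_all
    qed
    show "AE x in cell_measure. cmod (h x * of_real (F n (torus_map x))) \<le> cmod (h x)" for n
      using infdist_nonneg
      by (intro AE_I2) (auto simp: norm_mult F_def max_def intro!: mult_left_le mult_nonneg_nonneg)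
  qed (use cell_L2_integrable1[OF h] in auto)
  then show ?thesis
    unfolding orth_continuous[OF F_cont] LIMSEQ_const_iff by (rule sym)
qed simp

text \<open>The closed sets form a generator stable under intersection, and vanishing of the
  integral passes to complements and to countable disjoint unions.\<close>

lemma orth_borel:
  assumes B: "B \<in> sets borel"
  shows "(\<integral>x. h x * indicator B (torus_map x) \<partial>cell_measure) = 0"
proof -
  have [measurable]: "h \<in> borel_measurable borel" by (rule cell_L2_measurable[OF h])
  have int: "integrable cell_measure (\<lambda>x. h x * indicator A (torus_map x))" if [measurable]: "A \<in> sets borel" for A
    by (rule integrable_mult_bounded[where B=1]) (auto simp: indicator_def)
  have B': "B \<in> sigma_sets UNIV (Collect closed)"
    using B by (simp add: borel_eq_closed)
  have m: "sigma_sets UNIV (Collect closed) = sets (borel :: (complex^3) measure)"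
    by (simp add: borel_eq_closed)
  have "Int_stable (Collect closed :: (complex^3) set set)" by (auto simp: Int_stable_def)
  moreover have "(Collect closed :: (complex^3) set set) \<subseteq> Pow UNIV" by simp
  ultimately show ?thesis using B'
  proof (induction rule: sigma_sets_induct_disjoint)
    case (basic A)
    then show ?case using orth_closed by simp
  next
    case empty
    then show ?case by simp
  next
    case (compl A)
    have A [measurable]: "A \<in> sets borel" using compl(1) m by simp
    have "(\<integral>x. h x * indicator (UNIV - A) (torus_map x) \<partial>cell_measure) =
        (\<integral>x. h x * indicator UNIV (torus_map x) - h x * indicator A (torus_map x) \<partial>cell_measure)"
      by (intro Bochner_Integration.integral_cong) (auto simp: indicator_def)
    also have "\<dots> = 0" using int[of UNIV] int[OF A] orth_closed[of UNIV] compl by simp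
    finally show ?case .
  next
    case (union A)
    have A [measurable]: "A i \<in> sets borel" for i using union(2) m by auto
    have U [measurable]: "(\<Union>i\<in>I. A i) \<in> sets borel" for I :: "nat set" by auto
    have "(\<lambda>n. \<integral>x. h x * indicator (\<Union>i<n. A i) (torus_map x) \<partial>cell_measure) \<longlonglongrightarrow>
      (\<integral>x. h x * indicator (\<Union>i. A i) (torus_map x) \<partial>cell_measure)"
    proof (rule integral_dominated_convergence[where w="\<lambda>x. cmod (h x)"])
      show "AE x in cell_measure. (\<lambda>n. h x * indicator (\<Union>i<n. A i) (torus_map x)) \<longlonglongrightarrow> h x * indicator (\<Union>i. A i) (torus_map x)"
        by (intro AE_I2 tendsto_mult tendsto_const LIMSEQ_indicator_UN)
      show "AE x in cell_measure. cmod (h x * indicator (\<Union>i<n. A i) (torus_map x)) \<le> cmod (h x)" for n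
        by (intro AE_I2) (auto simp: indicator_def)
    qed (use cell_L2_integrable1[OF h] in auto)
    moreover have "(\<integral>x. h x * indicator (\<Union>i<n. A i) (torus_map x) \<partial>cell_measure) = 0" for n
    proof -
      have ind: "(indicator (\<Union>i<n. A i) z :: complex) = (\<Sum>i<n. indicator (A i) z)" for z
        by (rule indicator_UN_disjoint) (use union(1) in \<open>auto simp: disjoint_family_on_def\<close>)
      have "(\<integral>x. h x * indicator (\<Union>i<n. A i) (torus_map x) \<partial>cell_measure) =
          (\<integral>x. (\<Sum>i<n. h x * indicator (A i) (torus_map x)) \<partial>cell_measure)"
        unfolding ind sum_distrib_left ..
      also have "\<dots> = (\<Sum>i<n. \<integral>x. h x * indicator (A i) (torus_map x) \<partial>cell_measure)"
        by (intro Bochner_Integration.integral_sum int A)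
      also have "\<dots> = 0" unfolding union(3) by simp
      finally show ?thesis .
    qed
    ultimately have "(\<lambda>n::nat. 0) \<longlonglongrightarrow> (\<integral>x. h x * indicator (\<Union>i. A i) (torus_map x) \<partial>cell_measure)"
      by (simp only:)
    then show ?case unfolding LIMSEQ_const_iff by (rule sym)
  qed
qed

end

text \<open>Half-angle formula: \<open>sin t / (1 - cos t)\<close> is the cotangent of
  \<open>t / 2\<close>, that is \<open>tan (pi / 2 - t / 2)\<close>. Being a Borel left inverse of
  \<open>torus_map\<close> on the open cell, it lets Borel subsets of the cell be pulled back from
  the torus.\<close>

definition torus_inv :: "complex^3 \<Rightarrow> real^3" where
  "torus_inv z = (\<chi> i. pi - 2 * arctan (Im (z $ i) / (1 - Re (z $ i))))"

lemma torus_inv_torus_map: "x \<in> cell \<Longrightarrow> torus_inv (torus_map x) = x"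
proof -
  assume x: "x \<in> cell"
  have "pi - 2 * arctan (sin t / (1 - cos t)) = t" if t: "0 < t" "t < 2 * pi" for t
  proof -
    have s: "sin (t / 2) > 0" using t by (intro sin_gt_zero) auto
    have a: "sin t = 2 * sin (t / 2) * cos (t / 2)" using sin_double[of "t / 2"] by simp
    have b: "1 - cos t = 2 * (sin (t / 2))\<^sup>2"
      using cos_double_sin[of "t / 2"] by simp
    have "sin t / (1 - cos t) = cos (t / 2) / sin (t / 2)"
      unfolding a b using s by (simp add: power2_eq_square)
    also have "\<dots> = tan (pi / 2 - t / 2)"
      by (simp add: tan_def sin_diff cos_diff)
    finally have "arctan (sin t / (1 - cos t)) = pi / 2 - t / 2"
      using arctan_tan[of "pi / 2 - t / 2"] t by simp
    then show ?thesis by simp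
  qed
  then show ?thesis
    using x by (simp add: torus_inv_def torus_map_def vec_eq_iff cell_def Re_exp Im_exp)
qed

lemma torus_inv_measurable [measurable]: "torus_inv \<in> borel_measurable borel"
proof (rule borel_measurable_euclidean_space[THEN iffD2], rule ballI)
  fix b :: "real^3" assume "b \<in> Basis"
  then obtain i where b: "b = axis i 1" by (auto simp: Basis_vec_def)
  have [measurable]: "(\<lambda>z :: complex^3. z $ i) \<in> borel_measurable borel"
    by (intro borel_measurable_continuous_onI continuous_intros)
  show "(\<lambda>z. torus_inv z \<bullet> b) \<in> borel_measurable borel"
    unfolding b inner_axis torus_inv_def by simp
qed

text \<open>Up to a null set of the cell measure each Borel set is the preimage under
  \<open>torus_map\<close> of a Borel set, so the integral of \<open>h\<close> over every set is
  zero.\<close>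

lemma Fourier_complete:
  assumes h: "h \<in> cell_L2" and orth: "\<And>k. (\<integral>x. h x * pexp (ivec k) x \<partial>cell_measure) = 0"
  shows "AE x in cell_measure. h x = 0"
proof (rule cellM.density_zero)
  have [measurable]: "h \<in> borel_measurable borel" by (rule cell_L2_measurable[OF h])
  show "integrable cell_measure h" by (rule cell_L2_integrable1[OF h])
  fix A assume "A \<in> sets cell_measure"
  then have [measurable]: "A \<in> sets borel" by simp
  have [measurable]: "torus_inv -` A \<in> sets borel"
    using measurable_sets[OF torus_inv_measurable, of A] by simp
  have "set_lebesgue_integral cell_measure A h = (\<integral>x. h x * indicator (torus_inv -` A) (torus_map x) \<partial>cell_measure)"
    unfolding set_lebesgue_integral_def
  proof (rule integral_cong_AE)
    show "AE x in cell_measure. indicator A x *\<^sub>R h x = h x * indicator (torus_inv -` A) (torus_map x)"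
      using AE_in_cell by eventually_elim (auto simp: indicator_def torus_inv_torus_map)
  qed measurable
  then show "set_lebesgue_integral cell_measure A h = 0"
    using orth_borel[OF h orth, of "torus_inv -` A"] by simp
qed

section \<open>Fourier coefficients, convergence in mean square and Parseval's identity\<close>

definition fc :: "real^3 \<Rightarrow> (real^3 \<Rightarrow> complex) \<Rightarrow> int^3 \<Rightarrow> complex" where
  "fc \<eta> f k = ip f (ek \<eta> k)"

definition ftrig :: "real^3 \<Rightarrow> (int^3) set \<Rightarrow> (int^3 \<Rightarrow> complex) \<Rightarrow> real^3 \<Rightarrow> complex" where
  "ftrig \<eta> A c x = (\<Sum>k\<in>A. c k * ek \<eta> k x)"

lemma ftrig_L2 [simp]: "ftrig \<eta> A c \<in> cell_L2"
  unfolding ftrig_def[abs_def] by (intro cell_L2_sum cell_L2_scale ek_L2)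

lemma fc_ftrig: "finite A \<Longrightarrow> fc \<eta> (ftrig \<eta> A c) k = (if k \<in> A then c k else 0)"
  unfolding fc_def ftrig_def[abs_def]
  by (subst ip_sum_left) (auto simp: cell_L2_scale ip_scale_left ip_ek_ek if_distrib[of "(*) _"] cong: if_cong)

lemma ip_ftrig: "finite A \<Longrightarrow> f \<in> cell_L2 \<Longrightarrow> ip f (ftrig \<eta> A c) = (\<Sum>k\<in>A. cnj (c k) * fc \<eta> f k)"
  unfolding fc_def ftrig_def[abs_def]
  by (subst ip_sum_right) (auto simp: cell_L2_scale ip_scale_right)

lemma ip_ftrig_ftrig: "finite A \<Longrightarrow> ip (ftrig \<eta> A b) (ftrig \<eta> A c) = (\<Sum>k\<in>A. b k * cnj (c k))"
  by (simp add: ip_ftrig fc_ftrig mult.commute)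

lemma nrm2_ftrig: "finite A \<Longrightarrow> nrm2 (ftrig \<eta> A c) = (\<Sum>k\<in>A. (cmod (c k))\<^sup>2)"
proof -
  assume "finite A"
  then have "complex_of_real (nrm2 (ftrig \<eta> A c)) = of_real (\<Sum>k\<in>A. (cmod (c k))\<^sup>2)"
    by (simp add: ip_self[symmetric] ip_ftrig_ftrig complex_norm_square del: of_real_power)
  then show ?thesis using of_real_eq_iff by blast
qed

lemma nrm2_diff_ftrig:
  assumes "finite A" "f \<in> cell_L2"
  shows "nrm2 (\<lambda>x. f x - ftrig \<eta> A (fc \<eta> f) x) = nrm2 f - (\<Sum>k\<in>A. (cmod (fc \<eta> f k))\<^sup>2)"
proof -
  have "ip f (ftrig \<eta> A (fc \<eta> f)) = of_real (\<Sum>k\<in>A. (cmod (fc \<eta> f k))\<^sup>2)"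
    using assms by (simp add: ip_ftrig complex_norm_square mult.commute del: of_real_power)
  then show ?thesis
    using nrm2_diff[OF assms(2) ftrig_L2, of \<eta> A "fc \<eta> f"] nrm2_ftrig[OF assms(1), of \<eta> "fc \<eta> f"] by simp
qed

lemma Bessel:
  assumes "finite A" "f \<in> cell_L2"
  shows "(\<Sum>k\<in>A. (cmod (fc \<eta> f k))\<^sup>2) \<le> nrm2 f"
  using nrm2_diff_ftrig[OF assms, of \<eta>] nrm2_nonneg[of "\<lambda>x. f x - ftrig \<eta> A (fc \<eta> f) x"] by linarith

lemma ibox_mono: "M \<le> N \<Longrightarrow> ibox M \<subseteq> ibox N"
  unfolding ibox_def by (auto intro: order_trans)

lemma ftrig_diff: "finite B \<Longrightarrow> A \<subseteq> B \<Longrightarrow> ftrig \<eta> B c x - ftrig \<eta> A c x = ftrig \<eta> (B - A) c x"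
  unfolding ftrig_def by (subst sum_diff) auto

text \<open>Multiplication by the unimodular \<open>pexp (- \<eta>)\<close> reduces the twisted
  basis to the periodic characters; the index changes sign because \<open>ip\<close> conjugates its
  second argument.\<close>

lemma fc_eq_0_AE:
  assumes f: "f \<in> cell_L2" and 0: "\<And>k. fc \<eta> f k = 0"
  shows "AE x in cell_measure. f x = 0"
proof -
  have "AE x in cell_measure. pexp (- \<eta>) x * f x = 0"
  proof (rule Fourier_complete)
    show "(\<lambda>x. pexp (- \<eta>) x * f x) \<in> cell_L2"
      by (rule cell_L2_mult_bounded[OF f, where B=1]) auto
    fix k
    have "fc \<eta> f (- k) = of_real (1 / sqrt ((2 * pi) ^ 3)) * (\<integral>x. (pexp (- \<eta>) x * f x) * pexp (ivec k) x \<partial>cell_measure)"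
    proof -
      have "pexp (- (\<eta> + ivec (- k))) x = pexp (- \<eta>) x * pexp (ivec k) x" for x
      proof -
        have "- (\<eta> + ivec (- k)) = - \<eta> + ivec k" by (simp add: vec_eq_iff)
        then show ?thesis by (simp only: pexp_add_left)
      qed
      then show ?thesis
        unfolding fc_def ip_def ek_def complex_cnj_mult cnj_pexp complex_cnj_complex_of_real
        by (subst Bochner_Integration.integral_mult_right_zero[symmetric], intro Bochner_Integration.integral_cong refl)
          (simp add: mult_ac)
    qed
    then have "of_real (1 / sqrt ((2 * pi) ^ 3)) * (\<integral>x. (pexp (- \<eta>) x * f x) * pexp (ivec k) x \<partial>cell_measure) = 0"
      using 0 by metis
    then show "(\<integral>x. (pexp (- \<eta>) x * f x) * pexp (ivec k) x \<partial>cell_measure) = 0"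
      using cell_volume_pos by auto
  qed
  then show ?thesis
    by eventually_elim (metis cmod_pexp mult_eq_0_iff norm_zero zero_neq_one)
qed

text \<open>Bessel's inequality makes the partial sums Cauchy; their limit has the same coefficients
  as \<open>f\<close>, and completeness identifies the two.\<close>

theorem Fourier_tendsto:
  assumes f: "f \<in> cell_L2"
  shows "(\<lambda>N. nrm2 (\<lambda>x. f x - ftrig \<eta> (ibox N) (fc \<eta> f) x)) \<longlonglongrightarrow> 0"
proof -
  define S where "S N = ftrig \<eta> (ibox N) (fc \<eta> f)" for N
  define a where "a N = (\<Sum>k\<in>ibox N. (cmod (fc \<eta> f k))\<^sup>2)" for N
  have S: "S N \<in> cell_L2" for N by (simp add: S_def)
  have "incseq a"
    unfolding a_def incseq_def by (auto intro!: sum_mono2 ibox_mono)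
  moreover have "bdd_above (range a)"
    using Bessel[OF _ f, of _ \<eta>] by (auto simp: a_def bdd_above_def intro!: exI[of _ "nrm2 f"])
  ultimately have "convergent a" using LIMSEQ_incseq_SUP convergent_def by blast
  then have Ca: "Cauchy a" by (rule convergent_Cauchy)
  have S_diff: "nrm2 (\<lambda>x. S M x - S N x) = \<bar>a M - a N\<bar>" for M N
  proof -
    have *: "nrm2 (\<lambda>x. S N x - S M x) = \<bar>a N - a M\<bar>" if "M \<le> N" for M N
    proof -
      have sub: "ibox M \<subseteq> ibox N" by (rule ibox_mono[OF that])
      have "nrm2 (\<lambda>x. S N x - S M x) = (\<Sum>k\<in>ibox N - ibox M. (cmod (fc \<eta> f k))\<^sup>2)"
        by (simp add: S_def ftrig_diff[OF _ sub] nrm2_ftrig)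
      also have "\<dots> = a N - a M" unfolding a_def by (rule sum_diff) (use sub in auto)
      finally show ?thesis by (metis abs_of_nonneg nrm2_nonneg)
    qed
    show ?thesis
      using *[of M N] *[of N M] by (cases "M \<le> N") (auto simp: nrm2_minus_commute[of "S N"] abs_minus_commute)
  qed
  obtain g where g: "g \<in> cell_L2" and lim: "(\<lambda>n. nrm2 (\<lambda>x. S n x - g x)) \<longlonglongrightarrow> 0"
  proof (rule Riesz_Fischer_cell[OF S])
    fix e :: real assume "e > 0"
    from Ca[unfolded Cauchy_def, rule_format, OF this]
    show "\<exists>N. \<forall>m\<ge>N. \<forall>n\<ge>N. nrm2 (\<lambda>x. S m x - S n x) < e"
      unfolding S_diff by (simp add: dist_real_def)
  qed blast
  have "fc \<eta> (\<lambda>x. f x - g x) k = 0" for k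
  proof -
    have "(\<lambda>n. ip (S n) (ek \<eta> k)) \<longlonglongrightarrow> ip g (ek \<eta> k)"
      by (rule ip_tendsto_left[OF S g ek_L2 lim])
    moreover have "\<forall>\<^sub>F n in sequentially. ip (S n) (ek \<eta> k) = fc \<eta> f k"
      using eventually_ge_at_top[of "nat \<bar>k $ 1\<bar> + nat \<bar>k $ 2\<bar> + nat \<bar>k $ 3\<bar>"]
    proof eventually_elim
      case (elim n)
      then have "k \<in> ibox n" by (auto simp: ibox_def forall_3)
      then show ?case using fc_ftrig[of "ibox n" \<eta> "fc \<eta> f" k] by (simp add: S_def fc_def)
    qed
    then have "(\<lambda>n. ip (S n) (ek \<eta> k)) \<longlonglongrightarrow> fc \<eta> f k" by (rule tendsto_eventually)
    ultimately have "ip g (ek \<eta> k) = fc \<eta> f k" by (rule LIMSEQ_unique)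
    then show ?thesis unfolding fc_def using f g by (simp add: ip_diff_left)
  qed
  then have ae: "AE x in cell_measure. f x - g x = 0"
    by (rule fc_eq_0_AE[OF cell_L2_diff[OF f g]])
  have "nrm2 (\<lambda>x. f x - S n x) = nrm2 (\<lambda>x. S n x - g x)" for n
  proof -
    have "nrm2 (\<lambda>x. S n x - f x) = nrm2 (\<lambda>x. S n x - g x)"
    proof (rule nrm2_cong_AE)
      show "AE x in cell_measure. S n x - f x = S n x - g x"
        using ae by eventually_elim simp
    qed (auto intro: cell_L2_diff S f g)
    then show ?thesis by (simp add: nrm2_minus_commute[of f])
  qed
  then show ?thesis using lim by (simp add: S_def)
qed

lemma Parseval:
  assumes f: "f \<in> cell_L2"
  shows "(\<lambda>N. \<Sum>k\<in>ibox N. (cmod (fc \<eta> f k))\<^sup>2) \<longlonglongrightarrow> nrm2 f"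
proof -
  have "(\<lambda>N. nrm2 f - nrm2 (\<lambda>x. f x - ftrig \<eta> (ibox N) (fc \<eta> f) x)) \<longlonglongrightarrow> nrm2 f - 0"
    by (intro tendsto_intros Fourier_tendsto f)
  then show ?thesis by (simp add: nrm2_diff_ftrig f)
qed

lemma Parseval_ip:
  assumes f: "f \<in> cell_L2" and h: "h \<in> cell_L2"
  shows "(\<lambda>N. \<Sum>k\<in>ibox N. fc \<eta> f k * cnj (fc \<eta> h k)) \<longlonglongrightarrow> ip f h"
proof -
  have "(\<lambda>N. ip (ftrig \<eta> (ibox N) (fc \<eta> f)) h) \<longlonglongrightarrow> ip f h"
    using Fourier_tendsto[OF f, of \<eta>]
    by (intro ip_tendsto_left f h ftrig_L2) (simp add: nrm2_minus_commute[of f])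
  moreover have "ip (ftrig \<eta> (ibox N) (fc \<eta> f)) h = (\<Sum>k\<in>ibox N. fc \<eta> f k * cnj (fc \<eta> h k))" for N
    by (subst ip_cnj) (simp add: ip_ftrig h)
  ultimately show ?thesis by simp
qed

section \<open>Fourier coefficients of weak gradients\<close>

lemma vec_nth_measurable [measurable (raw)]:
  fixes g :: "'a \<Rightarrow> 'b::{second_countable_topology, real_normed_vector}^3"
  assumes "g \<in> borel_measurable M"
  shows "(\<lambda>x. g x $ j) \<in> borel_measurable M"
  using assms by (rule measurable_compose) (intro borel_measurable_continuous_onI continuous_intros)

lemma le_square_plus_1: "(x :: real) \<le> x\<^sup>2 + 1"
proof -
  have "0 \<le> (x - 1 / 2)\<^sup>2" by simp
  then show ?thesis by (simp add: power2_eq_square algebra_simps)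
qed

lemma has_weak_gradient_L2_loc:
  assumes "has_weak_gradient f g"
  shows "f \<in> L2_loc" "g \<in> L2_loc"
  using assms by (auto simp: has_weak_gradient_def)

lemma L2_loc_measurable: "f \<in> L2_loc \<Longrightarrow> f \<in> borel_measurable borel"
  by (simp add: L2_loc_def)

lemma L2_loc_component:
  fixes g :: "real^3 \<Rightarrow> complex^3"
  assumes "g \<in> L2_loc"
  shows "(\<lambda>x. g x $ j) \<in> L2_loc"
proof -
  have [measurable]: "g \<in> borel_measurable borel" using assms by (rule L2_loc_measurable)
  have "set_integrable lborel K (\<lambda>x. (norm (g x $ j))\<^sup>2)" if "compact K" for K
  proof (rule set_integrable_bound)
    show "set_integrable lborel K (\<lambda>x. (norm (g x))\<^sup>2)"
      using assms that by (auto simp: L2_loc_def)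
    have [measurable]: "K \<in> sets borel" using that by (intro borel_closed compact_imp_closed)
    show "set_borel_measurable lborel K (\<lambda>x. (norm (g x $ j))\<^sup>2)"
      unfolding set_borel_measurable_def by measurable
    show "AE x in lborel. x \<in> K \<longrightarrow> norm ((norm (g x $ j))\<^sup>2) \<le> norm ((norm (g x))\<^sup>2)"
      by (auto intro!: AE_I2 power_mono Finite_Cartesian_Product.norm_nth_le)
  qed
  then show ?thesis by (simp add: L2_loc_def)
qed

lemma L2_loc_cell_L2:
  fixes f :: "real^3 \<Rightarrow> complex"
  assumes "f \<in> L2_loc"
  shows "f \<in> cell_L2"
proof -
  have [measurable]: "f \<in> borel_measurable borel" using assms by (rule L2_loc_measurable)
  have "set_integrable lborel (cbox 0 (\<chi> i. 2 * pi)) (\<lambda>x. (norm (f x))\<^sup>2)"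
    using assms by (auto simp: L2_loc_def)
  then have "set_integrable lborel cell (\<lambda>x. (norm (f x))\<^sup>2)"
    by (rule set_integrable_subset) (auto simp: cell_eq_box box_subset_cbox)
  then show ?thesis
    by (simp add: cell_L2_def integrable_cell set_integrable_def)
qed

lemma weak_gradient_cell_L2:
  assumes "has_weak_gradient f g"
  shows "f \<in> cell_L2" "(\<lambda>x. g x $ j) \<in> cell_L2"
  using has_weak_gradient_L2_loc[OF assms] L2_loc_cell_L2 L2_loc_component by blast+

text \<open>Local square integrability implies local integrability through
  \<open>x \<le> x^2 + 1\<close>, the constant being integrable on compact sets.\<close>

lemma integrable_compact_support_L2_loc:
  fixes f u :: "real^3 \<Rightarrow> complex"
  assumes f: "f \<in> L2_loc" and [measurable]: "u \<in> borel_measurable borel"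
    and bd: "\<And>x. cmod (u x) \<le> B" and K: "compact K" and supp: "\<And>x. x \<notin> K \<Longrightarrow> u x = 0"
  shows "integrable lborel (\<lambda>x. u x * f x)"
proof -
  have [measurable]: "f \<in> borel_measurable borel" using f by (rule L2_loc_measurable)
  have [measurable]: "K \<in> sets borel" using K by (intro borel_closed compact_imp_closed)
  have B: "B \<ge> 0" using bd[of 0] norm_ge_zero order_trans by blast
  have "integrable lborel (\<lambda>x. indicator K x *\<^sub>R (cmod (f x))\<^sup>2)"
    using f K by (auto simp: L2_loc_def set_integrable_def)
  moreover have "integrable lborel (indicator K :: real^3 \<Rightarrow> real)"
    using emeasure_bounded_finite[OF compact_imp_bounded[OF K]] by (intro integrable_real_indicator) auto
  ultimately have "integrable lborel (\<lambda>x. B * (indicator K x *\<^sub>R (cmod (f x))\<^sup>2 + indicator K x))"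
    by (intro Bochner_Integration.integrable_mult_right Bochner_Integration.integrable_add)
  then show ?thesis
  proof (rule Bochner_Integration.integrable_bound)
    show "AE x in lborel. norm (u x * f x) \<le> norm (B * (indicator K x *\<^sub>R (cmod (f x))\<^sup>2 + indicator K x))"
    proof (rule AE_I2)
      fix x
      show "norm (u x * f x) \<le> norm (B * (indicator K x *\<^sub>R (cmod (f x))\<^sup>2 + indicator K x))"
      proof (cases "x \<in> K")
        case True
        have "cmod (u x) * cmod (f x) \<le> B * ((cmod (f x))\<^sup>2 + 1)"
          using bd[of x] B by (intro mult_mono le_square_plus_1) auto
        then show ?thesis using True B by (simp add: norm_mult)
      qed (simp add: supp)
    qed
  qed measurable
qed

lemma test_function_bounds:
  assumes "test_function \<phi>"
  obtains K B where "compact K" "\<And>x. x \<notin> K \<Longrightarrow> \<phi> x = 0" "\<And>x j. x \<notin> K \<Longrightarrow> partial_deriv j \<phi> x = 0"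
    "\<And>x. \<bar>\<phi> x\<bar> \<le> B" "\<And>x j. \<bar>partial_deriv j \<phi> x\<bar> \<le> B" "B \<ge> 0"
proof -
  define K where "K = closure {x. \<phi> x \<noteq> 0}"
  have K: "compact K" using assms by (simp add: test_function_def K_def)
  have 0: "\<phi> x = 0" if "x \<notin> K" for x
    using that closure_subset[of "{x. \<phi> x \<noteq> 0}"] by (auto simp: K_def)
  have 1: "partial_deriv j \<phi> x = 0" if "x \<notin> K" for x j
  proof -
    have "(\<phi> has_derivative (\<lambda>_. 0)) (at x)"
      by (rule has_derivative_transform_within_open[OF has_derivative_const[of 0], where s="- K"])
        (use that K 0 in \<open>auto intro: compact_imp_closed\<close>)
    then show ?thesis by (rule partial_deriv_eqI)
  qed
  have bnd: "\<exists>B. \<forall>x. \<bar>f x\<bar> \<le> B" if c: "continuous_on UNIV f" and z: "\<And>x. x \<notin> K \<Longrightarrow> f x = 0"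
    for f :: "real^3 \<Rightarrow> real"
  proof -
    obtain B where B: "\<And>x. x \<in> K \<Longrightarrow> norm (f x) \<le> B"
      using continuous_on_compact_bound[OF K continuous_on_subset[OF c]] by blast
    have "\<bar>f x\<bar> \<le> max B 0" for x using B[of x] z[of x] by (cases "x \<in> K") auto
    then show ?thesis by blast
  qed
  obtain B0 where B0: "\<And>x. \<bar>\<phi> x\<bar> \<le> B0" using bnd[OF test_function_continuous[OF assms] 0] by blast
  have "\<forall>j. \<exists>B. \<forall>x. \<bar>partial_deriv j \<phi> x\<bar> \<le> B"
    by (intro allI bnd test_function_partial_continuous[OF assms] 1)
  then obtain Bj where Bj: "\<And>j x. \<bar>partial_deriv j \<phi> x\<bar> \<le> Bj j" by metis
  have Bj0: "Bj j \<ge> 0" for j using Bj[where j=j and x=0] by linarith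
  have B0': "B0 \<ge> 0" using B0[of 0] by linarith
  have *: "B0 \<le> B0 + (\<Sum>j\<in>UNIV. Bj j)" "Bj j \<le> B0 + (\<Sum>j\<in>UNIV. Bj j)" for j
    using sum_nonneg[of UNIV Bj] member_le_sum[of j UNIV Bj] Bj0 B0' by auto
  have c1: "\<bar>\<phi> x\<bar> \<le> B0 + (\<Sum>j\<in>UNIV. Bj j)" for x
    using B0[of x] *(1) by (rule order_trans)
  have c2: "\<bar>partial_deriv j \<phi> x\<bar> \<le> B0 + (\<Sum>j\<in>UNIV. Bj j)" for x j
    using Bj[of j x] *(2)[of j] by (rule order_trans)
  have c3: "0 \<le> B0 + (\<Sum>j\<in>UNIV. Bj j)" using B0' *(1) by (rule order_trans)
  show thesis by (rule that[OF K 0 1 c1 c2 c3])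
qed

lemma test_function_measurable:
  assumes "test_function \<phi>"
  shows "\<phi> \<in> borel_measurable borel" "partial_deriv j \<phi> \<in> borel_measurable borel"
  using test_function_continuous[OF assms] test_function_partial_continuous[OF assms]
  by (auto intro: borel_measurable_continuous_onI)

text \<open>Test functions are real, so the complex weight is reached by testing with
  \<open>\<theta>\<close> times cosine and \<open>\<theta>\<close> times sine and combining the two
  identities.\<close>

lemma weak_gradient_pexp:
  assumes wg: "has_weak_gradient f g" and \<theta>: "test_function \<theta>"
  shows "(LINT x|lborel. (of_real (partial_deriv j \<theta> x) - \<i> * of_real (\<kappa> $ j) * of_real (\<theta> x)) * pexp (- \<kappa>) x * f x)
      = - (LINT x|lborel. of_real (\<theta> x) * pexp (- \<kappa>) x * g x $ j)"
proof -
  obtain K B where KB: "compact K" "\<And>x. x \<notin> K \<Longrightarrow> \<theta> x = 0" "\<And>x j. x \<notin> K \<Longrightarrow> partial_deriv j \<theta> x = 0"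
    "\<And>x. \<bar>\<theta> x\<bar> \<le> B" "\<And>x j. \<bar>partial_deriv j \<theta> x\<bar> \<le> B" "B \<ge> 0"
    using test_function_bounds[OF \<theta>] by metis
  note f = has_weak_gradient_L2_loc(1)[OF wg]
  note g = L2_loc_component[OF has_weak_gradient_L2_loc(2)[OF wg], of j]
  have [measurable]: "\<theta> \<in> borel_measurable borel" "partial_deriv j \<theta> \<in> borel_measurable borel" for j
    using test_function_measurable[OF \<theta>] by auto
  define c s where "c x = cos (x \<bullet> \<kappa>)" and "s x = sin (x \<bullet> \<kappa>)" for x
  have [measurable]: "c \<in> borel_measurable borel" "s \<in> borel_measurable borel"
    unfolding c_def s_def by measurable
  have pe: "pexp (- \<kappa>) x = of_real (c x) - \<i> * of_real (s x)" for x
    by (simp add: pexp_def c_def s_def complex_eq_iff Re_exp Im_exp)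
  have dc: "((\<lambda>x. cos (x \<bullet> \<kappa>)) has_derivative (\<lambda>h. - sin (x \<bullet> \<kappa>) * (h \<bullet> \<kappa>))) (at x)" for x
    by (auto intro!: derivative_eq_intros)
  have ds: "((\<lambda>x. sin (x \<bullet> \<kappa>)) has_derivative (\<lambda>h. cos (x \<bullet> \<kappa>) * (h \<bullet> \<kappa>))) (at x)" for x
    by (auto intro!: derivative_eq_intros)
  have tc: "test_function (\<lambda>x. \<theta> x * c x)" and ts: "test_function (\<lambda>x. \<theta> x * s x)"
    unfolding c_def s_def using cont_diff_cos_sin by (auto intro: test_function_mult \<theta>)
  have dif: "\<theta> differentiable (at x)" "c differentiable (at x)" "s differentiable (at x)" for x
    using test_function_differentiable[OF \<theta>] dc ds by (auto simp: differentiable_def c_def[abs_def] s_def[abs_def])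
  have pc: "partial_deriv j (\<lambda>x. \<theta> x * c x) x = partial_deriv j \<theta> x * c x - \<theta> x * (\<kappa> $ j * s x)" for x
    unfolding partial_deriv_mult[OF dif(1,2)] unfolding c_def[abs_def] partial_deriv_eqI[OF dc]
    by (simp add: inner_axis' s_def)
  have ps: "partial_deriv j (\<lambda>x. \<theta> x * s x) x = partial_deriv j \<theta> x * s x + \<theta> x * (\<kappa> $ j * c x)" for x
    unfolding partial_deriv_mult[OF dif(1,3)] unfolding s_def[abs_def] partial_deriv_eqI[OF ds]
    by (simp add: inner_axis' c_def)
  have cs1: "\<bar>c x\<bar> \<le> 1" "\<bar>s x\<bar> \<le> 1" for x by (simp_all add: c_def s_def)
  have tb: "cmod (of_real (\<theta> x * c x)) \<le> B" "cmod (of_real (\<theta> x * s x)) \<le> B" for x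
    using mult_mono[OF KB(4)[of x] cs1(1)[of x]] mult_mono[OF KB(4)[of x] cs1(2)[of x]] KB(6) by (auto simp: abs_mult norm_mult)
  have kb: "\<bar>\<kappa> $ j * s x\<bar> \<le> \<bar>\<kappa> $ j\<bar>" "\<bar>\<kappa> $ j * c x\<bar> \<le> \<bar>\<kappa> $ j\<bar>" for x
    using cs1[of x] by (auto simp: abs_mult intro: mult_left_le)
  have db: "cmod (of_real (partial_deriv j (\<lambda>x. \<theta> x * c x) x)) \<le> B + B * \<bar>\<kappa> $ j\<bar>"
    "cmod (of_real (partial_deriv j (\<lambda>x. \<theta> x * s x) x)) \<le> B + B * \<bar>\<kappa> $ j\<bar>" for x
  proof -
    have "\<bar>partial_deriv j \<theta> x * c x\<bar> \<le> B * 1" "\<bar>partial_deriv j \<theta> x * s x\<bar> \<le> B * 1"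
      "\<bar>\<theta> x * (\<kappa> $ j * s x)\<bar> \<le> B * \<bar>\<kappa> $ j\<bar>" "\<bar>\<theta> x * (\<kappa> $ j * c x)\<bar> \<le> B * \<bar>\<kappa> $ j\<bar>"
      unfolding abs_mult[of "partial_deriv j \<theta> x"] abs_mult[of "\<theta> x"]
      by (intro mult_mono KB cs1 kb abs_ge_zero)+
    then show "cmod (of_real (partial_deriv j (\<lambda>x. \<theta> x * c x) x)) \<le> B + B * \<bar>\<kappa> $ j\<bar>"
      "cmod (of_real (partial_deriv j (\<lambda>x. \<theta> x * s x) x)) \<le> B + B * \<bar>\<kappa> $ j\<bar>"
      unfolding pc ps norm_of_real by linarith+
  qed
  have [measurable]: "partial_deriv j (\<lambda>x. \<theta> x * c x) \<in> borel_measurable borel" "partial_deriv j (\<lambda>x. \<theta> x * s x) \<in> borel_measurable borel"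
    using test_function_measurable tc ts by auto
  have i1: "integrable lborel (\<lambda>x. of_real (partial_deriv j (\<lambda>x. \<theta> x * c x) x) * f x)"
    by (rule integrable_compact_support_L2_loc[OF f _ db(1) KB(1)]) (auto simp: pc KB(2,3))
  have i2: "integrable lborel (\<lambda>x. of_real (partial_deriv j (\<lambda>x. \<theta> x * s x) x) * f x)"
    by (rule integrable_compact_support_L2_loc[OF f _ db(2) KB(1)]) (auto simp: ps KB(2,3))
  have i3: "integrable lborel (\<lambda>x. of_real (\<theta> x * c x) * g x $ j)"
    by (rule integrable_compact_support_L2_loc[OF g _ tb(1) KB(1)]) (auto simp: KB(2,3))
  have i4: "integrable lborel (\<lambda>x. of_real (\<theta> x * s x) * g x $ j)"
    by (rule integrable_compact_support_L2_loc[OF g _ tb(2) KB(1)]) (auto simp: KB(2,3))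
  have w: "(LINT x|lborel. of_real (partial_deriv j (\<lambda>x. \<theta> x * c x) x) * f x) = - (LINT x|lborel. of_real (\<theta> x * c x) * (g x $ j))"
    "(LINT x|lborel. of_real (partial_deriv j (\<lambda>x. \<theta> x * s x) x) * f x) = - (LINT x|lborel. of_real (\<theta> x * s x) * (g x $ j))"
    using wg tc ts unfolding has_weak_gradient_def by blast+
  have "(LINT x|lborel. (of_real (partial_deriv j \<theta> x) - \<i> * of_real (\<kappa> $ j) * of_real (\<theta> x)) * pexp (- \<kappa>) x * f x)
    = (LINT x|lborel. of_real (partial_deriv j (\<lambda>x. \<theta> x * c x) x) * f x - \<i> * (of_real (partial_deriv j (\<lambda>x. \<theta> x * s x) x) * f x))"
    by (intro Bochner_Integration.integral_cong refl) (simp add: pc ps pe algebra_simps)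
  also have "\<dots> = (LINT x|lborel. of_real (partial_deriv j (\<lambda>x. \<theta> x * c x) x) * f x) - \<i> * (LINT x|lborel. of_real (partial_deriv j (\<lambda>x. \<theta> x * s x) x) * f x)"
    using i1 i2 by simp
  also have "\<dots> = - ((LINT x|lborel. of_real (\<theta> x * c x) * (g x $ j)) - \<i> * (LINT x|lborel. of_real (\<theta> x * s x) * (g x $ j)))"
    unfolding w by simp
  also have "\<dots> = - (LINT x|lborel. of_real (\<theta> x * c x) * (g x $ j) - \<i> * (of_real (\<theta> x * s x) * (g x $ j)))"
    using i3 i4 by simp
  also have "(LINT x|lborel. of_real (\<theta> x * c x) * (g x $ j) - \<i> * (of_real (\<theta> x * s x) * (g x $ j)))
     = (LINT x|lborel. of_real (\<theta> x) * pexp (- \<kappa>) x * g x $ j)"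
    by (intro Bochner_Integration.integral_cong refl) (simp add: pe algebra_simps)
  finally show ?thesis .
qed

lemma sum_ibox_prod:
  fixes f :: "3 \<Rightarrow> int \<Rightarrow> real"
  shows "(\<Sum>m\<in>ibox K. \<Prod>i\<in>UNIV. f i (m $ i)) = (\<Prod>i\<in>UNIV. \<Sum>a\<in>{- int K..int K}. f i a)"
proof -
  have ibox: "m \<in> ibox K \<longleftrightarrow> (\<forall>i. m $ i \<in> {- int K..int K})" for m
  proof -
    have "\<bar>a\<bar> \<le> int K \<longleftrightarrow> a \<in> {- int K..int K}" for a by auto
    then show ?thesis unfolding ibox_def by simp
  qed
  have "(\<Prod>i\<in>UNIV. \<Sum>a\<in>{- int K..int K}. f i a) = (\<Sum>p\<in>PiE UNIV (\<lambda>_. {- int K..int K}). \<Prod>i\<in>UNIV. f i (p i))"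
    by (rule prod_sum_PiE) auto
  also have "\<dots> = (\<Sum>m\<in>ibox K. \<Prod>i\<in>UNIV. f i (m $ i))"
    by (rule sum.reindex_bij_witness[where i="\<lambda>m. (\<lambda>i. m $ i)" and j=vec_lambda])
      (auto simp: ibox PiE_iff)
  finally show ?thesis by simp
qed

lemma window_as_prod: "window n x = (\<Prod>i\<in>UNIV. window1 n (x $ i))"
  by (simp add: window_def prod_UNIV_3)

lemma H1_Bloch_periodic:
  assumes "\<psi> \<in> H1_Bloch \<eta>"
  shows "periodic_AE (\<lambda>x. pexp (- (\<eta> + ivec k)) x * \<psi> x)"
  unfolding periodic_AE_def
proof
  fix j
  have "AE x in lborel. pexp (- \<eta>) (x + axis j (2 * pi)) * \<psi> (x + axis j (2 * pi)) = pexp (- \<eta>) x * \<psi> x"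
    using assms by (auto simp: H1_Bloch_def H1_per_def pexp_def)
  then show "AE x in lborel. pexp (- (\<eta> + ivec k)) (x + axis j (2 * pi)) * \<psi> (x + axis j (2 * pi)) = pexp (- (\<eta> + ivec k)) x * \<psi> x"
  proof eventually_elim
    case (elim x)
    have e: "pexp (- (\<eta> + ivec k)) y = pexp (ivec (- k)) y * pexp (- \<eta>) y" for y
    proof -
      have "- (\<eta> + ivec k) = ivec (- k) + - \<eta>" by (simp add: vec_eq_iff)
      then show ?thesis by (simp only: pexp_add_left)
    qed
    show ?case unfolding e pexp_ivec_periodic using elim by (simp add: mult.assoc)
  qed
qed

text \<open>The obstacle is that periodicity is given for \<open>\<psi>\<close> only and not for its
  weak gradient. Testing with a window times a plane wave, the side with \<open>\<psi>\<close> is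
  evaluated exactly by periodicity and does not depend on \<open>n\<close>; on the side with
  \<open>g\<close> the window is sent to the indicator of the cell.\<close>

theorem fc_weak_gradient:
  assumes \<psi>: "\<psi> \<in> H1_Bloch \<eta>" and wg: "has_weak_gradient \<psi> g"
  shows "fc \<eta> (\<lambda>x. g x $ j) k = \<i> * of_real ((\<eta> + ivec k) $ j) * fc \<eta> \<psi> k"
proof -
  define \<kappa> where "\<kappa> = \<eta> + ivec k"
  define F where "F x = pexp (- \<kappa>) x * \<psi> x" for x
  define G where "G x = pexp (- \<kappa>) x * g x $ j" for x
  note L = weak_gradient_cell_L2[OF wg]
  have [measurable]: "\<psi> \<in> borel_measurable borel" "(\<lambda>x. g x $ j) \<in> borel_measurable borel"
    using L by (auto simp: cell_L2_def)
  have F_meas [measurable]: "F \<in> borel_measurable borel" unfolding F_def by measurable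
  have G_meas [measurable]: "G \<in> borel_measurable borel" unfolding G_def by measurable
  have F_L2: "F \<in> cell_L2" unfolding F_def by (rule cell_L2_mult_bounded[OF L(1), where B=1]) auto
  have F_per: "periodic_AE F" unfolding F_def \<kappa>_def by (rule H1_Bloch_periodic[OF \<psi>])
  note F_int = cell_L2_integrable1[OF F_L2]
  have win: "integrable lborel (\<lambda>x. window n x *\<^sub>R F x) \<and> (\<integral>x. window n x *\<^sub>R F x \<partial>lborel) = integral\<^sup>L cell_measure F" for n
  proof -
    have b: "\<bar>window n x\<bar> \<le> 1" for x
      unfolding window_as_prod abs_prod by (rule prod_le_1) (auto simp: window1_bound)
    have s: "\<bar>x $ i\<bar> \<le> 2 * pi * real 2" if "window n x \<noteq> 0" for x i
      using window_nonzero[OF that, of i] by auto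
    have sum: "AE y in cell_measure. (\<Sum>m\<in>ibox 2. window n (y + shift m)) = 1"
      using AE_in_cell
    proof eventually_elim
      case (elim y)
      have "(\<Sum>m\<in>ibox 2. window n (y + shift m)) = (\<Prod>i\<in>UNIV. \<Sum>a\<in>{-2..2::int}. window1 n (y $ i + 2 * pi * of_int a))"
        using sum_ibox_prod[of "\<lambda>i a. window1 n (y $ i + 2 * pi * of_int a)" 2] by (simp add: window_as_prod)
      also have "\<dots> = 1"
      proof (rule prod.neutral, rule ballI)
        fix i :: 3
        show "(\<Sum>a\<in>{-2..2::int}. window1 n (y $ i + 2 * pi * of_int a)) = 1"
          by (rule window1_sum) (use elim in \<open>auto simp: cell_def intro: less_trans[of _ 0] less_trans[of _ "2 * pi"]\<close>)
      qed
      finally show ?case .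
    qed
    show ?thesis
      using periodic_integral_window[OF F_meas F_per F_int test_function_measurable(1)[OF test_function_window] b s sum] by simp
  qed
  \<comment> \<open>The derivative of the window contributes nothing, since its translates sum to
    the derivative of a constant.\<close>
  have dwin: "integrable lborel (\<lambda>x. partial_deriv j (window n) x *\<^sub>R F x) \<and> (\<integral>x. partial_deriv j (window n) x *\<^sub>R F x \<partial>lborel) = 0" for n
  proof -
    obtain w' where w': "\<And>t. (window1 n has_real_derivative w' t) (at t)"
      using smooth1_deriv[OF smooth1_window1] by metis
    obtain K B where KB: "compact K" "\<And>x. x \<notin> K \<Longrightarrow> window n x = 0" "\<And>x j. x \<notin> K \<Longrightarrow> partial_deriv j (window n) x = 0"
      "\<And>x. \<bar>window n x\<bar> \<le> B" "\<And>x j. \<bar>partial_deriv j (window n) x\<bar> \<le> B" "B \<ge> 0"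
      using test_function_bounds[OF test_function_window] by metis
    have s: "\<bar>x $ i\<bar> \<le> 2 * pi * real 2" if "partial_deriv j (window n) x \<noteq> 0" for x i
    proof (rule ccontr)
      assume "\<not> \<bar>x $ i\<bar> \<le> 2 * pi * real 2"
      then have x: "\<bar>x $ i\<bar> > 4 * pi" by simp
      have "(window n has_derivative (\<lambda>_. 0)) (at x)"
      proof (rule has_derivative_transform_within_open[OF has_derivative_const[of 0]])
        show "open {x :: real^3. \<bar>x $ i\<bar> > 4 * pi}"
          by (intro open_Collect_less continuous_intros)
        show "0 = window n y" if "y \<in> {x :: real^3. \<bar>x $ i\<bar> > 4 * pi}" for y
          using window_nonzero[of n y i] that by (cases "window n y = 0") auto
      qed (use x in auto)
      then show False using that by (simp add: partial_deriv_eqI)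
    qed
    have sum: "AE y in cell_measure. (\<Sum>m\<in>ibox 2. partial_deriv j (window n) (y + shift m)) = 0"
      using AE_in_cell
    proof eventually_elim
      case (elim y)
      have "(\<Sum>m\<in>ibox 2. partial_deriv j (window n) (y + shift m)) =
         (\<Prod>i\<in>UNIV. \<Sum>a\<in>{-2..2::int}. if i = j then w' (y $ i + 2 * pi * of_int a) else window1 n (y $ i + 2 * pi * of_int a))"
        using sum_ibox_prod[of "\<lambda>i a. if i = j then w' (y $ i + 2 * pi * of_int a) else window1 n (y $ i + 2 * pi * of_int a)" 2]
        unfolding partial_deriv_window[OF w'] vector_add_component shift_nth by simp
      also have "\<dots> = 0"
      proof (rule prod_zero)
        have "(\<Sum>a\<in>{-2..2::int}. w' (y $ j + 2 * pi * of_int a)) = 0"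
          by (rule window1_deriv_sum[OF w']) (use elim in \<open>auto simp: cell_def\<close>)
        then show "\<exists>i\<in>UNIV. (\<Sum>a\<in>{-2..2::int}. if i = j then w' (y $ i + 2 * pi * of_int a) else window1 n (y $ i + 2 * pi * of_int a)) = 0"
          by (intro bexI[of _ j]) auto
      qed simp
      finally show ?case .
    qed
    show ?thesis
      using periodic_integral_window[OF F_meas F_per F_int test_function_measurable(2)[OF test_function_window] KB(5) s sum] by simp
  qed
  have const: "(\<integral>x. of_real (window n x) * G x \<partial>lborel) = \<i> * of_real (\<kappa> $ j) * integral\<^sup>L cell_measure F" for n
  proof -
    have "- (\<integral>x. of_real (window n x) * G x \<partial>lborel) =
        (\<integral>x. (of_real (partial_deriv j (window n) x) - \<i> * of_real (\<kappa> $ j) * of_real (window n x)) * pexp (- \<kappa>) x * \<psi> x \<partial>lborel)"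
      using weak_gradient_pexp[OF wg test_function_window, of j n \<kappa>] by (simp add: G_def mult.assoc)
    also have "\<dots> = (\<integral>x. partial_deriv j (window n) x *\<^sub>R F x - \<i> * of_real (\<kappa> $ j) * (window n x *\<^sub>R F x) \<partial>lborel)"
      by (intro Bochner_Integration.integral_cong refl) (simp add: F_def scaleR_conv_of_real algebra_simps)
    also have "\<dots> = (\<integral>x. partial_deriv j (window n) x *\<^sub>R F x \<partial>lborel)
        - (\<integral>x. \<i> * of_real (\<kappa> $ j) * (window n x *\<^sub>R F x) \<partial>lborel)"
      by (intro Bochner_Integration.integral_diff Bochner_Integration.integrable_mult_right
          dwin[THEN conjunct1] win[THEN conjunct1])
    also have "\<dots> = - (\<i> * of_real (\<kappa> $ j) * integral\<^sup>L cell_measure F)"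
      unfolding Bochner_Integration.integral_mult_right_zero dwin[THEN conjunct2] win[THEN conjunct2] by simp
    finally show ?thesis by simp
  qed
  have win_meas [measurable]: "window n \<in> borel_measurable borel" for n
    by (rule test_function_measurable(1)[OF test_function_window])
  \<comment> \<open>All windows are supported in one fixed box and bounded by 1, which yields a
    dominating function.\<close>
  have "(\<lambda>n. \<integral>x. of_real (window n x) * G x \<partial>lborel) \<longlonglongrightarrow> (\<integral>x. indicator cell x *\<^sub>R G x \<partial>lborel)"
  proof (rule integral_dominated_convergence[where w="\<lambda>x. indicator (cbox 0 (\<chi> i. 4 * pi)) x * ((cmod (g x $ j))\<^sup>2 + 1)"])
    let ?K = "cbox 0 (\<chi> i. 4 * pi) :: (real^3) set"
    have "integrable lborel (\<lambda>x. indicator ?K x *\<^sub>R (cmod (g x $ j))\<^sup>2)"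
      using L2_loc_component[OF has_weak_gradient_L2_loc(2)[OF wg], of j] by (auto simp: L2_loc_def set_integrable_def)
    moreover have "integrable lborel (indicator ?K :: real^3 \<Rightarrow> real)"
      using emeasure_bounded_finite[OF bounded_cbox] by (intro integrable_real_indicator) auto
    ultimately show "integrable lborel (\<lambda>x. indicator ?K x * ((cmod (g x $ j))\<^sup>2 + 1))"
      by (simp add: ring_distribs)
    show "AE x in lborel. (\<lambda>n. of_real (window n x) * G x) \<longlonglongrightarrow> indicator cell x *\<^sub>R G x"
      using AE_off_faces
    proof eventually_elim
      case (elim x)
      have "(\<lambda>n. window n x) \<longlonglongrightarrow> (\<Prod>i\<in>UNIV. indicator {0<..2 * pi} (x $ i))"
        unfolding window_as_prod by (intro tendsto_prod window1_tendsto)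
      also have "(\<Prod>i\<in>UNIV. indicator {0<..2 * pi} (x $ i)) = (indicator cell x :: real)"
      proof -
        have "x $ i \<noteq> 2 * pi" for i using elim[rule_format, of i 1] by simp
        then have "x $ i \<in> {0<..2 * pi} \<longleftrightarrow> 0 < x $ i \<and> x $ i < 2 * pi" for i by (auto simp: less_le)
        then show ?thesis
          by (auto simp: indicator_def cell_def prod_zero_iff)
      qed
      finally have "(\<lambda>n. complex_of_real (window n x) * G x) \<longlonglongrightarrow> of_real (indicator cell x) * G x"
        by (intro tendsto_intros)
      then show ?case by (simp add: scaleR_conv_of_real)
    qed
    show "AE x in lborel. norm (of_real (window n x) * G x) \<le> indicator ?K x * ((cmod (g x $ j))\<^sup>2 + 1)" for n
    proof (rule AE_I2)
      fix x
      show "norm (of_real (window n x) * G x) \<le> indicator ?K x * ((cmod (g x $ j))\<^sup>2 + 1)"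
      proof (cases "x \<in> ?K")
        case False
        have "x \<in> ?K" if "window n x \<noteq> 0"
          using window_nonzero[OF that] by (auto simp: mem_box_cart less_imp_le)
        with False have "window n x = 0" by blast
        then show ?thesis by simp
      next
        case True
        have b: "\<bar>window n x\<bar> \<le> 1"
          unfolding window_as_prod abs_prod by (rule prod_le_1) (auto simp: window1_bound)
        have "cmod (g x $ j) \<le> (cmod (g x $ j))\<^sup>2 + 1" by (rule le_square_plus_1)
        moreover have "\<bar>window n x\<bar> * cmod (g x $ j) \<le> 1 * cmod (g x $ j)"
          using b by (intro mult_right_mono) auto
        ultimately show ?thesis using True by (simp add: G_def norm_mult)
      qed
    qed
  qed (use win_meas in auto)
  then have "\<i> * of_real (\<kappa> $ j) * integral\<^sup>L cell_measure F = (\<integral>x. indicator cell x *\<^sub>R G x \<partial>lborel)"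
    unfolding const LIMSEQ_const_iff .
  also have "\<dots> = integral\<^sup>L cell_measure G"
    by (simp add: integral_cell set_lebesgue_integral_def)
  finally have main: "integral\<^sup>L cell_measure G = \<i> * of_real (\<kappa> $ j) * integral\<^sup>L cell_measure F" ..
  have fcF: "fc \<eta> f k = of_real (1 / sqrt ((2 * pi) ^ 3)) * (\<integral>x. pexp (- \<kappa>) x * f x \<partial>cell_measure)" for f
    unfolding fc_def ip_def ek_def \<kappa>_def complex_cnj_mult cnj_pexp complex_cnj_complex_of_real
    by (subst Bochner_Integration.integral_mult_right_zero[symmetric], intro Bochner_Integration.integral_cong refl)
      (simp only: mult_ac)
  show ?thesis
    unfolding fcF using main by (simp add: F_def[abs_def] G_def[abs_def] \<kappa>_def)
qed

section \<open>Weak gradients of Lipschitz functions, limits and products\<close>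

lemma vec_lambda_measurable [measurable (raw)]:
  fixes f :: "3 \<Rightarrow> 'a \<Rightarrow> 'b::euclidean_space"
  assumes "\<And>j. f j \<in> borel_measurable M"
  shows "(\<lambda>x. \<chi> j. f j x) \<in> borel_measurable M"
proof (rule borel_measurable_euclidean_space[THEN iffD2], rule ballI)
  fix b :: "'b^3" assume "b \<in> Basis"
  then obtain i u where b: "b = axis i u" by (auto simp: Basis_vec_def)
  show "(\<lambda>x. (\<chi> j. f j x) \<bullet> b) \<in> borel_measurable M"
    unfolding b inner_axis using assms by simp
qed

lemma norm_vec_sq: "(norm (g :: complex^3))\<^sup>2 = (\<Sum>j\<in>UNIV. (cmod (g $ j))\<^sup>2)"
  by (simp add: norm_vec_def L2_set_def sum_nonneg)

lemma L2_loc_bounded: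
  fixes f :: "real^3 \<Rightarrow> 'b::real_normed_vector"
  assumes f: "f \<in> borel_measurable borel" and bd: "\<And>x. norm (f x) \<le> B"
  shows "f \<in> L2_loc"
proof -
  have [measurable]: "(\<lambda>x. norm (f x)) \<in> borel_measurable borel"
    using f by (rule measurable_compose) (intro borel_measurable_continuous_onI continuous_intros)
  have "set_integrable lborel K (\<lambda>x. (norm (f x))\<^sup>2)" if K: "compact K" for K
  proof (rule set_integrable_bound)
    have [measurable]: "K \<in> sets borel" using K by (intro borel_closed compact_imp_closed)
    show "set_integrable lborel K (\<lambda>x. B\<^sup>2)"
      using emeasure_bounded_finite[OF compact_imp_bounded[OF K]]
      unfolding set_integrable_def by (intro integrable_scaleR_left integrable_real_indicator) auto
    show "set_borel_measurable lborel K (\<lambda>x. (norm (f x))\<^sup>2)"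
      unfolding set_borel_measurable_def by measurable
    show "AE x in lborel. x \<in> K \<longrightarrow> norm ((norm (f x))\<^sup>2) \<le> norm (B\<^sup>2)"
      using bd by (auto intro!: AE_I2 power_mono)
  qed
  then show ?thesis using f by (simp add: L2_loc_def)
qed

lemma L2_loc_vec:
  fixes g :: "3 \<Rightarrow> real^3 \<Rightarrow> complex"
  assumes g: "\<And>j. g j \<in> L2_loc"
  shows "(\<lambda>x. \<chi> j. g j x) \<in> L2_loc"
proof -
  have [measurable]: "g j \<in> borel_measurable borel" for j using g by (rule L2_loc_measurable)
  have "set_integrable lborel K (\<lambda>x. (norm (\<chi> j. g j x))\<^sup>2)" if K: "compact K" for K
    unfolding norm_vec_sq vec_lambda_beta set_integrable_def scaleR_sum_right
    using g K by (intro Bochner_Integration.integrable_sum) (auto simp: L2_loc_def set_integrable_def)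
  then show ?thesis by (simp add: L2_loc_def)
qed

lemma has_vector_derivative_quotient:
  fixes F :: "real \<Rightarrow> complex"
  assumes "(F has_vector_derivative D) (at 0)"
  shows "((\<lambda>t. (F t - F 0) / of_real t) \<longlongrightarrow> D) (at 0)"
proof -
  have "(\<lambda>h. norm (F (0 + h) - F 0 - h *\<^sub>R D) / norm h) \<midarrow>0\<rightarrow> 0"
    using assms unfolding has_vector_derivative_def has_derivative_at by blast
  moreover have "\<forall>\<^sub>F h in at 0. norm (F (0 + h) - F 0 - h *\<^sub>R D) / norm h = norm ((F h - F 0) / of_real h - D)"
    unfolding eventually_at_filter
  proof (intro always_eventually allI impI)
    fix h :: real assume h: "h \<noteq> 0"
    have "(F h - F 0) / of_real h - D = (F h - F 0 - h *\<^sub>R D) / of_real h"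
      using h by (simp add: field_simps scaleR_conv_of_real)
    then show "norm (F (0 + h) - F 0 - h *\<^sub>R D) / norm h = norm ((F h - F 0) / of_real h - D)"
      by (simp add: norm_divide)
  qed
  ultimately have "((\<lambda>h. norm ((F h - F 0) / of_real h - D)) \<longlongrightarrow> 0) (at 0)"
    by (rule Lim_transform_eventually)
  then show ?thesis by (simp add: LIM_zero_iff tendsto_norm_zero_iff)
qed

lemma Lipschitz_imp_measurable:
  fixes f :: "real^3 \<Rightarrow> complex"
  assumes "\<And>x y. cmod (f x - f y) \<le> L * norm (x - y)" "L \<ge> 0"
  shows "f \<in> borel_measurable borel"
proof -
  have "L-lipschitz_on UNIV f"
    using assms by (intro lipschitz_onI) (auto simp: dist_norm)
  then show ?thesis by (intro borel_measurable_continuous_onI lipschitz_on_continuous_on)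
qed

text \<open>Discrete integration by parts: moving the difference quotient from the test function to
  \<open>f\<close> is exact. The two quotients are bounded by the derivative of the test function
  and by the Lipschitz constant, so dominated convergence applies on both sides. The pointwise
  derivatives are a hypothesis, to be checked on explicit functions.\<close>

theorem weak_gradient_Lipschitz:
  fixes f :: "real^3 \<Rightarrow> complex" and G :: "real^3 \<Rightarrow> complex^3"
  assumes lip: "\<And>x y. cmod (f x - f y) \<le> L * norm (x - y)" and L: "L \<ge> 0"
    and bd: "\<And>x. cmod (f x) \<le> B"
    and G [measurable]: "G \<in> borel_measurable borel" and G_bd: "\<And>x. norm (G x) \<le> C"
    and deriv: "\<And>j. AE x in lborel. ((\<lambda>t. f (x + t *\<^sub>R axis j 1)) has_vector_derivative G x $ j) (at 0)"
  shows "has_weak_gradient f G"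
proof -
  have f [measurable]: "f \<in> borel_measurable borel" by (rule Lipschitz_imp_measurable[OF lip L])
  have f_L2: "f \<in> L2_loc" by (rule L2_loc_bounded[OF f bd])
  have B: "B \<ge> 0" using bd[of 0] norm_ge_zero order_trans by blast
  have "(LINT x|lborel. of_real (partial_deriv j \<phi> x) * f x) = - (LINT x|lborel. of_real (\<phi> x) * (G x $ j))"
    if \<phi>: "test_function \<phi>" for \<phi> j
  proof -
    obtain K D where KD: "compact K" "\<And>x. x \<notin> K \<Longrightarrow> \<phi> x = 0" "\<And>x j. x \<notin> K \<Longrightarrow> partial_deriv j \<phi> x = 0"
      "\<And>x. \<bar>\<phi> x\<bar> \<le> D" "\<And>x j. \<bar>partial_deriv j \<phi> x\<bar> \<le> D" "D \<ge> 0"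
      using test_function_bounds[OF \<phi>] by metis
    obtain R where R: "\<And>x. x \<in> K \<Longrightarrow> norm x \<le> R"
      using compact_imp_bounded[OF KD(1)] unfolding bounded_iff by blast
    have [measurable]: "\<phi> \<in> borel_measurable borel" "partial_deriv j \<phi> \<in> borel_measurable borel"
      using test_function_measurable[OF \<phi>] by auto
    define e :: "real^3" where "e = axis j 1"
    have e: "norm e = 1" by (simp add: e_def)
    define h where "h n = 1 / real (Suc n)" for n
    have h: "h n > 0" "h n \<le> 1" for n by (auto simp: h_def)
    have h0: "h \<longlonglongrightarrow> 0" unfolding h_def by real_asymp
    define K' where "K' = cball (0 :: real^3) (R + 1)"
    have K': "compact K'" by (simp add: K'_def)
    have supp: "\<phi> x = 0 \<and> \<phi> (x + h n *\<^sub>R e) = 0" if x: "x \<notin> K'" for x n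
    proof -
      have nx: "norm x > R + 1" using x by (simp add: K'_def)
      have "norm x \<le> norm (x + h n *\<^sub>R e) + norm (h n *\<^sub>R e)"
        using norm_triangle_ineq4[of "x + h n *\<^sub>R e" "h n *\<^sub>R e"] by simp
      then have "norm (x + h n *\<^sub>R e) > R" using nx e h[of n] by simp
      then show ?thesis using nx R KD(2) by force
    qed
    have dphi: "((\<lambda>t. \<phi> (x + t *\<^sub>R e)) has_real_derivative partial_deriv j \<phi> (x + t *\<^sub>R e)) (at t)" for x t
    proof -
      have "(\<phi> has_derivative frechet_derivative \<phi> (at (x + t *\<^sub>R e))) (at (x + t *\<^sub>R e))"
        using test_function_differentiable[OF \<phi>] by (simp add: frechet_derivative_works)
      moreover have "((\<lambda>t. x + t *\<^sub>R e) has_derivative (\<lambda>s. s *\<^sub>R e)) (at t)"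
        by (auto intro!: derivative_eq_intros)
      ultimately have "((\<lambda>t. \<phi> (x + t *\<^sub>R e)) has_derivative (\<lambda>s. frechet_derivative \<phi> (at (x + t *\<^sub>R e)) (s *\<^sub>R e))) (at t)"
        by (rule has_derivative_compose[rotated])
      moreover have "frechet_derivative \<phi> (at (x + t *\<^sub>R e)) (s *\<^sub>R e) = partial_deriv j \<phi> (x + t *\<^sub>R e) * s" for s
        using linear_frechet_derivative[OF test_function_differentiable[OF \<phi>]]
        by (simp add: partial_deriv_def e_def linear_scale)
      ultimately show ?thesis by (simp add: has_field_derivative_def)
    qed
    have quot_bd: "\<bar>\<phi> (x + h n *\<^sub>R e) - \<phi> x\<bar> \<le> D * h n" for x n
    proof -
      obtain z where "\<phi> (x + h n *\<^sub>R e) - \<phi> (x + 0 *\<^sub>R e) = (h n - 0) * partial_deriv j \<phi> (x + z *\<^sub>R e)"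
        using MVT2[OF h(1)[of n], of "\<lambda>t. \<phi> (x + t *\<^sub>R e)" "\<lambda>t. partial_deriv j \<phi> (x + t *\<^sub>R e)"] dphi by blast
      then show ?thesis
        using h(1)[of n] KD(5)[of j "x + z *\<^sub>R e"] by (simp add: abs_mult mult.commute mult_left_mono)
    qed
    define A where "A n x = of_real ((\<phi> (x + h n *\<^sub>R e) - \<phi> x) / h n) * f x" for n x
    \<comment> \<open>Translation puts the quotient on \<open>f\<close> with the opposite step
      \<open>- h n\<close>, which is the origin of the minus sign in the limit.\<close>
    define E where "E n x = of_real (\<phi> x) * ((f (x - h n *\<^sub>R e) - f x) / of_real (h n))" for n x
    have [measurable]: "A n \<in> borel_measurable borel" "E n \<in> borel_measurable borel" for n
      unfolding A_def[abs_def] E_def[abs_def] by measurable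
    have i1: "integrable lborel (\<lambda>x. of_real (\<phi> (x + h n *\<^sub>R e)) * f x)" for n
      by (rule integrable_compact_support_L2_loc[OF f_L2 _ _ K', where B=D]) (use KD(4) supp in auto)
    have i2: "integrable lborel (\<lambda>x. of_real (\<phi> x) * f x)"
      by (rule integrable_compact_support_L2_loc[OF f_L2 _ _ K', where B=D]) (use KD(4) supp in auto)
    have i3: "integrable lborel (\<lambda>x. of_real (\<phi> x) * f (x - h n *\<^sub>R e))" for n
      by (rule integrable_compact_support_L2_loc[OF L2_loc_bounded[where B=B] _ _ K', where B=D]) (use KD(4) supp bd in auto)
    have AE_eq: "integral\<^sup>L lborel (A n) = integral\<^sup>L lborel (E n)" for n
    proof -
      have "integral\<^sup>L lborel (A n) = (\<integral>x. (1 / of_real (h n)) * (of_real (\<phi> (x + h n *\<^sub>R e)) * f x - of_real (\<phi> x) * f x) \<partial>lborel)"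
        by (intro Bochner_Integration.integral_cong refl) (simp add: A_def field_simps)
      also have "\<dots> = (1 / of_real (h n)) * ((\<integral>x. of_real (\<phi> (x + h n *\<^sub>R e)) * f x \<partial>lborel) - (\<integral>x. of_real (\<phi> x) * f x \<partial>lborel))"
        using i1[of n] i2 by (simp only: Bochner_Integration.integral_mult_right_zero Bochner_Integration.integral_diff)
      also have "(\<integral>x. of_real (\<phi> (x + h n *\<^sub>R e)) * f x \<partial>lborel) = (\<integral>x. of_real (\<phi> x) * f (x - h n *\<^sub>R e) \<partial>lborel)"
        by (subst lborel_integral_translate(1)[where c="- (h n *\<^sub>R e)", symmetric]) auto
      also have "(1 / of_real (h n)) * ((\<integral>x. of_real (\<phi> x) * f (x - h n *\<^sub>R e) \<partial>lborel) - (\<integral>x. of_real (\<phi> x) * f x \<partial>lborel))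
        = (\<integral>x. (1 / of_real (h n)) * (of_real (\<phi> x) * f (x - h n *\<^sub>R e) - of_real (\<phi> x) * f x) \<partial>lborel)"
        using i3[of n] i2 by (simp only: Bochner_Integration.integral_mult_right_zero Bochner_Integration.integral_diff)
      also have "\<dots> = integral\<^sup>L lborel (E n)"
        by (intro Bochner_Integration.integral_cong refl) (simp add: E_def field_simps)
      finally show ?thesis .
    qed
    have ind_int: "integrable lborel (\<lambda>x. c * indicator K' x :: real)" for c
      using emeasure_bounded_finite[OF compact_imp_bounded[OF K']] K'
      by (intro Bochner_Integration.integrable_mult_right integrable_real_indicator) (auto simp: K'_def)
    have "(\<lambda>n. integral\<^sup>L lborel (A n)) \<longlonglongrightarrow> (\<integral>x. of_real (partial_deriv j \<phi> x) * f x \<partial>lborel)"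
    proof (rule integral_dominated_convergence[where w="\<lambda>x. D * B * indicator K' x"])
      show "AE x in lborel. (\<lambda>n. A n x) \<longlonglongrightarrow> of_real (partial_deriv j \<phi> x) * f x"
      proof (rule AE_I2)
        fix x
        have "(\<lambda>t. (\<phi> (x + (0 + t) *\<^sub>R e) - \<phi> (x + 0 *\<^sub>R e)) / t) \<midarrow>0\<rightarrow> partial_deriv j \<phi> (x + 0 *\<^sub>R e)"
          using dphi[of x 0] unfolding DERIV_def .
        then have "(\<lambda>n. (\<phi> (x + (0 + h n) *\<^sub>R e) - \<phi> (x + 0 *\<^sub>R e)) / h n) \<longlonglongrightarrow> partial_deriv j \<phi> (x + 0 *\<^sub>R e)"
          by (rule filterlim_compose) (use h0 h in \<open>auto simp: filterlim_at intro!: always_eventually less_imp_neq[symmetric]\<close>)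
        then have "(\<lambda>n. complex_of_real ((\<phi> (x + h n *\<^sub>R e) - \<phi> x) / h n) * f x) \<longlonglongrightarrow> of_real (partial_deriv j \<phi> x) * f x"
          by (intro tendsto_intros) simp
        then show "(\<lambda>n. A n x) \<longlonglongrightarrow> of_real (partial_deriv j \<phi> x) * f x"
          by (simp only: A_def)
      qed
      show "AE x in lborel. norm (A n x) \<le> D * B * indicator K' x" for n
      proof (rule AE_I2)
        fix x
        show "norm (A n x) \<le> D * B * indicator K' x"
        proof (cases "x \<in> K'")
          case True
          have "\<bar>(\<phi> (x + h n *\<^sub>R e) - \<phi> x) / h n\<bar> \<le> D"
            using quot_bd[of x n] h(1)[of n] by (simp add: abs_divide field_simps)
          then have "\<bar>(\<phi> (x + h n *\<^sub>R e) - \<phi> x) / h n\<bar> * cmod (f x) \<le> D * B"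
            using bd[of x] KD(6) by (intro mult_mono) auto
          then show ?thesis using True unfolding A_def norm_mult norm_of_real by simp
        next
          case False
          then show ?thesis using supp[of x n] by (simp add: A_def)
        qed
      qed
    qed (use ind_int in auto)
    moreover have "(\<lambda>n. integral\<^sup>L lborel (E n)) \<longlonglongrightarrow> (\<integral>x. - (of_real (\<phi> x) * (G x $ j)) \<partial>lborel)"
    proof (rule integral_dominated_convergence[where w="\<lambda>x. D * L * indicator K' x"])
      show "AE x in lborel. (\<lambda>n. E n x) \<longlonglongrightarrow> - (of_real (\<phi> x) * (G x $ j))"
        using deriv[of j]
      proof eventually_elim
        case (elim x)
        from has_vector_derivative_quotient[OF this]
        have "((\<lambda>t. (f (x + t *\<^sub>R e) - f x) / of_real t) \<longlongrightarrow> G x $ j) (at 0)" by (simp add: e_def)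
        then have "(\<lambda>n. (f (x + (- h n) *\<^sub>R e) - f x) / of_real (- h n)) \<longlonglongrightarrow> G x $ j"
          by (rule filterlim_compose)
            (use h0 h in \<open>auto simp: filterlim_at intro!: always_eventually less_imp_neq[symmetric] tendsto_eq_intros\<close>)
        then have "(\<lambda>n. - (of_real (\<phi> x) * ((f (x + (- h n) *\<^sub>R e) - f x) / of_real (- h n)))) \<longlonglongrightarrow> - (of_real (\<phi> x) * G x $ j)"
          by (intro tendsto_intros)
        then show ?case by (simp add: E_def)
      qed
      show "AE x in lborel. norm (E n x) \<le> D * L * indicator K' x" for n
      proof (rule AE_I2)
        fix x
        show "norm (E n x) \<le> D * L * indicator K' x"
        proof (cases "x \<in> K'")
          case True
          have "cmod (f (x - h n *\<^sub>R e) - f x) \<le> L * norm ((x - h n *\<^sub>R e) - x)" by (rule lip)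
          also have "norm ((x - h n *\<^sub>R e) - x) = h n" using e h(1)[of n] by simp
          finally have "cmod ((f (x - h n *\<^sub>R e) - f x) / of_real (h n)) \<le> L"
            using h(1)[of n] by (simp add: norm_divide field_simps)
          then have "\<bar>\<phi> x\<bar> * cmod ((f (x - h n *\<^sub>R e) - f x) / of_real (h n)) \<le> D * L"
            using KD(4)[of x] KD(6) L by (intro mult_mono) auto
          then show ?thesis using True unfolding E_def norm_mult norm_of_real by simp
        next
          case False
          then show ?thesis using supp[of x n] by (simp add: E_def)
        qed
      qed
    qed (use ind_int in auto)
    ultimately have "(\<integral>x. of_real (partial_deriv j \<phi> x) * f x \<partial>lborel) = (\<integral>x. - (of_real (\<phi> x) * (G x $ j)) \<partial>lborel)"
      unfolding AE_eq by (rule LIMSEQ_unique)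
    then show ?thesis by simp
  qed
  then show ?thesis
    using f_L2 L2_loc_bounded[OF G G_bd] by (simp add: has_weak_gradient_def)
qed

lemma tendsto_integral_compact_support:
  fixes f :: "nat \<Rightarrow> real^3 \<Rightarrow> complex"
  assumes f: "\<And>n. f n \<in> L2_loc" and F: "F \<in> L2_loc"
    and u [measurable]: "u \<in> borel_measurable borel" and bd: "\<And>x. cmod (u x) \<le> B"
    and K: "compact K" and supp: "\<And>x. x \<notin> K \<Longrightarrow> u x = 0"
    and int: "\<And>n. integrable lborel (\<lambda>x. indicator K x * (cmod (f n x - F x))\<^sup>2)"
    and lim: "(\<lambda>n. \<integral>x. indicator K x * (cmod (f n x - F x))\<^sup>2 \<partial>lborel) \<longlonglongrightarrow> 0"
  shows "(\<lambda>n. \<integral>x. u x * f n x \<partial>lborel) \<longlonglongrightarrow> (\<integral>x. u x * F x \<partial>lborel)"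
proof (rule LIM_zero_cancel, rule Lim_null_comparison)
  define D where "D n = (\<integral>x. indicator K x * (cmod (f n x - F x))\<^sup>2 \<partial>lborel)" for n
  define V where "V = measure lborel K"
  \<comment> \<open>Weight for Young's inequality, comparable with the mean square error; the term
    \<open>1 / Suc n\<close> keeps it positive when \<open>D n = 0\<close>.\<close>
  define s where "s n = sqrt (D n) + 1 / real (Suc n)" for n
  have [measurable]: "f n \<in> borel_measurable borel" "F \<in> borel_measurable borel" for n
    using f F by (auto intro: L2_loc_measurable)
  have [measurable]: "K \<in> sets borel" using K by (intro borel_closed compact_imp_closed)
  have B: "B \<ge> 0" using bd[of 0] norm_ge_zero order_trans by blast
  have D0: "D n \<ge> 0" for n by (simp add: D_def)
  have s0: "s n > 0" for n using D0[of n] by (simp add: s_def add_nonneg_pos)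
  have i: "integrable lborel (\<lambda>x. u x * f n x)" "integrable lborel (\<lambda>x. u x * F x)" for n
    using integrable_compact_support_L2_loc[OF f u bd K supp] integrable_compact_support_L2_loc[OF F u bd K supp] by auto
  have indK: "integrable lborel (indicator K :: real^3 \<Rightarrow> real)"
    using emeasure_bounded_finite[OF compact_imp_bounded[OF K]] by (intro integrable_real_indicator) auto
  show "\<forall>\<^sub>F n in sequentially. norm ((\<integral>x. u x * f n x \<partial>lborel) - (\<integral>x. u x * F x \<partial>lborel)) \<le> B * (s n * V + sqrt (D n))"
  proof (rule always_eventually, rule allI)
    fix n
    have "norm ((\<integral>x. u x * f n x \<partial>lborel) - (\<integral>x. u x * F x \<partial>lborel)) = norm (\<integral>x. u x * f n x - u x * F x \<partial>lborel)"
      using i by (simp only: Bochner_Integration.integral_diff)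
    also have "\<dots> \<le> (\<integral>x. norm (u x * f n x - u x * F x) \<partial>lborel)" by (rule integral_norm_bound)
    also have "\<dots> \<le> (\<integral>x. B * (s n * indicator K x + (1 / s n) * (indicator K x * (cmod (f n x - F x))\<^sup>2)) \<partial>lborel)"
    proof (rule integral_mono)
      show "integrable lborel (\<lambda>x. norm (u x * f n x - u x * F x))"
        using i by (intro integrable_norm Bochner_Integration.integrable_diff)
      show "integrable lborel (\<lambda>x. B * (s n * indicator K x + (1 / s n) * (indicator K x * (cmod (f n x - F x))\<^sup>2)))"
        by (intro Bochner_Integration.integrable_mult_right Bochner_Integration.integrable_add indK int)
      show "norm (u x * f n x - u x * F x) \<le> B * (s n * indicator K x + (1 / s n) * (indicator K x * (cmod (f n x - F x))\<^sup>2))" for x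
      proof (cases "x \<in> K")
        case True
        define d where "d = cmod (f n x - F x)"
        have "2 * (1 * d) \<le> s n * 1\<^sup>2 + d\<^sup>2 / s n" by (rule amgm_sq[OF s0])
        moreover have "d \<ge> 0" by (simp add: d_def)
        ultimately have "d \<le> s n + (1 / s n) * d\<^sup>2" by simp
        then have "cmod (u x) * d \<le> B * (s n + (1 / s n) * d\<^sup>2)"
          using bd[of x] B \<open>d \<ge> 0\<close> by (intro mult_mono) auto
        moreover have "norm (u x * f n x - u x * F x) = cmod (u x) * d"
          by (simp add: d_def norm_mult flip: right_diff_distrib)
        ultimately show ?thesis using True by (simp add: d_def)
      qed (simp add: supp)
    qed
    also have "\<dots> = B * (s n * V + (1 / s n) * D n)"
    proof -
      have "(\<integral>x. indicator K x \<partial>lborel) = V" by (simp add: V_def)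
      then show ?thesis
        using indK int[of n] by (simp only: Bochner_Integration.integral_mult_right_zero
          Bochner_Integration.integral_add Bochner_Integration.integrable_mult_right D_def)
    qed
    also have "(1 / s n) * D n \<le> sqrt (D n)"
    proof -
      have "D n = sqrt (D n) * sqrt (D n)" using D0[of n] by simp
      also have "\<dots> \<le> sqrt (D n) * s n" by (intro mult_left_mono) (auto simp: s_def D0)
      finally show ?thesis using s0[of n] by (simp add: field_simps)
    qed
    finally show "norm ((\<integral>x. u x * f n x \<partial>lborel) - (\<integral>x. u x * F x \<partial>lborel)) \<le> B * (s n * V + sqrt (D n))"
      using B by (simp add: mult_left_mono)
  qed
  have sq: "(\<lambda>n. sqrt (D n)) \<longlonglongrightarrow> 0"
    using tendsto_real_sqrt[OF lim] by (simp add: D_def)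
  have "(\<lambda>n. 1 / real (Suc n)) \<longlonglongrightarrow> 0" by real_asymp
  from tendsto_add[OF sq this] have "s \<longlonglongrightarrow> 0" by (simp add: s_def[abs_def])
  then have "(\<lambda>n. B * (s n * V + sqrt (D n))) \<longlonglongrightarrow> B * (0 * V + 0)"
    using sq by (intro tendsto_intros)
  then show "(\<lambda>n. B * (s n * V + sqrt (D n))) \<longlonglongrightarrow> 0" by simp
qed

lemma weak_gradient_limit:
  fixes f :: "nat \<Rightarrow> real^3 \<Rightarrow> complex"
  assumes fg: "\<And>n. has_weak_gradient (f n) (g n)" and F: "F \<in> L2_loc" and G: "G \<in> L2_loc"
    and int: "\<And>K n. compact K \<Longrightarrow> integrable lborel (\<lambda>x. indicator K x * (cmod (f n x - F x))\<^sup>2)"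
    and lim: "\<And>K. compact K \<Longrightarrow> (\<lambda>n. \<integral>x. indicator K x * (cmod (f n x - F x))\<^sup>2 \<partial>lborel) \<longlonglongrightarrow> 0"
    and int': "\<And>K n j. compact K \<Longrightarrow> integrable lborel (\<lambda>x. indicator K x * (cmod (g n x $ j - G x $ j))\<^sup>2)"
    and lim': "\<And>K j. compact K \<Longrightarrow> (\<lambda>n. \<integral>x. indicator K x * (cmod (g n x $ j - G x $ j))\<^sup>2 \<partial>lborel) \<longlonglongrightarrow> 0"
  shows "has_weak_gradient F G"
  unfolding has_weak_gradient_def
proof (intro conjI F G allI impI)
  fix \<phi> j assume \<phi>: "test_function \<phi>"
  obtain K D where KD: "compact K" "\<And>x. x \<notin> K \<Longrightarrow> \<phi> x = 0" "\<And>x j. x \<notin> K \<Longrightarrow> partial_deriv j \<phi> x = 0"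
    "\<And>x. \<bar>\<phi> x\<bar> \<le> D" "\<And>x j. \<bar>partial_deriv j \<phi> x\<bar> \<le> D" "D \<ge> 0"
    using test_function_bounds[OF \<phi>] by metis
  have [measurable]: "\<phi> \<in> borel_measurable borel" "partial_deriv j \<phi> \<in> borel_measurable borel"
    using test_function_measurable[OF \<phi>] by auto
  have "(\<lambda>n. \<integral>x. of_real (partial_deriv j \<phi> x) * f n x \<partial>lborel) \<longlonglongrightarrow> (\<integral>x. of_real (partial_deriv j \<phi> x) * F x \<partial>lborel)"
    by (rule tendsto_integral_compact_support[OF has_weak_gradient_L2_loc(1)[OF fg] F _ _ KD(1) _ int lim, where B=D])
      (use KD in auto)
  moreover have "(\<lambda>n. - (\<integral>x. of_real (\<phi> x) * g n x $ j \<partial>lborel)) \<longlonglongrightarrow> - (\<integral>x. of_real (\<phi> x) * G x $ j \<partial>lborel)"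
    by (rule tendsto_minus, rule tendsto_integral_compact_support[OF L2_loc_component[OF has_weak_gradient_L2_loc(2)[OF fg]] L2_loc_component[OF G] _ _ KD(1) _ int' lim', where B=D])
      (use KD in auto)
  moreover have "(\<integral>x. of_real (partial_deriv j \<phi> x) * f n x \<partial>lborel) = - (\<integral>x. of_real (\<phi> x) * g n x $ j \<partial>lborel)" for n
    using fg[of n] \<phi> by (simp add: has_weak_gradient_def)
  ultimately show "(LINT x|lborel. of_real (partial_deriv j \<phi> x) * F x) = - (LINT x|lborel. of_real (\<phi> x) * (G x $ j))"
    by (simp add: LIMSEQ_unique)
qed

text \<open>Membership in \<open>H1_Bloch\<close> asks for a weak gradient of the untwisted
  function; the product rule with a plane wave supplies it.\<close>

lemma weak_gradient_mult_pexp: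
  assumes wg: "has_weak_gradient \<psi> g"
  shows "has_weak_gradient (\<lambda>x. pexp (- \<eta>) x * \<psi> x)
    (\<lambda>x. \<chi> j. pexp (- \<eta>) x * g x $ j + (- (\<i> * of_real (\<eta> $ j))) * (pexp (- \<eta>) x * \<psi> x))"
proof -
  have unim: "(\<lambda>x. pexp (- \<eta>) x * f x) \<in> L2_loc" if f: "f \<in> L2_loc" for f :: "real^3 \<Rightarrow> complex"
  proof -
    have [measurable]: "f \<in> borel_measurable borel" using f by (rule L2_loc_measurable)
    show ?thesis using f by (auto simp: L2_loc_def norm_mult)
  qed
  note f = has_weak_gradient_L2_loc(1)[OF wg]
  note g = L2_loc_component[OF has_weak_gradient_L2_loc(2)[OF wg]]
  have [measurable]: "\<psi> \<in> borel_measurable borel" "(\<lambda>x. g x $ j) \<in> borel_measurable borel" for j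
    using f g by (auto intro: L2_loc_measurable)
  have comb: "(\<lambda>x. pexp (- \<eta>) x * g x $ j + (- (\<i> * of_real (\<eta> $ j))) * (pexp (- \<eta>) x * \<psi> x)) \<in> L2_loc" for j
  proof -
    have "set_integrable lborel K (\<lambda>x. (cmod (pexp (- \<eta>) x * g x $ j + (- (\<i> * of_real (\<eta> $ j))) * (pexp (- \<eta>) x * \<psi> x)))\<^sup>2)"
      if K: "compact K" for K
    proof (rule set_integrable_bound)
      have [measurable]: "K \<in> sets borel" using K by (intro borel_closed compact_imp_closed)
      show "set_integrable lborel K (\<lambda>x. 2 * (cmod (g x $ j))\<^sup>2 + (2 * (\<eta> $ j)\<^sup>2) * (cmod (\<psi> x))\<^sup>2)"
        using f g[of j] K by (intro set_integral_add set_integrable_mult_right) (auto simp: L2_loc_def)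
      show "set_borel_measurable lborel K (\<lambda>x. (cmod (pexp (- \<eta>) x * g x $ j + (- (\<i> * of_real (\<eta> $ j))) * (pexp (- \<eta>) x * \<psi> x)))\<^sup>2)"
        unfolding set_borel_measurable_def by measurable
      show "AE x in lborel. x \<in> K \<longrightarrow> norm ((cmod (pexp (- \<eta>) x * g x $ j + (- (\<i> * of_real (\<eta> $ j))) * (pexp (- \<eta>) x * \<psi> x)))\<^sup>2)
          \<le> norm (2 * (cmod (g x $ j))\<^sup>2 + (2 * (\<eta> $ j)\<^sup>2) * (cmod (\<psi> x))\<^sup>2)"
      proof (rule AE_I2, rule impI)
        fix x
        show "norm ((cmod (pexp (- \<eta>) x * g x $ j + (- (\<i> * of_real (\<eta> $ j))) * (pexp (- \<eta>) x * \<psi> x)))\<^sup>2)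
          \<le> norm (2 * (cmod (g x $ j))\<^sup>2 + (2 * (\<eta> $ j)\<^sup>2) * (cmod (\<psi> x))\<^sup>2)"
          using cmod_add_sq_le[of "pexp (- \<eta>) x * g x $ j" "(- (\<i> * of_real (\<eta> $ j))) * (pexp (- \<eta>) x * \<psi> x)"]
          by (simp add: norm_mult power_mult_distrib)
      qed
    qed
    then show ?thesis by (simp add: L2_loc_def)
  qed
  have "(LINT x|lborel. of_real (partial_deriv j \<phi> x) * (pexp (- \<eta>) x * \<psi> x)) =
      - (LINT x|lborel. of_real (\<phi> x) * (pexp (- \<eta>) x * g x $ j + (- (\<i> * of_real (\<eta> $ j))) * (pexp (- \<eta>) x * \<psi> x)))"
    if \<phi>: "test_function \<phi>" for \<phi> j
  proof -
    obtain K D where KD: "compact K" "\<And>x. x \<notin> K \<Longrightarrow> \<phi> x = 0" "\<And>x j. x \<notin> K \<Longrightarrow> partial_deriv j \<phi> x = 0"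
      "\<And>x. \<bar>\<phi> x\<bar> \<le> D" "\<And>x j. \<bar>partial_deriv j \<phi> x\<bar> \<le> D" "D \<ge> 0"
      using test_function_bounds[OF \<phi>] by metis
    have [measurable]: "\<phi> \<in> borel_measurable borel" "partial_deriv j \<phi> \<in> borel_measurable borel"
      using test_function_measurable[OF \<phi>] by auto
    define a where "a x = of_real (partial_deriv j \<phi> x) * (pexp (- \<eta>) x * \<psi> x)" for x
    define b where "b x = of_real (\<phi> x) * (pexp (- \<eta>) x * \<psi> x)" for x
    define c where "c x = of_real (\<phi> x) * (pexp (- \<eta>) x * g x $ j)" for x
    have ia: "integrable lborel a"
      unfolding a_def by (rule integrable_compact_support_L2_loc[OF unim[OF f] _ _ KD(1), where B=D]) (use KD in auto)
    have ib: "integrable lborel b"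
      unfolding b_def by (rule integrable_compact_support_L2_loc[OF unim[OF f] _ _ KD(1), where B=D]) (use KD in auto)
    have ic: "integrable lborel c"
      unfolding c_def by (rule integrable_compact_support_L2_loc[OF unim[OF g] _ _ KD(1), where B=D]) (use KD in auto)
    let ?m = "\<i> * of_real (\<eta> $ j)"
    have "(LINT x|lborel. a x - ?m * b x) = - (LINT x|lborel. c x)"
      using weak_gradient_pexp[OF wg \<phi>, of j \<eta>] by (simp add: a_def b_def c_def algebra_simps)
    moreover have "(LINT x|lborel. a x - ?m * b x) = (LINT x|lborel. a x) - ?m * (LINT x|lborel. b x)"
      using ia ib by (simp only: Bochner_Integration.integral_mult_right_zero Bochner_Integration.integral_diff Bochner_Integration.integrable_mult_right)
    ultimately have "(LINT x|lborel. a x) = - ((LINT x|lborel. c x) + (- ?m) * (LINT x|lborel. b x))"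
      by (simp add: algebra_simps)
    also have "(LINT x|lborel. c x) + (- ?m) * (LINT x|lborel. b x) = (LINT x|lborel. c x + (- ?m) * b x)"
      using ic ib by (simp only: Bochner_Integration.integral_mult_right_zero Bochner_Integration.integral_add Bochner_Integration.integrable_mult_right)
    finally show ?thesis by (simp add: a_def b_def c_def algebra_simps)
  qed
  then show ?thesis
    using unim[OF f] L2_loc_vec[OF comb] by (simp add: has_weak_gradient_def)
qed

lemma H1_Bloch_intro:
  assumes wg: "has_weak_gradient \<psi> g" and per: "periodic_AE (\<lambda>x. pexp (- \<eta>) x * \<psi> x)"
  shows "\<psi> \<in> H1_Bloch \<eta>"
  using weak_gradient_mult_pexp[OF wg, of \<eta>] per
  by (auto simp: H1_Bloch_def H1_per_def H1_loc_def periodic_AE_def pexp_def)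

lemma pexp_Lipschitz: "cmod (pexp \<kappa> x - pexp \<kappa> y) \<le> norm \<kappa> * norm (x - y)"
proof -
  define a where "a = (x - y) \<bullet> \<kappa>"
  have "pexp \<kappa> x - pexp \<kappa> y = pexp \<kappa> y * (pexp \<kappa> (x - y) - 1)"
    by (simp add: right_diff_distrib flip: pexp_add_right)
  then have "cmod (pexp \<kappa> x - pexp \<kappa> y) = cmod (pexp \<kappa> (x - y) - 1)"
    by (simp add: norm_mult)
  also have "pexp \<kappa> (x - y) = cis a" by (simp add: pexp_def a_def cis_conv_exp)
  also have "cmod (cis a - 1) \<le> \<bar>a\<bar>"
  proof -
    have "(cmod (cis a - 1))\<^sup>2 = (cos a - 1)\<^sup>2 + (sin a)\<^sup>2" by (simp add: cmod_power2)
    also have "\<dots> = 2 - 2 * cos a" by (simp add: power2_diff sin_squared_eq)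
    also have "\<dots> = (2 * sin (a / 2))\<^sup>2" using cos_double_sin[of "a / 2"] by (simp add: power_mult_distrib)
    finally have "cmod (cis a - 1) = \<bar>2 * sin (a / 2)\<bar>"
      by (metis abs_norm_cancel power2_eq_iff_nonneg abs_ge_zero power2_abs)
    also have "\<dots> \<le> \<bar>a\<bar>" using abs_sin_x_le_abs_x[of "a / 2"] by simp
    finally show ?thesis .
  qed
  also have "\<bar>a\<bar> \<le> norm \<kappa> * norm (x - y)"
    unfolding a_def using Cauchy_Schwarz_ineq2[of "x - y" \<kappa>] by (simp add: mult.commute)
  finally show ?thesis .
qed

lemma pexp_has_vector_derivative:
  "((\<lambda>t. pexp \<kappa> (x + t *\<^sub>R axis j 1)) has_vector_derivative (\<i> * of_real (\<kappa> $ j) * pexp \<kappa> x)) (at 0)"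
proof -
  have "((\<lambda>t. pexp \<kappa> x * exp (\<i> * of_real (\<kappa> $ j) * of_real t)) has_vector_derivative
      pexp \<kappa> x * (\<i> * of_real (\<kappa> $ j))) (at 0)"
    by (auto intro!: derivative_eq_intros has_vector_derivative_real_field simp: has_field_derivative_def)
  moreover have "pexp \<kappa> x * exp (\<i> * of_real (\<kappa> $ j) * of_real t) = pexp \<kappa> (x + t *\<^sub>R axis j 1)" for t
    unfolding pexp_add_right by (simp add: pexp_def inner_axis' mult_ac)
  ultimately show ?thesis by (simp add: mult.commute)
qed

lemma ftrig_pexp: "ftrig \<eta> A c x = (\<Sum>k\<in>A. (c k * of_real (1 / sqrt ((2 * pi) ^ 3))) * pexp (\<eta> + ivec k) x)"
  unfolding ftrig_def ek_def by (simp add: mult.assoc)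

lemma ftrig_bounded: "cmod (ftrig \<eta> A c x) \<le> (\<Sum>k\<in>A. cmod (c k * of_real (1 / sqrt ((2 * pi) ^ 3))))"
  unfolding ftrig_pexp by (rule order_trans[OF norm_sum]) (simp add: norm_mult[of _ "pexp _ _"] del: of_real_divide)

lemma ftrig_Lipschitz:
  "cmod (ftrig \<eta> A c x - ftrig \<eta> A c y) \<le>
    (\<Sum>k\<in>A. cmod (c k * of_real (1 / sqrt ((2 * pi) ^ 3))) * norm (\<eta> + ivec k)) * norm (x - y)"
proof -
  have "cmod (ftrig \<eta> A c x - ftrig \<eta> A c y) \<le>
      (\<Sum>k\<in>A. cmod (c k * of_real (1 / sqrt ((2 * pi) ^ 3)) * (pexp (\<eta> + ivec k) x - pexp (\<eta> + ivec k) y)))"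
    unfolding ftrig_pexp sum_subtractf[symmetric] right_diff_distrib by (rule norm_sum)
  also have "\<dots> \<le> (\<Sum>k\<in>A. cmod (c k * of_real (1 / sqrt ((2 * pi) ^ 3))) * (norm (\<eta> + ivec k) * norm (x - y)))"
    unfolding norm_mult[of _ "pexp _ _ - pexp _ _"]
    by (intro sum_mono mult_left_mono pexp_Lipschitz) auto
  finally show ?thesis by (simp add: sum_distrib_right mult.assoc)
qed

definition fgradc :: "real^3 \<Rightarrow> (int^3 \<Rightarrow> complex) \<Rightarrow> 3 \<Rightarrow> int^3 \<Rightarrow> complex" where
  "fgradc \<eta> c j k = \<i> * of_real ((\<eta> + ivec k) $ j) * c k"

lemma ftrig_has_vector_derivative:
  "((\<lambda>t. ftrig \<eta> A c (x + t *\<^sub>R axis j 1)) has_vector_derivative ftrig \<eta> A (fgradc \<eta> c j) x) (at 0)"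
proof -
  have "((\<lambda>t. \<Sum>k\<in>A. (c k * of_real (1 / sqrt ((2 * pi) ^ 3))) * pexp (\<eta> + ivec k) (x + t *\<^sub>R axis j 1)) has_vector_derivative
     (\<Sum>k\<in>A. (c k * of_real (1 / sqrt ((2 * pi) ^ 3))) * (\<i> * of_real ((\<eta> + ivec k) $ j) * pexp (\<eta> + ivec k) x))) (at 0)"
    by (intro has_vector_derivative_sum has_vector_derivative_mult_right pexp_has_vector_derivative)
  then show ?thesis unfolding ftrig_pexp fgradc_def by (simp only: mult_ac)
qed

lemma ftrig_measurable [measurable]: "ftrig \<eta> A c \<in> borel_measurable borel"
  by (rule cell_L2_measurable[OF ftrig_L2])

lemma norm_vec_le_sum: "norm (v :: complex^3) \<le> (\<Sum>j\<in>UNIV. cmod (v $ j))"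
  unfolding norm_vec_def by (rule L2_set_le_sum) simp

lemma has_weak_gradient_ftrig:
  "has_weak_gradient (ftrig \<eta> A c) (\<lambda>x. \<chi> j. ftrig \<eta> A (fgradc \<eta> c j) x)"
proof (rule weak_gradient_Lipschitz[OF ftrig_Lipschitz _ ftrig_bounded])
  show "norm (\<chi> j. ftrig \<eta> A (fgradc \<eta> c j) x) \<le>
      (\<Sum>j\<in>UNIV. \<Sum>k\<in>A. cmod (fgradc \<eta> c j k * of_real (1 / sqrt ((2 * pi) ^ 3))))" for x
    by (rule order_trans[OF norm_vec_le_sum], unfold vec_lambda_beta, intro sum_mono ftrig_bounded)
  show "AE x in lborel. ((\<lambda>t. ftrig \<eta> A c (x + t *\<^sub>R axis j 1)) has_vector_derivative (\<chi> j. ftrig \<eta> A (fgradc \<eta> c j) x) $ j) (at 0)" for j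
    by (intro AE_I2) (simp add: ftrig_has_vector_derivative)
qed (auto intro!: sum_nonneg)

section \<open>Quasi-periodic extension from the cell\<close>

definition cell_shift :: "real^3 \<Rightarrow> real^3" where
  "cell_shift x = shift (cell_index x)"

text \<open>Fourier data determine a function on the cell only, whereas \<open>H1_Bloch\<close>
  concerns functions on the whole space; the values are carried to the other cells by the Bloch
  phase.\<close>

definition Bloch_ext :: "real^3 \<Rightarrow> (real^3 \<Rightarrow> complex) \<Rightarrow> real^3 \<Rightarrow> complex" where
  "Bloch_ext \<eta> f x = pexp \<eta> (cell_shift x) * f (x - cell_shift x)"

lemma cell_shift_measurable [measurable]: "cell_shift \<in> borel_measurable borel"
proof -
  have [measurable]: "(\<lambda>x :: real^3. x $ i) \<in> borel_measurable borel" for i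
    by (intro borel_measurable_continuous_onI continuous_intros)
  have "cell_shift = (\<lambda>x. \<chi> i. 2 * pi * of_int \<lfloor>x $ i / (2 * pi)\<rfloor>)"
    by (simp add: fun_eq_iff vec_eq_iff cell_shift_def cell_index_def)
  also have "\<dots> \<in> borel_measurable borel" by (intro vec_lambda_measurable) measurable
  finally show ?thesis .
qed

lemma Bloch_ext_measurable [measurable (raw)]:
  assumes [measurable]: "f \<in> borel_measurable borel"
  shows "Bloch_ext \<eta> f \<in> borel_measurable borel"
  unfolding Bloch_ext_def[abs_def] by measurable

lemma cell_index_add_shift: "cell_index (x + shift m) = cell_index x + m"
proof -
  have "\<lfloor>(x $ i + 2 * pi * of_int (m $ i)) / (2 * pi)\<rfloor> = \<lfloor>x $ i / (2 * pi)\<rfloor> + m $ i" for i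
    by (simp add: add_divide_distrib)
  then show ?thesis by (simp add: cell_index_def vec_eq_iff)
qed

lemma shift_add: "shift (k + m) = shift k + shift m"
  by (simp add: vec_eq_iff ring_distribs)

lemma Bloch_ext_shift: "Bloch_ext \<eta> f (x + shift m) = pexp \<eta> (shift m) * Bloch_ext \<eta> f x"
proof -
  have "cell_shift (x + shift m) = cell_shift x + shift m"
    by (simp add: cell_shift_def cell_index_add_shift shift_add)
  then show ?thesis by (simp add: Bloch_ext_def pexp_add_right)
qed

lemma cell_index_cell: "x \<in> cell \<Longrightarrow> cell_index x = 0"
proof -
  assume x: "x \<in> cell"
  have "\<lfloor>x $ i / (2 * pi)\<rfloor> = 0" for i
    using x by (intro floor_unique) (auto simp: cell_def less_imp_le)
  then show ?thesis by (simp add: cell_index_def vec_eq_iff)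
qed

lemma shift_0 [simp]: "shift 0 = 0"
  by (simp add: vec_eq_iff)

lemma Bloch_ext_cell: "x \<in> cell \<Longrightarrow> Bloch_ext \<eta> f x = f x"
  by (simp add: Bloch_ext_def cell_shift_def cell_index_cell)

lemma Bloch_ext_periodic: "periodic_AE (\<lambda>x. pexp (- \<eta>) x * Bloch_ext \<eta> f x)"
proof -
  have "pexp (- \<eta>) (x + axis j (2 * pi)) * Bloch_ext \<eta> f (x + axis j (2 * pi)) = pexp (- \<eta>) x * Bloch_ext \<eta> f x" for x j
  proof -
    let ?s = "shift (axis j 1)"
    have "pexp (- \<eta>) (x + ?s) * Bloch_ext \<eta> f (x + ?s) = (pexp \<eta> ?s * pexp (- \<eta>) ?s) * (pexp (- \<eta>) x * Bloch_ext \<eta> f x)"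
      unfolding Bloch_ext_shift pexp_add_right by (simp only: mult_ac)
    then show ?thesis by (simp add: axis_eq_shift pexp_minus_mult)
  qed
  then show ?thesis by (simp add: periodic_AE_def)
qed

text \<open>A compact set meets finitely many translated cells, and on each of them the Bloch phase
  has modulus 1.\<close>

lemma Bloch_ext_integral_bound:
  assumes f: "f \<in> cell_L2" and K: "compact K" and KP: "\<And>x i. x \<in> K \<Longrightarrow> \<bar>x $ i\<bar> \<le> 2 * pi * real P"
  shows "integrable lborel (\<lambda>x. indicator K x * (cmod (Bloch_ext \<eta> f x))\<^sup>2)"
    and "(\<integral>x. indicator K x * (cmod (Bloch_ext \<eta> f x))\<^sup>2 \<partial>lborel) \<le> real (card (ibox P)) * nrm2 f"
proof -
  have [measurable]: "f \<in> borel_measurable borel" by (rule cell_L2_measurable[OF f])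
  have [measurable]: "K \<in> sets borel" using K by (intro borel_closed compact_imp_closed)
  define H where "H m x = indicator cell (x - shift m) * (cmod (Bloch_ext \<eta> f x))\<^sup>2" for m x
  have [measurable]: "H m \<in> borel_measurable borel" for m unfolding H_def[abs_def] by measurable
  have "H m (x + shift m) = indicator cell x *\<^sub>R (cmod (f x))\<^sup>2" for m x
    by (auto simp: H_def Bloch_ext_shift norm_mult indicator_def Bloch_ext_cell)
  moreover have "integrable lborel (\<lambda>x. indicator cell x *\<^sub>R (cmod (f x))\<^sup>2)"
    using cell_L2_integrable[OF f] by (subst (asm) integrable_cell) auto
  moreover have "(\<integral>x. indicator cell x *\<^sub>R (cmod (f x))\<^sup>2 \<partial>lborel) = nrm2 f"
    unfolding nrm2_def by (subst integral_cell) (auto simp: set_lebesgue_integral_def)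
  ultimately have H: "integrable lborel (H m)" "(\<integral>x. H m x \<partial>lborel) = nrm2 f" for m
    using lborel_integral_translate[of "H m" "shift m"] by auto
  have le: "AE x in lborel. indicator K x * (cmod (Bloch_ext \<eta> f x))\<^sup>2 \<le> (\<Sum>m\<in>ibox P. H m x)"
    using AE_off_faces
  proof eventually_elim
    case (elim x)
    show ?case
    proof (cases "x \<in> K")
      case True
      have "\<bar>\<lfloor>x $ i / (2 * pi)\<rfloor>\<bar> \<le> int P" for i
      proof -
        have "- real P \<le> x $ i / (2 * pi)" "x $ i / (2 * pi) \<le> real P"
          using KP[OF True, of i] by (auto simp: field_simps abs_le_iff)
        then show ?thesis by (simp add: abs_le_iff le_floor_iff floor_le_iff minus_le_iff)
      qed
      then have "cell_index x \<in> ibox P" by (simp add: ibox_def cell_index_def)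
      then have "H (cell_index x) x \<le> (\<Sum>m\<in>ibox P. H m x)"
        by (rule member_le_sum) (auto simp: H_def)
      moreover have "H (cell_index x) x = indicator K x * (cmod (Bloch_ext \<eta> f x))\<^sup>2"
        using mem_cell_shift_iff[OF elim, of "cell_index x"] True by (simp add: H_def)
      ultimately show ?thesis by (simp only:)
    next
      case False
      then show ?thesis by (simp add: H_def sum_nonneg)
    qed
  qed
  have sum_int: "integrable lborel (\<lambda>x. \<Sum>m\<in>ibox P. H m x)"
    by (intro Bochner_Integration.integrable_sum H)
  show int: "integrable lborel (\<lambda>x. indicator K x * (cmod (Bloch_ext \<eta> f x))\<^sup>2)"
  proof (rule Bochner_Integration.integrable_bound[OF sum_int])
    show "AE x in lborel. norm (indicator K x * (cmod (Bloch_ext \<eta> f x))\<^sup>2) \<le> norm (\<Sum>m\<in>ibox P. H m x)"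
      using le
    proof eventually_elim
      case (elim x)
      then show ?case by (simp add: abs_mult order_trans[OF _ abs_ge_self])
    qed
  qed measurable
  have "(\<integral>x. indicator K x * (cmod (Bloch_ext \<eta> f x))\<^sup>2 \<partial>lborel) \<le> (\<integral>x. (\<Sum>m\<in>ibox P. H m x) \<partial>lborel)"
    by (rule integral_mono_AE[OF int sum_int le])
  also have "\<dots> = (\<Sum>m\<in>ibox P. \<integral>x. H m x \<partial>lborel)"
    by (intro Bochner_Integration.integral_sum H)
  also have "\<dots> = real (card (ibox P)) * nrm2 f" by (simp add: H)
  finally show "(\<integral>x. indicator K x * (cmod (Bloch_ext \<eta> f x))\<^sup>2 \<partial>lborel) \<le> real (card (ibox P)) * nrm2 f" .
qed

lemma compact_subset_cells:
  fixes K :: "(real^3) set"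
  assumes "compact K"
  obtains P :: nat where "\<And>x i. x \<in> K \<Longrightarrow> \<bar>x $ i\<bar> \<le> 2 * pi * real P"
proof -
  obtain R where R: "\<And>x. x \<in> K \<Longrightarrow> norm x \<le> R"
    using compact_imp_bounded[OF assms] unfolding bounded_iff by blast
  obtain P :: nat where P: "real P \<ge> R" by (meson real_arch_simple)
  have "\<bar>x $ i\<bar> \<le> 2 * pi * real P" if "x \<in> K" for x i
  proof -
    have "\<bar>x $ i\<bar> \<le> 1 * real P" using component_le_norm_cart[of x i] R[OF that] P by linarith
    also have "\<dots> \<le> 2 * pi * real P" using pi_gt3 by (intro mult_right_mono) auto
    finally show ?thesis .
  qed
  then show thesis by (rule that)
qed

lemma Bloch_ext_L2_loc:
  assumes f: "f \<in> cell_L2"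
  shows "Bloch_ext \<eta> f \<in> L2_loc"
proof -
  have [measurable]: "f \<in> borel_measurable borel" by (rule cell_L2_measurable[OF f])
  have "set_integrable lborel K (\<lambda>x. (cmod (Bloch_ext \<eta> f x))\<^sup>2)" if K: "compact K" for K
  proof -
    obtain P where P: "\<And>x i. x \<in> K \<Longrightarrow> \<bar>x $ i\<bar> \<le> 2 * pi * real P"
      by (rule compact_subset_cells[OF K]) blast
    show ?thesis using Bloch_ext_integral_bound(1)[OF f K P] unfolding set_integrable_def real_scaleR_def .
  qed
  then show ?thesis by (simp add: L2_loc_def)
qed

lemma Bloch_ext_diff: "Bloch_ext \<eta> f x - Bloch_ext \<eta> h x = Bloch_ext \<eta> (\<lambda>x. f x - h x) x"
  by (simp add: Bloch_ext_def right_diff_distrib)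

lemma Bloch_ext_ftrig: "Bloch_ext \<eta> (ftrig \<eta> A c) x = ftrig \<eta> A c x"
proof -
  have "pexp (\<eta> + ivec k) x = pexp \<eta> (cell_shift x) * pexp (\<eta> + ivec k) (x - cell_shift x)" for k
  proof -
    have "pexp (\<eta> + ivec k) x = pexp (\<eta> + ivec k) (cell_shift x) * pexp (\<eta> + ivec k) (x - cell_shift x)"
      by (simp flip: pexp_add_right)
    also have "pexp (\<eta> + ivec k) (cell_shift x) = pexp \<eta> (cell_shift x)"
      by (simp add: pexp_add_left cell_shift_def pexp_ivec_shift)
    finally show ?thesis .
  qed
  then show ?thesis
    unfolding Bloch_ext_def ftrig_pexp sum_distrib_left by (intro sum.cong refl) (simp only: mult_ac)
qed

text \<open>The Sobolev space of Bloch functions seen through Fourier coefficients, with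
  \<open>f\<close> and \<open>g\<close> regarded on the cell only. The analysis below takes place
  here; \<open>fgrad_weak_gradient\<close> and \<open>weak_gradient_Bloch_ext\<close> are the two
  directions of the dictionary.\<close>

definition fgrad :: "real^3 \<Rightarrow> (real^3 \<Rightarrow> complex) \<Rightarrow> (3 \<Rightarrow> real^3 \<Rightarrow> complex) \<Rightarrow> bool" where
  "fgrad \<eta> f g \<longleftrightarrow> f \<in> cell_L2 \<and> (\<forall>j. g j \<in> cell_L2) \<and> (\<forall>j k. fc \<eta> (g j) k = fgradc \<eta> (fc \<eta> f) j k)"

lemma fgradD: "fgrad \<eta> f g \<Longrightarrow> f \<in> cell_L2" "fgrad \<eta> f g \<Longrightarrow> g j \<in> cell_L2"
  "fgrad \<eta> f g \<Longrightarrow> fc \<eta> (g j) k = \<i> * of_real ((\<eta> + ivec k) $ j) * fc \<eta> f k"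
  by (auto simp: fgrad_def fgradc_def)

lemma fgrad_weak_gradient:
  assumes "\<psi> \<in> H1_Bloch \<eta>" "has_weak_gradient \<psi> g"
  shows "fgrad \<eta> \<psi> (\<lambda>j x. g x $ j)"
  using assms weak_gradient_cell_L2[OF assms(2)] fc_weak_gradient[OF assms] by (simp add: fgrad_def fgradc_def)

text \<open>Partial Fourier sums are their own Bloch extensions and have classical gradients. They
  converge in mean square on every compact set, and weak gradients survive such limits.\<close>

theorem weak_gradient_Bloch_ext:
  assumes fg: "fgrad \<eta> f g"
  shows "has_weak_gradient (Bloch_ext \<eta> f) (\<lambda>x. \<chi> j. Bloch_ext \<eta> (g j) x)"
    and "Bloch_ext \<eta> f \<in> H1_Bloch \<eta>"
proof -
  note f = fgradD(1)[OF fg] and g = fgradD(2)[OF fg]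
  define F where "F N = ftrig \<eta> (ibox N) (fc \<eta> f)" for N
  define G where "G N j = ftrig \<eta> (ibox N) (fc \<eta> (g j))" for N j
  have FG: "has_weak_gradient (F N) (\<lambda>x. \<chi> j. G N j x)" for N
  proof -
    have "fc \<eta> (g j) = fgradc \<eta> (fc \<eta> f) j" for j using fg by (auto simp: fgrad_def)
    then show ?thesis unfolding F_def G_def by (simp add: has_weak_gradient_ftrig)
  qed
  have *: "(\<forall>N. integrable lborel (\<lambda>x. indicator K x * (cmod (ftrig \<eta> (ibox N) (fc \<eta> h) x - Bloch_ext \<eta> h x))\<^sup>2)) \<and>
      (\<lambda>N. \<integral>x. indicator K x * (cmod (ftrig \<eta> (ibox N) (fc \<eta> h) x - Bloch_ext \<eta> h x))\<^sup>2 \<partial>lborel) \<longlonglongrightarrow> 0"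
    if h: "h \<in> cell_L2" and K: "compact K" for h K
  proof -
    obtain P where P: "\<And>x i. x \<in> K \<Longrightarrow> \<bar>x $ i\<bar> \<le> 2 * pi * real P" using compact_subset_cells[OF K] by blast
    have eq: "ftrig \<eta> (ibox N) (fc \<eta> h) x - Bloch_ext \<eta> h x = Bloch_ext \<eta> (\<lambda>x. ftrig \<eta> (ibox N) (fc \<eta> h) x - h x) x" for N x
      by (subst Bloch_ext_ftrig[symmetric], rule Bloch_ext_diff)
    have d: "(\<lambda>x. ftrig \<eta> (ibox N) (fc \<eta> h) x - h x) \<in> cell_L2" for N
      by (rule cell_L2_diff[OF ftrig_L2 h])
    note b = Bloch_ext_integral_bound[OF d K P]
    have "(\<lambda>N. \<integral>x. indicator K x * (cmod (Bloch_ext \<eta> (\<lambda>x. ftrig \<eta> (ibox N) (fc \<eta> h) x - h x) x))\<^sup>2 \<partial>lborel) \<longlonglongrightarrow> 0"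
    proof (rule Lim_null_comparison)
      show "\<forall>\<^sub>F N in sequentially. norm (\<integral>x. indicator K x * (cmod (Bloch_ext \<eta> (\<lambda>x. ftrig \<eta> (ibox N) (fc \<eta> h) x - h x) x))\<^sup>2 \<partial>lborel)
          \<le> real (card (ibox P)) * nrm2 (\<lambda>x. ftrig \<eta> (ibox N) (fc \<eta> h) x - h x)"
        by (rule always_eventually, rule allI, subst real_norm_def, subst abs_of_nonneg[OF Bochner_Integration.integral_nonneg]) (use b(2) in auto)
      have "(\<lambda>N. real (card (ibox P)) * nrm2 (\<lambda>x. ftrig \<eta> (ibox N) (fc \<eta> h) x - h x)) \<longlonglongrightarrow> real (card (ibox P)) * 0"
        using Fourier_tendsto[OF h, of \<eta>] unfolding nrm2_minus_commute[of h] by (intro tendsto_mult tendsto_const)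
      then show "(\<lambda>N. real (card (ibox P)) * nrm2 (\<lambda>x. ftrig \<eta> (ibox N) (fc \<eta> h) x - h x)) \<longlonglongrightarrow> 0" by simp
    qed
    then show ?thesis unfolding eq using b(1) by blast
  qed
  show wg: "has_weak_gradient (Bloch_ext \<eta> f) (\<lambda>x. \<chi> j. Bloch_ext \<eta> (g j) x)"
    by (rule weak_gradient_limit[where f=F and g="\<lambda>N x. \<chi> j. G N j x", OF FG Bloch_ext_L2_loc[OF f] L2_loc_vec[OF Bloch_ext_L2_loc[OF g]]])
      (simp_all add: F_def G_def *[OF f] *[OF g])
  show "Bloch_ext \<eta> f \<in> H1_Bloch \<eta>"
    by (rule H1_Bloch_intro[OF wg Bloch_ext_periodic])
qed

lemma fgrad_ftrig:
  assumes "finite A"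
  shows "fgrad \<eta> (ftrig \<eta> A c) (\<lambda>j. ftrig \<eta> A (fgradc \<eta> c j))"
  using assms by (auto simp: fgrad_def fc_ftrig fgradc_def)

lemma fc_add: "f \<in> cell_L2 \<Longrightarrow> h \<in> cell_L2 \<Longrightarrow> fc \<eta> (\<lambda>x. f x + h x) k = fc \<eta> f k + fc \<eta> h k"
  by (simp add: fc_def ip_add_left)

lemma fc_diff: "f \<in> cell_L2 \<Longrightarrow> h \<in> cell_L2 \<Longrightarrow> fc \<eta> (\<lambda>x. f x - h x) k = fc \<eta> f k - fc \<eta> h k"
  by (simp add: fc_def ip_diff_left)

lemma fgrad_add:
  assumes "fgrad \<eta> f g" "fgrad \<eta> f' g'"
  shows "fgrad \<eta> (\<lambda>x. f x + f' x) (\<lambda>j x. g j x + g' j x)"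
  using assms unfolding fgrad_def fgradc_def
  by (auto simp: fc_add cell_L2_add ring_distribs)

lemma fgrad_diff:
  assumes "fgrad \<eta> f g" "fgrad \<eta> f' g'"
  shows "fgrad \<eta> (\<lambda>x. f x - f' x) (\<lambda>j x. g j x - g' j x)"
  using assms unfolding fgrad_def fgradc_def
  by (auto simp: fc_diff cell_L2_diff ring_distribs)

lemma fgrad_scale:
  assumes "fgrad \<eta> f g"
  shows "fgrad \<eta> (\<lambda>x. c * f x) (\<lambda>j x. c * g j x)"
  using assms unfolding fgrad_def fgradc_def fc_def
  by (auto simp: ip_scale_left cell_L2_scale mult_ac)

lemma fgrad_limit:
  assumes fg: "\<And>n. fgrad \<eta> (f n) (g n)" and F: "F \<in> cell_L2" and G: "\<And>j. G j \<in> cell_L2"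
    and "(\<lambda>n. nrm2 (\<lambda>x. f n x - F x)) \<longlonglongrightarrow> 0" and "\<And>j. (\<lambda>n. nrm2 (\<lambda>x. g n j x - G j x)) \<longlonglongrightarrow> 0"
  shows "fgrad \<eta> F G"
  unfolding fgrad_def fgradc_def
proof (intro conjI allI F G)
  fix j k
  have "(\<lambda>n. fc \<eta> (g n j) k) \<longlonglongrightarrow> fc \<eta> (G j) k"
    unfolding fc_def by (rule ip_tendsto_left[OF fgradD(2)[OF fg] G ek_L2 assms(5)])
  moreover have "(\<lambda>n. fc \<eta> (f n) k) \<longlonglongrightarrow> fc \<eta> F k"
    unfolding fc_def by (rule ip_tendsto_left[OF fgradD(1)[OF fg] F ek_L2 assms(4)])
  then have "(\<lambda>n. \<i> * of_real ((\<eta> + ivec k) $ j) * fc \<eta> (f n) k) \<longlonglongrightarrow> \<i> * of_real ((\<eta> + ivec k) $ j) * fc \<eta> F k"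
    by (intro tendsto_intros)
  ultimately show "fc \<eta> (G j) k = \<i> * of_real ((\<eta> + ivec k) $ j) * fc \<eta> F k"
    unfolding fgradD(3)[OF fg] by (rule LIMSEQ_unique)
qed

lemma norm_real_vec_sq: "(norm (v :: real^3))\<^sup>2 = (\<Sum>j\<in>UNIV. (v $ j)\<^sup>2)"
  unfolding power2_norm_eq_inner inner_vec_def by (simp add: power2_eq_square)

lemma fgrad_sum_eq:
  assumes "fgrad \<eta> f g"
  shows "(\<Sum>j\<in>UNIV. (cmod (fc \<eta> (g j) k))\<^sup>2) = (norm (\<eta> + ivec k))\<^sup>2 * (cmod (fc \<eta> f k))\<^sup>2"
  unfolding fgradD(3)[OF assms] norm_real_vec_sq sum_distrib_right
  by (intro sum.cong refl) (simp only: norm_mult power_mult_distrib norm_ii norm_of_real power_one mult_1 power2_abs)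

text \<open>Outside \<open>ibox N\<close> some component of \<open>k\<close> exceeds
  \<open>N\<close> in modulus, so the wave vector has length at least
  \<open>N - norm \<eta>\<close>. A bounded gradient therefore makes the tails uniformly small,
  which is the source of compactness.\<close>

lemma fgrad_tail:
  assumes fg: "fgrad \<eta> f g" and N: "real N > norm \<eta>"
  shows "nrm2 f \<le> (\<Sum>k\<in>ibox N. (cmod (fc \<eta> f k))\<^sup>2) + (\<Sum>j\<in>UNIV. nrm2 (g j)) / (real N - norm \<eta>)\<^sup>2"
proof -
  define a where "a = real N - norm \<eta>"
  have a: "a > 0" using N by (simp add: a_def)
  have "(\<Sum>k\<in>ibox M. (cmod (fc \<eta> f k))\<^sup>2) \<le> (\<Sum>k\<in>ibox N. (cmod (fc \<eta> f k))\<^sup>2) + (\<Sum>j\<in>UNIV. nrm2 (g j)) / a\<^sup>2" for M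
  proof -
    have "(\<Sum>k\<in>ibox M - ibox N. (cmod (fc \<eta> f k))\<^sup>2) \<le> (\<Sum>k\<in>ibox M - ibox N. (\<Sum>j\<in>UNIV. (cmod (fc \<eta> (g j) k))\<^sup>2) / a\<^sup>2)"
    proof (rule sum_mono)
      fix k assume "k \<in> ibox M - ibox N"
      then obtain i where "\<bar>k $ i\<bar> > int N" by (auto simp: ibox_def not_le)
      then have "real N < \<bar>of_int (k $ i)\<bar>" by linarith
      also have "\<bar>of_int (k $ i)\<bar> \<le> norm (ivec k)" using component_le_norm_cart[of "ivec k" i] by simp
      also have "\<dots> \<le> norm (\<eta> + ivec k) + norm \<eta>" using norm_triangle_ineq4[of "\<eta> + ivec k" \<eta>] by simp
      finally have "a \<le> norm (\<eta> + ivec k)" by (simp add: a_def)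
      then have "a\<^sup>2 \<le> (norm (\<eta> + ivec k))\<^sup>2" using a by (intro power_mono) auto
      then have "a\<^sup>2 * (cmod (fc \<eta> f k))\<^sup>2 \<le> (\<Sum>j\<in>UNIV. (cmod (fc \<eta> (g j) k))\<^sup>2)"
        unfolding fgrad_sum_eq[OF fg] by (intro mult_right_mono) auto
      then show "(cmod (fc \<eta> f k))\<^sup>2 \<le> (\<Sum>j\<in>UNIV. (cmod (fc \<eta> (g j) k))\<^sup>2) / a\<^sup>2"
        using a by (simp add: field_simps)
    qed
    also have "\<dots> = (\<Sum>j\<in>UNIV. \<Sum>k\<in>ibox M - ibox N. (cmod (fc \<eta> (g j) k))\<^sup>2) / a\<^sup>2"
      by (subst sum.swap) (simp add: sum_divide_distrib)
    also have "\<dots> \<le> (\<Sum>j\<in>UNIV. nrm2 (g j)) / a\<^sup>2"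
      by (intro divide_right_mono sum_mono Bessel fgradD(2)[OF fg]) auto
    finally have "(\<Sum>k\<in>ibox M - ibox N. (cmod (fc \<eta> f k))\<^sup>2) \<le> (\<Sum>j\<in>UNIV. nrm2 (g j)) / a\<^sup>2" .
    moreover have "(\<Sum>k\<in>ibox M. (cmod (fc \<eta> f k))\<^sup>2) \<le> (\<Sum>k\<in>ibox N \<union> (ibox M - ibox N). (cmod (fc \<eta> f k))\<^sup>2)"
      by (rule sum_mono2) auto
    moreover have "(\<Sum>k\<in>ibox N \<union> (ibox M - ibox N). (cmod (fc \<eta> f k))\<^sup>2) =
        (\<Sum>k\<in>ibox N. (cmod (fc \<eta> f k))\<^sup>2) + (\<Sum>k\<in>ibox M - ibox N. (cmod (fc \<eta> f k))\<^sup>2)"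
      by (rule sum.union_disjoint) auto
    ultimately show ?thesis by linarith
  qed
  then show ?thesis
    using LIMSEQ_le_const2[OF Parseval[OF fgradD(1)[OF fg], of \<eta>]] by (auto simp: a_def)
qed

text \<open>A diagonal subsequence makes every coefficient converge; uniform smallness of the tails
  upgrades this to the Cauchy property in mean square.\<close>

theorem Rellich_cell:
  fixes f :: "nat \<Rightarrow> real^3 \<Rightarrow> complex"
  assumes fg: "\<And>n. fgrad \<eta> (f n) (g n)"
    and C: "\<And>n. nrm2 (f n) \<le> C" and E: "\<And>n. (\<Sum>j\<in>UNIV. nrm2 (g n j)) \<le> E"
  obtains s F where "strict_mono s" "F \<in> cell_L2" "(\<lambda>n. nrm2 (\<lambda>x. f (s n) x - F x)) \<longlonglongrightarrow> 0"
proof -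
  note f = fgradD(1)[OF fg] and g = fgradD(2)[OF fg]
  have fc_bd: "cmod (fc \<eta> (f n) k) \<le> sqrt C" for n k
  proof -
    have "(cmod (fc \<eta> (f n) k))\<^sup>2 \<le> C"
      using Bessel[of "{k}", OF _ f, of \<eta> n] C[of n] by simp
    then show ?thesis by (rule real_le_rsqrt)
  qed
  interpret subseqs "\<lambda>n (s :: nat \<Rightarrow> nat). convergent (\<lambda>i. fc \<eta> (f (s i)) (from_nat n))"
  proof
    fix n and s :: "nat \<Rightarrow> nat" assume "strict_mono s"
    have "bounded (range (\<lambda>i. fc \<eta> (f (s i)) (from_nat n)))"
      using fc_bd by (auto simp: bounded_iff)
    then obtain l r where "strict_mono r" "((\<lambda>i. fc \<eta> (f (s i)) (from_nat n)) \<circ> r) \<longlonglongrightarrow> l"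
      using bounded_imp_convergent_subsequence by blast
    then show "\<exists>r'. strict_mono r' \<and> convergent (\<lambda>i. fc \<eta> (f ((s \<circ> r') i)) (from_nat n))"
      by (intro exI[of _ r]) (auto simp: convergent_def o_def)
  qed
  define s where "s = diagseq"
  have s: "strict_mono s" unfolding s_def by (rule subseq_diagseq)
  have conv: "convergent (\<lambda>i. fc \<eta> (f (s i)) k)" for k
  proof -
    \<comment> \<open>The diagonal sequence is a subsequence of the one extracted for coefficient
      number \<open>n\<close> only from index \<open>Suc n\<close> on; an initial segment does not
      affect convergence.\<close>
    have "convergent (\<lambda>i. fc \<eta> (f ((diagseq \<circ> ((+) (Suc (to_nat k)))) i)) (from_nat (to_nat k)))"
    proof (rule diagseq_holds)
      fix r s :: "nat \<Rightarrow> nat" and n assume r: "strict_mono r" "convergent (\<lambda>i. fc \<eta> (f (s i)) (from_nat n))"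
      then show "convergent (\<lambda>i. fc \<eta> (f ((s \<circ> r) i)) (from_nat n))"
        using convergent_subseq_convergent[OF r(2,1)] by (simp add: o_def)
    qed
    then have "convergent (\<lambda>i. fc \<eta> (f (s (i + Suc (to_nat k)))) k)"
      by (simp add: s_def add.commute)
    then show ?thesis by (subst (asm) convergent_ignore_initial_segment)
  qed
  define L where "L k = lim (\<lambda>i. fc \<eta> (f (s i)) k)" for k
  have L: "(\<lambda>i. fc \<eta> (f (s i)) k) \<longlonglongrightarrow> L k" for k
    using conv[of k] by (simp add: L_def convergent_LIMSEQ_iff)
  have E0: "E \<ge> 0" using E[of 0] by (meson nrm2_nonneg order_trans sum_nonneg)
  have Cauchy: "\<exists>M. \<forall>m\<ge>M. \<forall>n\<ge>M. nrm2 (\<lambda>x. f (s m) x - f (s n) x) < e" if e: "e > 0" for e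
  proof -
    \<comment> \<open>The gradients of a difference have total squared norm at most
      \<open>4 * E\<close>, so this \<open>N\<close> makes the tail smaller than
      \<open>e / 2\<close>; the summand 1 serves to bound \<open>real N - norm \<eta>\<close> by its
      square.\<close>
    obtain N :: nat where N: "real N > norm \<eta> + 1 + 8 * E / e" using reals_Archimedean2 by blast
    have Eb: "8 * E / e \<ge> 0" using E0 e by simp
    have N1: "real N > norm \<eta>" using N Eb by linarith
    have tail: "4 * E / (real N - norm \<eta>)\<^sup>2 < e / 2"
    proof -
      have d: "real N - norm \<eta> > 1 + 8 * E / e" using N by linarith
      have "(real N - norm \<eta>) * 1 \<le> (real N - norm \<eta>) * (real N - norm \<eta>)"
        using d Eb by (intro mult_left_mono) linarith+
      then have "(real N - norm \<eta>)\<^sup>2 > 8 * E / e" using d by (simp add: power2_eq_square)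
      then have "8 * E < (real N - norm \<eta>)\<^sup>2 * e" using e by (simp add: field_simps)
      then show ?thesis using N1 by (simp add: field_simps)
    qed
    have "(\<lambda>i. \<Sum>k\<in>ibox N. (cmod (fc \<eta> (f (s i)) k - L k))\<^sup>2) \<longlonglongrightarrow> (\<Sum>k\<in>ibox N. (cmod (L k - L k))\<^sup>2)"
      by (intro tendsto_intros L)
    then have "(\<lambda>i. \<Sum>k\<in>ibox N. (cmod (fc \<eta> (f (s i)) k - L k))\<^sup>2) \<longlonglongrightarrow> 0" by simp
    from order_tendstoD(2)[OF this, of "e / 8"] e
    obtain M where M: "\<And>i. i \<ge> M \<Longrightarrow> (\<Sum>k\<in>ibox N. (cmod (fc \<eta> (f (s i)) k - L k))\<^sup>2) < e / 8"
      by (auto simp: eventually_sequentially)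
    have "nrm2 (\<lambda>x. f (s m) x - f (s n) x) < e" if mn: "m \<ge> M" "n \<ge> M" for m n
    proof -
      have "nrm2 (\<lambda>x. f (s m) x - f (s n) x) \<le>
          (\<Sum>k\<in>ibox N. (cmod (fc \<eta> (\<lambda>x. f (s m) x - f (s n) x) k))\<^sup>2) +
          (\<Sum>j\<in>UNIV. nrm2 (\<lambda>x. g (s m) j x - g (s n) j x)) / (real N - norm \<eta>)\<^sup>2"
        by (rule fgrad_tail[OF fgrad_diff[OF fg fg] N1])
      also have "(\<Sum>k\<in>ibox N. (cmod (fc \<eta> (\<lambda>x. f (s m) x - f (s n) x) k))\<^sup>2) \<le>
          (\<Sum>k\<in>ibox N. 2 * (cmod (fc \<eta> (f (s m)) k - L k))\<^sup>2 + 2 * (cmod (fc \<eta> (f (s n)) k - L k))\<^sup>2)"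
      proof (rule sum_mono)
        fix k
        have "fc \<eta> (\<lambda>x. f (s m) x - f (s n) x) k = (fc \<eta> (f (s m)) k - L k) + (L k - fc \<eta> (f (s n)) k)"
          by (simp add: fc_diff f)
        then show "(cmod (fc \<eta> (\<lambda>x. f (s m) x - f (s n) x) k))\<^sup>2 \<le> 2 * (cmod (fc \<eta> (f (s m)) k - L k))\<^sup>2 + 2 * (cmod (fc \<eta> (f (s n)) k - L k))\<^sup>2"
          using cmod_add_sq_le[of "fc \<eta> (f (s m)) k - L k" "L k - fc \<eta> (f (s n)) k"] by (simp add: norm_minus_commute)
      qed
      also have "\<dots> < e / 2"
        using M[OF mn(1)] M[OF mn(2)] by (simp add: sum.distrib flip: sum_distrib_left)
      also have "(\<Sum>j\<in>UNIV. nrm2 (\<lambda>x. g (s m) j x - g (s n) j x)) \<le> 4 * E"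
      proof -
        have "(\<Sum>j\<in>UNIV. nrm2 (\<lambda>x. g (s m) j x - g (s n) j x)) \<le> (\<Sum>j\<in>UNIV. 2 * nrm2 (g (s m) j) + 2 * nrm2 (g (s n) j))"
        proof (rule sum_mono)
          fix j
          show "nrm2 (\<lambda>x. g (s m) j x - g (s n) j x) \<le> 2 * nrm2 (g (s m) j) + 2 * nrm2 (g (s n) j)"
            using nrm2_add_le[OF g[of "s m" j] cell_L2_scale[OF g[of "s n" j], of "-1"]] by (simp add: nrm2_scale[of "-1", simplified])
        qed
        also have "\<dots> \<le> 4 * E"
          using E[of "s m"] E[of "s n"] by (simp add: sum.distrib flip: sum_distrib_left)
        finally show ?thesis .
      qed
      finally have "nrm2 (\<lambda>x. f (s m) x - f (s n) x) < e / 2 + 4 * E / (real N - norm \<eta>)\<^sup>2"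
        by (simp add: divide_right_mono)
      then show ?thesis using tail by linarith
    qed
    then show ?thesis by blast
  qed
  obtain F where "F \<in> cell_L2" "(\<lambda>n. nrm2 (\<lambda>x. f (s n) x - F x)) \<longlonglongrightarrow> 0"
    using Riesz_Fischer_cell[of "\<lambda>n. f (s n)", OF f Cauchy] by blast
  then show thesis using s that by blast
qed

section \<open>The first Bloch eigenvalue\<close>

definition energy :: "(real^3 \<Rightarrow> real) \<Rightarrow> (3 \<Rightarrow> real^3 \<Rightarrow> complex) \<Rightarrow> real" where
  "energy a g = (\<Sum>j\<in>UNIV. \<integral>x. a x * (cmod (g j x))\<^sup>2 \<partial>cell_measure)"

lemma weighted_integrable:
  assumes [measurable]: "a \<in> borel_measurable borel" and a: "\<And>x. \<bar>a x\<bar> \<le> b" and g: "f \<in> cell_L2"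
  shows "integrable cell_measure (\<lambda>x. a x * (cmod (f x))\<^sup>2)"
proof -
  have [measurable]: "f \<in> borel_measurable borel" by (rule cell_L2_measurable[OF g])
  have "integrable cell_measure (\<lambda>x. b * (cmod (f x))\<^sup>2)"
    using cell_L2_integrable[OF g] by simp
  then show ?thesis
  proof (rule Bochner_Integration.integrable_bound)
    have "\<bar>a x\<bar> * (cmod (f x))\<^sup>2 \<le> b * (cmod (f x))\<^sup>2" for x
      by (intro mult_right_mono a) auto
    then show "AE x in cell_measure. norm (a x * (cmod (f x))\<^sup>2) \<le> norm (b * (cmod (f x))\<^sup>2)"
      by (intro AE_I2) (auto simp: abs_mult intro: order_trans[OF _ mult_right_mono[OF abs_ge_self]])
  qed measurable
qed

lemma energy_vec:
  assumes a: "a \<in> borel_measurable borel" "\<And>x. \<bar>a x\<bar> \<le> b" and g: "\<And>j. g j \<in> cell_L2"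
    and eq: "\<And>x. x \<in> cell \<Longrightarrow> h x = (\<chi> j. g j x)" and h: "h \<in> borel_measurable borel"
  shows "(LINT x:cell|lborel. a x * (norm (h x :: complex^3))\<^sup>2) = energy a g"
proof -
  have [measurable]: "a \<in> borel_measurable borel" "h \<in> borel_measurable borel" "g j \<in> borel_measurable borel" for j
    using a h cell_L2_measurable[OF g] by auto
  have "(LINT x:cell|lborel. a x * (norm (h x))\<^sup>2) = (\<integral>x. a x * (norm (h x))\<^sup>2 \<partial>cell_measure)"
    by (subst integral_cell) auto
  also have "\<dots> = (\<integral>x. (\<Sum>j\<in>UNIV. a x * (cmod (g j x))\<^sup>2) \<partial>cell_measure)"
  proof (rule integral_cong_AE)
    show "AE x in cell_measure. a x * (norm (h x))\<^sup>2 = (\<Sum>j\<in>UNIV. a x * (cmod (g j x))\<^sup>2)"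
      using AE_in_cell by eventually_elim (simp add: eq norm_vec_sq sum_distrib_left)
  qed measurable
  also have "\<dots> = energy a g"
    unfolding energy_def by (intro Bochner_Integration.integral_sum weighted_integrable[OF a g])
  finally show ?thesis .
qed

lemma nrm2_set_integral:
  assumes "f \<in> cell_L2" "\<And>x. x \<in> cell \<Longrightarrow> h x = f x" "h \<in> borel_measurable borel"
  shows "(LINT x:cell|lborel. (cmod (h x))\<^sup>2) = nrm2 f"
proof -
  have [measurable]: "h \<in> borel_measurable borel" "f \<in> borel_measurable borel"
    using assms cell_L2_measurable by auto
  have "(LINT x:cell|lborel. (cmod (h x))\<^sup>2) = (\<integral>x. (cmod (h x))\<^sup>2 \<partial>cell_measure)"
    by (subst integral_cell) auto
  also have "\<dots> = nrm2 f"
    unfolding nrm2_def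
  proof (rule integral_cong_AE)
    show "AE x in cell_measure. (cmod (h x))\<^sup>2 = (cmod (f x))\<^sup>2"
      using AE_in_cell by eventually_elim (simp add: assms(2))
  qed measurable
  finally show ?thesis .
qed

text \<open>Both minima run over the same set of values: a Bloch function restricts to Fourier data,
  and Fourier data extend by \<open>Bloch_ext\<close> without changing integrals over the
  cell.\<close>

lemma Bloch_eigenvalue1_fgrad:
  assumes a: "a \<in> borel_measurable borel" "\<And>x. \<bar>a x\<bar> \<le> b"
  shows "Bloch_eigenvalue1 a \<eta> = (LEAST m. \<exists>f g. fgrad \<eta> f g \<and> nrm2 f = 1 \<and> m = energy a g)"
proof -
  have "m \<in> {(LINT x:cell|lborel. a x * (norm (g x))\<^sup>2) | \<psi> g.
        \<psi> \<in> H1_Bloch \<eta> \<and> has_weak_gradient \<psi> g \<and> (LINT x:cell|lborel. (cmod (\<psi> x))\<^sup>2) = 1}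
      \<longleftrightarrow> (\<exists>f g. fgrad \<eta> f g \<and> nrm2 f = 1 \<and> m = energy a g)" (is "?L \<longleftrightarrow> ?R") for m
  proof
    assume ?L
    then obtain \<psi> g where *: "m = (LINT x:cell|lborel. a x * (norm (g x))\<^sup>2)" "\<psi> \<in> H1_Bloch \<eta>"
      "has_weak_gradient \<psi> g" "(LINT x:cell|lborel. (cmod (\<psi> x))\<^sup>2) = 1" by blast
    note fg = fgrad_weak_gradient[OF *(2,3)]
    have "(LINT x:cell|lborel. a x * (norm (g x))\<^sup>2) = energy a (\<lambda>j x. g x $ j)"
      using has_weak_gradient_L2_loc[OF *(3)]
      by (intro energy_vec[OF a fgradD(2)[OF fg]]) (auto simp: vec_eq_iff intro: L2_loc_measurable)
    moreover have "nrm2 \<psi> = 1"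
      using nrm2_set_integral[OF fgradD(1)[OF fg], of \<psi>] *(4) cell_L2_measurable[OF fgradD(1)[OF fg]] by simp
    ultimately show ?R using fg *(1) by blast
  next
    assume ?R
    then obtain f g where fg: "fgrad \<eta> f g" "nrm2 f = 1" "m = energy a g" by blast
    note w = weak_gradient_Bloch_ext[OF fg(1)]
    have "(LINT x:cell|lborel. a x * (norm (\<chi> j. Bloch_ext \<eta> (g j) x))\<^sup>2) = energy a g"
      using has_weak_gradient_L2_loc[OF w(1)]
      by (intro energy_vec[OF a fgradD(2)[OF fg(1)]]) (auto simp: Bloch_ext_cell intro: L2_loc_measurable)
    moreover have "(LINT x:cell|lborel. (cmod (Bloch_ext \<eta> f x))\<^sup>2) = 1"
      using has_weak_gradient_L2_loc(1)[OF w(1)] fg(2)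
      by (subst nrm2_set_integral[OF fgradD(1)[OF fg(1)]]) (auto simp: Bloch_ext_cell intro: L2_loc_measurable)
    ultimately show ?L using w fg(3) by (auto intro!: exI[of _ "Bloch_ext \<eta> f"] exI[of _ "\<lambda>x. \<chi> j. Bloch_ext \<eta> (g j) x"])
  qed
  then show ?thesis unfolding Bloch_eigenvalue1_def by simp
qed

lemma energy_nonneg: "(\<And>x. a x \<ge> 0) \<Longrightarrow> energy a g \<ge> 0"
  unfolding energy_def by (intro sum_nonneg Bochner_Integration.integral_nonneg) auto

lemma energy_scale: "energy a (\<lambda>j x. c * g j x) = (cmod c)\<^sup>2 * energy a g"
proof -
  have "(\<integral>x. a x * (cmod (c * g j x))\<^sup>2 \<partial>cell_measure) = (cmod c)\<^sup>2 * (\<integral>x. a x * (cmod (g j x))\<^sup>2 \<partial>cell_measure)" for j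
    by (subst Bochner_Integration.integral_mult_right_zero[symmetric])
      (simp add: norm_mult power_mult_distrib mult_ac)
  then show ?thesis by (simp add: energy_def sum_distrib_left)
qed

text \<open>Absorbing the root of the coefficient into the gradient turns energies into plain norms,
  to which the Hilbert space identities apply.\<close>

lemma energy_sqrt:
  assumes "\<And>x. a x \<ge> 0"
  shows "energy a g = (\<Sum>j\<in>UNIV. nrm2 (\<lambda>x. of_real (sqrt (a x)) * g j x))"
  unfolding energy_def nrm2_def using assms by (simp add: norm_mult power_mult_distrib)

lemma energy_mono:
  assumes a: "a \<in> borel_measurable borel" "\<And>x. \<bar>a x\<bar> \<le> b" and a': "a' \<in> borel_measurable borel" "\<And>x. \<bar>a' x\<bar> \<le> b'"
    and le: "\<And>x. x \<in> cell \<Longrightarrow> a x \<le> a' x" and g: "\<And>j. g j \<in> cell_L2"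
  shows "energy a g \<le> energy a' g"
  unfolding energy_def
proof (rule sum_mono, rule integral_mono_AE)
  show "AE x in cell_measure. a x * (cmod (g j x))\<^sup>2 \<le> a' x * (cmod (g j x))\<^sup>2" for j
    using AE_in_cell by eventually_elim (auto intro!: mult_right_mono le)
qed (auto intro!: weighted_integrable[OF a g] weighted_integrable[OF a' g])

lemma energy_const: "energy (\<lambda>_. c) g = c * (\<Sum>j\<in>UNIV. nrm2 (g j))"
  by (simp add: energy_def nrm2_def sum_distrib_left)

lemma energy_parallelogram:
  assumes a: "a \<in> borel_measurable borel" "\<And>x. 0 \<le> a x" "\<And>x. a x \<le> b"
    and g: "\<And>j. g j \<in> cell_L2" and h: "\<And>j. h j \<in> cell_L2"
  shows "energy a (\<lambda>j x. g j x + h j x) + energy a (\<lambda>j x. g j x - h j x) = 2 * energy a g + 2 * energy a h"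
proof -
  have [measurable]: "a \<in> borel_measurable borel" by (rule a(1))
  have L: "(\<lambda>x. of_real (sqrt (a x)) * f x) \<in> cell_L2" if "f \<in> cell_L2" for f
    by (rule cell_L2_mult_bounded[OF that, where B="sqrt b"]) (auto simp: a)
  have "nrm2 (\<lambda>x. of_real (sqrt (a x)) * (g j x + h j x)) + nrm2 (\<lambda>x. of_real (sqrt (a x)) * (g j x - h j x))
      = 2 * nrm2 (\<lambda>x. of_real (sqrt (a x)) * g j x) + 2 * nrm2 (\<lambda>x. of_real (sqrt (a x)) * h j x)" for j
    unfolding distrib_left right_diff_distrib using nrm2_add[OF L[OF g[of j]] L[OF h[of j]]] nrm2_diff[OF L[OF g[of j]] L[OF h[of j]]]
    by simp
  then show ?thesis
    unfolding energy_sqrt[OF a(2)] by (simp add: sum_distrib_left flip: sum.distrib)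
qed

lemma energy_tendsto:
  assumes a: "a \<in> borel_measurable borel" "\<And>x. 0 \<le> a x" "\<And>x. a x \<le> b"
    and g: "\<And>n j. g n j \<in> cell_L2" and h: "\<And>j. h j \<in> cell_L2"
    and lim: "\<And>j. (\<lambda>n. nrm2 (\<lambda>x. g n j x - h j x)) \<longlonglongrightarrow> 0"
  shows "(\<lambda>n. energy a (g n)) \<longlonglongrightarrow> energy a h"
proof -
  have [measurable]: "a \<in> borel_measurable borel" by (rule a(1))
  have L: "(\<lambda>x. of_real (sqrt (a x)) * f x) \<in> cell_L2" if "f \<in> cell_L2" for f
    by (rule cell_L2_mult_bounded[OF that, where B="sqrt b"]) (auto simp: a)
  have "(\<lambda>n. nrm2 (\<lambda>x. of_real (sqrt (a x)) * g n j x)) \<longlonglongrightarrow> nrm2 (\<lambda>x. of_real (sqrt (a x)) * h j x)" for j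
  proof (rule nrm2_tendsto[OF L[OF g] L[OF h]])
    show "(\<lambda>n. nrm2 (\<lambda>x. of_real (sqrt (a x)) * g n j x - of_real (sqrt (a x)) * h j x)) \<longlonglongrightarrow> 0"
    proof (rule Lim_null_comparison)
      have "nrm2 (\<lambda>x. of_real (sqrt (a x)) * g n j x - of_real (sqrt (a x)) * h j x) \<le> b * nrm2 (\<lambda>x. g n j x - h j x)" for n
      proof -
        have d: "(\<lambda>x. g n j x - h j x) \<in> cell_L2" by (rule cell_L2_diff[OF g h])
        have "nrm2 (\<lambda>x. of_real (sqrt (a x)) * g n j x - of_real (sqrt (a x)) * h j x) = (\<integral>x. a x * (cmod (g n j x - h j x))\<^sup>2 \<partial>cell_measure)"
          unfolding nrm2_def right_diff_distrib[symmetric] using a(2) by (simp add: norm_mult power_mult_distrib)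
        also have "\<dots> \<le> (\<integral>x. b * (cmod (g n j x - h j x))\<^sup>2 \<partial>cell_measure)"
        proof (rule integral_mono)
          have "\<bar>a x\<bar> \<le> b" for x using a(2)[of x] a(3)[of x] by simp
          from weighted_integrable[OF a(1) this d]
          show "integrable cell_measure (\<lambda>x. a x * (cmod (g n j x - h j x))\<^sup>2)" .
          show "integrable cell_measure (\<lambda>x. b * (cmod (g n j x - h j x))\<^sup>2)"
            using cell_L2_integrable[OF d] by simp
          show "a x * (cmod (g n j x - h j x))\<^sup>2 \<le> b * (cmod (g n j x - h j x))\<^sup>2" for x
            by (intro mult_right_mono a) auto
        qed
        also have "\<dots> = b * nrm2 (\<lambda>x. g n j x - h j x)" by (simp add: nrm2_def)
        finally show ?thesis .
      qed
      then show "\<forall>\<^sub>F n in sequentially. norm (nrm2 (\<lambda>x. of_real (sqrt (a x)) * g n j x - of_real (sqrt (a x)) * h j x)) \<le> b * nrm2 (\<lambda>x. g n j x - h j x)"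
        by (simp add: always_eventually)
      show "(\<lambda>n. b * nrm2 (\<lambda>x. g n j x - h j x)) \<longlonglongrightarrow> 0"
        using tendsto_mult[OF tendsto_const[of b] lim[of j]] by simp
    qed
  qed
  then show ?thesis unfolding energy_sqrt[OF a(2)] by (intro tendsto_sum)
qed

text \<open>
  Convergence of a minimising sequence in the energy norm is automatic once it converges
  in \<open>L\<^sup>2\<close>: by the parallelogram law the energy of the differences is controlled by their \<open>L\<^sup>2\<close> norm.
\<close>

theorem Bloch_minimizer:
  assumes a: "a \<in> borel_measurable borel" and \<alpha>: "\<alpha> > 0" "\<And>x. \<alpha> \<le> a x" and b: "\<And>x. a x \<le> b"
  obtains f g where "fgrad \<eta> f g" "nrm2 f = 1" "energy a g = Bloch_eigenvalue1 a \<eta>"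
    "\<And>f' g'. fgrad \<eta> f' g' \<Longrightarrow> Bloch_eigenvalue1 a \<eta> * nrm2 f' \<le> energy a g'"
proof -
  have a0: "0 \<le> a x" for x using \<alpha>(1) \<alpha>(2)[of x] by linarith
  have ab: "\<bar>a x\<bar> \<le> b" for x using a0[of x] b[of x] by simp
  define S where "S = {m. \<exists>f g. fgrad \<eta> f g \<and> nrm2 f = 1 \<and> m = energy a g}"
  define l where "l = Inf S"
  have bdd: "bdd_below S" by (rule bdd_belowI[of _ 0]) (auto simp: S_def energy_nonneg[OF a0])
  have "fgrad \<eta> (ftrig \<eta> {0} (\<lambda>_. 1)) (\<lambda>j. ftrig \<eta> {0} (fgradc \<eta> (\<lambda>_. 1) j))"
    by (rule fgrad_ftrig) simp
  moreover have "nrm2 (ftrig \<eta> {0} (\<lambda>_. 1)) = 1" by (simp add: nrm2_ftrig)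
  ultimately have ne: "S \<noteq> {}" unfolding S_def by blast
  have l0: "l \<ge> 0" unfolding l_def using ne by (intro cInf_greatest) (auto simp: S_def energy_nonneg[OF a0])
  have lower: "l * nrm2 f' \<le> energy a g'" if fg: "fgrad \<eta> f' g'" for f' g'
  proof (cases "nrm2 f' = 0")
    case True
    then show ?thesis by (simp add: energy_nonneg[OF a0])
  next
    case False
    then have pos: "nrm2 f' > 0" using nrm2_nonneg[of f'] by linarith
    define c where "c = complex_of_real (1 / sqrt (nrm2 f'))"
    have c: "(cmod c)\<^sup>2 = 1 / nrm2 f'" using pos by (simp add: c_def norm_divide power_divide)
    have "nrm2 (\<lambda>x. c * f' x) = 1" using pos by (simp add: nrm2_scale c)
    then have "energy a (\<lambda>j x. c * g' j x) \<in> S" unfolding S_def using fgrad_scale[OF fg, of c] by blast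
    then have "l \<le> energy a (\<lambda>j x. c * g' j x)" unfolding l_def by (intro cInf_lower bdd)
    then show ?thesis using pos by (simp add: energy_scale c field_simps)
  qed
  have "\<exists>f g. fgrad \<eta> f g \<and> nrm2 f = 1 \<and> energy a g < l + 1 / real (Suc n)" for n
  proof -
    have "\<exists>m\<in>S. m < l + 1 / real (Suc n)"
      unfolding l_def by (rule cInf_lessD[OF ne]) simp
    then show ?thesis by (auto simp: S_def)
  qed
  then obtain f g where fg: "\<And>n. fgrad \<eta> (f n) (g n)" and f1: "\<And>n. nrm2 (f n) = 1"
    and e: "\<And>n. energy a (g n) < l + 1 / real (Suc n)"
    by metis
  have fL: "f n \<in> cell_L2" for n by (rule fgradD(1)[OF fg])
  have gL: "g n j \<in> cell_L2" for n j by (rule fgradD(2)[OF fg])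
  have coer: "\<alpha> * (\<Sum>j\<in>UNIV. nrm2 (h j)) \<le> energy a h" if "\<And>j. h j \<in> cell_L2" for h
    using energy_mono[of "\<lambda>_. \<alpha>" \<alpha> a b h] \<alpha> a ab that by (simp add: energy_const)
  have Eb: "(\<Sum>j\<in>UNIV. nrm2 (g n j)) \<le> (l + 1) / \<alpha>" for n
  proof -
    have "1 / real (Suc n) \<le> 1" by simp
    then have "energy a (g n) \<le> l + 1" using e[of n] by linarith
    then have "\<alpha> * (\<Sum>j\<in>UNIV. nrm2 (g n j)) \<le> l + 1" using coer[of "g n", OF gL] by linarith
    then show ?thesis using \<alpha>(1) by (simp add: field_simps)
  qed
  obtain s F where s: "strict_mono s" and F: "F \<in> cell_L2" and lim: "(\<lambda>n. nrm2 (\<lambda>x. f (s n) x - F x)) \<longlonglongrightarrow> 0"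
    by (rule Rellich_cell[OF fg eq_refl[OF f1] Eb])
  define D where "D n = nrm2 (\<lambda>x. f (s n) x - F x)" for n
  \<comment> \<open>Collects the errors of the parallelogram argument: energies exceed
    \<open>l\<close> by at most \<open>1 / Suc n\<close>, and the deviation \<open>D n\<close> from
    the limit enters with the factor \<open>l\<close>; division by the ellipticity constant
    \<open>\<alpha>\<close> passes from energies to norms.\<close>
  define d where "d n = 2 / (\<alpha> * real (Suc n)) + 2 * l / \<alpha> * D n" for n
  have d_lim: "d \<longlonglongrightarrow> 0"
  proof -
    have "(\<lambda>n. 2 / (\<alpha> * real (Suc n))) \<longlonglongrightarrow> 0" using \<alpha>(1) by real_asymp
    moreover have "(\<lambda>n. 2 * l / \<alpha> * D n) \<longlonglongrightarrow> 2 * l / \<alpha> * 0"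
      using lim unfolding D_def by (intro tendsto_mult tendsto_const)
    ultimately have "(\<lambda>n. 2 / (\<alpha> * real (Suc n)) + 2 * l / \<alpha> * D n) \<longlonglongrightarrow> 0 + 2 * l / \<alpha> * 0"
      by (rule tendsto_add)
    then show ?thesis by (simp add: d_def[abs_def])
  qed
  have diff: "nrm2 (\<lambda>x. g (s m) j x - g (s n) j x) \<le> d m + d n" for m n j
  proof -
    \<comment> \<open>Two unit functions that are close have a sum of squared norm close to 4, so
      the energy of the sum is nearly \<open>4 * l\<close> at least, which leaves little for the
      difference.\<close>
    have "nrm2 (\<lambda>x. f (s m) x + f (s n) x) = 4 - nrm2 (\<lambda>x. f (s m) x - f (s n) x)"
      using nrm2_add[OF fL[of "s m"] fL[of "s n"]] nrm2_diff[OF fL[of "s m"] fL[of "s n"]] by (simp add: f1)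
    moreover have "nrm2 (\<lambda>x. f (s m) x - f (s n) x) \<le> 2 * D m + 2 * D n"
    proof -
      have "nrm2 (\<lambda>x. (f (s m) x - F x) + (F x - f (s n) x)) \<le> 2 * nrm2 (\<lambda>x. f (s m) x - F x) + 2 * nrm2 (\<lambda>x. F x - f (s n) x)"
        by (intro nrm2_add_le cell_L2_diff fL F)
      then show ?thesis by (simp add: D_def nrm2_minus_commute[of F])
    qed
    ultimately have sum: "4 - 2 * D m - 2 * D n \<le> nrm2 (\<lambda>x. f (s m) x + f (s n) x)" by linarith
    have "l * (4 - 2 * D m - 2 * D n) \<le> l * nrm2 (\<lambda>x. f (s m) x + f (s n) x)"
      by (rule mult_left_mono[OF sum l0])
    also have "\<dots> \<le> energy a (\<lambda>j x. g (s m) j x + g (s n) j x)"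
      by (rule lower[OF fgrad_add[OF fg fg]])
    finally have "energy a (\<lambda>j x. g (s m) j x - g (s n) j x) \<le> 2 * energy a (g (s m)) + 2 * energy a (g (s n)) - l * (4 - 2 * D m - 2 * D n)"
      using energy_parallelogram[of a b "g (s m)" "g (s n)", OF a a0 b gL gL] by linarith
    moreover have "energy a (g (s k)) \<le> l + 1 / real (Suc k)" for k
    proof -
      have "1 / real (Suc (s k)) \<le> 1 / real (Suc k)"
        using seq_suble[OF s, of k] by (intro divide_left_mono) auto
      then show ?thesis using e[of "s k"] by linarith
    qed
    note this[of m] this[of n]
    ultimately have "energy a (\<lambda>j x. g (s m) j x - g (s n) j x) \<le> 2 / real (Suc m) + 2 / real (Suc n) + 2 * l * D m + 2 * l * D n"
      by (simp add: algebra_simps)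
    moreover have "\<alpha> * nrm2 (\<lambda>x. g (s m) j x - g (s n) j x) \<le> energy a (\<lambda>j x. g (s m) j x - g (s n) j x)"
    proof -
      have "nrm2 (\<lambda>x. g (s m) j x - g (s n) j x) \<le> (\<Sum>j\<in>UNIV. nrm2 (\<lambda>x. g (s m) j x - g (s n) j x))"
        by (rule member_le_sum) auto
      then have "\<alpha> * nrm2 (\<lambda>x. g (s m) j x - g (s n) j x) \<le> \<alpha> * (\<Sum>j\<in>UNIV. nrm2 (\<lambda>x. g (s m) j x - g (s n) j x))"
        using \<alpha>(1) by (intro mult_left_mono) auto
      also have "\<dots> \<le> energy a (\<lambda>j x. g (s m) j x - g (s n) j x)"
        by (rule coer) (intro cell_L2_diff gL)
      finally show ?thesis .
    qed
    ultimately have "\<alpha> * nrm2 (\<lambda>x. g (s m) j x - g (s n) j x) \<le> 2 / real (Suc m) + 2 / real (Suc n) + 2 * l * D m + 2 * l * D n"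
      by linarith
    also have "\<dots> = \<alpha> * (d m + d n)"
    proof -
      have "\<alpha> * (2 / (\<alpha> * S)) = 2 / S" "\<alpha> * (2 * l / \<alpha> * S) = 2 * l * S" for S
        using \<alpha>(1) by simp_all
      then have "\<alpha> * d k = 2 / real (Suc k) + 2 * l * D k" for k
        unfolding d_def distrib_left by (simp only:)
      then show ?thesis by (simp only: distrib_left)
    qed
    finally show ?thesis using \<alpha>(1) by simp
  qed
  have ex: "\<forall>j. \<exists>G. G \<in> cell_L2 \<and> (\<lambda>n. nrm2 (\<lambda>x. g (s n) j x - G x)) \<longlonglongrightarrow> 0"
  proof
    fix j
    have C: "\<exists>N. \<forall>m\<ge>N. \<forall>n\<ge>N. nrm2 (\<lambda>x. g (s m) j x - g (s n) j x) < e" if "e > 0" for e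
    proof -
      have "e / 2 > 0" using that by simp
      from order_tendstoD(2)[OF d_lim this] obtain N where N: "\<forall>n\<ge>N. d n < e / 2"
        unfolding eventually_sequentially by blast
      have "nrm2 (\<lambda>x. g (s m) j x - g (s n) j x) < e" if "m \<ge> N" "n \<ge> N" for m n
      proof -
        have "d m < e / 2" "d n < e / 2" using N that by auto
        then show ?thesis using diff[of m j n] by linarith
      qed
      then show ?thesis by blast
    qed
    obtain G where "G \<in> cell_L2" "(\<lambda>n. nrm2 (\<lambda>x. g (s n) j x - G x)) \<longlonglongrightarrow> 0"
      by (rule Riesz_Fischer_cell[of "\<lambda>n. g (s n) j", OF gL C])
    then show "\<exists>G. G \<in> cell_L2 \<and> (\<lambda>n. nrm2 (\<lambda>x. g (s n) j x - G x)) \<longlonglongrightarrow> 0"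
      by (intro exI[of _ G] conjI)
  qed
  from choice[OF ex] obtain G where GP: "\<forall>j. G j \<in> cell_L2 \<and> (\<lambda>n. nrm2 (\<lambda>x. g (s n) j x - G j x)) \<longlonglongrightarrow> 0"
    by (rule exE)
  note G = GP[rule_format, THEN conjunct1] and Glim = GP[rule_format, THEN conjunct2]
  have FG: "fgrad \<eta> F G" by (rule fgrad_limit[OF fg F G lim Glim])
  have "(\<lambda>n. nrm2 (f (s n))) \<longlonglongrightarrow> nrm2 F" by (rule nrm2_tendsto[OF fL F lim])
  then have F1: "nrm2 F = 1" by (simp add: f1 LIMSEQ_const_iff)
  have en: "(\<lambda>n. energy a (g (s n))) \<longlonglongrightarrow> energy a G"
    by (rule energy_tendsto[OF a a0 b gL G Glim])
  have "(\<lambda>n. l + 1 / real (Suc n)) \<longlonglongrightarrow> l" by real_asymp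
  then have "energy a G \<le> l"
  proof (rule LIMSEQ_le[OF en], intro exI[of _ 0] allI impI)
    fix n
    have "1 / real (Suc (s n)) \<le> 1 / real (Suc n)"
      using seq_suble[OF s, of n] by (intro divide_left_mono) auto
    then show "energy a (g (s n)) \<le> l + 1 / real (Suc n)" using e[of "s n"] by linarith
  qed
  then have Gl: "energy a G = l" using lower[OF FG] F1 by simp
  have "Bloch_eigenvalue1 a \<eta> = l"
    unfolding Bloch_eigenvalue1_fgrad[OF a ab]
  proof (rule Least_equality)
    show "\<exists>f g. fgrad \<eta> f g \<and> nrm2 f = 1 \<and> l = energy a g" using FG F1 Gl by blast
    show "l \<le> m" if "\<exists>f g. fgrad \<eta> f g \<and> nrm2 f = 1 \<and> m = energy a g" for m
      using that lower by fastforce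
  qed
  then show thesis using that[OF FG F1] Gl lower by simp
qed

text \<open>By Parseval the gradient puts the weight \<open>(norm (\<eta> + ivec k))^2\<close> on
  each coefficient.\<close>

lemma fgrad_lower_bound:
  assumes fg: "fgrad \<eta> f g" and min: "\<And>k. norm (\<eta> + ivec k0) \<le> norm (\<eta> + ivec k)"
  shows "(norm (\<eta> + ivec k0))\<^sup>2 * nrm2 f \<le> (\<Sum>j\<in>UNIV. nrm2 (g j))"
proof (rule LIMSEQ_le)
  show "(\<lambda>N. (norm (\<eta> + ivec k0))\<^sup>2 * (\<Sum>k\<in>ibox N. (cmod (fc \<eta> f k))\<^sup>2)) \<longlonglongrightarrow> (norm (\<eta> + ivec k0))\<^sup>2 * nrm2 f"
    by (intro tendsto_mult tendsto_const Parseval fgradD(1)[OF fg])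
  show "(\<lambda>N. \<Sum>j\<in>UNIV. \<Sum>k\<in>ibox N. (cmod (fc \<eta> (g j) k))\<^sup>2) \<longlonglongrightarrow> (\<Sum>j\<in>UNIV. nrm2 (g j))"
    by (intro tendsto_sum Parseval fgradD(2)[OF fg])
  show "\<exists>N. \<forall>n\<ge>N. (norm (\<eta> + ivec k0))\<^sup>2 * (\<Sum>k\<in>ibox n. (cmod (fc \<eta> f k))\<^sup>2) \<le> (\<Sum>j\<in>UNIV. \<Sum>k\<in>ibox n. (cmod (fc \<eta> (g j) k))\<^sup>2)"
  proof (intro exI[of _ 0] allI impI)
    fix n
    have "(\<Sum>j\<in>UNIV. \<Sum>k\<in>ibox n. (cmod (fc \<eta> (g j) k))\<^sup>2) = (\<Sum>k\<in>ibox n. (norm (\<eta> + ivec k))\<^sup>2 * (cmod (fc \<eta> f k))\<^sup>2)"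
      by (subst sum.swap) (simp add: fgrad_sum_eq[OF fg])
    moreover have "(norm (\<eta> + ivec k0))\<^sup>2 * (\<Sum>k\<in>ibox n. (cmod (fc \<eta> f k))\<^sup>2) \<le> (\<Sum>k\<in>ibox n. (norm (\<eta> + ivec k))\<^sup>2 * (cmod (fc \<eta> f k))\<^sup>2)"
      unfolding sum_distrib_left by (intro sum_mono mult_right_mono power_mono min) auto
    ultimately show "(norm (\<eta> + ivec k0))\<^sup>2 * (\<Sum>k\<in>ibox n. (cmod (fc \<eta> f k))\<^sup>2) \<le> (\<Sum>j\<in>UNIV. \<Sum>k\<in>ibox n. (cmod (fc \<eta> (g j) k))\<^sup>2)"
      by simp
  qed
qed

text \<open>Attained by the single plane wave with the shortest wave vector.\<close>

theorem Bloch_eigenvalue1_homogeneous: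
  assumes min: "\<And>k. norm (\<eta> + ivec k0) \<le> norm (\<eta> + ivec k)"
  shows "Bloch_eigenvalue1 (\<lambda>_. 1) \<eta> = (norm (\<eta> + ivec k0))\<^sup>2"
proof -
  have "Bloch_eigenvalue1 (\<lambda>_. 1) \<eta> = (LEAST m. \<exists>f g. fgrad \<eta> f g \<and> nrm2 f = 1 \<and> m = energy (\<lambda>_. 1) g)"
    by (rule Bloch_eigenvalue1_fgrad[where b=1]) auto
  also have "\<dots> = (norm (\<eta> + ivec k0))\<^sup>2"
  proof (rule Least_equality)
    let ?f = "ftrig \<eta> {k0} (\<lambda>_. 1)" and ?g = "\<lambda>j. ftrig \<eta> {k0} (fgradc \<eta> (\<lambda>_. 1) j)"
    have "energy (\<lambda>_. 1) ?g = (norm (\<eta> + ivec k0))\<^sup>2"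
      unfolding energy_const norm_real_vec_sq by (simp add: nrm2_ftrig fgradc_def norm_mult del: of_real_add)
    then show "\<exists>f g. fgrad \<eta> f g \<and> nrm2 f = 1 \<and> (norm (\<eta> + ivec k0))\<^sup>2 = energy (\<lambda>_. 1) g"
      using fgrad_ftrig[of "{k0}" \<eta> "\<lambda>_. 1"] by (intro exI[of _ ?f] exI[of _ ?g]) (simp add: nrm2_ftrig)
    show "(norm (\<eta> + ivec k0))\<^sup>2 \<le> m" if "\<exists>f g. fgrad \<eta> f g \<and> nrm2 f = 1 \<and> m = energy (\<lambda>_. 1) g" for m
      using that fgrad_lower_bound[OF _ min] unfolding energy_const by fastforce
  qed
  finally show ?thesis .
qed

lemma nearest_lattice_point:
  obtains k0 :: "int^3" where "\<And>k. norm (\<eta> + ivec k0) \<le> norm (\<eta> + ivec k)"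
proof -
  define k0 :: "int^3" where "k0 = (\<chi> j. - round (\<eta> $ j))"
  have "norm (\<eta> + ivec k0) \<le> norm (\<eta> + ivec k)" for k
  proof (rule norm_le_componentwise_cart)
    fix j
    show "norm ((\<eta> + ivec k0) $ j) \<le> norm ((\<eta> + ivec k) $ j)"
      using round_diff_minimal[of "\<eta> $ j" "- (k $ j)"] by (simp add: k0_def)
  qed
  then show thesis by (rule that)
qed

section \<open>The periodic corrector\<close>

text \<open>Integration by parts without boundary terms: both functions satisfy the same Bloch
  condition, and the Fourier multiplier of a derivative is purely imaginary, hence skew with respect
  to \<open>ip\<close>.\<close>

lemma ip_fgrad:
  assumes f: "fgrad \<eta> f g" and h: "fgrad \<eta> h G"
  shows "ip (g j) h = - ip f (G j)"
proof -
  have "(\<lambda>N. \<Sum>k\<in>ibox N. fc \<eta> (g j) k * cnj (fc \<eta> h k)) \<longlonglongrightarrow> ip (g j) h"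
    by (rule Parseval_ip[OF fgradD(2)[OF f] fgradD(1)[OF h]])
  moreover have "(\<lambda>N. - (\<Sum>k\<in>ibox N. fc \<eta> f k * cnj (fc \<eta> (G j) k))) \<longlonglongrightarrow> - ip f (G j)"
    by (rule tendsto_minus[OF Parseval_ip[OF fgradD(1)[OF f] fgradD(2)[OF h]]])
  moreover have "(\<Sum>k\<in>ibox N. fc \<eta> (g j) k * cnj (fc \<eta> h k)) = - (\<Sum>k\<in>ibox N. fc \<eta> f k * cnj (fc \<eta> (G j) k))" for N
    unfolding fgradD(3)[OF f] fgradD(3)[OF h] sum_negf[symmetric]
    by (intro sum.cong refl) (simp add: algebra_simps)
  ultimately show ?thesis by (simp add: LIMSEQ_unique)
qed

text \<open>The class of the corrector and of the components of its flux: periodic Lipschitz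
  functions together with prescribed bounded partial derivatives almost everywhere. It admits
  integration by parts and products with trigonometric polynomials.\<close>

definition per_lip :: "(real^3 \<Rightarrow> real) \<Rightarrow> (3 \<Rightarrow> real^3 \<Rightarrow> real) \<Rightarrow> bool" where
  "per_lip u du \<longleftrightarrow> (\<exists>B. \<forall>x. \<bar>u x\<bar> \<le> B) \<and> (\<exists>L\<ge>0. \<forall>x y. \<bar>u x - u y\<bar> \<le> L * norm (x - y)) \<and>
     (\<forall>i. du i \<in> borel_measurable borel) \<and> (\<exists>C. \<forall>i x. \<bar>du i x\<bar> \<le> C) \<and>
     (\<forall>x j. u (x + axis j (2 * pi)) = u x) \<and>
     (\<forall>i. AE x in lborel. ((\<lambda>t. u (x + t *\<^sub>R axis i 1)) has_real_derivative du i x) (at 0))"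

lemma ftrig_shift: "ftrig \<eta> A c (x + axis j (2 * pi)) = pexp \<eta> (axis j (2 * pi)) * ftrig \<eta> A c x"
  using Bloch_ext_shift[of \<eta> "ftrig \<eta> A c" x "axis j 1"] by (simp add: Bloch_ext_ftrig axis_eq_shift)

lemma Lipschitz_product:
  fixes u :: "real^3 \<Rightarrow> real" and f :: "real^3 \<Rightarrow> complex"
  assumes u: "\<And>x. \<bar>u x\<bar> \<le> B" "\<And>x y. \<bar>u x - u y\<bar> \<le> L * norm (x - y)"
    and f: "\<And>x. cmod (f x) \<le> C" "\<And>x y. cmod (f x - f y) \<le> M * norm (x - y)" and "L \<ge> 0" "M \<ge> 0"
  shows "cmod (of_real (u x) * f x - of_real (u y) * f y) \<le> (B * M + L * C) * norm (x - y)"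
proof -
  have B: "B \<ge> 0" using u(1)[of 0] by linarith
  have "of_real (u x) * f x - of_real (u y) * f y = of_real (u x) * (f x - f y) + of_real (u x - u y) * f y"
    by (simp add: algebra_simps)
  also have "cmod \<dots> \<le> \<bar>u x\<bar> * cmod (f x - f y) + \<bar>u x - u y\<bar> * cmod (f y)"
    by (rule order_trans[OF norm_triangle_ineq]) (simp add: norm_mult del: of_real_diff)
  also have "\<dots> \<le> B * (M * norm (x - y)) + (L * norm (x - y)) * C"
    using B assms by (intro add_mono mult_mono) auto
  finally show ?thesis by (simp add: algebra_simps)
qed

text \<open>The product is Lipschitz, so \<open>weak_gradient_Lipschitz\<close> gives its gradient,
  and the Bloch condition is inherited from the plane waves. Both the trial functions and the
  products of flux and Fourier sum have this shape.\<close>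

lemma per_lip_ftrig:
  assumes u: "per_lip u du"
  shows "fgrad \<eta> (\<lambda>x. of_real (u x) * ftrig \<eta> A c x)
    (\<lambda>i x. of_real (du i x) * ftrig \<eta> A c x + of_real (u x) * ftrig \<eta> A (fgradc \<eta> c i) x)"
proof -
  obtain B L C where B: "\<And>x. \<bar>u x\<bar> \<le> B" and L: "L \<ge> 0" "\<And>x y. \<bar>u x - u y\<bar> \<le> L * norm (x - y)"
    and C: "\<And>i x. \<bar>du i x\<bar> \<le> C"
    using u unfolding per_lip_def by metis
  have per: "u (x + axis j (2 * pi)) = u x" for x j using u by (auto simp: per_lip_def)
  have dv: "AE x in lborel. ((\<lambda>t. u (x + t *\<^sub>R axis i 1)) has_real_derivative du i x) (at 0)" for i
    using u by (auto simp: per_lip_def)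
  have [measurable]: "du i \<in> borel_measurable borel" for i using u by (auto simp: per_lip_def)
  have u_meas [measurable]: "u \<in> borel_measurable borel"
  proof -
    have "L-lipschitz_on UNIV u" using L by (intro lipschitz_onI) (auto simp: dist_norm)
    then show ?thesis by (intro borel_measurable_continuous_onI lipschitz_on_continuous_on)
  qed
  define Fb where "Fb c = (\<Sum>k\<in>A. cmod (c k * of_real (1 / sqrt ((2 * pi) ^ 3))))" for c :: "int^3 \<Rightarrow> complex"
  define Fl where "Fl = (\<Sum>k\<in>A. cmod (c k * of_real (1 / sqrt ((2 * pi) ^ 3))) * norm (\<eta> + ivec k))"
  have Fb: "cmod (ftrig \<eta> A c x) \<le> Fb c" for c x unfolding Fb_def by (rule ftrig_bounded)
  have Fl: "cmod (ftrig \<eta> A c x - ftrig \<eta> A c y) \<le> Fl * norm (x - y)" for x y unfolding Fl_def by (rule ftrig_Lipschitz)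
  have Fl0: "Fl \<ge> 0" unfolding Fl_def by (intro sum_nonneg) auto
  have Fb0: "Fb c \<ge> 0" for c unfolding Fb_def by (intro sum_nonneg) auto
  have B0: "B \<ge> 0" using B[of 0] by linarith
  have C0: "C \<ge> 0" using C[of undefined 0] by linarith
  let ?\<psi> = "\<lambda>x. of_real (u x) * ftrig \<eta> A c x"
  let ?g = "\<lambda>i x. of_real (du i x) * ftrig \<eta> A c x + of_real (u x) * ftrig \<eta> A (fgradc \<eta> c i) x"
  have bd: "cmod (?\<psi> x) \<le> B * Fb c" for x
    unfolding norm_mult norm_of_real using B[of x] Fb[of c x] B0 by (intro mult_mono) auto
  have lip: "cmod (?\<psi> x - ?\<psi> y) \<le> (B * Fl + L * Fb c) * norm (x - y)" for x y
    by (rule Lipschitz_product[OF B L(2) Fb Fl L(1) Fl0])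
  have wg: "has_weak_gradient ?\<psi> (\<lambda>x. \<chi> i. ?g i x)"
  proof (rule weak_gradient_Lipschitz[OF lip _ bd])
    show "B * Fl + L * Fb c \<ge> 0" using B0 Fl0 L(1) Fb0 by simp
    show "(\<lambda>x. \<chi> i. ?g i x) \<in> borel_measurable borel" by (intro vec_lambda_measurable) measurable
    show "norm (\<chi> i. ?g i x) \<le> (\<Sum>i\<in>UNIV. C * Fb c + B * Fb (fgradc \<eta> c i))" for x
    proof (rule order_trans[OF norm_vec_le_sum], unfold vec_lambda_beta, rule sum_mono)
      fix i :: 3
      have "cmod (?g i x) \<le> \<bar>du i x\<bar> * cmod (ftrig \<eta> A c x) + \<bar>u x\<bar> * cmod (ftrig \<eta> A (fgradc \<eta> c i) x)"
        by (rule order_trans[OF norm_triangle_ineq]) (simp add: norm_mult)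
      also have "\<dots> \<le> C * Fb c + B * Fb (fgradc \<eta> c i)"
        using B C Fb B0 C0 by (intro add_mono mult_mono) auto
      finally show "cmod (?g i x) \<le> C * Fb c + B * Fb (fgradc \<eta> c i)" .
    qed
    show "AE x in lborel. ((\<lambda>t. ?\<psi> (x + t *\<^sub>R axis j 1)) has_vector_derivative (\<chi> i. ?g i x) $ j) (at 0)" for j
      using dv[of j]
    proof eventually_elim
      case (elim x)
      have "((\<lambda>t. of_real (u (x + t *\<^sub>R axis j 1)) :: complex) has_vector_derivative of_real (du j x)) (at 0)"
        using elim by (intro has_vector_derivative_of_real) (simp add: has_real_derivative_iff_has_vector_derivative)
      from has_vector_derivative_mult[OF this ftrig_has_vector_derivative[of \<eta> A c x j]]
      show ?case by (simp add: add.commute)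
    qed
  qed
  have "pexp (- \<eta>) (x + axis j (2 * pi)) * ?\<psi> (x + axis j (2 * pi)) = pexp (- \<eta>) x * ?\<psi> x" for x j
  proof -
    have "pexp (- \<eta>) (x + axis j (2 * pi)) * ?\<psi> (x + axis j (2 * pi)) =
       (pexp \<eta> (axis j (2 * pi)) * pexp (- \<eta>) (axis j (2 * pi))) * (pexp (- \<eta>) x * ?\<psi> x)"
      unfolding per ftrig_shift pexp_add_right by (simp only: mult_ac)
    then show ?thesis by (simp add: pexp_minus_mult)
  qed
  then have "?\<psi> \<in> H1_Bloch \<eta>"
    by (intro H1_Bloch_intro[OF wg]) (simp add: periodic_AE_def)
  from fgrad_weak_gradient[OF this wg] show ?thesis by simp
qed

lemma per_lip_fgrad_0:
  assumes u: "per_lip u du"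
  shows "fgrad 0 (\<lambda>x. of_real (u x)) (\<lambda>i x. of_real (du i x))"
proof -
  have i0: "ivec 0 = 0" by (simp add: vec_eq_iff)
  \<comment> \<open>The constant 1 as a trigonometric polynomial with one frequency; the coefficient
    undoes the normalisation of \<open>ek\<close>.\<close>
  have 1: "ftrig 0 {0} (\<lambda>_. of_real (sqrt ((2 * pi) ^ 3))) x = 1" for x
    by (simp add: ftrig_pexp i0 flip: of_real_mult)
  have 2: "ftrig 0 {0} (fgradc 0 (\<lambda>_. of_real (sqrt ((2 * pi) ^ 3))) i) x = 0" for i x
    by (simp add: ftrig_def fgradc_def i0)
  show ?thesis
    using per_lip_ftrig[OF u, of 0 "{0}" "\<lambda>_. of_real (sqrt ((2 * pi) ^ 3))"] unfolding 1 2 by simp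
qed

lemma per_lip_const: "per_lip (\<lambda>_. c) (\<lambda>_ _. 0)"
  unfolding per_lip_def
proof (intro conjI)
  show "\<exists>B. \<forall>x :: real^3. \<bar>c\<bar> \<le> B" by blast
  show "\<exists>L\<ge>0. \<forall>x y :: real^3. \<bar>c - c\<bar> \<le> L * norm (x - y)" by (intro exI[of _ 0]) simp
  show "\<exists>C. \<forall>(i :: 3) (x :: real^3). \<bar>0 :: real\<bar> \<le> C" by (intro exI[of _ 0]) simp
qed auto

lemma per_lip_ibp:
  assumes u: "per_lip u du" and v: "per_lip v dv"
  shows "(\<integral>x. du i x * v x \<partial>cell_measure) = - (\<integral>x. u x * dv i x \<partial>cell_measure)"
proof -
  have "ip (\<lambda>x. of_real (du i x)) (\<lambda>x. of_real (v x)) = - ip (\<lambda>x. of_real (u x)) (\<lambda>x. of_real (dv i x))"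
    by (rule ip_fgrad[OF per_lip_fgrad_0[OF u] per_lip_fgrad_0[OF v]])
  then have "complex_of_real (\<integral>x. du i x * v x \<partial>cell_measure) = of_real (- (\<integral>x. u x * dv i x \<partial>cell_measure))"
    unfolding ip_def by (simp flip: of_real_mult)
  then show ?thesis using of_real_eq_iff by blast
qed

text \<open>Invariance of the microscopic structure: period \<open>2 * pi / N\<close> across the
  fibers and all translations along them, besides the macroscopic period.\<close>

definition cell_inv :: "nat \<Rightarrow> (real^3 \<Rightarrow> 'b) \<Rightarrow> bool" where
  "cell_inv N u \<longleftrightarrow> (\<forall>x j. u (x + axis j (2 * pi)) = u x) \<and> (\<forall>x. u (x + axis 1 (2 * pi / real N)) = u x) \<and>
     (\<forall>x. u (x + axis 2 (2 * pi / real N)) = u x) \<and> (\<forall>x s. u (x + axis 3 s) = u x)"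

lemma cell_invI:
  assumes N: "N \<ge> 1"
    and u: "\<And>x. u x = f (cos (real N * x $ 1)) (sin (real N * x $ 1)) (cos (real N * x $ 2)) (sin (real N * x $ 2))"
  shows "cell_inv N u"
proof -
  have N0: "real N \<noteq> 0" using N by simp
  have a: "cos (real N * (y + 2 * pi)) = cos (real N * y)" "sin (real N * (y + 2 * pi)) = sin (real N * y)" for y
  proof -
    have "real N * (y + 2 * pi) = real N * y + 2 * of_int (int N) * pi" by (simp add: algebra_simps)
    then show "cos (real N * (y + 2 * pi)) = cos (real N * y)" "sin (real N * (y + 2 * pi)) = sin (real N * y)"
      using cos_int_2pin[of "int N"] sin_int_2pin[of "int N"] by (simp_all add: cos_add sin_add mult_ac)
  qed
  have b: "cos (real N * (y + 2 * pi / real N)) = cos (real N * y)" "sin (real N * (y + 2 * pi / real N)) = sin (real N * y)" for y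
    using N0 by (simp_all add: distrib_left)
  have "u (x + axis j (2 * pi)) = u x" for x j
    using exhaust_3[of j] by (elim disjE) (simp_all add: u axis_def a)
  then show ?thesis
    unfolding cell_inv_def by (simp add: u axis_def b)
qed

lemma cell_inv_periodic: "cell_inv N u \<Longrightarrow> u (x + axis j (2 * pi)) = u x"
  by (simp add: cell_inv_def)

text \<open>A nonzero component of the frequency is detected by a translation that leaves
  \<open>u\<close> invariant: half a wavelength along the fibers, or one microscopic period across
  them, whose phase is 1 only if the component is a multiple of \<open>N\<close>. Low frequencies
  are thus killed exactly and not only asymptotically.\<close>

lemma cell_inv_oscillation:
  assumes inv: "cell_inv N u" and u: "u \<in> borel_measurable borel" "\<And>x. cmod (u x) \<le> B"
    and m: "m \<noteq> 0" "\<And>i. \<bar>m $ i\<bar> < int N" 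
  shows "(\<integral>x. u x * pexp (ivec m) x \<partial>cell_measure) = 0"
proof -
  obtain j where j: "m $ j \<noteq> 0" using m(1) by (auto simp: vec_eq_iff)
  show ?thesis
  proof (cases "j = 3")
    case True
    have "pexp (ivec m) (axis 3 (pi / of_int (m $ 3))) = exp (\<i> * of_real pi)"
      using j True by (simp add: pexp_def inner_axis')
    then have "pexp (ivec m) (axis 3 (pi / of_int (m $ 3))) \<noteq> 1" by (simp add: exp_pi_i')
    then show ?thesis
      by (rule oscillation[OF u cell_inv_periodic[OF inv], rotated]) (use inv in \<open>auto simp: cell_inv_def\<close>)
  next
    case False
    have N: "real N > 0" using m(2)[of j] by linarith
    have "pexp (ivec m) (axis j (2 * pi / real N)) = cis (2 * pi * of_int (m $ j) / real N)"
      by (simp add: pexp_def inner_axis' cis_conv_exp)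
    also have "\<dots> \<noteq> 1"
    proof
      assume "cis (2 * pi * of_int (m $ j) / real N) = 1"
      then have "cos (2 * pi * of_int (m $ j) / real N) = 1" by (metis cis.simps(1) one_complex.simps(1))
      then obtain q :: int where "2 * pi * of_int (m $ j) / real N = of_int q * 2 * pi"
        unfolding cos_one_2pi_int by blast
      then have "of_int (m $ j) = of_int q * real N" using N by (simp add: field_simps)
      then have e: "m $ j = q * int N" by (metis of_int_eq_iff of_int_mult of_int_of_nat_eq)
      then have "\<bar>q\<bar> * int N < 1 * int N" using m(2)[of j] by (simp add: abs_mult)
      then have "\<bar>q\<bar> < 1" using N by (simp only: mult_less_cancel_right)
      then show False using e j by simp
    qed
    finally have ne: "pexp (ivec m) (axis j (2 * pi / real N)) \<noteq> 1" .
    have "u (x + axis j (2 * pi / real N)) = u x" for x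
      using inv False exhaust_3[of j] by (auto simp: cell_inv_def)
    from oscillation[OF u cell_inv_periodic[OF inv] this ne] show ?thesis .
  qed
qed

section \<open>The explicit corrector and its flux\<close>

definition sig :: "nat \<Rightarrow> real^3 \<Rightarrow> real" where
  "sig N x = 4 + 2 * cos (real N * x $ 1) + 2 * cos (real N * x $ 2)"

definition dsig :: "nat \<Rightarrow> 3 \<Rightarrow> real^3 \<Rightarrow> real" where
  "dsig N j x = (if j = 3 then 0 else - (2 * real N * sin (real N * x $ j)))"

definition ddsig :: "nat \<Rightarrow> 3 \<Rightarrow> real^3 \<Rightarrow> real" where
  "ddsig N j x = (if j = 3 then 0 else - (2 * (real N)\<^sup>2 * cos (real N * x $ j)))"

lemma nth_measurable [measurable]: "(\<lambda>x :: real^3. x $ i) \<in> borel_measurable borel"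
  by (intro borel_measurable_continuous_onI continuous_intros)

lemma sig_measurable [measurable]: "sig N \<in> borel_measurable borel"
  unfolding sig_def[abs_def] by measurable

lemma dsig_measurable [measurable]: "dsig N j \<in> borel_measurable borel"
  unfolding dsig_def[abs_def] by measurable

lemma ddsig_measurable [measurable]: "ddsig N j \<in> borel_measurable borel"
  unfolding ddsig_def[abs_def] by measurable

lemma sig_bounds: "0 \<le> sig N x" "sig N x \<le> 8"
  using cos_ge_minus_one[of "real N * x $ 1"] cos_ge_minus_one[of "real N * x $ 2"]
    cos_le_one[of "real N * x $ 1"] cos_le_one[of "real N * x $ 2"]
  unfolding sig_def by linarith+

lemma dsig_bound: "\<bar>dsig N j x\<bar> \<le> 2 * real N"
  unfolding dsig_def by (auto simp: abs_mult intro: mult_left_le)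

lemma ddsig_bound: "\<bar>ddsig N j x\<bar> \<le> 2 * (real N)\<^sup>2"
  unfolding ddsig_def by (auto simp: abs_mult intro: mult_left_le)

text \<open>From \<open>4 sin^2 = (2 + 2 cos) (2 - 2 cos)\<close>. The identity is kept exact,
  because the divergence of the flux relies on the cancellation of its terms.\<close>

lemma sum_dsig_sq:
  "(\<Sum>j\<in>UNIV. (dsig N j x)\<^sup>2) = (real N)\<^sup>2 * (4 * sig N x - (2 + 2 * cos (real N * x $ 1))\<^sup>2 - (2 + 2 * cos (real N * x $ 2))\<^sup>2)"
  unfolding sum_3 dsig_def sig_def
  by (simp add: power_mult_distrib sin_squared_eq) (simp add: power2_eq_square algebra_simps)

lemma sum_dsig_sq_le: "(\<Sum>j\<in>UNIV. (dsig N j x)\<^sup>2) \<le> 4 * (real N)\<^sup>2 * sig N x"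
proof -
  have "(real N)\<^sup>2 * (4 * sig N x - (2 + 2 * cos (real N * x $ 1))\<^sup>2 - (2 + 2 * cos (real N * x $ 2))\<^sup>2) \<le> (real N)\<^sup>2 * (4 * sig N x)"
    by (intro mult_left_mono) auto
  then show ?thesis unfolding sum_dsig_sq by (simp add: mult_ac)
qed

lemma sum_ddsig: "(\<Sum>j\<in>UNIV. ddsig N j x) = (real N)\<^sup>2 * (4 - sig N x)"
  unfolding sum_3 ddsig_def sig_def by (simp add: algebra_simps)

lemma sig_derivative:
  "((\<lambda>t. sig N (x + t *\<^sub>R axis i 1)) has_real_derivative dsig N i x) (at 0)"
  using exhaust_3[of i]
  by (elim disjE) (auto simp: sig_def dsig_def axis_def intro!: derivative_eq_intros)

lemma dsig_derivative:
  "((\<lambda>t. dsig N j (x + t *\<^sub>R axis i 1)) has_real_derivative (if i = j then ddsig N j x else 0)) (at 0)"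
  using exhaust_3[of i] exhaust_3[of j]
  by (elim disjE) (auto simp: ddsig_def dsig_def axis_def power2_eq_square intro!: derivative_eq_intros)

lemma abs_cos_diff_le: "\<bar>cos a - cos b\<bar> \<le> \<bar>a - b\<bar>" for a b :: real
proof -
  have "cos a - cos b = 2 * sin ((a + b) / 2) * sin ((b - a) / 2)" by (rule cos_diff_cos)
  then have "\<bar>cos a - cos b\<bar> = 2 * (\<bar>sin ((a + b) / 2)\<bar> * \<bar>sin ((b - a) / 2)\<bar>)" by (simp add: abs_mult)
  also have "\<dots> \<le> 2 * (1 * \<bar>(b - a) / 2\<bar>)"
    by (intro mult_left_mono mult_mono abs_sin_x_le_abs_x abs_sin_le_one) auto
  finally show ?thesis by simp
qed

lemma abs_sin_diff_le: "\<bar>sin a - sin b\<bar> \<le> \<bar>a - b\<bar>" for a b :: real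
  using abs_cos_diff_le[of "pi / 2 - a" "pi / 2 - b"] by (simp add: cos_diff)

lemma sig_Lipschitz: "\<bar>sig N x - sig N y\<bar> \<le> 4 * real N * norm (x - y)"
proof -
  have "\<bar>cos (real N * x $ i) - cos (real N * y $ i)\<bar> \<le> real N * norm (x - y)" for i
  proof -
    have "\<bar>cos (real N * x $ i) - cos (real N * y $ i)\<bar> \<le> real N * \<bar>(x - y) $ i\<bar>"
      using abs_cos_diff_le[of "real N * x $ i" "real N * y $ i"] by (simp add: abs_mult flip: right_diff_distrib)
    also have "\<dots> \<le> real N * norm (x - y)" by (intro mult_left_mono component_le_norm_cart) auto
    finally show ?thesis .
  qed
  from this[of 1] this[of 2] show ?thesis unfolding sig_def by (simp add: abs_if split: if_splits)
qed

lemma dsig_Lipschitz: "\<bar>dsig N j x - dsig N j y\<bar> \<le> 2 * (real N)\<^sup>2 * norm (x - y)"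
proof -
  have "\<bar>sin (real N * x $ j) - sin (real N * y $ j)\<bar> \<le> real N * \<bar>(x - y) $ j\<bar>"
    using abs_sin_diff_le[of "real N * x $ j" "real N * y $ j"] by (simp add: abs_mult flip: right_diff_distrib)
  also have "\<dots> \<le> real N * norm (x - y)" by (intro mult_left_mono component_le_norm_cart) auto
  finally have *: "2 * real N * \<bar>sin (real N * x $ j) - sin (real N * y $ j)\<bar> \<le> 2 * real N * (real N * norm (x - y))"
    by (intro mult_left_mono) auto
  have "\<bar>dsig N j x - dsig N j y\<bar> \<le> 2 * real N * \<bar>sin (real N * x $ j) - sin (real N * y $ j)\<bar>"
  proof (cases "j = 3")
    case False
    have "dsig N j x - dsig N j y = (- (2 * real N)) * (sin (real N * x $ j) - sin (real N * y $ j))"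
      using False by (simp add: dsig_def algebra_simps)
    then show ?thesis by (simp add: abs_mult)
  qed (simp add: dsig_def)
  then show ?thesis using * by (simp add: power2_eq_square mult_ac)
qed

lemma cell_inv_sig: "N \<ge> 1 \<Longrightarrow> cell_inv N (sig N)"
  by (rule cell_invI[of _ _ "\<lambda>c1 s1 c2 s2. 4 + 2 * c1 + 2 * c2"]) (simp_all add: sig_def)

definition msig :: "nat \<Rightarrow> real \<Rightarrow> real^3 \<Rightarrow> real" where
  "msig N \<rho> x = max (sig N x) (\<rho>\<^sup>2)"

text \<open>There is no truncation at 1: the excess is at most
  \<open>ln 8 / (2 * - ln \<rho>)\<close> and vanishes in the limit, so that a single truncation
  level has to be handled.\<close>

definition corr :: "nat \<Rightarrow> real \<Rightarrow> real^3 \<Rightarrow> real" where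
  "corr N \<rho> x = ln (msig N \<rho> x / \<rho>\<^sup>2) / (2 * - ln \<rho>)"

text \<open>Outside the tubes this is the gradient of \<open>corr\<close>. Inside, the denominator
  is frozen at \<open>\<rho>^2\<close>, so that the jump of that gradient across the tube turns into
  a bounded divergence instead of a surface measure.\<close>

definition flux :: "nat \<Rightarrow> real \<Rightarrow> 3 \<Rightarrow> real^3 \<Rightarrow> real" where
  "flux N \<rho> j x = dsig N j x * (1 / (2 * - ln \<rho> * msig N \<rho> x))"

definition dcorr :: "nat \<Rightarrow> real \<Rightarrow> 3 \<Rightarrow> real^3 \<Rightarrow> real" where
  "dcorr N \<rho> i x = (if sig N x > \<rho>\<^sup>2 then flux N \<rho> i x else 0)"

definition dflux :: "nat \<Rightarrow> real \<Rightarrow> 3 \<Rightarrow> 3 \<Rightarrow> real^3 \<Rightarrow> real" where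
  "dflux N \<rho> j i x = (if i = j then ddsig N j x else 0) * (1 / (2 * - ln \<rho> * msig N \<rho> x)) -
     (if sig N x > \<rho>\<^sup>2 then dsig N j x * dsig N i x / (2 * - ln \<rho> * (sig N x)\<^sup>2) else 0)"

text \<open>Minus the Laplacian of \<open>corr\<close> outside the tubes, namely
  \<open>N^2 a b / (- ln \<rho> * sig^2)\<close> with \<open>a + b = sig\<close>.\<close>

definition spread :: "nat \<Rightarrow> real \<Rightarrow> real^3 \<Rightarrow> real" where
  "spread N \<rho> x = (if sig N x > \<rho>\<^sup>2 then (real N)\<^sup>2 * (2 + 2 * cos (real N * x $ 1)) * (2 + 2 * cos (real N * x $ 2))
     / (- ln \<rho> * (sig N x)\<^sup>2) else 0)"

text \<open>The Laplacian of \<open>sig\<close> divided by \<open>2 * - ln \<rho> * \<rho>^2\<close>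
  inside the tubes: the smeared-out source of the flux.\<close>

definition core :: "nat \<Rightarrow> real \<Rightarrow> real^3 \<Rightarrow> real" where
  "core N \<rho> x = (if sig N x > \<rho>\<^sup>2 then 0 else (real N)\<^sup>2 * (4 - sig N x) / (2 * - ln \<rho> * \<rho>\<^sup>2))"

context
  fixes N :: nat and \<rho> :: real
  assumes N: "N \<ge> 1" and \<rho>: "0 < \<rho>" "\<rho> < 1" and level: "AE x in lborel. sig N x \<noteq> \<rho>\<^sup>2"
begin

lemma minus_ln_pos: "- ln \<rho> > 0" using \<rho> by simp

lemma msig_ge: "msig N \<rho> x \<ge> \<rho>\<^sup>2" "msig N \<rho> x > 0" "msig N \<rho> x \<le> 8"
proof -
  show a: "msig N \<rho> x \<ge> \<rho>\<^sup>2" by (simp add: msig_def)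
  have "\<rho>\<^sup>2 > 0" using \<rho> by simp
  then show "msig N \<rho> x > 0" using a by linarith
  have "\<rho>\<^sup>2 \<le> 1" using \<rho> by (simp add: power_le_one)
  then show "msig N \<rho> x \<le> 8" using sig_bounds(2)[of N x] by (simp add: msig_def)
qed

lemma msig_Lipschitz: "\<bar>msig N \<rho> x - msig N \<rho> y\<bar> \<le> 4 * real N * norm (x - y)"
proof -
  have "\<bar>msig N \<rho> x - msig N \<rho> y\<bar> \<le> \<bar>sig N x - sig N y\<bar>" by (auto simp: msig_def max_def)
  then show ?thesis using sig_Lipschitz[of N x y] by linarith
qed

lemma msig_measurable [measurable]: "msig N \<rho> \<in> borel_measurable borel"
  unfolding msig_def[abs_def] by measurable

text \<open>Off the critical level one branch of the maximum is active in a whole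
  neighbourhood.\<close>

lemma msig_derivative:
  assumes "sig N x \<noteq> \<rho>\<^sup>2"
  shows "((\<lambda>t. msig N \<rho> (x + t *\<^sub>R axis i 1)) has_real_derivative (if sig N x > \<rho>\<^sup>2 then dsig N i x else 0)) (at 0)"
proof -
  have cont: "continuous_on UNIV (\<lambda>t :: real. sig N (x + t *\<^sub>R axis i 1))"
    unfolding sig_def by (intro continuous_intros)
  show ?thesis
  proof (cases "sig N x > \<rho>\<^sup>2")
    case True
    have "((\<lambda>t. msig N \<rho> (x + t *\<^sub>R axis i 1)) has_real_derivative dsig N i x) (at 0)"
    proof (rule has_field_derivative_transform_within_open[OF sig_derivative])
      show "open {t. \<rho>\<^sup>2 < sig N (x + t *\<^sub>R axis i 1)}"
        by (intro open_Collect_less continuous_intros cont)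
    qed (use True in \<open>auto simp: msig_def max_def\<close>)
    then show ?thesis using True by simp
  next
    case False
    have "((\<lambda>t. msig N \<rho> (x + t *\<^sub>R axis i 1)) has_real_derivative 0) (at 0)"
    proof (rule has_field_derivative_transform_within_open[OF DERIV_const[of "\<rho>\<^sup>2"]])
      show "open {t. sig N (x + t *\<^sub>R axis i 1) < \<rho>\<^sup>2}"
        by (intro open_Collect_less continuous_intros cont)
    qed (use False assms in \<open>auto simp: msig_def max_def\<close>)
    then show ?thesis using False by simp
  qed
qed

lemma inv_msig_Lipschitz:
  "\<bar>1 / (2 * - ln \<rho> * msig N \<rho> x) - 1 / (2 * - ln \<rho> * msig N \<rho> y)\<bar> \<le> (1 / (2 * - ln \<rho>)) * (4 * real N / \<rho> ^ 4) * norm (x - y)"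
proof -
  let ?m = "msig N \<rho> x" and ?m' = "msig N \<rho> y"
  have "\<bar>1 / ?m - 1 / ?m'\<bar> = \<bar>?m - ?m'\<bar> / (?m * ?m')"
    using msig_ge(2)[of x] msig_ge(2)[of y] by (simp add: field_simps abs_divide abs_mult abs_minus_commute)
  also have "\<dots> \<le> (4 * real N * norm (x - y)) / (\<rho>\<^sup>2 * \<rho>\<^sup>2)"
    using msig_Lipschitz[of x y] msig_ge(1)[of x] msig_ge(1)[of y] \<rho> by (intro frac_le mult_mono) (auto simp: msig_ge(2) less_imp_le)
  finally have "\<bar>1 / ?m - 1 / ?m'\<bar> \<le> 4 * real N / \<rho> ^ 4 * norm (x - y)" by (simp add: power4_eq_xxxx power2_eq_square mult_ac)
  then have "(1 / (2 * - ln \<rho>)) * \<bar>1 / ?m - 1 / ?m'\<bar> \<le> (1 / (2 * - ln \<rho>)) * (4 * real N / \<rho> ^ 4 * norm (x - y))"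
    using minus_ln_pos by (intro mult_left_mono) auto
  moreover have "1 / (2 * - ln \<rho> * ?m) - 1 / (2 * - ln \<rho> * ?m') = (1 / (2 * - ln \<rho>)) * (1 / ?m - 1 / ?m')"
    by (simp add: right_diff_distrib)
  ultimately show ?thesis using minus_ln_pos by (simp only: abs_mult) simp
qed

lemma inv_msig_bound: "0 \<le> 1 / (2 * - ln \<rho> * msig N \<rho> x)" "1 / (2 * - ln \<rho> * msig N \<rho> x) \<le> 1 / (2 * - ln \<rho> * \<rho>\<^sup>2)"
proof -
  have p: "0 < 2 * - ln \<rho>" using minus_ln_pos by simp
  show "0 \<le> 1 / (2 * - ln \<rho> * msig N \<rho> x)"
    using p msig_ge(2)[of x] by (intro divide_nonneg_nonneg mult_nonneg_nonneg) auto
  show "1 / (2 * - ln \<rho> * msig N \<rho> x) \<le> 1 / (2 * - ln \<rho> * \<rho>\<^sup>2)"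
    using p msig_ge(1)[of x] \<rho> by (intro divide_left_mono mult_left_mono mult_pos_pos) (auto simp: msig_ge(2))
qed

lemma corr_bounds: "0 \<le> corr N \<rho> x" "corr N \<rho> x \<le> 1 + ln 8 / (2 * - ln \<rho>)"
proof -
  have "1 \<le> msig N \<rho> x / \<rho>\<^sup>2" using msig_ge(1)[of x] \<rho> by simp
  then show "0 \<le> corr N \<rho> x"
    unfolding corr_def using minus_ln_pos by (intro divide_nonneg_nonneg ln_ge_zero) auto
  have "ln (msig N \<rho> x / \<rho>\<^sup>2) \<le> ln (8 / \<rho>\<^sup>2)"
    using msig_ge[of x] \<rho> by (intro ln_mono divide_right_mono) auto
  also have "ln (8 / \<rho>\<^sup>2) = ln 8 + 2 * - ln \<rho>" using \<rho> by (simp add: ln_div ln_realpow)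
  finally have "corr N \<rho> x \<le> (ln 8 + 2 * - ln \<rho>) / (2 * - ln \<rho>)"
    unfolding corr_def using minus_ln_pos by (intro divide_right_mono) auto
  also have "\<dots> = 1 + ln 8 / (2 * - ln \<rho>)" using minus_ln_pos by (simp add: field_simps)
  finally show "corr N \<rho> x \<le> 1 + ln 8 / (2 * - ln \<rho>)" .
qed

lemma corr_eq_0: "\<not> sig N x > \<rho>\<^sup>2 \<Longrightarrow> corr N \<rho> x = 0"
  using \<rho> by (simp add: corr_def msig_def max_def)

lemma ln_Lipschitz: "c > 0 \<Longrightarrow> a \<ge> c \<Longrightarrow> b \<ge> c \<Longrightarrow> \<bar>ln a - ln b\<bar> \<le> \<bar>a - b\<bar> / c" for a b c :: real
proof -
  have *: "ln a - ln b \<le> (a - b) / c" if "c > 0" "b \<ge> c" "a \<ge> b" for a b c :: real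
  proof -
    have "ln a - ln b \<le> (a - b) / b" using that by (intro ln_diff_le) auto
    also have "\<dots> \<le> (a - b) / c" using that by (intro divide_left_mono) auto
    finally show ?thesis .
  qed
  assume "c > 0" "a \<ge> c" "b \<ge> c"
  then show ?thesis using *[of c b a] *[of c a b] ln_mono[of a b] ln_mono[of b a] by (cases "a \<ge> b") auto
qed

lemma cell_inv_flux: "cell_inv N (flux N \<rho> j)"
  by (rule cell_invI[OF N, of _ "\<lambda>c1 s1 c2 s2. (if j = 3 then 0 else - (2 * real N * (if j = 1 then s1 else s2))) * (1 / (2 * - ln \<rho> * max (4 + 2 * c1 + 2 * c2) (\<rho>\<^sup>2)))"])
    (use exhaust_3[of j] in \<open>auto simp: flux_def msig_def dsig_def sig_def\<close>)

lemma cell_inv_corr: "cell_inv N (corr N \<rho>)"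
  by (rule cell_invI[OF N, of _ "\<lambda>c1 s1 c2 s2. ln (max (4 + 2 * c1 + 2 * c2) (\<rho>\<^sup>2) / \<rho>\<^sup>2) / (2 * - ln \<rho>)"])
    (simp add: corr_def msig_def sig_def)

lemma cell_inv_spread: "cell_inv N (spread N \<rho>)"
  by (rule cell_invI[OF N, of _ "\<lambda>c1 s1 c2 s2. if 4 + 2 * c1 + 2 * c2 > \<rho>\<^sup>2 then (real N)\<^sup>2 * (2 + 2 * c1) * (2 + 2 * c2)
     / (- ln \<rho> * (4 + 2 * c1 + 2 * c2)\<^sup>2) else 0"])
    (simp add: spread_def sig_def)

lemma flux_measurable [measurable]: "flux N \<rho> j \<in> borel_measurable borel"
  unfolding flux_def[abs_def] by measurable

lemma corr_measurable [measurable]: "corr N \<rho> \<in> borel_measurable borel"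
  unfolding corr_def[abs_def] by measurable

lemma dcorr_measurable [measurable]: "dcorr N \<rho> i \<in> borel_measurable borel"
  unfolding dcorr_def[abs_def] by measurable

lemma dflux_measurable [measurable]: "dflux N \<rho> j i \<in> borel_measurable borel"
  unfolding dflux_def[abs_def] by measurable

lemma spread_measurable [measurable]: "spread N \<rho> \<in> borel_measurable borel"
  unfolding spread_def[abs_def] by measurable

lemma core_measurable [measurable]: "core N \<rho> \<in> borel_measurable borel"
  unfolding core_def[abs_def] by measurable

lemma flux_bound: "\<bar>flux N \<rho> j x\<bar> \<le> 2 * real N * (1 / (2 * - ln \<rho> * \<rho>\<^sup>2))"
  unfolding flux_def abs_mult using dsig_bound[of N j x] inv_msig_bound[of x]
  by (intro mult_mono) auto

lemma per_lip_corr: "per_lip (corr N \<rho>) (dcorr N \<rho>)"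
  unfolding per_lip_def
proof (intro conjI allI)
  show "\<exists>B. \<forall>x. \<bar>corr N \<rho> x\<bar> \<le> B"
    using corr_bounds by (intro exI[of _ "1 + ln 8 / (2 * - ln \<rho>)"]) (simp add: abs_le_iff order_trans[OF _ corr_bounds(1)])
  show "\<exists>L\<ge>0. \<forall>x y. \<bar>corr N \<rho> x - corr N \<rho> y\<bar> \<le> L * norm (x - y)"
  proof (intro exI[of _ "4 * real N / \<rho>\<^sup>2 / (2 * - ln \<rho>)"] conjI allI)
    show "0 \<le> 4 * real N / \<rho>\<^sup>2 / (2 * - ln \<rho>)" using minus_ln_pos by (intro divide_nonneg_nonneg) auto
    fix x y
    have r2: "\<rho>\<^sup>2 > 0" using \<rho> by simp
    have "ln (msig N \<rho> x / \<rho>\<^sup>2) = ln (msig N \<rho> x) - ln (\<rho>\<^sup>2)" for x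
      using msig_ge(2)[of x] r2 by (simp add: ln_div)
    then have "corr N \<rho> x - corr N \<rho> y = (ln (msig N \<rho> x) - ln (msig N \<rho> y)) / (2 * - ln \<rho>)"
      unfolding corr_def by (simp add: diff_divide_distrib)
    then have "\<bar>corr N \<rho> x - corr N \<rho> y\<bar> = \<bar>ln (msig N \<rho> x) - ln (msig N \<rho> y)\<bar> / (2 * - ln \<rho>)"
      using minus_ln_pos by (simp add: abs_divide)
    also have "\<dots> \<le> (\<bar>msig N \<rho> x - msig N \<rho> y\<bar> / \<rho>\<^sup>2) / (2 * - ln \<rho>)"
      using minus_ln_pos r2 by (intro divide_right_mono ln_Lipschitz msig_ge) auto
    also have "\<dots> \<le> (4 * real N * norm (x - y) / \<rho>\<^sup>2) / (2 * - ln \<rho>)"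
      using minus_ln_pos by (intro divide_right_mono msig_Lipschitz) auto
    finally show "\<bar>corr N \<rho> x - corr N \<rho> y\<bar> \<le> 4 * real N / \<rho>\<^sup>2 / (2 * - ln \<rho>) * norm (x - y)" by simp
  qed
  show "\<exists>C. \<forall>i x. \<bar>dcorr N \<rho> i x\<bar> \<le> C"
  proof (intro exI allI)
    fix i x
    show "\<bar>dcorr N \<rho> i x\<bar> \<le> 2 * real N * (1 / (2 * - ln \<rho> * \<rho>\<^sup>2))"
      using flux_bound[of i x] order_trans[OF abs_ge_zero flux_bound[of i x]]
      unfolding dcorr_def by (cases "sig N x > \<rho>\<^sup>2") (simp_all only: if_True if_False abs_zero)
  qed
  show "corr N \<rho> (x + axis j (2 * pi)) = corr N \<rho> x" for x j
    using cell_inv_corr by (rule cell_inv_periodic)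
  show "AE x in lborel. ((\<lambda>t. corr N \<rho> (x + t *\<^sub>R axis i 1)) has_real_derivative dcorr N \<rho> i x) (at 0)" for i
    using level
  proof eventually_elim
    case (elim x)
    have p: "msig N \<rho> (x + 0 *\<^sub>R axis i 1) / \<rho>\<^sup>2 > 0" using msig_ge(2)[of x] \<rho> by simp
    have "((\<lambda>t. ln (msig N \<rho> (x + t *\<^sub>R axis i 1) / \<rho>\<^sup>2) / (2 * - ln \<rho>)) has_real_derivative
       (1 / (msig N \<rho> (x + 0 *\<^sub>R axis i 1) / \<rho>\<^sup>2) * ((if sig N x > \<rho>\<^sup>2 then dsig N i x else 0) / \<rho>\<^sup>2)) / (2 * - ln \<rho>)) (at 0)"
      by (intro DERIV_cdivide DERIV_chain2[where f=ln and g="\<lambda>t. msig N \<rho> (x + t *\<^sub>R axis i 1) / \<rho>\<^sup>2", OF DERIV_ln_divide[OF p]] msig_derivative elim)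
    moreover have "(1 / (msig N \<rho> (x + 0 *\<^sub>R axis i 1) / \<rho>\<^sup>2) * ((if sig N x > \<rho>\<^sup>2 then dsig N i x else 0) / \<rho>\<^sup>2)) / (2 * - ln \<rho>) = dcorr N \<rho> i x"
      using \<rho> by (simp add: dcorr_def flux_def)
    ultimately show ?case unfolding corr_def by simp
  qed
qed measurable

lemma dflux_bound: "\<bar>dflux N \<rho> j i x\<bar> \<le> 2 * (real N)\<^sup>2 * (1 / (2 * - ln \<rho> * \<rho>\<^sup>2)) + 2 * real N * (2 * real N) / (2 * - ln \<rho> * (\<rho>\<^sup>2)\<^sup>2)"
proof -
  have p: "0 < 2 * - ln \<rho>" using minus_ln_pos by simp
  have "\<bar>(if i = j then ddsig N j x else 0) * (1 / (2 * - ln \<rho> * msig N \<rho> x))\<bar> \<le> 2 * (real N)\<^sup>2 * (1 / (2 * - ln \<rho> * \<rho>\<^sup>2))"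
    unfolding abs_mult using ddsig_bound[of N j x] inv_msig_bound[of x] by (intro mult_mono) auto
  moreover have "\<bar>if sig N x > \<rho>\<^sup>2 then dsig N j x * dsig N i x / (2 * - ln \<rho> * (sig N x)\<^sup>2) else 0\<bar> \<le> 2 * real N * (2 * real N) / (2 * - ln \<rho> * (\<rho>\<^sup>2)\<^sup>2)"
  proof (cases "sig N x > \<rho>\<^sup>2")
    case True
    have "\<bar>dsig N j x * dsig N i x / (2 * - ln \<rho> * (sig N x)\<^sup>2)\<bar> = \<bar>dsig N j x\<bar> * \<bar>dsig N i x\<bar> / (2 * - ln \<rho> * (sig N x)\<^sup>2)"
      using p by (simp add: abs_divide abs_mult)
    also have "\<dots> \<le> 2 * real N * (2 * real N) / (2 * - ln \<rho> * (\<rho>\<^sup>2)\<^sup>2)"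
      using p True \<rho> by (intro frac_le mult_mono dsig_bound mult_left_mono power_mono mult_pos_pos) auto
    finally show ?thesis using True by simp
  next
    case False
    have "0 \<le> 2 * real N * (2 * real N) / (2 * - ln \<rho> * (\<rho>\<^sup>2)\<^sup>2)" using p by (intro divide_nonneg_nonneg mult_nonneg_nonneg) auto
    then show ?thesis using False by simp
  qed
  ultimately show ?thesis unfolding dflux_def by linarith
qed

lemma per_lip_flux: "per_lip (flux N \<rho> j) (dflux N \<rho> j)"
  unfolding per_lip_def
proof (intro conjI allI)
  define c where "c x = 1 / (2 * - ln \<rho> * msig N \<rho> x)" for x
  have fl: "flux N \<rho> j x = dsig N j x * c x" for x by (simp only: flux_def c_def)
  show "\<exists>B. \<forall>x. \<bar>flux N \<rho> j x\<bar> \<le> B" using flux_bound by blast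
  show "\<exists>L\<ge>0. \<forall>x y. \<bar>flux N \<rho> j x - flux N \<rho> j y\<bar> \<le> L * norm (x - y)"
  proof -
    define L where "L = 2 * real N * ((1 / (2 * - ln \<rho>)) * (4 * real N / \<rho> ^ 4)) + 2 * (real N)\<^sup>2 * (1 / (2 * - ln \<rho> * \<rho>\<^sup>2))"
    have p: "0 < 2 * - ln \<rho>" using minus_ln_pos by simp
    have L0: "L \<ge> 0" unfolding L_def using p \<rho>
      by (intro add_nonneg_nonneg mult_nonneg_nonneg divide_nonneg_nonneg) auto
    have "\<bar>flux N \<rho> j x - flux N \<rho> j y\<bar> \<le> L * norm (x - y)" for x y
    proof -
      have "flux N \<rho> j x - flux N \<rho> j y = dsig N j x * (c x - c y) + (dsig N j x - dsig N j y) * c y"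
        by (simp only: fl) (simp add: algebra_simps)
      then have "\<bar>flux N \<rho> j x - flux N \<rho> j y\<bar> \<le> \<bar>dsig N j x\<bar> * \<bar>c x - c y\<bar> + \<bar>dsig N j x - dsig N j y\<bar> * \<bar>c y\<bar>"
        by (metis abs_mult abs_triangle_ineq)
      also have "\<dots> \<le> 2 * real N * ((1 / (2 * - ln \<rho>)) * (4 * real N / \<rho> ^ 4) * norm (x - y)) + 2 * (real N)\<^sup>2 * norm (x - y) * (1 / (2 * - ln \<rho> * \<rho>\<^sup>2))"
        using inv_msig_Lipschitz[of x y] inv_msig_bound[of y] unfolding c_def
        by (intro add_mono mult_mono dsig_bound dsig_Lipschitz) auto
      also have "\<dots> = L * norm (x - y)" by (simp add: L_def algebra_simps)
      finally show ?thesis .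
    qed
    then show ?thesis using L0 by blast
  qed
  show "\<exists>C. \<forall>i x. \<bar>dflux N \<rho> j i x\<bar> \<le> C" using dflux_bound by blast
  show "flux N \<rho> j (x + axis i (2 * pi)) = flux N \<rho> j x" for x i
    using cell_inv_flux by (rule cell_inv_periodic)
  show "AE x in lborel. ((\<lambda>t. flux N \<rho> j (x + t *\<^sub>R axis i 1)) has_real_derivative dflux N \<rho> j i x) (at 0)" for i
    using level
  proof eventually_elim
    case (elim x)
    have p: "2 * - ln \<rho> * msig N \<rho> (x + 0 *\<^sub>R axis i 1) \<noteq> 0" using minus_ln_pos msig_ge(2)[of x] by simp
    let ?D = "if sig N x > \<rho>\<^sup>2 then dsig N i x else 0"
    have "((\<lambda>t. 1 / (2 * - ln \<rho> * msig N \<rho> (x + t *\<^sub>R axis i 1))) has_real_derivative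
        (0 * (2 * - ln \<rho> * msig N \<rho> (x + 0 *\<^sub>R axis i 1)) - 1 * (2 * - ln \<rho> * ?D)) / ((2 * - ln \<rho> * msig N \<rho> (x + 0 *\<^sub>R axis i 1)) * (2 * - ln \<rho> * msig N \<rho> (x + 0 *\<^sub>R axis i 1)))) (at 0)"
      by (intro DERIV_divide DERIV_const DERIV_cmult msig_derivative elim p)
    from DERIV_mult[OF dsig_derivative this]
    have "((\<lambda>t. flux N \<rho> j (x + t *\<^sub>R axis i 1)) has_real_derivative
       (if i = j then ddsig N j x else 0) * (1 / (2 * - ln \<rho> * msig N \<rho> (x + 0 *\<^sub>R axis i 1))) +
       (0 * (2 * - ln \<rho> * msig N \<rho> (x + 0 *\<^sub>R axis i 1)) - 1 * (2 * - ln \<rho> * ?D)) / ((2 * - ln \<rho> * msig N \<rho> (x + 0 *\<^sub>R axis i 1)) * (2 * - ln \<rho> * msig N \<rho> (x + 0 *\<^sub>R axis i 1))) * dsig N j (x + 0 *\<^sub>R axis i 1)) (at 0)"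
      unfolding flux_def .
    moreover have "(if i = j then ddsig N j x else 0) * (1 / (2 * - ln \<rho> * msig N \<rho> (x + 0 *\<^sub>R axis i 1))) +
       (0 * (2 * - ln \<rho> * msig N \<rho> (x + 0 *\<^sub>R axis i 1)) - 1 * (2 * - ln \<rho> * ?D)) / ((2 * - ln \<rho> * msig N \<rho> (x + 0 *\<^sub>R axis i 1)) * (2 * - ln \<rho> * msig N \<rho> (x + 0 *\<^sub>R axis i 1))) * dsig N j (x + 0 *\<^sub>R axis i 1)
       = dflux N \<rho> j i x"
    proof (cases "sig N x > \<rho>\<^sup>2")
      case True
      have s: "msig N \<rho> x = sig N x" "sig N x \<noteq> 0" using True \<rho> by (auto simp: msig_def)
      have l: "ln \<rho> \<noteq> 0" using minus_ln_pos by simp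
      have "(0 * (2 * - ln \<rho> * sig N x) - 1 * (2 * - ln \<rho> * dsig N i x)) / ((2 * - ln \<rho> * sig N x) * (2 * - ln \<rho> * sig N x)) * dsig N j x
        = - (dsig N j x * dsig N i x / (2 * - ln \<rho> * (sig N x)\<^sup>2))"
        using s(2) l by (simp add: field_simps power2_eq_square)
      then show ?thesis using True by (simp only: dflux_def s scaleR_zero_left add_0_right if_True)
    next
      case False
      then show ?thesis by (simp add: dflux_def)
    qed
    ultimately show ?case by (simp only:)
  qed
qed measurable

text \<open>Outside the tubes the quotient rule produces
  \<open>(4 - s) s - (4 s - a^2 - b^2)\<close> with \<open>s = a + b\<close>, which collapses to
  \<open>- 2 a b\<close>. The terms linear in \<open>s\<close>, which would be singular at the axes
  after division by \<open>s^2\<close>, cancel.\<close>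

lemma div_flux: "(\<Sum>j\<in>UNIV. dflux N \<rho> j j x) = core N \<rho> x - spread N \<rho> x"
proof (cases "sig N x > \<rho>\<^sup>2")
  case True
  define L where "L = - ln \<rho>"
  define s where "s = sig N x"
  define a b where "a = 2 + 2 * cos (real N * x $ 1)" and "b = 2 + 2 * cos (real N * x $ 2)"
  have sab: "s = a + b" by (simp add: s_def a_def b_def sig_def)
  have m: "msig N \<rho> x = s" using True by (simp add: msig_def s_def)
  have s0: "s \<noteq> 0" using True \<rho> unfolding s_def by (smt (verit) zero_less_power)
  have L0: "L \<noteq> 0" using minus_ln_pos by (simp add: L_def)
  have "(\<Sum>j\<in>UNIV. dflux N \<rho> j j x) = (\<Sum>j\<in>UNIV. ddsig N j x) * (1 / (2 * L * s)) - (\<Sum>j\<in>UNIV. (dsig N j x)\<^sup>2) / (2 * L * s\<^sup>2)"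
    using True by (simp add: dflux_def m L_def s_def sum_subtractf power2_eq_square sum_divide_distrib sum_distrib_right del: mult_minus_right mult_minus_left)
  also have "\<dots> = (real N)\<^sup>2 * (4 - s) * (1 / (2 * L * s)) - (real N)\<^sup>2 * (4 * s - a\<^sup>2 - b\<^sup>2) / (2 * L * s\<^sup>2)"
    unfolding sum_ddsig sum_dsig_sq by (simp add: s_def a_def b_def)
  also have "\<dots> = (real N)\<^sup>2 * ((4 - s) * s - (4 * s - a\<^sup>2 - b\<^sup>2)) / (2 * L * s\<^sup>2)"
    using s0 L0 by (simp add: field_simps power2_eq_square)
  also have "(4 - s) * s - (4 * s - a\<^sup>2 - b\<^sup>2) = - (2 * a * b)"
    by (simp add: sab power2_eq_square algebra_simps)
  also have "(real N)\<^sup>2 * - (2 * a * b) / (2 * L * s\<^sup>2) = - ((real N)\<^sup>2 * a * b / (L * s\<^sup>2))"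
    using L0 s0 by (simp add: field_simps)
  also have "\<dots> = core N \<rho> x - spread N \<rho> x"
    using True by (simp add: core_def spread_def L_def s_def a_def b_def)
  finally show ?thesis .
next
  case False
  have m: "msig N \<rho> x = \<rho>\<^sup>2" using False by (simp add: msig_def)
  have "(\<Sum>j\<in>UNIV. dflux N \<rho> j j x) = (\<Sum>j\<in>UNIV. ddsig N j x) * (1 / (2 * - ln \<rho> * \<rho>\<^sup>2))"
    unfolding sum_distrib_right using False by (simp add: dflux_def m)
  then show ?thesis unfolding sum_ddsig using False by (simp add: core_def spread_def)
qed

text \<open>From \<open>4 a b \<le> (a + b)^2\<close>. The bound is uniform up to the tubes, and its
  order \<open>N^2 / - ln \<rho>\<close> is the one that converges.\<close>

lemma spread_bounds: "0 \<le> spread N \<rho> x" "spread N \<rho> x \<le> (real N)\<^sup>2 / (4 * - ln \<rho>)"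
proof -
  define a b where "a = 2 + 2 * cos (real N * x $ 1)" and "b = 2 + 2 * cos (real N * x $ 2)"
  have ab: "a \<ge> 0" "b \<ge> 0"
    using cos_ge_minus_one[of "real N * x $ 1"] cos_ge_minus_one[of "real N * x $ 2"] unfolding a_def b_def by linarith+
  have s: "sig N x = a + b" by (simp add: a_def b_def sig_def)
  show "0 \<le> spread N \<rho> x"
  proof -
    have "0 \<le> (real N)\<^sup>2 * a * b / (- ln \<rho> * (sig N x)\<^sup>2)"
      using ab minus_ln_pos by (intro divide_nonneg_nonneg mult_nonneg_nonneg) auto
    then show ?thesis unfolding spread_def a_def b_def by simp
  qed
  have "4 * (a * b) \<le> (a + b)\<^sup>2"
    using zero_le_power2[of "a - b"] by (simp add: power2_eq_square algebra_simps)
  then have "(real N)\<^sup>2 * (4 * (a * b)) \<le> (real N)\<^sup>2 * (a + b)\<^sup>2" by (intro mult_left_mono) auto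
  then show "spread N \<rho> x \<le> (real N)\<^sup>2 / (4 * - ln \<rho>)"
    unfolding spread_def a_def[symmetric] b_def[symmetric] s
  proof (cases "a + b > \<rho>\<^sup>2")
    case True
    assume *: "(real N)\<^sup>2 * (4 * (a * b)) \<le> (real N)\<^sup>2 * (a + b)\<^sup>2"
    have ab0: "(a + b)\<^sup>2 > 0" using True \<rho> by (smt (verit) zero_less_power)
    have "(real N)\<^sup>2 * a * b / (- ln \<rho> * (a + b)\<^sup>2) = ((real N)\<^sup>2 * (4 * (a * b)) / (a + b)\<^sup>2) / (4 * - ln \<rho>)"
      by (simp add: mult_ac)
    also have "\<dots> \<le> (real N)\<^sup>2 / (4 * - ln \<rho>)"
      using * ab0 minus_ln_pos by (intro divide_right_mono) (simp_all add: divide_le_eq)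
    finally show "(if \<rho>\<^sup>2 < a + b then (real N)\<^sup>2 * a * b / (- ln \<rho> * (a + b)\<^sup>2) else 0) \<le> (real N)\<^sup>2 / (4 * - ln \<rho>)"
      using True by simp
  next
    case False
    have "0 \<le> (real N)\<^sup>2 / (4 * - ln \<rho>)" using minus_ln_pos by (intro divide_nonneg_nonneg) auto
    then show "(if \<rho>\<^sup>2 < a + b then (real N)\<^sup>2 * a * b / (- ln \<rho> * (a + b)\<^sup>2) else 0) \<le> (real N)\<^sup>2 / (4 * - ln \<rho>)"
      using False by simp
  qed
qed

lemma bounded_integrable:
  fixes u :: "real^3 \<Rightarrow> real"
  assumes "u \<in> borel_measurable borel" "\<And>x. \<bar>u x\<bar> \<le> B"
  shows "integrable cell_measure u"
  using assms by (intro cellM.integrable_const_bound[where B=B]) auto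

lemma core_bounds: "0 \<le> core N \<rho> x" "core N \<rho> x \<le> (real N)\<^sup>2 * 4 / (2 * - ln \<rho> * \<rho>\<^sup>2)"
proof -
  have p: "0 < 2 * - ln \<rho> * \<rho>\<^sup>2" using minus_ln_pos \<rho> by (intro mult_pos_pos) auto
  have r1: "\<rho>\<^sup>2 \<le> 1" using \<rho> by (simp add: power_le_one)
  show "0 \<le> core N \<rho> x"
  proof (cases "sig N x > \<rho>\<^sup>2")
    case False
    have "0 \<le> (real N)\<^sup>2 * (4 - sig N x) / (2 * - ln \<rho> * \<rho>\<^sup>2)"
      by (rule divide_nonneg_nonneg[OF mult_nonneg_nonneg less_imp_le[OF p]]) (use r1 False in auto)
    then show ?thesis by (simp add: core_def)
  qed (simp add: core_def)
  have "(real N)\<^sup>2 * (4 - sig N x) / (2 * - ln \<rho> * \<rho>\<^sup>2) \<le> (real N)\<^sup>2 * 4 / (2 * - ln \<rho> * \<rho>\<^sup>2)"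
    using p sig_bounds(1)[of N x] by (intro divide_right_mono mult_left_mono) auto
  moreover have "0 \<le> (real N)\<^sup>2 * 4 / (2 * - ln \<rho> * \<rho>\<^sup>2)" using p by (intro divide_nonneg_nonneg) auto
  ultimately show "core N \<rho> x \<le> (real N)\<^sup>2 * 4 / (2 * - ln \<rho> * \<rho>\<^sup>2)" unfolding core_def by simp
qed

lemma spread_integrable: "integrable cell_measure (spread N \<rho>)"
  using spread_bounds by (intro bounded_integrable[where B="(real N)\<^sup>2 / (4 * - ln \<rho>)"]) (auto simp: abs_le_iff order_trans[OF _ spread_bounds(1)])

lemma core_integrable: "integrable cell_measure (core N \<rho>)"
  using core_bounds by (intro bounded_integrable[where B="(real N)\<^sup>2 * 4 / (2 * - ln \<rho> * \<rho>\<^sup>2)"]) (auto simp: abs_le_iff order_trans[OF _ core_bounds(1)])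

lemma dflux_integrable: "integrable cell_measure (dflux N \<rho> j i)"
  by (rule bounded_integrable[OF dflux_measurable dflux_bound])

text \<open>A periodic divergence has zero mean, so the integral of the spread-out part is reduced
  to one over the thin tubes, where the integrand is almost constant.\<close>

lemma integral_spread: "(\<integral>x. spread N \<rho> x \<partial>cell_measure) = (\<integral>x. core N \<rho> x \<partial>cell_measure)"
proof -
  have "(\<integral>x. dflux N \<rho> j j x * 1 \<partial>cell_measure) = - (\<integral>x. flux N \<rho> j x * 0 \<partial>cell_measure)" for j
    by (rule per_lip_ibp[OF per_lip_flux per_lip_const])
  then have "(\<Sum>j\<in>UNIV. \<integral>x. dflux N \<rho> j j x \<partial>cell_measure) = 0" by simp
  also have "(\<Sum>j\<in>UNIV. \<integral>x. dflux N \<rho> j j x \<partial>cell_measure) = (\<integral>x. (\<Sum>j\<in>UNIV. dflux N \<rho> j j x) \<partial>cell_measure)"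
    by (intro Bochner_Integration.integral_sum[symmetric] dflux_integrable)
  finally show ?thesis
    unfolding div_flux using spread_integrable core_integrable by simp
qed

lemma integral_dcorr: "(\<integral>x. dcorr N \<rho> i x \<partial>cell_measure) = 0"
  using per_lip_ibp[OF per_lip_corr per_lip_const[of 1], of i] by simp

text \<open>One gradient is replaced by the flux, which agrees with it wherever it is nonzero, and
  the other is integrated by parts. The corrector vanishes where \<open>core\<close> lives, so only
  \<open>spread\<close> remains, weighted by a corrector that is at most 1 up to a vanishing
  error.\<close>

lemma integral_dcorr_sq:
  "(\<Sum>j\<in>UNIV. \<integral>x. (dcorr N \<rho> j x)\<^sup>2 \<partial>cell_measure) \<le> (1 + ln 8 / (2 * - ln \<rho>)) * (\<integral>x. core N \<rho> x \<partial>cell_measure)"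
proof -
  have "(\<integral>x. (dcorr N \<rho> j x)\<^sup>2 \<partial>cell_measure) = (\<integral>x. dcorr N \<rho> j x * flux N \<rho> j x \<partial>cell_measure)" for j
    by (intro Bochner_Integration.integral_cong) (auto simp: dcorr_def power2_eq_square)
  also have "(\<integral>x. dcorr N \<rho> j x * flux N \<rho> j x \<partial>cell_measure) = - (\<integral>x. corr N \<rho> x * dflux N \<rho> j j x \<partial>cell_measure)" for j
    by (rule per_lip_ibp[OF per_lip_corr per_lip_flux])
  finally have "(\<Sum>j\<in>UNIV. \<integral>x. (dcorr N \<rho> j x)\<^sup>2 \<partial>cell_measure) = - (\<Sum>j\<in>UNIV. \<integral>x. corr N \<rho> x * dflux N \<rho> j j x \<partial>cell_measure)"
    by (simp add: sum_negf)
  also have "(\<Sum>j\<in>UNIV. \<integral>x. corr N \<rho> x * dflux N \<rho> j j x \<partial>cell_measure) = (\<integral>x. (\<Sum>j\<in>UNIV. corr N \<rho> x * dflux N \<rho> j j x) \<partial>cell_measure)"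
  proof (intro Bochner_Integration.integral_sum[symmetric])
    fix j :: 3
    let ?C = "2 * (real N)\<^sup>2 * (1 / (2 * - ln \<rho> * \<rho>\<^sup>2)) + 2 * real N * (2 * real N) / (2 * - ln \<rho> * (\<rho>\<^sup>2)\<^sup>2)"
    show "integrable cell_measure (\<lambda>x. corr N \<rho> x * dflux N \<rho> j j x)"
    proof (rule bounded_integrable[where B="(1 + ln 8 / (2 * - ln \<rho>)) * ?C"])
      show "\<bar>corr N \<rho> x * dflux N \<rho> j j x\<bar> \<le> (1 + ln 8 / (2 * - ln \<rho>)) * ?C" for x
        unfolding abs_mult using corr_bounds[of x] dflux_bound[of j j x] by (intro mult_mono) auto
    qed measurable
  qed
  also have "- \<dots> = (\<integral>x. corr N \<rho> x * spread N \<rho> x \<partial>cell_measure)"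
    unfolding sum_distrib_left[symmetric] div_flux integral_minus[symmetric]
    by (intro Bochner_Integration.integral_cong refl) (auto simp: core_def corr_eq_0)
  also have "\<dots> \<le> (\<integral>x. (1 + ln 8 / (2 * - ln \<rho>)) * spread N \<rho> x \<partial>cell_measure)"
  proof (rule integral_mono)
    show "integrable cell_measure (\<lambda>x. corr N \<rho> x * spread N \<rho> x)"
    proof (rule bounded_integrable[where B="(1 + ln 8 / (2 * - ln \<rho>)) * ((real N)\<^sup>2 / (4 * - ln \<rho>))"])
      show "\<bar>corr N \<rho> x * spread N \<rho> x\<bar> \<le> (1 + ln 8 / (2 * - ln \<rho>)) * ((real N)\<^sup>2 / (4 * - ln \<rho>))" for x
        unfolding abs_mult using corr_bounds[of x] spread_bounds[of x] by (intro mult_mono) auto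
    qed measurable
    show "corr N \<rho> x * spread N \<rho> x \<le> (1 + ln 8 / (2 * - ln \<rho>)) * spread N \<rho> x" for x
      by (intro mult_right_mono corr_bounds spread_bounds)
  qed (use spread_integrable in auto)
  finally show ?thesis by (simp add: integral_spread)
qed

end

section \<open>Volumes of tubes around the fibers\<close>

text \<open>The image of the finite cell measure under \<open>sig N\<close> has at most countably
  many atoms, so every interval contains a null level; periodicity carries this from the cell to the
  whole space.\<close>

lemma generic_level:
  assumes "0 \<le> a" "a < b"
  obtains \<rho> where "a < \<rho>" "\<rho> < b" "AE x in lborel. sig N x \<noteq> \<rho>\<^sup>2"
proof -
  define M where "M = distr cell_measure borel (sig N)"
  interpret M: finite_measure M
    unfolding M_def by (rule cellM.finite_measure_distr) simp
  have "a\<^sup>2 < b\<^sup>2" using assms by (intro power_strict_mono) auto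
  then have "uncountable {a\<^sup>2<..<b\<^sup>2}" by (simp add: uncountable_open_interval)
  then obtain t where t: "t \<in> {a\<^sup>2<..<b\<^sup>2}" "measure M {t} = 0"
    using M.countable_support countable_subset[of "{a\<^sup>2<..<b\<^sup>2}" "{t. measure M {t} \<noteq> 0}"] by blast
  have "a\<^sup>2 < t" "0 \<le> a\<^sup>2" using t(1) by auto
  then have t0: "t \<ge> 0" by linarith
  have "measure M {t} = measure cell_measure {x. sig N x = t}"
    unfolding M_def by (subst measure_distr) (auto simp: vimage_def)
  then have "measure cell_measure {x. sig N x = t} = 0" using t(2) by simp
  then have "emeasure cell_measure {x. sig N x = t} = 0" by (simp add: cellM.emeasure_eq_measure)
  then have "{x. sig N x = t} \<in> null_sets cell_measure"
    by (intro null_setsI) auto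
  then have "AE x in cell_measure. sig N x \<noteq> t" by (rule AE_I') auto
  then have "AE x in lborel. x \<in> cell \<longrightarrow> sig N x \<noteq> t" by (simp add: AE_cell_measure_iff)
  then have "AE x in lborel. x + shift (- m) \<in> cell \<longrightarrow> sig N (x + shift (- m)) \<noteq> t" for m
    by (rule AE_lborel_translate)
  moreover have "AE x in lborel. sig N (x + shift m) = sig N x" for m
  proof (rule periodic_AE_shift)
    have "sig N (x + axis j (2 * pi)) = sig N x" for x j
    proof (cases "N = 0")
      case False
      then have "N \<ge> 1" by simp
      from cell_inv_periodic[OF cell_inv_sig[OF this]] show ?thesis .
    qed (simp add: sig_def)
    then show "periodic_AE (sig N)" by (simp add: periodic_AE_def)
  qed
  ultimately have "AE x in lborel. \<forall>m. (x + shift (- m) \<in> cell \<longrightarrow> sig N (x + shift (- m)) \<noteq> t) \<and> sig N (x + shift (- m)) = sig N x"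
    unfolding AE_all_countable by auto
  then have "AE x in lborel. sig N x \<noteq> t"
    using AE_off_faces
  proof eventually_elim
    case (elim x)
    have sm: "shift (- m) = - shift m" for m by (simp add: vec_eq_iff)
    have "x + shift (- cell_index x) \<in> cell"
      using mem_cell_shift_iff[OF elim(2), of "cell_index x"] by (simp add: sm)
    then show ?case using elim(1) by metis
  qed
  then have lev: "AE x in lborel. sig N x \<noteq> (sqrt t)\<^sup>2" using t0 by simp
  have "a < sqrt t" using t(1) assms by (intro real_less_rsqrt) auto
  moreover have "sqrt t < b" using t(1) assms by (intro real_less_lsqrt) auto
  ultimately show thesis using lev by (rule that)
qed

text \<open>Splits space into the plane across the fibers, read as \<open>complex\<close> where the
  area of a disc is known, and the direction of the axes.\<close>

definition complex_real_vec :: "complex \<times> real \<Rightarrow> real^3" where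
  "complex_real_vec p = (\<chi> i. if i = 1 then Re (fst p) else if i = 2 then Im (fst p) else snd p)"

lemma complex_real_vec_nth [simp]:
  "complex_real_vec p $ 1 = Re (fst p)" "complex_real_vec p $ 2 = Im (fst p)" "complex_real_vec p $ 3 = snd p"
  by (simp_all add: complex_real_vec_def)

lemma complex_real_vec_measurable [measurable]: "complex_real_vec \<in> borel_measurable borel"
  unfolding complex_real_vec_def[abs_def]
proof (rule vec_lambda_measurable)
  fix j :: 3
  have "continuous_on UNIV (\<lambda>x :: complex \<times> real. if j = 1 then Re (fst x) else if j = 2 then Im (fst x) else snd x)"
    using exhaust_3[of j] by (elim disjE) (auto intro!: continuous_intros)
  then show "(\<lambda>x :: complex \<times> real. if j = 1 then Re (fst x) else if j = 2 then Im (fst x) else snd x) \<in> borel_measurable borel"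
    by (rule borel_measurable_continuous_onI)
qed

lemma emeasure_lborel_Times:
  fixes A :: "complex set" and B :: "real set"
  assumes "A \<in> sets borel" "B \<in> sets borel"
  shows "emeasure lborel (A \<times> B) = emeasure lborel A * emeasure lborel B"
  unfolding lborel_prod[symmetric] using assms by (intro lborel.emeasure_pair_measure_Times) auto

lemma lborel_complex_real_vec: "distr lborel borel complex_real_vec = lborel"
proof (rule lborel_eqI[symmetric])
  fix l u :: "real^3" assume le: "\<And>b. b \<in> Basis \<Longrightarrow> l \<bullet> b \<le> u \<bullet> b"
  have le': "l $ i \<le> u $ i" for i using le[of "axis i 1"] by (simp add: inner_axis axis_in_Basis_iff)
  have cb: "z \<in> box (Complex a b) (Complex c d) \<longleftrightarrow> a < Re z \<and> Re z < c \<and> b < Im z \<and> Im z < d" for z a b c d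
    by (auto simp: box_def Basis_complex_def inner_complex_def)
  have "complex_real_vec -` box l u = box (Complex (l $ 1) (l $ 2)) (Complex (u $ 1) (u $ 2)) \<times> {l $ 3<..<u $ 3}"
    by (auto simp: mem_box_cart forall_3 cb)
  then have "emeasure (distr lborel borel complex_real_vec) (box l u) =
      emeasure lborel (box (Complex (l $ 1) (l $ 2)) (Complex (u $ 1) (u $ 2))) * emeasure lborel {l $ 3<..<u $ 3}"
    by (subst emeasure_distr) (auto simp: emeasure_lborel_Times)
  also have "\<dots> = ennreal ((u $ 1 - l $ 1) * (u $ 2 - l $ 2)) * ennreal (u $ 3 - l $ 3)"
    using le' by (subst emeasure_lborel_box) (auto simp: Basis_complex_def inner_complex_def)
  also have "\<dots> = ennreal ((u $ 1 - l $ 1) * (u $ 2 - l $ 2) * (u $ 3 - l $ 3))"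
    using le' by (simp add: ennreal_mult)
  also have "(u $ 1 - l $ 1) * (u $ 2 - l $ 2) * (u $ 3 - l $ 3) = (\<Prod>b\<in>Basis. (u - l) \<bullet> b)"
  proof -
    have B: "(Basis :: (real^3) set) = (\<lambda>i. axis i 1) ` UNIV" by (auto simp: Basis_vec_def)
    have "inj (\<lambda>i :: 3. axis i (1 :: real))" by (auto simp: inj_on_def axis_eq_axis)
    then show ?thesis unfolding B by (simp add: prod.reindex prod_UNIV_3 inner_axis)
  qed
  finally show "emeasure (distr lborel borel complex_real_vec) (box l u) = ennreal (\<Prod>b\<in>Basis. (u - l) \<bullet> b)" .
qed simp

text \<open>The area \<open>pi * t^2\<close> times the length \<open>2 * pi\<close>; a radius below
  \<open>pi\<close> keeps the disc inside the section of the cell.\<close>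

lemma measure_cylinder:
  assumes t: "0 \<le> t" "t < pi"
  shows "measure cell_measure {x. (x $ 1 - pi)\<^sup>2 + (x $ 2 - pi)\<^sup>2 \<le> t\<^sup>2} = 2 * pi\<^sup>2 * t\<^sup>2"
proof -
  let ?A = "{x :: real^3. (x $ 1 - pi)\<^sup>2 + (x $ 2 - pi)\<^sup>2 \<le> t\<^sup>2}"
  have A [measurable]: "?A \<in> sets borel"
    by (intro borel_closed closed_Collect_le continuous_intros)
  have "emeasure cell_measure ?A = emeasure lborel (cell \<inter> ?A)"
    unfolding cell_measure_def by (subst emeasure_density) (auto simp: ennreal_indicator nn_integral_set_ennreal simp flip: indicator_inter_arith)
  also have "\<dots> = emeasure (distr lborel borel complex_real_vec) (cell \<inter> ?A)"
    by (simp add: lborel_complex_real_vec)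
  also have "\<dots> = emeasure lborel (complex_real_vec -` (cell \<inter> ?A))"
    by (subst emeasure_distr) auto
  also have "complex_real_vec -` (cell \<inter> ?A) = cball (Complex pi pi) t \<times> {0<..<2 * pi}"
  proof -
    have "(a - pi)\<^sup>2 + (b - pi)\<^sup>2 \<le> t\<^sup>2 \<Longrightarrow> 0 < a \<and> a < 2 * pi \<and> 0 < b \<and> b < 2 * pi" for a b
    proof -
      assume *: "(a - pi)\<^sup>2 + (b - pi)\<^sup>2 \<le> t\<^sup>2"
      have "(a - pi)\<^sup>2 \<le> t\<^sup>2" "(b - pi)\<^sup>2 \<le> t\<^sup>2"
        using * zero_le_power2[of "a - pi"] zero_le_power2[of "b - pi"] by linarith+
      then have "\<bar>a - pi\<bar> \<le> t" "\<bar>b - pi\<bar> \<le> t" using t(1) by (auto simp: abs_le_square_iff[symmetric])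
      then show ?thesis using t by linarith
    qed
    moreover have "z \<in> cball (Complex pi pi) t \<longleftrightarrow> (Re z - pi)\<^sup>2 + (Im z - pi)\<^sup>2 \<le> t\<^sup>2" for z
    proof -
      have "z \<in> cball (Complex pi pi) t \<longleftrightarrow> (cmod (Complex pi pi - z))\<^sup>2 \<le> t\<^sup>2"
        using t(1) by (simp add: dist_norm power_mono_iff)
      also have "(cmod (Complex pi pi - z))\<^sup>2 = (Re z - pi)\<^sup>2 + (Im z - pi)\<^sup>2"
        by (simp add: cmod_power2 power2_commute)
      finally show ?thesis .
    qed
    ultimately show ?thesis
      by (auto simp: cell_def forall_3)
  qed
  also have "emeasure lborel (cball (Complex pi pi) t \<times> {0<..<2 * pi}) = ennreal (2 * pi\<^sup>2 * t\<^sup>2)"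
    using t by (subst emeasure_lborel_Times) (auto simp: emeasure_cball unit_ball_vol_2 power2_eq_square mult_ac simp flip: ennreal_mult)
  finally show ?thesis by (simp add: measure_def)
qed

lemma two_minus_cos: "2 - 2 * cos y = 4 * (sin (y / 2))\<^sup>2" for y :: real
  using cos_double_sin[of "y / 2"] by simp

lemma two_minus_cos_upper: "2 - 2 * cos y \<le> y\<^sup>2" for y :: real
proof -
  have "\<bar>sin (y / 2)\<bar> \<le> \<bar>y / 2\<bar>" by (rule abs_sin_x_le_abs_x)
  then have "\<bar>sin (y / 2)\<bar>\<^sup>2 \<le> \<bar>y / 2\<bar>\<^sup>2" by (rule power_mono) simp
  then have "(sin (y / 2))\<^sup>2 \<le> (y / 2)\<^sup>2" by (simp only: power2_abs)
  then show ?thesis unfolding two_minus_cos by (simp add: power_divide)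
qed

lemma pi_sq_le_10: "pi\<^sup>2 \<le> 10"
proof -
  have "pi\<^sup>2 \<le> (3.15)\<^sup>2" using pi_approx by (intro power_mono) auto
  then show ?thesis by (simp add: power2_eq_square)
qed

text \<open>Squares the Taylor bound \<open>sin u \<ge> u - u^3 / 6\<close> at
  \<open>u = \<bar>y\<bar> / 2\<close>; the range of \<open>y\<close> keeps the right side
  nonnegative, so that squaring is monotone.\<close>

lemma two_minus_cos_lower:
  fixes y :: real
  assumes "\<bar>y\<bar> \<le> pi"
  shows "y\<^sup>2 * (1 - y\<^sup>2 / 12) \<le> 2 - 2 * cos y"
proof -
  have *: "u\<^sup>2 * (1 - u\<^sup>2 / 3) \<le> (sin u)\<^sup>2" if u: "0 \<le> u" "u\<^sup>2 \<le> 6" for u :: real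
  proof -
    have "\<bar>sin u - (\<Sum>m<3. sin_coeff m * u ^ m)\<bar> \<le> inverse (fact 3) * \<bar>u\<bar> ^ 3"
      by (rule Maclaurin_sin_bound)
    moreover have "(\<Sum>m<3. sin_coeff m * u ^ m) = u"
      by (simp add: eval_nat_numeral sin_coeff_def)
    ultimately have "\<bar>sin u - u\<bar> \<le> u ^ 3 / 6" using u(1) by (simp add: fact_numeral)
    then have "u - u ^ 3 / 6 \<le> sin u" by linarith
    moreover have "u * (1 - u\<^sup>2 / 6) = u - u ^ 3 / 6"
      by (simp add: power3_eq_cube power2_eq_square algebra_simps)
    ultimately have s: "u * (1 - u\<^sup>2 / 6) \<le> sin u" by linarith
    have n: "0 \<le> u * (1 - u\<^sup>2 / 6)" using u by (intro mult_nonneg_nonneg) auto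
    have "u\<^sup>2 * (1 - u\<^sup>2 / 3) \<le> u\<^sup>2 * (1 - u\<^sup>2 / 6)\<^sup>2"
      by (intro mult_left_mono) (auto simp: power2_diff)
    also have "\<dots> = (u * (1 - u\<^sup>2 / 6))\<^sup>2" by (simp add: power_mult_distrib)
    also have "\<dots> \<le> (sin u)\<^sup>2" by (rule power_mono[OF s n])
    finally show ?thesis .
  qed
  have "(\<bar>y\<bar> / 2)\<^sup>2 \<le> 6"
  proof -
    have "\<bar>y\<bar>\<^sup>2 \<le> pi\<^sup>2" using assms by (intro power_mono) auto
    then show ?thesis using pi_sq_le_10 by (simp add: power_divide)
  qed
  from *[OF _ this] have "(\<bar>y\<bar> / 2)\<^sup>2 * (1 - (\<bar>y\<bar> / 2)\<^sup>2 / 3) \<le> (sin (\<bar>y\<bar> / 2))\<^sup>2" by simp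
  then have "y\<^sup>2 / 4 * (1 - y\<^sup>2 / 12) \<le> (sin (\<bar>y\<bar> / 2))\<^sup>2" by (simp add: power_divide)
  moreover have "(sin (\<bar>y\<bar> / 2))\<^sup>2 = (sin (y / 2))\<^sup>2" by (cases "y \<ge> 0") auto
  ultimately show ?thesis unfolding two_minus_cos by simp
qed

text \<open>As \<open>pi^2 \<le> 10\<close>, the correction factor \<open>1 - y^2 / 12\<close> is at
  least \<open>1 / 6\<close> throughout a microscopic cell.\<close>

lemma two_minus_cos_lower_6:
  fixes y :: real
  assumes "\<bar>y\<bar> \<le> pi"
  shows "y\<^sup>2 / 6 \<le> 2 - 2 * cos y"
proof -
  have "\<bar>y\<bar>\<^sup>2 \<le> pi\<^sup>2" using assms by (intro power_mono) auto
  then have "y\<^sup>2 \<le> 10" using pi_sq_le_10 by simp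
  then have "y\<^sup>2 * (1 / 6) \<le> y\<^sup>2 * (1 - y\<^sup>2 / 12)" by (intro mult_left_mono) auto
  then show ?thesis using two_minus_cos_lower[OF assms] by simp
qed

definition core_volume :: "nat \<Rightarrow> real \<Rightarrow> real" where
  "core_volume N \<rho> = measure cell_measure {x. sig N x \<le> \<rho>\<^sup>2}"

lemma core_set_measurable [measurable]: "{x. sig N x \<le> c} \<in> sets borel"
  by measurable

text \<open>Dilation by \<open>N\<close> carries the microscopic pattern to that of
  \<open>N = 1\<close> and preserves the means of periodic functions.\<close>

lemma core_volume_scale:
  assumes N: "N \<ge> 1"
  shows "core_volume N \<rho> = core_volume 1 \<rho>"
proof -
  have s: "sig N x = sig 1 (real N *\<^sub>R x)" for x by (simp add: sig_def)
  have "core_volume N \<rho> = (\<integral>x. indicator {x. sig N x \<le> \<rho>\<^sup>2} x \<partial>cell_measure)"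
    by (simp add: core_volume_def)
  also have "\<dots> = (\<integral>x. indicator {x. sig 1 x \<le> \<rho>\<^sup>2} (real N *\<^sub>R x) \<partial>cell_measure)"
    by (intro Bochner_Integration.integral_cong refl) (simp add: indicator_def s)
  also have "\<dots> = (\<integral>x. indicator {x. sig 1 x \<le> \<rho>\<^sup>2} x \<partial>cell_measure)"
  proof (rule periodic_integral_scale[OF _ _ _ N])
    show "periodic_AE (indicator {x. sig 1 x \<le> \<rho>\<^sup>2} :: real^3 \<Rightarrow> real)"
      using cell_inv_periodic[OF cell_inv_sig[of 1]] by (simp add: periodic_AE_def indicator_def)
    show "integrable cell_measure (indicator {x. sig 1 x \<le> \<rho>\<^sup>2} :: real^3 \<Rightarrow> real)"
      by (intro integrable_real_indicator) (auto simp: cellM.emeasure_finite less_top[symmetric])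
  qed measurable
  also have "\<dots> = core_volume 1 \<rho>" by (simp add: core_volume_def)
  finally show ?thesis .
qed

text \<open>The tube is squeezed between two circular cylinders: on it \<open>sig\<close> lies
  between \<open>1 - \<rho>^2 / 2\<close> times the squared distance to the axis and the squared
  distance itself.\<close>

lemma core_volume_bounds:
  assumes N: "N \<ge> 1" and \<rho>: "0 < \<rho>" "\<rho> \<le> 1 / 2"
  shows "2 * pi\<^sup>2 * \<rho>\<^sup>2 \<le> core_volume N \<rho>" "core_volume N \<rho> \<le> 2 * pi\<^sup>2 * \<rho>\<^sup>2 / (1 - \<rho>\<^sup>2 / 2)"
proof -
  have s: "sig 1 x = (2 - 2 * cos (x $ 1 - pi)) + (2 - 2 * cos (x $ 2 - pi))" for x
    by (simp add: sig_def cos_diff)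
  have \<rho>2: "\<rho>\<^sup>2 \<le> (1 / 2)\<^sup>2" using \<rho> by (intro power_mono) auto
  then have \<rho>4: "\<rho>\<^sup>2 \<le> 1 / 4" by (simp add: power2_eq_square)
  have "2 * pi\<^sup>2 * \<rho>\<^sup>2 = measure cell_measure {x. (x $ 1 - pi)\<^sup>2 + (x $ 2 - pi)\<^sup>2 \<le> \<rho>\<^sup>2}"
    using measure_cylinder[of \<rho>] \<rho> pi_gt3 by simp
  also have "\<dots> \<le> core_volume 1 \<rho>"
    unfolding core_volume_def
  proof (rule cellM.finite_measure_mono)
    show "{x :: real^3. (x $ 1 - pi)\<^sup>2 + (x $ 2 - pi)\<^sup>2 \<le> \<rho>\<^sup>2} \<subseteq> {x. sig 1 x \<le> \<rho>\<^sup>2}"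
    proof clarify
      fix x :: "real^3" assume "(x $ 1 - pi)\<^sup>2 + (x $ 2 - pi)\<^sup>2 \<le> \<rho>\<^sup>2"
      then show "sig 1 x \<le> \<rho>\<^sup>2"
        using two_minus_cos_upper[of "x $ 1 - pi"] two_minus_cos_upper[of "x $ 2 - pi"] unfolding s by linarith
    qed
  qed simp
  finally show "2 * pi\<^sup>2 * \<rho>\<^sup>2 \<le> core_volume N \<rho>" by (simp add: core_volume_scale[OF N])
  define t where "t = sqrt (\<rho>\<^sup>2 / (1 - \<rho>\<^sup>2 / 2))"
  have d: "1 - \<rho>\<^sup>2 / 2 > 0" using \<rho>4 by linarith
  have t2: "t\<^sup>2 = \<rho>\<^sup>2 / (1 - \<rho>\<^sup>2 / 2)" using d by (simp add: t_def)
  have t0: "0 \<le> t" using d by (simp add: t_def)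
  have "t\<^sup>2 \<le> 1" unfolding t2 using \<rho>4 d by (simp add: divide_le_eq)
  then have "t \<le> 1" using power2_le_imp_le[of t 1] by simp
  then have tpi: "t < pi" using pi_gt3 by linarith
  have "core_volume 1 \<rho> = measure cell_measure {x. x \<in> cell \<and> sig 1 x \<le> \<rho>\<^sup>2}"
    unfolding core_volume_def
    by (rule cellM.finite_measure_eq_AE) (use AE_in_cell in \<open>auto elim: eventually_mono\<close>)
  also have "\<dots> \<le> measure cell_measure {x. (x $ 1 - pi)\<^sup>2 + (x $ 2 - pi)\<^sup>2 \<le> t\<^sup>2}"
  proof (rule cellM.finite_measure_mono)
    show "{x. x \<in> cell \<and> sig 1 x \<le> \<rho>\<^sup>2} \<subseteq> {x :: real^3. (x $ 1 - pi)\<^sup>2 + (x $ 2 - pi)\<^sup>2 \<le> t\<^sup>2}"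
    proof clarify
      fix x assume x: "x \<in> cell" "sig 1 x \<le> \<rho>\<^sup>2"
      define a b where "a = x $ 1 - pi" and "b = x $ 2 - pi"
      have pi: "\<bar>a\<bar> \<le> pi" "\<bar>b\<bar> \<le> pi" using x(1) by (auto simp: cell_def a_def b_def abs_le_iff less_imp_le)
      have ab: "(2 - 2 * cos a) + (2 - 2 * cos b) \<le> \<rho>\<^sup>2" using x(2) unfolding s a_def b_def .
      \<comment> \<open>The crude bound is fed back into the sharp one: from
        \<open>a^2 \<le> 6 \<rho>^2\<close> the factor \<open>1 - a^2 / 12\<close> is at least
        \<open>1 - \<rho>^2 / 2\<close>.\<close>
      have ab6: "a\<^sup>2 / 6 \<le> \<rho>\<^sup>2" "b\<^sup>2 / 6 \<le> \<rho>\<^sup>2"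
        using two_minus_cos_lower_6[OF pi(1)] two_minus_cos_lower_6[OF pi(2)] ab
          zero_le_power2[of a] zero_le_power2[of b] by linarith+
      have "a\<^sup>2 * (1 - \<rho>\<^sup>2 / 2) \<le> a\<^sup>2 * (1 - a\<^sup>2 / 12)" "b\<^sup>2 * (1 - \<rho>\<^sup>2 / 2) \<le> b\<^sup>2 * (1 - b\<^sup>2 / 12)"
        using ab6 by (auto intro!: mult_left_mono)
      then have "(a\<^sup>2 + b\<^sup>2) * (1 - \<rho>\<^sup>2 / 2) \<le> \<rho>\<^sup>2"
        using two_minus_cos_lower[OF pi(1)] two_minus_cos_lower[OF pi(2)] ab by (simp add: distrib_right)
      then show "(x $ 1 - pi)\<^sup>2 + (x $ 2 - pi)\<^sup>2 \<le> t\<^sup>2"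
        unfolding t2 a_def[symmetric] b_def[symmetric] using d by (simp add: pos_le_divide_eq)
    qed
  qed (auto intro!: borel_closed closed_Collect_le continuous_intros)
  also have "\<dots> = 2 * pi\<^sup>2 * \<rho>\<^sup>2 / (1 - \<rho>\<^sup>2 / 2)"
    using measure_cylinder[OF t0 tpi] by (simp add: t2)
  finally show "core_volume N \<rho> \<le> 2 * pi\<^sup>2 * \<rho>\<^sup>2 / (1 - \<rho>\<^sup>2 / 2)" by (simp add: core_volume_scale[OF N])
qed

text \<open>As \<open>sig\<close> is at least one sixth of the squared scaled distance to the axis,
  any factor above the root of 6 works; 3 is one.\<close>

lemma core_subset_fibers:
  assumes N: "N \<ge> 1" and r: "r > 0" and \<rho>: "0 < \<rho>" "\<rho> \<le> r / 3" and x: "x \<in> cell" "sig N x \<le> \<rho>\<^sup>2"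
  shows "x \<in> fibers (1 / real N) r"
proof -
  have N0: "real N > 0" using N by simp
  \<comment> \<open>Index of the microscopic cell containing \<open>x\<close>; \<open>y\<close> is
    the scaled displacement from the fiber axis at its centre.\<close>
  define k where "k i = \<lfloor>real N * x $ i / (2 * pi)\<rfloor>" for i
  define y where "y i = real N * x $ i - (2 * pi * of_int (k i) + pi)" for i
  have y: "\<bar>y i\<bar> \<le> pi" for i
  proof -
    have "of_int (k i) \<le> real N * x $ i / (2 * pi)" "real N * x $ i / (2 * pi) < of_int (k i) + 1"
      by (auto simp: k_def)
    then have "2 * pi * of_int (k i) \<le> real N * x $ i" "real N * x $ i < 2 * pi * (of_int (k i) + 1)"
      by (auto simp: field_simps)
    then show ?thesis by (simp add: y_def abs_le_iff algebra_simps)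
  qed
  have k0: "0 \<le> k i" for i
    using x(1) N0 by (auto simp: k_def cell_def less_imp_le)
  have k1: "k i \<le> int N - 1" for i
  proof -
    have "real N * x $ i / (2 * pi) < real N" using x(1) N0 by (auto simp: cell_def field_simps)
    then have "k i < int N" unfolding k_def by (simp add: floor_less_iff)
    then show ?thesis by simp
  qed
  have c: "cos (real N * x $ i) = - cos (y i)" for i
  proof -
    have "real N * x $ i = (y i + pi) + 2 * of_int (k i) * pi" by (simp add: y_def)
    then show ?thesis using cos_int_2pin[of "k i"] sin_int_2pin[of "k i"]
      by (simp add: cos_add[of "y i + pi"] mult_ac)
  qed
  have "(y 1)\<^sup>2 / 6 + (y 2)\<^sup>2 / 6 \<le> \<rho>\<^sup>2"
    using two_minus_cos_lower_6[OF y[of 1]] two_minus_cos_lower_6[OF y[of 2]] x(2) unfolding sig_def c by linarith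
  moreover have "\<rho>\<^sup>2 \<le> (r / 3)\<^sup>2" using \<rho> by (intro power_mono) auto
  moreover have "(r / 3)\<^sup>2 * 6 \<le> r\<^sup>2" by (simp add: power_divide)
  ultimately have yr: "(y 1)\<^sup>2 + (y 2)\<^sup>2 \<le> r\<^sup>2" by linarith
  have e: "x $ i - (2 * pi * real (nat (k i)) * (1 / real N) + pi * (1 / real N)) = y i / real N" for i
    using N0 k0[of i] by (simp add: y_def field_simps)
  have "((y 1) / real N)\<^sup>2 + (y 2 / real N)\<^sup>2 \<le> (1 / real N * r)\<^sup>2"
    using divide_right_mono[OF yr, of "(real N)\<^sup>2"] by (simp add: power_divide add_divide_distrib)
  moreover have "real (nat (k i)) \<le> 1 / (1 / real N) - 1" for i
  proof -
    have "real_of_int (k i) \<le> real_of_int (int N - 1)" using k1[of i] by (simp only: of_int_le_iff)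
    then show ?thesis using k0[of i] by simp
  qed
  ultimately have "real (nat (k 1)) \<le> 1 / (1 / real N) - 1 \<and> real (nat (k 2)) \<le> 1 / (1 / real N) - 1 \<and>
     (x $ 1 - (2 * pi * real (nat (k 1)) * (1 / real N) + pi * (1 / real N)))\<^sup>2 +
     (x $ 2 - (2 * pi * real (nat (k 2)) * (1 / real N) + pi * (1 / real N)))\<^sup>2 \<le> (1 / real N * r)\<^sup>2"
    by (simp only: e)
  then show ?thesis
    unfolding fibers_def using x(1) by blast
qed

text \<open>The upper bound \<open>2 - 2 cos y \<le> y^2\<close> carries no constant, so the radius
  \<open>r\<close> corresponds to the level \<open>r^2\<close> itself.\<close>

lemma fibers_subset_core:
  assumes N: "N \<ge> 1" and x: "x \<in> fibers (1 / real N) r"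
  shows "sig N x \<le> r\<^sup>2"
proof -
  have N0: "real N > 0" using N by simp
  obtain k1 k2 :: nat where k: "(x $ 1 - (2 * pi * real k1 * (1 / real N) + pi * (1 / real N)))\<^sup>2 +
     (x $ 2 - (2 * pi * real k2 * (1 / real N) + pi * (1 / real N)))\<^sup>2 \<le> (1 / real N * r)\<^sup>2"
    using x unfolding fibers_def by blast
  define a where "a = real N * x $ 1 - (2 * pi * real k1 + pi)"
  define b where "b = real N * x $ 2 - (2 * pi * real k2 + pi)"
  have e: "x $ 1 - (2 * pi * real k1 * (1 / real N) + pi * (1 / real N)) = a / real N"
    "x $ 2 - (2 * pi * real k2 * (1 / real N) + pi * (1 / real N)) = b / real N"
    using N0 by (simp_all add: a_def b_def field_simps)
  have "(a\<^sup>2 + b\<^sup>2) / (real N)\<^sup>2 \<le> r\<^sup>2 / (real N)\<^sup>2"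
    using k unfolding e by (simp add: power_divide add_divide_distrib)
  then have ab: "a\<^sup>2 + b\<^sup>2 \<le> r\<^sup>2" using N0 by (simp add: divide_le_cancel)
  have c: "cos (2 * pi * real q + pi + z) = - cos z" for q :: nat and z :: real
  proof -
    have "2 * pi * real q + pi + z = (z + pi) + 2 * pi * of_int (int q)" by simp
    then have "cos (2 * pi * real q + pi + z) = cos ((z + pi) + 2 * pi * of_int (int q))" by (simp only:)
    also have "\<dots> = - cos z" unfolding cos_add[of "z + pi"] cos_int_2pin sin_int_2pin by simp
    finally show ?thesis .
  qed
  have "cos (real N * x $ 1) = - cos a" "cos (real N * x $ 2) = - cos b"
    using c[of k1 a] c[of k2 b] by (simp_all add: a_def b_def)
  then have "sig N x = (2 - 2 * cos a) + (2 - 2 * cos b)" by (simp add: sig_def)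
  then show ?thesis using two_minus_cos_upper[of a] two_minus_cos_upper[of b] ab by linarith
qed

text \<open>Distinct lattice translates of the open cell are disjoint, so a point of the cell can
  only meet the untranslated fibers.\<close>

lemma conductivity_on_cell: "x \<in> cell \<Longrightarrow> conductivity \<epsilon> r b x = (if x \<in> fibers \<epsilon> r then b else 1)"
proof -
  assume x: "x \<in> cell"
  have "(\<exists>k :: int^3. x - shift k \<in> fibers \<epsilon> r) \<longleftrightarrow> x \<in> fibers \<epsilon> r"
  proof
    assume "\<exists>k :: int^3. x - shift k \<in> fibers \<epsilon> r"
    then obtain k :: "int^3" where k: "x - shift k \<in> fibers \<epsilon> r" by blast
    have "k $ i = 0" for i
    proof -
      have "0 < x $ i - 2 * pi * of_int (k $ i)" "x $ i - 2 * pi * of_int (k $ i) < 2 * pi"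
        using k by (auto simp: fibers_def cell_def)
      moreover have "0 < x $ i" "x $ i < 2 * pi" using x by (auto simp: cell_def)
      ultimately have "2 * pi * of_int (k $ i) < 2 * pi * 1" "2 * pi * (- 1) < 2 * pi * of_int (k $ i)" by linarith+
      moreover have "(0 :: real) < 2 * pi" by simp
      ultimately have "of_int (k $ i) < (1 :: real)" "(- 1 :: real) < of_int (k $ i)"
        by (metis mult_less_cancel_left_pos)+
      then show ?thesis by linarith
    qed
    then have "k = 0" by (simp add: vec_eq_iff)
    then show "x \<in> fibers \<epsilon> r" using k by simp
  next
    assume "x \<in> fibers \<epsilon> r"
    then have "x - shift 0 \<in> fibers \<epsilon> r" by simp
    then show "\<exists>k :: int^3. x - shift k \<in> fibers \<epsilon> r" by blast
  qed
  then show ?thesis by (simp add: conductivity_def shift_def)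
qed

lemma fibers_measurable [measurable]: "fibers \<epsilon> r \<in> sets borel"
proof -
  have "fibers \<epsilon> r = cell \<inter> (\<Union>k1 :: nat. \<Union>k2 :: nat. {x. real k1 \<le> 1 / \<epsilon> - 1 \<and> real k2 \<le> 1 / \<epsilon> - 1 \<and>
     (x $ 1 - (2 * pi * real k1 * \<epsilon> + pi * \<epsilon>))\<^sup>2 + (x $ 2 - (2 * pi * real k2 * \<epsilon> + pi * \<epsilon>))\<^sup>2 \<le> (\<epsilon> * r)\<^sup>2})"
    by (auto simp: fibers_def)
  also have "\<dots> \<in> sets borel" by measurable
  finally show ?thesis .
qed

lemma conductivity_measurable [measurable]: "conductivity \<epsilon> r b \<in> borel_measurable borel"
proof -
  have "conductivity \<epsilon> r b = (\<lambda>x. if x \<in> (\<Union>k :: int^3. (\<lambda>x. x - shift k) -` fibers \<epsilon> r) then b else 1)"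
    by (auto simp: conductivity_def shift_def fun_eq_iff)
  moreover have "(\<lambda>x. x - shift k) -` fibers \<epsilon> r \<in> sets borel" for k
  proof -
    have "(\<lambda>x :: real^3. x - shift k) \<in> borel_measurable borel" by measurable
    from measurable_sets[OF this fibers_measurable] show ?thesis by simp
  qed
  then have [measurable]: "(\<Union>k :: int^3. (\<lambda>x. x - shift k) -` fibers \<epsilon> r) \<in> sets borel"
    by (intro sets.countable_UN) auto
  ultimately show ?thesis by simp
qed

section \<open>Integrals of the corrector, of the flux and of its divergence\<close>

context
  fixes N :: nat and \<rho> :: real
  assumes N: "N \<ge> 1" and \<rho>: "0 < \<rho>" "\<rho> \<le> 1 / 2" and level: "AE x in lborel. sig N x \<noteq> \<rho>\<^sup>2"
begin

lemma \<rho>1: "\<rho> < 1" using \<rho> by simp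

lemmas geo = N \<rho>(1) \<rho>1 level

lemma indicator_core_integrable: "integrable cell_measure (\<lambda>x. c * indicator {x. sig N x \<le> \<rho>\<^sup>2} x :: real)"
  by (intro Bochner_Integration.integrable_mult_right integrable_real_indicator) (auto simp: cellM.emeasure_finite less_top[symmetric])

text \<open>On the tubes \<open>core\<close> lies between \<open>4 - \<rho>^2\<close> and 4 times
  the scale \<open>q\<close>. Since \<open>q\<close> contains \<open>1 / \<rho>^2\<close> and the
  volume of the tubes is of order \<open>\<rho>^2\<close>, the powers of the radius cancel and the
  ratio \<open>N^2 / - ln \<rho>\<close> remains.\<close>

lemma integral_core_bounds:
  "(4 - \<rho>\<^sup>2) * pi\<^sup>2 * ((real N)\<^sup>2 / - ln \<rho>) \<le> (\<integral>x. core N \<rho> x \<partial>cell_measure)"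
  "(\<integral>x. core N \<rho> x \<partial>cell_measure) \<le> 4 * pi\<^sup>2 * ((real N)\<^sup>2 / - ln \<rho>) / (1 - \<rho>\<^sup>2 / 2)"
proof -
  define q where "q = (real N)\<^sup>2 / (2 * - ln \<rho> * \<rho>\<^sup>2)"
  have L: "- ln \<rho> > 0" by (rule minus_ln_pos[OF geo])
  have q: "q \<ge> 0" unfolding q_def using L by (intro divide_nonneg_nonneg mult_nonneg_nonneg) auto
  have r2: "\<rho>\<^sup>2 > 0" using \<rho> by simp
  have vol: "(\<integral>x. c * indicator {x. sig N x \<le> \<rho>\<^sup>2} x \<partial>cell_measure) = c * core_volume N \<rho>" for c :: real
    by (simp add: core_volume_def)
  have c: "core N \<rho> x = q * (4 - sig N x) * indicator {x. sig N x \<le> \<rho>\<^sup>2} x" for x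
    by (simp add: core_def q_def indicator_def)
  have "q * (4 - \<rho>\<^sup>2) * core_volume N \<rho> \<le> (\<integral>x. core N \<rho> x \<partial>cell_measure)"
    unfolding vol[symmetric]
  proof (rule integral_mono[OF indicator_core_integrable core_integrable[OF geo]])
    show "q * (4 - \<rho>\<^sup>2) * indicator {x. sig N x \<le> \<rho>\<^sup>2} x \<le> core N \<rho> x" for x
      unfolding c using q by (auto simp: indicator_def intro!: mult_left_mono)
  qed
  moreover have "q * (4 - \<rho>\<^sup>2) * (2 * pi\<^sup>2 * \<rho>\<^sup>2) \<le> q * (4 - \<rho>\<^sup>2) * core_volume N \<rho>"
  proof (intro mult_left_mono core_volume_bounds N \<rho> mult_nonneg_nonneg q)
    have "\<rho>\<^sup>2 \<le> 1" using \<rho> by (simp add: power_le_one)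
    then show "0 \<le> 4 - \<rho>\<^sup>2" by simp
  qed
  moreover have "q * (4 - \<rho>\<^sup>2) * (2 * pi\<^sup>2 * \<rho>\<^sup>2) = (4 - \<rho>\<^sup>2) * pi\<^sup>2 * ((real N)\<^sup>2 / - ln \<rho>)"
    using L r2 by (simp add: q_def field_simps)
  ultimately show "(4 - \<rho>\<^sup>2) * pi\<^sup>2 * ((real N)\<^sup>2 / - ln \<rho>) \<le> (\<integral>x. core N \<rho> x \<partial>cell_measure)" by linarith
  have "(\<integral>x. core N \<rho> x \<partial>cell_measure) \<le> q * 4 * core_volume N \<rho>"
    unfolding vol[symmetric]
  proof (rule integral_mono[OF core_integrable[OF geo] indicator_core_integrable])
    show "core N \<rho> x \<le> q * 4 * indicator {x. sig N x \<le> \<rho>\<^sup>2} x" for x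
      unfolding c using q sig_bounds(1)[of N x] by (auto simp: indicator_def intro!: mult_left_mono)
  qed
  also have "\<dots> \<le> q * 4 * (2 * pi\<^sup>2 * \<rho>\<^sup>2 / (1 - \<rho>\<^sup>2 / 2))"
    using q by (intro mult_left_mono core_volume_bounds N \<rho>) auto
  also have "\<dots> = 4 * pi\<^sup>2 * ((real N)\<^sup>2 / - ln \<rho>) / (1 - \<rho>\<^sup>2 / 2)"
    using L r2 by (simp add: q_def)
  finally show "(\<integral>x. core N \<rho> x \<partial>cell_measure) \<le> 4 * pi\<^sup>2 * ((real N)\<^sup>2 / - ln \<rho>) / (1 - \<rho>\<^sup>2 / 2)" .
qed

lemma flux_core_bound:
  assumes "sig N x \<le> \<rho>\<^sup>2"
  shows "(\<Sum>j\<in>UNIV. (flux N \<rho> j x)\<^sup>2) \<le> (real N / (- ln \<rho> * \<rho>))\<^sup>2"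
proof -
  have L: "- ln \<rho> > 0" by (rule minus_ln_pos[OF geo])
  have m: "msig N \<rho> x = \<rho>\<^sup>2" using assms by (simp add: msig_def)
  have "(\<Sum>j\<in>UNIV. (flux N \<rho> j x)\<^sup>2) = (\<Sum>j\<in>UNIV. (dsig N j x)\<^sup>2) * (1 / (2 * - ln \<rho> * \<rho>\<^sup>2))\<^sup>2"
    unfolding flux_def m power_mult_distrib sum_distrib_right ..
  also have "\<dots> \<le> (4 * (real N)\<^sup>2 * \<rho>\<^sup>2) * (1 / (2 * - ln \<rho> * \<rho>\<^sup>2))\<^sup>2"
  proof (intro mult_right_mono)
    have "4 * (real N)\<^sup>2 * sig N x \<le> 4 * (real N)\<^sup>2 * \<rho>\<^sup>2" using assms by (intro mult_left_mono) auto
    then show "(\<Sum>j\<in>UNIV. (dsig N j x)\<^sup>2) \<le> 4 * (real N)\<^sup>2 * \<rho>\<^sup>2" using sum_dsig_sq_le[of N x] by linarith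
  qed auto
  also have "\<dots> = (real N / (- ln \<rho> * \<rho>))\<^sup>2"
  proof -
    have "(4 * n\<^sup>2 * r\<^sup>2) * (1 / (2 * l * r\<^sup>2))\<^sup>2 = (n / (l * r))\<^sup>2" if "l > 0" "r > 0" for l r n :: real
      using that by (simp add: power2_eq_square field_simps)
    from this[OF L \<rho>(1)] show ?thesis .
  qed
  finally show ?thesis .
qed

lemma flux_sq_integrable: "integrable cell_measure (\<lambda>x. (flux N \<rho> j x)\<^sup>2)"
proof (rule bounded_integrable[OF geo, where B="(2 * real N * (1 / (2 * - ln \<rho> * \<rho>\<^sup>2)))\<^sup>2"])
  show "\<bar>(flux N \<rho> j x)\<^sup>2\<bar> \<le> (2 * real N * (1 / (2 * - ln \<rho> * \<rho>\<^sup>2)))\<^sup>2" for x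
    using power_mono[OF flux_bound[OF geo, of j x], of 2] by simp
qed (use flux_measurable[OF geo] in measurable)

lemma dcorr_sq_integrable: "integrable cell_measure (\<lambda>x. (dcorr N \<rho> j x)\<^sup>2)"
proof (rule Bochner_Integration.integrable_bound[OF flux_sq_integrable[of j]])
  show "AE x in cell_measure. norm ((dcorr N \<rho> j x)\<^sup>2) \<le> norm ((flux N \<rho> j x)\<^sup>2)"
    by (intro AE_I2) (auto simp: dcorr_def)
qed (use dcorr_measurable[OF geo] in measurable)

text \<open>The second term is the price of extending the flux into the tubes. With a tube volume of
  order \<open>\<rho>^2\<close> it is of order \<open>(N / - ln \<rho>)^2\<close>, one logarithm
  smaller than the first term.\<close>

lemma integral_flux_sq:
  "(\<Sum>j\<in>UNIV. \<integral>x. (flux N \<rho> j x)\<^sup>2 \<partial>cell_measure) \<le>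
     (1 + ln 8 / (2 * - ln \<rho>)) * (\<integral>x. core N \<rho> x \<partial>cell_measure)
     + (real N / (- ln \<rho> * \<rho>))\<^sup>2 * core_volume N \<rho>"
proof -
  have "(\<Sum>j\<in>UNIV. \<integral>x. (flux N \<rho> j x)\<^sup>2 \<partial>cell_measure) = (\<integral>x. (\<Sum>j\<in>UNIV. (flux N \<rho> j x)\<^sup>2) \<partial>cell_measure)"
    by (intro Bochner_Integration.integral_sum[symmetric] flux_sq_integrable)
  also have "\<dots> \<le> (\<integral>x. (\<Sum>j\<in>UNIV. (dcorr N \<rho> j x)\<^sup>2) + (real N / (- ln \<rho> * \<rho>))\<^sup>2 * indicator {x. sig N x \<le> \<rho>\<^sup>2} x \<partial>cell_measure)"
  proof (rule integral_mono)
    show "(\<Sum>j\<in>UNIV. (flux N \<rho> j x)\<^sup>2) \<le> (\<Sum>j\<in>UNIV. (dcorr N \<rho> j x)\<^sup>2) + (real N / (- ln \<rho> * \<rho>))\<^sup>2 * indicator {x. sig N x \<le> \<rho>\<^sup>2} x" for x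
      using flux_core_bound[of x] by (cases "sig N x \<le> \<rho>\<^sup>2") (simp_all add: dcorr_def)
  qed (intro Bochner_Integration.integrable_add Bochner_Integration.integrable_sum flux_sq_integrable dcorr_sq_integrable indicator_core_integrable)+
  also have "\<dots> = (\<integral>x. (\<Sum>j\<in>UNIV. (dcorr N \<rho> j x)\<^sup>2) \<partial>cell_measure) + (\<integral>x. (real N / (- ln \<rho> * \<rho>))\<^sup>2 * indicator {x. sig N x \<le> \<rho>\<^sup>2} x \<partial>cell_measure)"
    by (intro Bochner_Integration.integral_add Bochner_Integration.integrable_sum dcorr_sq_integrable indicator_core_integrable)
  also have "(\<integral>x. (\<Sum>j\<in>UNIV. (dcorr N \<rho> j x)\<^sup>2) \<partial>cell_measure) = (\<Sum>j\<in>UNIV. \<integral>x. (dcorr N \<rho> j x)\<^sup>2 \<partial>cell_measure)"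
    by (intro Bochner_Integration.integral_sum dcorr_sq_integrable)
  also have "(\<integral>x. (real N / (- ln \<rho> * \<rho>))\<^sup>2 * indicator {x. sig N x \<le> \<rho>\<^sup>2} x \<partial>cell_measure) = (real N / (- ln \<rho> * \<rho>))\<^sup>2 * core_volume N \<rho>"
    by (simp add: core_volume_def)
  finally show ?thesis using integral_dcorr_sq[OF geo] by linarith
qed

lemma flux_integrable: "integrable cell_measure (flux N \<rho> j)"
  by (rule bounded_integrable[OF geo flux_measurable[OF geo] flux_bound[OF geo]])

text \<open>The gradient of the periodic corrector has zero mean, so only the extension into the
  tubes contributes.\<close>

lemma integral_flux: "\<bar>\<integral>x. flux N \<rho> j x \<partial>cell_measure\<bar> \<le> real N / (- ln \<rho> * \<rho>) * core_volume N \<rho>"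
proof -
  have dcorr_int: "integrable cell_measure (dcorr N \<rho> j)"
    by (rule Bochner_Integration.integrable_bound[OF flux_integrable[of j]])
      (use dcorr_measurable[OF geo] in \<open>auto simp: dcorr_def\<close>)
  have "(\<integral>x. flux N \<rho> j x \<partial>cell_measure) = (\<integral>x. flux N \<rho> j x - dcorr N \<rho> j x \<partial>cell_measure)"
    using flux_integrable dcorr_int integral_dcorr[OF geo, of j] by simp
  also have "\<bar>\<dots>\<bar> \<le> (\<integral>x. \<bar>flux N \<rho> j x - dcorr N \<rho> j x\<bar> \<partial>cell_measure)"
    by (rule integral_abs_bound)
  also have "\<dots> \<le> (\<integral>x. real N / (- ln \<rho> * \<rho>) * indicator {x. sig N x \<le> \<rho>\<^sup>2} x \<partial>cell_measure)"
  proof (rule integral_mono)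
    show "\<bar>flux N \<rho> j x - dcorr N \<rho> j x\<bar> \<le> real N / (- ln \<rho> * \<rho>) * indicator {x. sig N x \<le> \<rho>\<^sup>2} x" for x
    proof (cases "sig N x \<le> \<rho>\<^sup>2")
      case True
      have "(flux N \<rho> j x)\<^sup>2 \<le> (\<Sum>j\<in>UNIV. (flux N \<rho> j x)\<^sup>2)" by (rule member_le_sum) auto
      then have "\<bar>flux N \<rho> j x\<bar>\<^sup>2 \<le> (real N / (- ln \<rho> * \<rho>))\<^sup>2" using flux_core_bound[OF True] by simp
      moreover have "0 \<le> real N / (- ln \<rho> * \<rho>)" using minus_ln_pos[OF geo] \<rho> by (intro divide_nonneg_nonneg mult_nonneg_nonneg) auto
      ultimately have "\<bar>flux N \<rho> j x\<bar> \<le> real N / (- ln \<rho> * \<rho>)" by (rule power2_le_imp_le)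
      then show ?thesis using True by (simp add: dcorr_def)
    qed (simp add: dcorr_def)
  qed (auto intro!: integrable_abs Bochner_Integration.integrable_diff flux_integrable dcorr_int indicator_core_integrable)
  also have "\<dots> = real N / (- ln \<rho> * \<rho>) * core_volume N \<rho>" by (simp add: core_volume_def)
  finally show ?thesis .
qed

text \<open>Off the tubes of radius \<open>t\<close>, \<open>ln (sig / \<rho>^2)\<close> exceeds
  \<open>2 ln t - 2 ln \<rho>\<close>. The intermediate radius \<open>t\<close> is left free, to be
  chosen so that both the excluded volume and \<open>ln t / - ln \<rho>\<close> tend to
  zero.\<close>

lemma integral_corr_sq:
  assumes t: "\<rho> \<le> t" "t \<le> 1 / 2" "0 \<le> 1 + ln t / - ln \<rho>"
  shows "(1 + ln t / - ln \<rho>)\<^sup>2 * ((2 * pi) ^ 3 - core_volume N t) \<le> (\<integral>x. (corr N \<rho> x)\<^sup>2 \<partial>cell_measure)"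
proof -
  have L: "- ln \<rho> > 0" by (rule minus_ln_pos[OF geo])
  let ?S = "{x. sig N x \<le> t\<^sup>2}"
  have "measure cell_measure (UNIV - ?S) = measure cell_measure UNIV - measure cell_measure ?S"
    using cellM.finite_measure_compl[of ?S] by simp
  then have "(1 + ln t / - ln \<rho>)\<^sup>2 * ((2 * pi) ^ 3 - core_volume N t) = (\<integral>x. (1 + ln t / - ln \<rho>)\<^sup>2 * indicator (UNIV - ?S) x \<partial>cell_measure)"
    by (simp add: core_volume_def measure_cell_measure del: power_mult_distrib)
  also have "\<dots> \<le> (\<integral>x. (corr N \<rho> x)\<^sup>2 \<partial>cell_measure)"
  proof (rule integral_mono)
    show "integrable cell_measure (\<lambda>x. (1 + ln t / - ln \<rho>)\<^sup>2 * indicator (UNIV - ?S) x :: real)"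
      by (intro Bochner_Integration.integrable_mult_right integrable_real_indicator) (auto simp: cellM.emeasure_finite less_top[symmetric])
    show "integrable cell_measure (\<lambda>x. (corr N \<rho> x)\<^sup>2)"
    proof (rule bounded_integrable[OF geo, where B="(1 + ln 8 / (2 * - ln \<rho>))\<^sup>2"])
      show "\<bar>(corr N \<rho> x)\<^sup>2\<bar> \<le> (1 + ln 8 / (2 * - ln \<rho>))\<^sup>2" for x
        using power_mono[OF corr_bounds(2)[OF geo, of x] corr_bounds(1)[OF geo, of x], of 2] by simp
    qed (use corr_measurable[OF geo] in measurable)
    show "(1 + ln t / - ln \<rho>)\<^sup>2 * indicator (UNIV - ?S) x \<le> (corr N \<rho> x)\<^sup>2" for x
    proof (cases "sig N x \<le> t\<^sup>2")
      case False
      have tp: "t > 0" using \<rho> t by simp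
      have "\<rho>\<^sup>2 \<le> t\<^sup>2" using \<rho> t by (intro power_mono) auto
      then have m: "msig N \<rho> x = sig N x" using False by (simp add: msig_def)
      have "ln (t\<^sup>2 / \<rho>\<^sup>2) \<le> ln (msig N \<rho> x / \<rho>\<^sup>2)"
        unfolding m using False tp \<rho> by (intro ln_mono divide_right_mono divide_pos_pos) auto
      moreover have "ln (t\<^sup>2 / \<rho>\<^sup>2) = 2 * ln t + 2 * - ln \<rho>" using tp \<rho> by (simp add: ln_div ln_realpow)
      ultimately have "(2 * ln t + 2 * - ln \<rho>) / (2 * - ln \<rho>) \<le> corr N \<rho> x"
        unfolding corr_def using L by (intro divide_right_mono) auto
      also have "(2 * ln t + 2 * - ln \<rho>) / (2 * - ln \<rho>) = 1 + ln t / - ln \<rho>" using L by (simp add: field_simps)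
      finally have "(1 + ln t / - ln \<rho>)\<^sup>2 \<le> (corr N \<rho> x)\<^sup>2" using t(3) by (intro power_mono)
      then show ?thesis using False by simp
    qed simp
  qed
  finally show ?thesis .
qed

end

section \<open>Oscillating weights\<close>

text \<open>Each off-diagonal term carries a nonzero frequency \<open>k - l\<close> below
  \<open>N\<close> and vanishes by \<open>cell_inv_oscillation\<close>; every diagonal term sees the
  mean of the weight.\<close>

lemma ip_weighted_ftrig:
  fixes u :: "real^3 \<Rightarrow> real"
  assumes inv: "cell_inv N u" and u [measurable]: "u \<in> borel_measurable borel" and bd: "\<And>x. \<bar>u x\<bar> \<le> B"
    and A: "finite A" and A': "finite A'" and small: "\<And>k l i. k \<in> A \<Longrightarrow> l \<in> A' \<Longrightarrow> \<bar>k $ i - l $ i\<bar> < int N"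
  shows "ip (\<lambda>x. of_real (u x) * ftrig \<eta> A c x) (ftrig \<eta> A' c') =
    of_real ((\<integral>x. u x \<partial>cell_measure) / (2 * pi) ^ 3) * ip (ftrig \<eta> A c) (ftrig \<eta> A' c')"
proof -
  define m where "m = complex_of_real ((\<integral>x. u x \<partial>cell_measure) / (2 * pi) ^ 3)"
  have uek: "(\<lambda>x. of_real (u x) * ek \<eta> k x) \<in> cell_L2" for k
    by (rule cell_L2_mult_bounded[OF ek_L2, where B=B]) (auto simp: bd)
  have kl: "ip (\<lambda>x. of_real (u x) * ek \<eta> k x) (ek \<eta> l) = m * ip (ek \<eta> k) (ek \<eta> l)" if "k \<in> A" "l \<in> A'" for k l
  proof -
    have "ip (\<lambda>x. of_real (u x) * ek \<eta> k x) (ek \<eta> l) = of_real (1 / (2 * pi) ^ 3) * (\<integral>x. of_real (u x) * pexp (ivec (k - l)) x \<partial>cell_measure)"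
      unfolding ip_def mult.assoc ek_mult_cnj by (subst Bochner_Integration.integral_mult_right_zero[symmetric]) (simp only: mult_ac)
    also have "\<dots> = m * ip (ek \<eta> k) (ek \<eta> l)"
    proof (cases "k = l")
      case True
      have "ivec 0 = 0" by (simp add: vec_eq_iff)
      then show ?thesis using True by (simp add: ip_ek_ek m_def)
    next
      case False
      have "cell_inv N (\<lambda>x. complex_of_real (u x))" using inv by (simp add: cell_inv_def)
      then have "(\<integral>x. of_real (u x) * pexp (ivec (k - l)) x \<partial>cell_measure) = 0"
        by (rule cell_inv_oscillation[where B=B]) (use False small[OF that] bd in auto)
      then show ?thesis using False by (simp add: ip_ek_ek)
    qed
    finally show ?thesis .
  qed
  have "ip (\<lambda>x. of_real (u x) * ftrig \<eta> A c x) (ftrig \<eta> A' c') = ip (\<lambda>x. \<Sum>k\<in>A. c k * (of_real (u x) * ek \<eta> k x)) (\<lambda>x. \<Sum>l\<in>A'. c' l * ek \<eta> l x)"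
    unfolding ftrig_def[abs_def] by (simp add: sum_distrib_left mult_ac)
  also have "\<dots> = (\<Sum>k\<in>A. \<Sum>l\<in>A'. c k * (cnj (c' l) * ip (\<lambda>x. of_real (u x) * ek \<eta> k x) (ek \<eta> l)))"
    by (subst ip_sum_left) (auto simp: ip_sum_right ip_scale_left ip_scale_right cell_L2_scale uek cell_L2_sum sum_distrib_left)
  also have "\<dots> = m * (\<Sum>k\<in>A. \<Sum>l\<in>A'. c k * (cnj (c' l) * ip (ek \<eta> k) (ek \<eta> l)))"
    unfolding sum_distrib_left by (intro sum.cong refl) (simp only: kl mult_ac)
  also have "(\<Sum>k\<in>A. \<Sum>l\<in>A'. c k * (cnj (c' l) * ip (ek \<eta> k) (ek \<eta> l))) = ip (\<lambda>x. \<Sum>k\<in>A. c k * ek \<eta> k x) (\<lambda>x. \<Sum>l\<in>A'. c' l * ek \<eta> l x)"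
    by (subst ip_sum_left) (auto simp: ip_sum_right ip_scale_left ip_scale_right cell_L2_scale cell_L2_sum sum_distrib_left)
  finally show ?thesis by (simp only: m_def ftrig_def[abs_def])
qed

lemma ip_weight_swap: "ip f (\<lambda>x. of_real (u x) * h x) = ip (\<lambda>x. of_real (u x) * f x) h"
  unfolding ip_def by (simp add: mult_ac)

lemma nrm2_weighted_le:
  fixes u :: "real^3 \<Rightarrow> real"
  assumes "u \<in> borel_measurable borel" "\<And>x. \<bar>u x\<bar> \<le> B" "h \<in> borel_measurable borel" "\<And>x. cmod (h x) \<le> H"
  shows "nrm2 (\<lambda>x. of_real (u x) * h x) \<le> H\<^sup>2 * (\<integral>x. (u x)\<^sup>2 \<partial>cell_measure)"
proof -
  have [measurable]: "u \<in> borel_measurable borel" "h \<in> borel_measurable borel" using assms by auto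
  have "(\<integral>x. (cmod (of_real (u x) * h x))\<^sup>2 \<partial>cell_measure) \<le> (\<integral>x. H\<^sup>2 * (u x)\<^sup>2 \<partial>cell_measure)"
  proof (rule integral_mono)
    have B: "(u x)\<^sup>2 \<le> B\<^sup>2" for x using power_mono[OF assms(2)[of x], of 2] by simp
    show "integrable cell_measure (\<lambda>x. (cmod (of_real (u x) * h x))\<^sup>2)"
      by (rule cell_L2_integrable, rule cell_L2_bounded[where B="B * H"])
        (use assms(2,4) in \<open>auto simp: norm_mult intro!: mult_mono order_trans[OF abs_ge_zero assms(2)]\<close>)
    show "integrable cell_measure (\<lambda>x. H\<^sup>2 * (u x)\<^sup>2)"
      by (intro Bochner_Integration.integrable_mult_right cellM.integrable_const_bound[where B="B\<^sup>2"]) (use B in auto)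
    show "(cmod (of_real (u x) * h x))\<^sup>2 \<le> H\<^sup>2 * (u x)\<^sup>2" for x
    proof -
      have "(cmod (h x))\<^sup>2 * (u x)\<^sup>2 \<le> H\<^sup>2 * (u x)\<^sup>2"
        using assms(4)[of x] by (intro mult_right_mono power_mono) auto
      then show ?thesis by (simp add: norm_mult power_mult_distrib mult.commute)
    qed
  qed
  then show ?thesis by (simp add: nrm2_def)
qed

text \<open>
  A weight that oscillates at scale \<open>1/N\<close> acts in the limit as its mean, because it is exactly
  orthogonal to the low nonzero frequencies.
\<close>

lemma ip_weighted_tendsto:
  fixes u :: "nat \<Rightarrow> real^3 \<Rightarrow> real"
  assumes inv: "\<And>n. cell_inv (N n) (u n)" and u: "\<And>n. u n \<in> borel_measurable borel"
    and bd: "\<And>n x. \<bar>u n x\<bar> \<le> B n" and N: "filterlim N at_top sequentially"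
    and D: "\<forall>\<^sub>F n in sequentially. (\<integral>x. (u n x)\<^sup>2 \<partial>cell_measure) \<le> D"
    and m: "(\<lambda>n. (\<integral>x. u n x \<partial>cell_measure) / (2 * pi) ^ 3) \<longlonglongrightarrow> m"
    and f: "\<And>n. f n \<in> cell_L2" and F: "F \<in> cell_L2" and lim: "(\<lambda>n. nrm2 (\<lambda>x. f n x - F x)) \<longlonglongrightarrow> 0"
  shows "(\<lambda>n. ip (f n) (\<lambda>x. of_real (u n x) * ftrig \<eta> (ibox K) c x)) \<longlonglongrightarrow> of_real m * ip F (ftrig \<eta> (ibox K) c)"
proof -
  define \<phi> where "\<phi> = ftrig \<eta> (ibox K) c"
  define H where "H = (\<Sum>k\<in>ibox K. cmod (c k * of_real (1 / sqrt ((2 * pi) ^ 3))))"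
  have H: "cmod (\<phi> x) \<le> H" for x unfolding \<phi>_def H_def by (rule ftrig_bounded)
  define mm where "mm n = (\<integral>x. u n x \<partial>cell_measure) / (2 * pi) ^ 3" for n
  have \<phi>_L2: "\<phi> \<in> cell_L2" by (simp add: \<phi>_def)
  have u\<phi>: "(\<lambda>x. of_real (u n x) * \<phi> x) \<in> cell_L2" for n
    by (rule cell_L2_mult_bounded[OF \<phi>_L2, where B="B n"]) (use u bd in auto)
  \<comment> \<open>Bound for the weighted polynomial in mean square, uniform in \<open>n\<close>:
    the weights are controlled uniformly through their squares, while the supremum bound
    \<open>B n\<close> may grow.\<close>
  define W where "W = sqrt (H\<^sup>2 * \<bar>D\<bar>)"
  have W0: "W \<ge> 0" by (simp add: W_def)
  have Wb: "\<forall>\<^sub>F n in sequentially. sqrt (nrm2 (\<lambda>x. of_real (u n x) * \<phi> x)) \<le> W"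
    using D
  proof eventually_elim
    case (elim n)
    have "nrm2 (\<lambda>x. of_real (u n x) * \<phi> x) \<le> H\<^sup>2 * (\<integral>x. (u n x)\<^sup>2 \<partial>cell_measure)"
      by (rule nrm2_weighted_le[OF u bd cell_L2_measurable[OF \<phi>_L2] H])
    also have "\<dots> \<le> H\<^sup>2 * \<bar>D\<bar>" using elim by (intro mult_left_mono) auto
    finally show ?case by (simp add: W_def)
  qed
  have main: "(\<lambda>n. ip (f n) (\<lambda>x. of_real (u n x) * \<phi> x) - of_real (mm n) * ip F \<phi>) \<longlonglongrightarrow> 0"
  proof (rule LIMSEQ_I)
    fix e :: real assume e: "e > 0"
    define e' where "e' = (e / (2 * (W + 1)))\<^sup>2"
    have e': "e' > 0" using e W0 by (simp add: e'_def)
    from order_tendstoD(2)[OF Fourier_tendsto[OF F, of \<eta>] e'] obtain M0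
      where M0: "\<forall>M\<ge>M0. nrm2 (\<lambda>x. F x - ftrig \<eta> (ibox M) (fc \<eta> F) x) < e'"
      unfolding eventually_sequentially by blast
    \<comment> \<open>With \<open>M \<ge> K\<close>, passing from \<open>F\<close> to its partial
      sum leaves the product with \<open>\<phi>\<close> unchanged.\<close>
    define M where "M = max M0 K"
    define FM where "FM = ftrig \<eta> (ibox M) (fc \<eta> F)"
    have FM_L2: "FM \<in> cell_L2" by (simp add: FM_def)
    have small: "sqrt t * W < e / 2" if "t < e'" "t \<ge> 0" for t
    proof -
      have "sqrt t < e / (2 * (W + 1))"
        using that e W0 by (intro real_less_lsqrt) (auto simp: e'_def)
      then have "sqrt t * W \<le> e / (2 * (W + 1)) * W" using W0 by (intro mult_right_mono) auto
      also have "\<dots> < e / 2" using e W0 by (simp add: field_simps)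
      finally show ?thesis .
    qed
    have FMs: "nrm2 (\<lambda>x. F x - FM x) < e'" using M0 by (simp add: FM_def M_def)
    have ipFM: "ip FM \<phi> = ip F \<phi>"
    proof -
      have "ip FM \<phi> = (\<Sum>k\<in>ibox K. cnj (c k) * fc \<eta> FM k)"
        unfolding \<phi>_def by (rule ip_ftrig) (simp_all add: FM_L2)
      also have "\<dots> = (\<Sum>k\<in>ibox K. cnj (c k) * fc \<eta> F k)"
        using ibox_mono[of K M] by (intro sum.cong refl) (auto simp: FM_def fc_ftrig M_def)
      also have "\<dots> = ip F \<phi>" unfolding \<phi>_def by (rule ip_ftrig[symmetric]) (simp_all add: F)
      finally show ?thesis .
    qed
    have "\<forall>\<^sub>F n in sequentially. norm (ip (f n) (\<lambda>x. of_real (u n x) * \<phi> x) - of_real (mm n) * ip F \<phi> - 0) < e"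
      using Wb order_tendstoD(2)[OF lim e'] filterlim_at_top[THEN iffD1, OF N, rule_format, of "2 * M + 1"]
    proof eventually_elim
      case (elim n)
      have N2: "\<bar>k $ i - l $ i\<bar> < int (N n)" if "k \<in> ibox M" "l \<in> ibox K" for k l i
      proof -
        have "l \<in> ibox M" using that(2) ibox_mono[of K M] by (auto simp: M_def)
        then have "\<bar>k $ i\<bar> \<le> int M" "\<bar>l $ i\<bar> \<le> int M" using that(1) by (auto simp: ibox_def)
        then show ?thesis using elim(3) by linarith
      qed
      have "ip FM (\<lambda>x. of_real (u n x) * \<phi> x) = of_real (mm n) * ip F \<phi>"
        unfolding ip_weight_swap ipFM[symmetric] mm_def unfolding FM_def \<phi>_def
        by (rule ip_weighted_ftrig[OF inv u bd]) (use N2 in auto)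
      moreover have "ip (f n) (\<lambda>x. of_real (u n x) * \<phi> x) = ip (\<lambda>x. f n x - F x) (\<lambda>x. of_real (u n x) * \<phi> x)
          + ip (\<lambda>x. F x - FM x) (\<lambda>x. of_real (u n x) * \<phi> x) + ip FM (\<lambda>x. of_real (u n x) * \<phi> x)"
        by (simp add: ip_diff_left f F FM_L2 u\<phi>)
      ultimately have eq: "ip (f n) (\<lambda>x. of_real (u n x) * \<phi> x) - of_real (mm n) * ip F \<phi> - 0 =
          ip (\<lambda>x. f n x - F x) (\<lambda>x. of_real (u n x) * \<phi> x) + ip (\<lambda>x. F x - FM x) (\<lambda>x. of_real (u n x) * \<phi> x)" by simp
      have *: "cmod (ip h (\<lambda>x. of_real (u n x) * \<phi> x)) < e / 2" if "h \<in> cell_L2" "nrm2 h < e'" for h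
      proof -
        have "cmod (ip h (\<lambda>x. of_real (u n x) * \<phi> x)) \<le> sqrt (nrm2 h) * sqrt (nrm2 (\<lambda>x. of_real (u n x) * \<phi> x))"
          by (rule Cauchy_Schwarz_ip[OF that(1) u\<phi>])
        also have "\<dots> \<le> sqrt (nrm2 h) * W" using elim(1) by (intro mult_left_mono) auto
        finally show ?thesis using small[OF that(2)] by simp
      qed
      have "cmod (ip (\<lambda>x. f n x - F x) (\<lambda>x. of_real (u n x) * \<phi> x)) < e / 2"
        by (rule *[OF cell_L2_diff[OF f F] elim(2)])
      moreover have "cmod (ip (\<lambda>x. F x - FM x) (\<lambda>x. of_real (u n x) * \<phi> x)) < e / 2"
        by (rule *[OF cell_L2_diff[OF F FM_L2] FMs])
      ultimately have "cmod (ip (\<lambda>x. f n x - F x) (\<lambda>x. of_real (u n x) * \<phi> x)) + cmod (ip (\<lambda>x. F x - FM x) (\<lambda>x. of_real (u n x) * \<phi> x)) < e"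
        by linarith
      then show ?case unfolding eq by (rule order.strict_trans1[OF norm_triangle_ineq])
    qed
    then show "\<exists>no. \<forall>n\<ge>no. norm (ip (f n) (\<lambda>x. of_real (u n x) * \<phi> x) - of_real (mm n) * ip F \<phi> - 0) < e"
      unfolding eventually_sequentially .
  qed
  have "(\<lambda>n. complex_of_real (mm n) * ip F \<phi>) \<longlonglongrightarrow> of_real m * ip F \<phi>"
    using m unfolding mm_def by (intro tendsto_intros)
  from tendsto_add[OF main this] show ?thesis by (simp add: \<phi>_def)
qed

text \<open>A weight independent of the third variable commutes with the derivative along the
  fibers. As it may be a discontinuous indicator, this is verified on coefficients: \<open>u\<close>
  times a basis function contains only frequencies with the same third component.\<close>

lemma fc_axis3_weight:
  fixes u :: "real^3 \<Rightarrow> real"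
  assumes fg: "fgrad \<eta> f g" and u [measurable]: "u \<in> borel_measurable borel" and bd: "\<And>x. \<bar>u x\<bar> \<le> B"
    and per: "\<And>x j. u (x + axis j (2 * pi)) = u x" and inv: "\<And>x s. u (x + axis 3 s) = u x"
  shows "fc \<eta> (\<lambda>x. of_real (u x) * g 3 x) k = \<i> * of_real ((\<eta> + ivec k) $ 3) * fc \<eta> (\<lambda>x. of_real (u x) * f x) k"
proof -
  have uek: "(\<lambda>x. of_real (u x) * ek \<eta> k x) \<in> cell_L2"
    by (rule cell_L2_mult_bounded[OF ek_L2, where B=B]) (auto simp: bd)
  have 0: "fc \<eta> (\<lambda>x. of_real (u x) * ek \<eta> k x) l = 0" if "l $ 3 \<noteq> k $ 3" for l
  proof -
    have "fc \<eta> (\<lambda>x. of_real (u x) * ek \<eta> k x) l = of_real (1 / (2 * pi) ^ 3) * (\<integral>x. of_real (u x) * pexp (ivec (k - l)) x \<partial>cell_measure)"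
      unfolding fc_def ip_def mult.assoc ek_mult_cnj by (subst Bochner_Integration.integral_mult_right_zero[symmetric]) (simp only: mult_ac)
    also have "(\<integral>x. of_real (u x) * pexp (ivec (k - l)) x \<partial>cell_measure) = 0"
    proof (rule oscillation[where B=B and t="axis 3 (pi / of_int (k $ 3 - l $ 3))"])
      have "pexp (ivec (k - l)) (axis 3 (pi / of_int (k $ 3 - l $ 3))) = exp (\<i> * of_real pi)"
        using that by (simp add: pexp_def inner_axis' del: of_int_diff)
      then show "pexp (ivec (k - l)) (axis 3 (pi / of_int (k $ 3 - l $ 3))) \<noteq> 1" by (simp add: exp_pi_i')
    qed (use bd per inv in auto)
    finally show ?thesis by simp
  qed
  have "(\<lambda>N. \<Sum>l\<in>ibox N. fc \<eta> (g 3) l * cnj (fc \<eta> (\<lambda>x. of_real (u x) * ek \<eta> k x) l)) \<longlonglongrightarrow> ip (g 3) (\<lambda>x. of_real (u x) * ek \<eta> k x)"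
    by (rule Parseval_ip[OF fgradD(2)[OF fg] uek])
  moreover have "(\<lambda>N. \<i> * of_real ((\<eta> + ivec k) $ 3) * (\<Sum>l\<in>ibox N. fc \<eta> f l * cnj (fc \<eta> (\<lambda>x. of_real (u x) * ek \<eta> k x) l))) \<longlonglongrightarrow>
      \<i> * of_real ((\<eta> + ivec k) $ 3) * ip f (\<lambda>x. of_real (u x) * ek \<eta> k x)"
    by (intro tendsto_mult tendsto_const Parseval_ip[OF fgradD(1)[OF fg] uek])
  moreover have "(\<Sum>l\<in>ibox N. fc \<eta> (g 3) l * cnj (fc \<eta> (\<lambda>x. of_real (u x) * ek \<eta> k x) l)) =
      \<i> * of_real ((\<eta> + ivec k) $ 3) * (\<Sum>l\<in>ibox N. fc \<eta> f l * cnj (fc \<eta> (\<lambda>x. of_real (u x) * ek \<eta> k x) l))" for N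
    unfolding sum_distrib_left
  proof (intro sum.cong refl)
    fix l
    show "fc \<eta> (g 3) l * cnj (fc \<eta> (\<lambda>x. of_real (u x) * ek \<eta> k x) l) =
      \<i> * of_real ((\<eta> + ivec k) $ 3) * (fc \<eta> f l * cnj (fc \<eta> (\<lambda>x. of_real (u x) * ek \<eta> k x) l))"
      using 0[of l] by (cases "l $ 3 = k $ 3") (simp_all add: fgradD(3)[OF fg])
  qed
  ultimately have "ip (g 3) (\<lambda>x. of_real (u x) * ek \<eta> k x) = \<i> * of_real ((\<eta> + ivec k) $ 3) * ip f (\<lambda>x. of_real (u x) * ek \<eta> k x)"
    by (simp only: LIMSEQ_unique)
  then show ?thesis by (simp only: fc_def ip_weight_swap)
qed

text \<open>The Poincare inequality along the fibers, localised by the weight: all axial frequencies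
  stay at distance \<open>d\<close> from zero, so the axial derivative controls the function on any
  union of lines.\<close>

lemma axis3_weight_estimate:
  fixes u :: "real^3 \<Rightarrow> real"
  assumes fg: "fgrad \<eta> f g" and u: "u \<in> borel_measurable borel" and bd: "\<And>x. \<bar>u x\<bar> \<le> B"
    and inv: "cell_inv N u" and d: "\<And>k :: int. d \<le> \<bar>\<eta> $ 3 + of_int k\<bar>" "d \<ge> 0"
  shows "d\<^sup>2 * nrm2 (\<lambda>x. of_real (u x) * f x) \<le> nrm2 (\<lambda>x. of_real (u x) * g 3 x)"
proof (rule LIMSEQ_le)
  have L: "(\<lambda>x. of_real (u x) * h x) \<in> cell_L2" if "h \<in> cell_L2" for h
    by (rule cell_L2_mult_bounded[OF that, where B=B]) (use u bd in auto)
  show "(\<lambda>N. d\<^sup>2 * (\<Sum>k\<in>ibox N. (cmod (fc \<eta> (\<lambda>x. of_real (u x) * f x) k))\<^sup>2)) \<longlonglongrightarrow> d\<^sup>2 * nrm2 (\<lambda>x. of_real (u x) * f x)"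
    by (intro tendsto_mult tendsto_const Parseval L fgradD(1)[OF fg])
  show "(\<lambda>N. \<Sum>k\<in>ibox N. (cmod (fc \<eta> (\<lambda>x. of_real (u x) * g 3 x) k))\<^sup>2) \<longlonglongrightarrow> nrm2 (\<lambda>x. of_real (u x) * g 3 x)"
    by (intro Parseval L fgradD(2)[OF fg])
  have "d\<^sup>2 * (\<Sum>k\<in>ibox n. (cmod (fc \<eta> (\<lambda>x. of_real (u x) * f x) k))\<^sup>2) \<le> (\<Sum>k\<in>ibox n. (cmod (fc \<eta> (\<lambda>x. of_real (u x) * g 3 x) k))\<^sup>2)" for n
    unfolding sum_distrib_left
  proof (rule sum_mono)
    fix k :: "int^3"
    have "d\<^sup>2 \<le> \<bar>\<eta> $ 3 + of_int (k $ 3)\<bar>\<^sup>2" using d by (intro power_mono) auto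
    then have "d\<^sup>2 * (cmod (fc \<eta> (\<lambda>x. of_real (u x) * f x) k))\<^sup>2 \<le> \<bar>\<eta> $ 3 + of_int (k $ 3)\<bar>\<^sup>2 * (cmod (fc \<eta> (\<lambda>x. of_real (u x) * f x) k))\<^sup>2"
      by (intro mult_right_mono) auto
    also have "\<dots> = (cmod (fc \<eta> (\<lambda>x. of_real (u x) * g 3 x) k))\<^sup>2"
      unfolding fc_axis3_weight[OF fg u bd cell_inv_periodic[OF inv] inv[unfolded cell_inv_def, THEN conjunct2, THEN conjunct2, THEN conjunct2, rule_format]] norm_mult power_mult_distrib norm_of_real norm_ii by simp
    finally show "d\<^sup>2 * (cmod (fc \<eta> (\<lambda>x. of_real (u x) * f x) k))\<^sup>2 \<le> (cmod (fc \<eta> (\<lambda>x. of_real (u x) * g 3 x) k))\<^sup>2" .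
  qed
  then show "\<exists>N. \<forall>n\<ge>N. d\<^sup>2 * (\<Sum>k\<in>ibox n. (cmod (fc \<eta> (\<lambda>x. of_real (u x) * f x) k))\<^sup>2) \<le> (\<Sum>k\<in>ibox n. (cmod (fc \<eta> (\<lambda>x. of_real (u x) * g 3 x) k))\<^sup>2)"
    by blast
qed

lemma conductivity_bounds: "b > 0 \<Longrightarrow> min 1 b \<le> conductivity \<epsilon> r b x" "b > 0 \<Longrightarrow> conductivity \<epsilon> r b x \<le> max 1 b"
  by (auto simp: conductivity_def)

lemma conductivity_abs_bound: "b > 0 \<Longrightarrow> \<bar>conductivity \<epsilon> r b x\<bar> \<le> max 1 b"
  by (auto simp: conductivity_def)

text \<open>The tubes lie inside the fibers, where the conductivity is \<open>b\<close>; there the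
  energy controls the axial derivative, and the axial Poincare inequality controls the
  function.\<close>

lemma core_energy_estimate:
  assumes N: "N \<ge> 1" and r: "r > 0" and \<rho>: "0 < \<rho>" "\<rho> \<le> r / 3" and b: "b \<ge> 1"
    and fg: "fgrad \<eta> f g" and d: "\<And>k :: int. d \<le> \<bar>\<eta> $ 3 + of_int k\<bar>" "d \<ge> 0"
    and E: "energy (conductivity (1 / real N) r b) g \<le> C"
  shows "b * (d\<^sup>2 * nrm2 (\<lambda>x. of_real (indicator {x. sig N x \<le> \<rho>\<^sup>2} x) * f x)) \<le> C"
proof -
  define u where "u = (indicator {x. sig N x \<le> \<rho>\<^sup>2} :: real^3 \<Rightarrow> real)"
  have u [measurable]: "u \<in> borel_measurable borel" unfolding u_def by measurable
  have u01: "u x = 0 \<or> u x = 1" for x by (simp add: u_def indicator_def)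
  have bd: "\<bar>u x\<bar> \<le> 1" for x by (simp add: u_def indicator_def)
  have inv: "cell_inv N u"
    using cell_inv_sig[OF N] unfolding cell_inv_def u_def indicator_def by simp
  have g3: "g 3 \<in> cell_L2" by (rule fgradD(2)[OF fg])
  have a: "\<bar>conductivity (1 / real N) r b x\<bar> \<le> b" for x using b by (auto simp: conductivity_def)
  have a0: "0 \<le> conductivity (1 / real N) r b x" for x using b by (auto simp: conductivity_def)
  have "b * nrm2 (\<lambda>x. of_real (u x) * g 3 x) = (\<integral>x. (b * u x) * (cmod (g 3 x))\<^sup>2 \<partial>cell_measure)"
  proof -
    have "(cmod (of_real (u x) * g 3 x))\<^sup>2 = u x * (cmod (g 3 x))\<^sup>2" for x
      using u01[of x] by (auto simp: norm_mult power_mult_distrib)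
    then show ?thesis by (simp add: nrm2_def mult.assoc)
  qed
  also have "\<dots> \<le> (\<integral>x. conductivity (1 / real N) r b x * (cmod (g 3 x))\<^sup>2 \<partial>cell_measure)"
  proof (rule integral_mono_AE)
    show "integrable cell_measure (\<lambda>x. (b * u x) * (cmod (g 3 x))\<^sup>2)"
      by (rule weighted_integrable[OF _ _ g3, where b=b]) (use u01 b in \<open>auto simp: u_def indicator_def\<close>)
    show "integrable cell_measure (\<lambda>x. conductivity (1 / real N) r b x * (cmod (g 3 x))\<^sup>2)"
      by (rule weighted_integrable[OF conductivity_measurable a g3])
    show "AE x in cell_measure. (b * u x) * (cmod (g 3 x))\<^sup>2 \<le> conductivity (1 / real N) r b x * (cmod (g 3 x))\<^sup>2"
      using AE_in_cell
    proof eventually_elim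
      case (elim x)
      have "b * u x \<le> conductivity (1 / real N) r b x"
      proof (cases "sig N x \<le> \<rho>\<^sup>2")
        case True
        then have "x \<in> fibers (1 / real N) r" using core_subset_fibers[OF N r \<rho> elim] by simp
        then show ?thesis using True elim by (simp add: u_def conductivity_on_cell)
      next
        case False
        then show ?thesis using a0[of x] by (simp add: u_def)
      qed
      then show ?case by (intro mult_right_mono) auto
    qed
  qed
  also have "\<dots> \<le> energy (conductivity (1 / real N) r b) g"
    unfolding energy_def using a0
    by (intro member_le_sum) (auto intro!: Bochner_Integration.integral_nonneg)
  finally have "b * nrm2 (\<lambda>x. of_real (u x) * g 3 x) \<le> C" using E by linarith
  moreover have "b * (d\<^sup>2 * nrm2 (\<lambda>x. of_real (u x) * f x)) \<le> b * nrm2 (\<lambda>x. of_real (u x) * g 3 x)"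
    using b by (intro mult_left_mono axis3_weight_estimate[OF fg u bd inv d]) auto
  ultimately show ?thesis unfolding u_def by linarith
qed

text \<open>The trial function is \<open>corr\<close> times a plane wave. As
  \<open>r < \<rho>\<close>, the function and its gradient vanish on the fibers, so the value
  \<open>b\<close> never enters its energy.\<close>

lemma Bloch_eigenvalue1_upper:
  assumes N: "N \<ge> 1" and \<rho>: "0 < \<rho>" "\<rho> \<le> 1 / 2" and level: "AE x in lborel. sig N x \<noteq> \<rho>\<^sup>2"
    and r: "0 < r" "r < \<rho>" and b: "b > 0"
  shows "Bloch_eigenvalue1 (conductivity (1 / real N) r b) \<eta> * (\<integral>x. (corr N \<rho> x)\<^sup>2 \<partial>cell_measure) \<le>
    (\<Sum>j\<in>UNIV. \<integral>x. (dcorr N \<rho> j x)\<^sup>2 \<partial>cell_measure) + (norm (\<eta> + ivec k0))\<^sup>2 * (\<integral>x. (corr N \<rho> x)\<^sup>2 \<partial>cell_measure)"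
proof -
  have \<rho>1: "\<rho> < 1" using \<rho> by simp
  note geo = N \<rho>(1) \<rho>1 level
  define w where "w = corr N \<rho>"
  define dw where "dw = dcorr N \<rho>"
  define V where "V = (2 * pi) ^ 3"
  have V: "V > 0" by (simp add: V_def)
  let ?e = "ftrig \<eta> {k0} (\<lambda>_. 1)"
  let ?f = "\<lambda>x. of_real (w x) * ?e x"
  let ?g = "\<lambda>i x. of_real (dw i x) * ?e x + of_real (w x) * ftrig \<eta> {k0} (fgradc \<eta> (\<lambda>_. 1) i) x"
  have fg: "fgrad \<eta> ?f ?g"
    unfolding w_def dw_def by (rule per_lip_ftrig[OF per_lip_corr[OF geo]])
  have e: "(cmod (?e x))\<^sup>2 = 1 / V" for x
    by (simp add: ftrig_def cmod_ek power_divide V_def)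
  have w_int: "integrable cell_measure (\<lambda>x. (w x)\<^sup>2)"
  proof (rule bounded_integrable[OF geo, where B="(1 + ln 8 / (2 * - ln \<rho>))\<^sup>2"])
    show "\<bar>(w x)\<^sup>2\<bar> \<le> (1 + ln 8 / (2 * - ln \<rho>))\<^sup>2" for x
      using power_mono[OF corr_bounds(2)[OF geo, of x] corr_bounds(1)[OF geo, of x], of 2] by (simp add: w_def)
  qed (use corr_measurable[OF geo] in \<open>auto simp: w_def\<close>)
  have dw_int: "integrable cell_measure (\<lambda>x. (dw j x)\<^sup>2)" for j
    unfolding dw_def by (rule dcorr_sq_integrable[OF N \<rho> level])
  have nf: "nrm2 ?f = (\<integral>x. (w x)\<^sup>2 \<partial>cell_measure) / V"
    unfolding nrm2_def norm_mult power_mult_distrib e by (simp add: power_mult_distrib)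
  have ng: "(cmod (?g i x))\<^sup>2 = ((dw i x)\<^sup>2 + ((\<eta> + ivec k0) $ i)\<^sup>2 * (w x)\<^sup>2) / V" for i x
  proof -
    \<comment> \<open>Up to the common phase the derivative of the corrector is real and that of the
      plane wave imaginary, so the squared modulus has no cross term.\<close>
    have "?g i x = Complex (dw i x) ((\<eta> + ivec k0) $ i * w x) * ?e x"
      by (simp add: ftrig_def fgradc_def complex_eq_iff algebra_simps)
    then have "(cmod (?g i x))\<^sup>2 = (cmod (Complex (dw i x) ((\<eta> + ivec k0) $ i * w x)))\<^sup>2 * (1 / V)"
      unfolding e[of x, symmetric] by (simp only: norm_mult power_mult_distrib)
    then show ?thesis by (simp add: cmod_power2 power_mult_distrib)
  qed
  have "energy (conductivity (1 / real N) r b) ?g = (\<Sum>i\<in>UNIV. \<integral>x. ((dw i x)\<^sup>2 + ((\<eta> + ivec k0) $ i)\<^sup>2 * (w x)\<^sup>2) / V \<partial>cell_measure)"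
    unfolding energy_def
  proof (intro sum.cong refl integral_cong_AE)
    fix i
    have [measurable]: "dw i \<in> borel_measurable borel" "w \<in> borel_measurable borel"
      using dcorr_measurable[OF geo] corr_measurable[OF geo] by (auto simp: dw_def w_def)
    show "(\<lambda>x. conductivity (1 / real N) r b x * (cmod (?g i x))\<^sup>2) \<in> borel_measurable cell_measure" by simp
    show "(\<lambda>x. ((dw i x)\<^sup>2 + ((\<eta> + ivec k0) $ i)\<^sup>2 * (w x)\<^sup>2) / V) \<in> borel_measurable cell_measure" by simp
    show "AE x in cell_measure. conductivity (1 / real N) r b x * (cmod (?g i x))\<^sup>2 = ((dw i x)\<^sup>2 + ((\<eta> + ivec k0) $ i)\<^sup>2 * (w x)\<^sup>2) / V"
      using AE_in_cell
    proof eventually_elim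
      case (elim x)
      show ?case
      proof (cases "x \<in> fibers (1 / real N) r")
        case True
        have "r\<^sup>2 < \<rho>\<^sup>2" using r by (intro power_strict_mono) auto
        then have "\<not> sig N x > \<rho>\<^sup>2" using fibers_subset_core[OF N True] by simp
        then have "w x = 0" "dw i x = 0" by (simp_all add: w_def dw_def corr_eq_0[OF geo] dcorr_def)
        then show ?thesis by simp
      next
        case False
        then show ?thesis unfolding ng using elim by (simp add: conductivity_on_cell)
      qed
    qed
  qed
  also have "\<dots> = ((\<Sum>i\<in>UNIV. \<integral>x. (dw i x)\<^sup>2 \<partial>cell_measure) + (norm (\<eta> + ivec k0))\<^sup>2 * (\<integral>x. (w x)\<^sup>2 \<partial>cell_measure)) / V"
    using w_int dw_int unfolding norm_real_vec_sq
    by (simp add: sum.distrib sum_distrib_right sum_divide_distrib[symmetric] del: vector_add_component)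
  finally have en: "energy (conductivity (1 / real N) r b) ?g = ((\<Sum>i\<in>UNIV. \<integral>x. (dw i x)\<^sup>2 \<partial>cell_measure) + (norm (\<eta> + ivec k0))\<^sup>2 * (\<integral>x. (w x)\<^sup>2 \<partial>cell_measure)) / V" .
  have mb: "min 1 b > 0" using b by simp
  obtain f g where "\<And>f' g'. fgrad \<eta> f' g' \<Longrightarrow> Bloch_eigenvalue1 (conductivity (1 / real N) r b) \<eta> * nrm2 f' \<le> energy (conductivity (1 / real N) r b) g'"
    by (rule Bloch_minimizer[OF conductivity_measurable mb conductivity_bounds(1)[OF b] conductivity_bounds(2)[OF b], of \<eta>]) blast
  from this[OF fg] have "Bloch_eigenvalue1 (conductivity (1 / real N) r b) \<eta> * ((\<integral>x. (w x)\<^sup>2 \<partial>cell_measure) / V) \<le>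
     ((\<Sum>i\<in>UNIV. \<integral>x. (dw i x)\<^sup>2 \<partial>cell_measure) + (norm (\<eta> + ivec k0))\<^sup>2 * (\<integral>x. (w x)\<^sup>2 \<partial>cell_measure)) / V"
    unfolding nf en .
  then show ?thesis using V by (simp add: w_def dw_def divide_le_cancel)
qed

text \<open>Changing the radius by a factor between \<open>1 / 4\<close> and 2 moves its logarithm
  by at most \<open>ln 4\<close>, which is negligible against the diverging logarithm.\<close>

lemma tendsto_scaled_log:
  fixes N :: "nat \<Rightarrow> nat" and r \<rho> :: "nat \<Rightarrow> real"
  assumes r: "\<And>n. r n > 0" "r \<longlonglongrightarrow> 0" and \<rho>: "\<And>n. r n / 4 \<le> \<rho> n" "\<And>n. \<rho> n \<le> 2 * r n"
    and q: "(\<lambda>n. (real (N n))\<^sup>2 / - ln (r n)) \<longlonglongrightarrow> c"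
  shows "\<rho> \<longlonglongrightarrow> 0" "filterlim (\<lambda>n. - ln (\<rho> n)) at_top sequentially" "(\<lambda>n. (real (N n))\<^sup>2 / - ln (\<rho> n)) \<longlonglongrightarrow> c"
proof -
  have \<rho>0: "\<rho> n > 0" for n using r(1)[of n] \<rho>(1)[of n] by linarith
  show \<rho>_lim: "\<rho> \<longlonglongrightarrow> 0"
  proof (rule tendsto_sandwich[where f="\<lambda>_. 0" and h="\<lambda>n. 2 * r n"])
    show "(\<lambda>_::nat. 0::real) \<longlonglongrightarrow> 0" by (rule tendsto_const)
    show "(\<lambda>n. 2 * r n) \<longlonglongrightarrow> 0" using tendsto_mult_right_zero[OF r(2), of 2] by simp
    show "\<forall>\<^sub>F n in sequentially. 0 \<le> \<rho> n" by (rule always_eventually) (auto intro: less_imp_le[OF \<rho>0])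
    show "\<forall>\<^sub>F n in sequentially. \<rho> n \<le> 2 * r n" by (rule always_eventually) (auto intro: \<rho>(2))
  qed
  have ln_lim: "filterlim (\<lambda>n. - ln (x n)) at_top sequentially" if "\<And>n. x n > 0" "x \<longlonglongrightarrow> 0" for x :: "nat \<Rightarrow> real"
  proof -
    have "filterlim x (at_right 0) sequentially"
      using that(2) that(1) less_imp_neq[OF that(1)] by (auto simp: filterlim_at eq_commute[of "0::real"] intro!: always_eventually)
    then have "filterlim (\<lambda>n. ln (x n)) at_bot sequentially"
      by (rule filterlim_compose[OF ln_at_0])
    then show ?thesis by (simp add: filterlim_uminus_at_top)
  qed
  show l\<rho>: "filterlim (\<lambda>n. - ln (\<rho> n)) at_top sequentially" by (rule ln_lim[OF \<rho>0 \<rho>_lim])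
  have lr: "filterlim (\<lambda>n. - ln (r n)) at_top sequentially" by (rule ln_lim[OF r])
  have e: "\<bar>ln (r n) - ln (\<rho> n)\<bar> \<le> ln 4" for n
  proof -
    have "ln (r n / 4) \<le> ln (\<rho> n)" "ln (\<rho> n) \<le> ln (2 * r n)"
      using \<rho>0[of n] r(1)[of n] \<rho>(1)[of n] \<rho>(2)[of n] by (intro ln_mono; simp)+
    moreover have "ln (r n / 4) = ln (r n) - ln 4" "ln (2 * r n) = ln 2 + ln (r n)"
      using r(1)[of n] by (simp_all add: ln_div ln_mult)
    moreover have "ln 2 \<le> ln (4 :: real)" by simp
    ultimately show ?thesis by linarith
  qed
  have "(\<lambda>n. (ln (r n) - ln (\<rho> n)) / - ln (\<rho> n)) \<longlonglongrightarrow> 0"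
  proof (rule Lim_null_comparison)
    show "\<forall>\<^sub>F n in sequentially. norm ((ln (r n) - ln (\<rho> n)) / - ln (\<rho> n)) \<le> ln 4 / - ln (\<rho> n)"
      using filterlim_at_top_dense[THEN iffD1, OF l\<rho>, rule_format, of 0]
    proof eventually_elim
      case (elim n)
      have "norm ((ln (r n) - ln (\<rho> n)) / - ln (\<rho> n)) = \<bar>ln (r n) - ln (\<rho> n)\<bar> / - ln (\<rho> n)"
        using elim by (simp add: abs_divide)
      also have "\<dots> \<le> ln 4 / - ln (\<rho> n)" using elim e[of n] by (intro divide_right_mono) auto
      finally show ?case .
    qed
    show "(\<lambda>n. ln 4 / - ln (\<rho> n)) \<longlonglongrightarrow> 0"
      by (rule tendsto_divide_0[OF tendsto_const filterlim_at_top_imp_at_infinity[OF l\<rho>]])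
  qed
  then have "(\<lambda>n. (real (N n))\<^sup>2 / - ln (r n) * (1 - (ln (r n) - ln (\<rho> n)) / - ln (\<rho> n))) \<longlonglongrightarrow> c * (1 - 0)"
    by (intro tendsto_intros q)
  moreover have "\<forall>\<^sub>F n in sequentially. (real (N n))\<^sup>2 / - ln (r n) * (1 - (ln (r n) - ln (\<rho> n)) / - ln (\<rho> n)) = (real (N n))\<^sup>2 / - ln (\<rho> n)"
    using filterlim_at_top_dense[THEN iffD1, OF l\<rho>, rule_format, of 0] filterlim_at_top_dense[THEN iffD1, OF lr, rule_format, of 0]
  proof eventually_elim
    case (elim n)
    then have "ln (\<rho> n) \<noteq> 0" "ln (r n) \<noteq> 0" by auto
    then show ?case by (simp add: field_simps)
  qed
  ultimately show "(\<lambda>n. (real (N n))\<^sup>2 / - ln (\<rho> n)) \<longlonglongrightarrow> c"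
    by (simp add: Lim_transform_eventually)
qed

section \<open>Homogenization limits\<close>

lemma core_volume_le:
  assumes N: "N \<ge> 1" and \<rho>: "0 < \<rho>" "\<rho> \<le> 1 / 2"
  shows "core_volume N \<rho> \<le> 4 * pi\<^sup>2 * \<rho>\<^sup>2"
proof -
  have "\<rho>\<^sup>2 \<le> (1 / 2)\<^sup>2" using \<rho> by (intro power_mono) auto
  then have "1 / 2 \<le> 1 - \<rho>\<^sup>2 / 2" by (simp add: power2_eq_square)
  then have "2 * pi\<^sup>2 * \<rho>\<^sup>2 / (1 - \<rho>\<^sup>2 / 2) \<le> 2 * pi\<^sup>2 * \<rho>\<^sup>2 / (1 / 2)"
    by (intro divide_left_mono) auto
  also have "\<dots> = 4 * pi\<^sup>2 * \<rho>\<^sup>2" by simp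
  finally show ?thesis using core_volume_bounds(2)[OF N \<rho>] by linarith
qed

text \<open>
  The trial functions are plane waves multiplied by the capacitary corrector. Its mean square is
  bounded below by its values outside the tubes of radius \<open>1 / \<bar>ln \<rho>\<bar>\<close>, where it is close to \<open>1\<close>.
\<close>

lemma Bloch_eigenvalue1_upper_limit:
  fixes N :: "nat \<Rightarrow> nat"
  assumes N: "\<And>n. N n \<ge> 1" and r: "\<And>n. r n > 0" "r \<longlonglongrightarrow> 0" and b: "\<And>n. b n > 0"
    and q: "(\<lambda>n. (real (N n))\<^sup>2 / - ln (r n)) \<longlonglongrightarrow> c"
  obtains U where "U \<longlonglongrightarrow> (norm (\<eta> + ivec k0))\<^sup>2 + c / (2 * pi)"
    "\<forall>\<^sub>F n in sequentially. Bloch_eigenvalue1 (conductivity (1 / real (N n)) (r n) (b n)) \<eta> \<le> U n"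
proof -
  have "\<forall>n. \<exists>\<rho>. r n < \<rho> \<and> \<rho> < 2 * r n \<and> (AE x in lborel. sig (N n) x \<noteq> \<rho>\<^sup>2)"
  proof
    fix n
    show "\<exists>\<rho>. r n < \<rho> \<and> \<rho> < 2 * r n \<and> (AE x in lborel. sig (N n) x \<noteq> \<rho>\<^sup>2)"
      by (rule generic_level[of "r n" "2 * r n" "N n"]) (use r(1)[of n] in auto)
  qed
  from choice[OF this] obtain \<rho> where \<rho>: "\<And>n. r n < \<rho> n" "\<And>n. \<rho> n < 2 * r n" and level: "\<And>n. AE x in lborel. sig (N n) x \<noteq> (\<rho> n)\<^sup>2"
    by auto
  have \<rho>0: "\<rho> n > 0" for n using \<rho>(1)[of n] r(1)[of n] by linarith
  define l where "l n = - ln (\<rho> n)" for n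
  have \<rho>': "r n / 4 \<le> \<rho> n" "\<rho> n \<le> 2 * r n" for n using \<rho>(1)[of n] \<rho>(2)[of n] r(1)[of n] by linarith+
  note lims = tendsto_scaled_log[OF r \<rho>' q]
  have \<rho>_lim: "\<rho> \<longlonglongrightarrow> 0" by (rule lims(1))
  have l_lim: "filterlim l at_top sequentially" unfolding l_def by (rule lims(2))
  have q_lim: "(\<lambda>n. (real (N n))\<^sup>2 / l n) \<longlonglongrightarrow> c" unfolding l_def by (rule lims(3))
  have t_lim: "(\<lambda>n. 1 / l n) \<longlonglongrightarrow> 0"
    by (rule tendsto_divide_0[OF tendsto_const filterlim_at_top_imp_at_infinity[OF l_lim]])
  have "((\<lambda>x::real. ln x / x) \<longlongrightarrow> 0) at_top" by real_asymp
  then have lnl_lim: "(\<lambda>n. ln (l n) / l n) \<longlonglongrightarrow> 0" by (rule filterlim_compose[OF _ l_lim])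
  \<comment> \<open>Lower bound for the mean square of the corrector at the intermediate radius
    \<open>t = 1 / l n\<close>: the excluded volume is of order \<open>t^2\<close>, and
    \<open>ln t / l n\<close> tends to zero.\<close>
  define w where "w n = (1 - ln (l n) / l n)\<^sup>2 * ((2 * pi) ^ 3 - 4 * pi\<^sup>2 * (1 / l n)\<^sup>2)" for n
  define s where "s n = (1 + ln 8 / 2 * (1 / l n)) * (4 * pi\<^sup>2 * ((real (N n))\<^sup>2 / l n) / (1 - (\<rho> n)\<^sup>2 / 2))" for n
  have "w \<longlonglongrightarrow> (1 - 0)\<^sup>2 * ((2 * pi) ^ 3 - 4 * pi\<^sup>2 * 0\<^sup>2)"
    unfolding w_def[abs_def] by (intro tendsto_intros lnl_lim t_lim)
  then have w_lim: "w \<longlonglongrightarrow> (2 * pi) ^ 3" by simp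
  have "s \<longlonglongrightarrow> (1 + ln 8 / 2 * 0) * (4 * pi\<^sup>2 * c / (1 - 0\<^sup>2 / 2))"
    unfolding s_def[abs_def] by (intro tendsto_intros t_lim q_lim \<rho>_lim) auto
  then have s_lim: "s \<longlonglongrightarrow> 4 * pi\<^sup>2 * c" by simp
  define U where "U n = (norm (\<eta> + ivec k0))\<^sup>2 + s n / w n" for n
  show thesis
  proof (rule that[of U])
    \<comment> \<open>The Dirichlet integral \<open>4 * pi^2 * c\<close> divided by the volume
      \<open>(2 * pi) ^ 3\<close> is \<open>c / (2 * pi)\<close>.\<close>
    have "U \<longlonglongrightarrow> (norm (\<eta> + ivec k0))\<^sup>2 + (4 * pi\<^sup>2 * c) / (2 * pi) ^ 3"
      unfolding U_def[abs_def] by (intro tendsto_intros s_lim w_lim) auto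
    then show "U \<longlonglongrightarrow> (norm (\<eta> + ivec k0))\<^sup>2 + c / (2 * pi)"
      by (simp add: power2_eq_square power3_eq_cube)
    have w_pos: "\<forall>\<^sub>F n in sequentially. 0 < w n" by (rule order_tendstoD(1)[OF w_lim]) simp
    have \<rho>_small: "\<forall>\<^sub>F n in sequentially. \<rho> n < 1 / 2" by (rule order_tendstoD(2)[OF \<rho>_lim]) simp
    have l_big: "\<forall>\<^sub>F n in sequentially. 2 < l n" using filterlim_at_top_dense[THEN iffD1, OF l_lim] by simp
    show "\<forall>\<^sub>F n in sequentially. Bloch_eigenvalue1 (conductivity (1 / real (N n)) (r n) (b n)) \<eta> \<le> U n"
      using w_pos \<rho>_small l_big
    proof eventually_elim
      case (elim n)
      have \<rho>2: "\<rho> n \<le> 1 / 2" using elim by simp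
      have \<rho>1: "\<rho> n < 1" using elim by simp
      define W where "W = (\<integral>x. (corr (N n) (\<rho> n) x)\<^sup>2 \<partial>cell_measure)"
      define L where "L = Bloch_eigenvalue1 (conductivity (1 / real (N n)) (r n) (b n)) \<eta>"
      have up: "L * W \<le> (\<Sum>j\<in>UNIV. \<integral>x. (dcorr (N n) (\<rho> n) j x)\<^sup>2 \<partial>cell_measure) + (norm (\<eta> + ivec k0))\<^sup>2 * W"
        unfolding L_def W_def by (rule Bloch_eigenvalue1_upper[OF N \<rho>0 \<rho>2 level r(1) \<rho>(1) b])
      have "(\<Sum>j\<in>UNIV. \<integral>x. (dcorr (N n) (\<rho> n) j x)\<^sup>2 \<partial>cell_measure) \<le> (1 + ln 8 / (2 * l n)) * (\<integral>x. core (N n) (\<rho> n) x \<partial>cell_measure)"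
        unfolding l_def by (rule integral_dcorr_sq[OF N \<rho>0 \<rho>1 level])
      also have "\<dots> \<le> (1 + ln 8 / (2 * l n)) * (4 * pi\<^sup>2 * ((real (N n))\<^sup>2 / l n) / (1 - (\<rho> n)\<^sup>2 / 2))"
      proof (rule mult_left_mono[OF integral_core_bounds(2)[OF N \<rho>0 \<rho>2 level, folded l_def]])
        have "0 \<le> ln 8 / (2 * l n)" using elim by (intro divide_nonneg_nonneg) auto
        then show "0 \<le> 1 + ln 8 / (2 * l n)" by linarith
      qed
      also have "\<dots> = s n" by (simp add: s_def)
      finally have s: "(\<Sum>j\<in>UNIV. \<integral>x. (dcorr (N n) (\<rho> n) j x)\<^sup>2 \<partial>cell_measure) \<le> s n" .
      have l0: "l n > 0" using elim by linarith
      have \<rho>l: "\<rho> n = exp (- l n)" using \<rho>0[of n] by (simp add: l_def)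
      have "l n \<le> exp (l n)" using exp_ge_add_one_self[of "l n"] by linarith
      then have "exp (- l n) \<le> 1 / l n" using l0 by (simp add: exp_minus divide_simps)
      then have t1: "\<rho> n \<le> 1 / l n" by (simp only: \<rho>l)
      have t2: "1 / l n \<le> 1 / 2" using elim by (simp add: divide_simps)
      have t0: "0 < 1 / l n" using l0 by simp
      have lnt: "ln (1 / l n) / - ln (\<rho> n) = - (ln (l n) / l n)"
      proof -
        have "ln (1 / l n) = - ln (l n)" using l0 by (simp add: ln_div)
        moreover have "- ln (\<rho> n) = l n" by (simp add: l_def)
        ultimately show ?thesis by (simp only: minus_divide_left)
      qed
      have "ln (l n) \<le> l n" using ln_le_minus_one[OF l0] by linarith
      then have t3: "0 \<le> 1 + ln (1 / l n) / - ln (\<rho> n)" unfolding lnt using l0 by (simp add: divide_simps)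
      have "w n \<le> (1 + ln (1 / l n) / - ln (\<rho> n))\<^sup>2 * ((2 * pi) ^ 3 - core_volume (N n) (1 / l n))"
        unfolding w_def lnt using core_volume_le[OF N t0 t2] by (simp add: mult_left_mono)
      also have "\<dots> \<le> W" unfolding W_def by (rule integral_corr_sq[OF N \<rho>0 \<rho>2 level t1 t2 t3])
      finally have wW: "w n \<le> W" .
      \<comment> \<open>Replacing \<open>W\<close> by its lower bound is legitimate if the factor is
        nonnegative; otherwise the left side is nonpositive.\<close>
      have "(L - (norm (\<eta> + ivec k0))\<^sup>2) * w n \<le> s n"
      proof (cases "L - (norm (\<eta> + ivec k0))\<^sup>2 \<ge> 0")
        case True
        have "(L - (norm (\<eta> + ivec k0))\<^sup>2) * w n \<le> (L - (norm (\<eta> + ivec k0))\<^sup>2) * W" by (rule mult_left_mono[OF wW True])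
        then show ?thesis using up s by (simp add: algebra_simps)
      next
        case False
        then have "(L - (norm (\<eta> + ivec k0))\<^sup>2) * w n \<le> 0" using elim(1) by (simp add: mult_le_0_iff)
        moreover have "0 \<le> (\<Sum>j\<in>UNIV. \<integral>x. (dcorr (N n) (\<rho> n) j x)\<^sup>2 \<partial>cell_measure)"
          by (intro sum_nonneg Bochner_Integration.integral_nonneg) simp
        ultimately show ?thesis using s by linarith
      qed
      then have "L - (norm (\<eta> + ivec k0))\<^sup>2 \<le> s n / w n" using elim(1) by (simp add: pos_le_divide_eq)
      then show ?case unfolding U_def L_def by linarith
    qed
  qed
qed

section \<open>Limits of the weights along a sequence of scales\<close>

context
  fixes N :: "nat \<Rightarrow> nat" and \<rho> :: "nat \<Rightarrow> real" and c :: real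
  assumes N: "\<And>n. N n \<ge> 1" and N_lim: "filterlim N at_top sequentially"
    and \<rho>: "\<And>n. 0 < \<rho> n" "\<And>n. \<rho> n \<le> 1 / 2" and level: "\<And>n. AE x in lborel. sig (N n) x \<noteq> (\<rho> n)\<^sup>2"
    and \<rho>_lim: "\<rho> \<longlonglongrightarrow> 0" and l_lim: "filterlim (\<lambda>n. - ln (\<rho> n)) at_top sequentially"
    and q_lim: "(\<lambda>n. (real (N n))\<^sup>2 / - ln (\<rho> n)) \<longlonglongrightarrow> c"
begin

lemma seq_\<rho>1: "\<rho> n < 1" using \<rho>(2)[of n] by simp

lemmas seq_geo = N \<rho>(1) seq_\<rho>1 level
lemmas seq_geo2 = N \<rho> level

lemma inverse_log_tendsto: "(\<lambda>n. 1 / - ln (\<rho> n)) \<longlonglongrightarrow> 0"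
  by (rule tendsto_divide_0[OF tendsto_const filterlim_at_top_imp_at_infinity[OF l_lim]])

lemma integral_core_tendsto: "(\<lambda>n. \<integral>x. core (N n) (\<rho> n) x \<partial>cell_measure) \<longlonglongrightarrow> 4 * pi\<^sup>2 * c"
proof (rule tendsto_sandwich)
  show "\<forall>\<^sub>F n in sequentially. (4 - (\<rho> n)\<^sup>2) * pi\<^sup>2 * ((real (N n))\<^sup>2 / - ln (\<rho> n)) \<le> (\<integral>x. core (N n) (\<rho> n) x \<partial>cell_measure)"
    by (intro always_eventually allI integral_core_bounds(1)[OF seq_geo2])
  show "\<forall>\<^sub>F n in sequentially. (\<integral>x. core (N n) (\<rho> n) x \<partial>cell_measure) \<le> 4 * pi\<^sup>2 * ((real (N n))\<^sup>2 / - ln (\<rho> n)) / (1 - (\<rho> n)\<^sup>2 / 2)"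
    by (intro always_eventually allI integral_core_bounds(2)[OF seq_geo2])
  have "(\<lambda>n. (4 - (\<rho> n)\<^sup>2) * pi\<^sup>2 * ((real (N n))\<^sup>2 / - ln (\<rho> n))) \<longlonglongrightarrow> (4 - 0\<^sup>2) * pi\<^sup>2 * c"
    by (intro tendsto_mult tendsto_diff tendsto_power tendsto_const \<rho>_lim q_lim)
  then show "(\<lambda>n. (4 - (\<rho> n)\<^sup>2) * pi\<^sup>2 * ((real (N n))\<^sup>2 / - ln (\<rho> n))) \<longlonglongrightarrow> 4 * pi\<^sup>2 * c" by simp
  have "(\<lambda>n. 4 * pi\<^sup>2 * ((real (N n))\<^sup>2 / - ln (\<rho> n)) / (1 - (\<rho> n)\<^sup>2 / 2)) \<longlonglongrightarrow> 4 * pi\<^sup>2 * c / (1 - 0\<^sup>2 / 2)"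
    by (intro tendsto_mult tendsto_divide tendsto_diff tendsto_power tendsto_const \<rho>_lim q_lim) auto
  then show "(\<lambda>n. 4 * pi\<^sup>2 * ((real (N n))\<^sup>2 / - ln (\<rho> n)) / (1 - (\<rho> n)\<^sup>2 / 2)) \<longlonglongrightarrow> 4 * pi\<^sup>2 * c" by simp
qed

text \<open>An upper bound with the exact limit is what the tangent inequality asks for, since the
  squared flux enters there with a negative sign.\<close>

lemma integral_flux_sq_limit:
  obtains U where "U \<longlonglongrightarrow> 4 * pi\<^sup>2 * c" "\<And>n. (\<Sum>j\<in>UNIV. \<integral>x. (flux (N n) (\<rho> n) j x)\<^sup>2 \<partial>cell_measure) \<le> U n"
proof (rule that)
  let ?U = "\<lambda>n. (1 + ln 8 / 2 * (1 / - ln (\<rho> n))) * (\<integral>x. core (N n) (\<rho> n) x \<partial>cell_measure) + 4 * pi\<^sup>2 * ((real (N n))\<^sup>2 / - ln (\<rho> n)) * (1 / - ln (\<rho> n))"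
  have "?U \<longlonglongrightarrow> (1 + ln 8 / 2 * 0) * (4 * pi\<^sup>2 * c) + 4 * pi\<^sup>2 * c * 0"
    by (intro tendsto_mult tendsto_add tendsto_const inverse_log_tendsto q_lim integral_core_tendsto)
  then show "?U \<longlonglongrightarrow> 4 * pi\<^sup>2 * c" by simp
  fix n
  have l: "- ln (\<rho> n) > 0" by (rule minus_ln_pos[OF seq_geo])
  have "(real (N n) / (- ln (\<rho> n) * \<rho> n))\<^sup>2 * core_volume (N n) (\<rho> n) \<le> (real (N n) / (- ln (\<rho> n) * \<rho> n))\<^sup>2 * (4 * pi\<^sup>2 * (\<rho> n)\<^sup>2)"
    by (intro mult_left_mono core_volume_le N \<rho>) simp
  also have "\<dots> = 4 * pi\<^sup>2 * ((real (N n))\<^sup>2 / - ln (\<rho> n)) * (1 / - ln (\<rho> n))"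
    using l \<rho>(1)[of n] by (simp add: power2_eq_square divide_simps)
  finally have "(real (N n) / (- ln (\<rho> n) * \<rho> n))\<^sup>2 * core_volume (N n) (\<rho> n) \<le> 4 * pi\<^sup>2 * ((real (N n))\<^sup>2 / - ln (\<rho> n)) * (1 / - ln (\<rho> n))" .
  moreover have "(1 + ln 8 / (2 * - ln (\<rho> n))) = (1 + ln 8 / 2 * (1 / - ln (\<rho> n)))" by simp
  ultimately show "(\<Sum>j\<in>UNIV. \<integral>x. (flux (N n) (\<rho> n) j x)\<^sup>2 \<partial>cell_measure) \<le> ?U n"
    using integral_flux_sq[OF seq_geo2, of n] by (simp only:)
qed

text \<open>Weak convergence of the flux to zero, tested against a strongly convergent factor: its
  mean tends to zero while its mean square stays bounded.\<close>

lemma ip_flux_tendsto: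
  assumes h: "\<And>n. h n \<in> cell_L2" and H: "H \<in> cell_L2" and lim: "(\<lambda>n. nrm2 (\<lambda>x. h n x - H x)) \<longlonglongrightarrow> 0"
  shows "(\<lambda>n. ip (h n) (\<lambda>x. of_real (flux (N n) (\<rho> n) j x) * ftrig \<eta> (ibox K) a x)) \<longlonglongrightarrow> 0"
proof -
  obtain U where U: "U \<longlonglongrightarrow> 4 * pi\<^sup>2 * c" "\<And>n. (\<Sum>j\<in>UNIV. \<integral>x. (flux (N n) (\<rho> n) j x)\<^sup>2 \<partial>cell_measure) \<le> U n"
    by (rule integral_flux_sq_limit) blast
  have "(\<lambda>n. ip (h n) (\<lambda>x. of_real (flux (N n) (\<rho> n) j x) * ftrig \<eta> (ibox K) a x)) \<longlonglongrightarrow> of_real 0 * ip H (ftrig \<eta> (ibox K) a)"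
  proof (rule ip_weighted_tendsto[OF cell_inv_flux[OF seq_geo] flux_measurable[OF seq_geo] flux_bound[OF seq_geo] N_lim _ _ h H lim, where D="4 * pi\<^sup>2 * c + 1"])
    have "\<forall>\<^sub>F n in sequentially. U n < 4 * pi\<^sup>2 * c + 1" by (rule order_tendstoD(2)[OF U(1)]) simp
    then show "\<forall>\<^sub>F n in sequentially. (\<integral>x. (flux (N n) (\<rho> n) j x)\<^sup>2 \<partial>cell_measure) \<le> 4 * pi\<^sup>2 * c + 1"
    proof eventually_elim
      case (elim n)
      have "(\<integral>x. (flux (N n) (\<rho> n) j x)\<^sup>2 \<partial>cell_measure) \<le> (\<Sum>j\<in>UNIV. \<integral>x. (flux (N n) (\<rho> n) j x)\<^sup>2 \<partial>cell_measure)"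
        by (intro member_le_sum) (auto intro!: Bochner_Integration.integral_nonneg)
      then show ?case using U(2)[of n] elim by linarith
    qed
    have "(\<lambda>n. \<integral>x. flux (N n) (\<rho> n) j x \<partial>cell_measure) \<longlonglongrightarrow> 0"
    proof (rule Lim_null_comparison)
      show "\<forall>\<^sub>F n in sequentially. norm (\<integral>x. flux (N n) (\<rho> n) j x \<partial>cell_measure) \<le> 4 * pi\<^sup>2 * ((real (N n))\<^sup>2 / - ln (\<rho> n)) * \<rho> n"
      proof (intro always_eventually allI)
        fix n
        have l: "- ln (\<rho> n) > 0" by (rule minus_ln_pos[OF seq_geo])
        have "norm (\<integral>x. flux (N n) (\<rho> n) j x \<partial>cell_measure) \<le> real (N n) / (- ln (\<rho> n) * \<rho> n) * core_volume (N n) (\<rho> n)"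
          unfolding real_norm_def by (rule integral_flux[OF seq_geo2])
        also have "\<dots> \<le> real (N n) / (- ln (\<rho> n) * \<rho> n) * (4 * pi\<^sup>2 * (\<rho> n)\<^sup>2)"
          by (rule mult_left_mono[OF core_volume_le[OF N \<rho>]]) (intro divide_nonneg_nonneg mult_nonneg_nonneg less_imp_le[OF l] less_imp_le[OF \<rho>(1)] of_nat_0_le_iff)
        also have "\<dots> = 4 * pi\<^sup>2 * (real (N n) / - ln (\<rho> n)) * \<rho> n"
          using l \<rho>(1)[of n] by (simp add: power2_eq_square divide_simps)
        also have "\<dots> \<le> 4 * pi\<^sup>2 * ((real (N n))\<^sup>2 / - ln (\<rho> n)) * \<rho> n"
        proof -
          \<comment> \<open>This brings in the convergent ratio \<open>N^2 / - ln \<rho>\<close>;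
            the remaining factor \<open>\<rho>\<close> tends to zero.\<close>
          have "real (N n) \<le> (real (N n))\<^sup>2" using N[of n] by (intro self_le_power) auto
          then have "real (N n) / - ln (\<rho> n) \<le> (real (N n))\<^sup>2 / - ln (\<rho> n)"
            by (rule divide_right_mono) (use l in linarith)
          then show ?thesis by (rule mult_right_mono[OF mult_left_mono]) (use \<rho>(1)[of n] in auto)
        qed
        finally show "norm (\<integral>x. flux (N n) (\<rho> n) j x \<partial>cell_measure) \<le> 4 * pi\<^sup>2 * ((real (N n))\<^sup>2 / - ln (\<rho> n)) * \<rho> n" .
      qed
      have "(\<lambda>n. 4 * pi\<^sup>2 * ((real (N n))\<^sup>2 / - ln (\<rho> n)) * \<rho> n) \<longlonglongrightarrow> 4 * pi\<^sup>2 * c * 0"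
        by (intro tendsto_mult tendsto_const q_lim \<rho>_lim)
      then show "(\<lambda>n. 4 * pi\<^sup>2 * ((real (N n))\<^sup>2 / - ln (\<rho> n)) * \<rho> n) \<longlonglongrightarrow> 0" by simp
    qed
    then show "(\<lambda>n. (\<integral>x. flux (N n) (\<rho> n) j x \<partial>cell_measure) / (2 * pi) ^ 3) \<longlonglongrightarrow> 0"
      by (rule tendsto_divide_zero)
  qed
  then show ?thesis by simp
qed

text \<open>The mean of \<open>spread\<close> equals that of \<open>core\<close>, whose integral
  tends to \<open>4 * pi^2 * c\<close>; division by the volume of the cell gives the additional
  zero-order term \<open>c / (2 * pi)\<close>.\<close>

lemma ip_spread_tendsto:
  assumes h: "\<And>n. h n \<in> cell_L2" and H: "H \<in> cell_L2" and lim: "(\<lambda>n. nrm2 (\<lambda>x. h n x - H x)) \<longlonglongrightarrow> 0"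
  shows "(\<lambda>n. ip (h n) (\<lambda>x. of_real (spread (N n) (\<rho> n) x) * ftrig \<eta> (ibox K) a x)) \<longlonglongrightarrow> of_real (c / (2 * pi)) * ip H (ftrig \<eta> (ibox K) a)"
proof (rule ip_weighted_tendsto[OF cell_inv_spread[OF seq_geo] spread_measurable[OF seq_geo] _ N_lim _ _ h H lim, where D="(c / 4 + 1)\<^sup>2 * (2 * pi) ^ 3"])
  have bd: "\<bar>spread (N n) (\<rho> n) x\<bar> \<le> (real (N n))\<^sup>2 / - ln (\<rho> n) / 4" for n x
    using spread_bounds[OF seq_geo, of n x] by simp
  then show "\<bar>spread (N n) (\<rho> n) x\<bar> \<le> (real (N n))\<^sup>2 / - ln (\<rho> n) / 4" for n x .
  have "(\<lambda>n. (real (N n))\<^sup>2 / - ln (\<rho> n) / 4) \<longlonglongrightarrow> c / 4" by (intro tendsto_divide tendsto_const q_lim) simp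
  from order_tendstoD(2)[OF this, of "c / 4 + 1"]
  have "\<forall>\<^sub>F n in sequentially. (real (N n))\<^sup>2 / - ln (\<rho> n) / 4 < c / 4 + 1" by simp
  then show "\<forall>\<^sub>F n in sequentially. (\<integral>x. (spread (N n) (\<rho> n) x)\<^sup>2 \<partial>cell_measure) \<le> (c / 4 + 1)\<^sup>2 * (2 * pi) ^ 3"
  proof eventually_elim
    case (elim n)
    have sq: "(spread (N n) (\<rho> n) x)\<^sup>2 \<le> (c / 4 + 1)\<^sup>2" for x
    proof -
      have "\<bar>spread (N n) (\<rho> n) x\<bar> \<le> c / 4 + 1" using bd[of n x] elim by linarith
      from power_mono[OF this, of 2] show ?thesis by simp
    qed
    have "(\<integral>x. (spread (N n) (\<rho> n) x)\<^sup>2 \<partial>cell_measure) \<le> (\<integral>x. (c / 4 + 1)\<^sup>2 \<partial>cell_measure)"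
    proof (rule integral_mono)
      show "integrable cell_measure (\<lambda>x. (spread (N n) (\<rho> n) x)\<^sup>2)"
        by (rule bounded_integrable[OF seq_geo, where B="(c / 4 + 1)\<^sup>2"]) (use sq spread_measurable[OF seq_geo] in auto)
    qed (use sq in auto)
    then show ?case by (simp add: measure_cell_measure mult.commute)
  qed
  have "(\<lambda>n. (\<integral>x. spread (N n) (\<rho> n) x \<partial>cell_measure) / (2 * pi) ^ 3) \<longlonglongrightarrow> 4 * pi\<^sup>2 * c / (2 * pi) ^ 3"
    unfolding integral_spread[OF seq_geo] by (intro tendsto_divide tendsto_const integral_core_tendsto) simp
  then show "(\<lambda>n. (\<integral>x. spread (N n) (\<rho> n) x \<partial>cell_measure) / (2 * pi) ^ 3) \<longlonglongrightarrow> c / (2 * pi)"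
    by (simp add: power2_eq_square power3_eq_cube)
qed

text \<open>The squared flux is again a microscopically periodic weight, so that for frequencies
  below \<open>N n / 2\<close> its mean replaces it exactly.\<close>

lemma nrm2_flux_ftrig:
  assumes "2 * K < N n"
  shows "(\<Sum>j\<in>UNIV. nrm2 (\<lambda>x. of_real (flux (N n) (\<rho> n) j x) * ftrig \<eta> (ibox K) a x)) =
    (\<Sum>j\<in>UNIV. \<integral>x. (flux (N n) (\<rho> n) j x)\<^sup>2 \<partial>cell_measure) / (2 * pi) ^ 3 * nrm2 (ftrig \<eta> (ibox K) a)"
  unfolding sum_divide_distrib sum_distrib_right
proof (rule sum.cong[OF refl])
  fix j
  let ?p = "flux (N n) (\<rho> n) j" and ?\<phi> = "ftrig \<eta> (ibox K) a"
  let ?B = "2 * real (N n) * (1 / (2 * - ln (\<rho> n) * (\<rho> n)\<^sup>2))"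
  have "complex_of_real (nrm2 (\<lambda>x. of_real (?p x) * ?\<phi> x)) = ip (\<lambda>x. of_real (?p x) * (of_real (?p x) * ?\<phi> x)) ?\<phi>"
    unfolding ip_self[symmetric] ip_weight_swap ..
  also have "\<dots> = ip (\<lambda>x. of_real ((?p x)\<^sup>2) * ?\<phi> x) ?\<phi>" by (simp add: power2_eq_square mult.assoc)
  also have "\<dots> = of_real ((\<integral>x. (?p x)\<^sup>2 \<partial>cell_measure) / (2 * pi) ^ 3) * ip ?\<phi> ?\<phi>"
  proof (rule ip_weighted_ftrig[where B="?B\<^sup>2" and N="N n"])
    show "cell_inv (N n) (\<lambda>x. (?p x)\<^sup>2)" using cell_inv_flux[OF seq_geo, of n j] unfolding cell_inv_def by simp
    show "(\<lambda>x. (?p x)\<^sup>2) \<in> borel_measurable borel" using flux_measurable[OF seq_geo, of n j] by simp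
    show "\<bar>(?p x)\<^sup>2\<bar> \<le> ?B\<^sup>2" for x using power_mono[OF flux_bound[OF seq_geo, of n j x], of 2] by simp
    show "\<bar>k $ i - l $ i\<bar> < int (N n)" if "k \<in> ibox K" "l \<in> ibox K" for k l i
    proof -
      have "\<bar>k $ i\<bar> \<le> int K" "\<bar>l $ i\<bar> \<le> int K" using that by (auto simp: ibox_def)
      then show ?thesis using assms by linarith
    qed
  qed simp_all
  finally show "nrm2 (\<lambda>x. of_real (?p x) * ?\<phi> x) = (\<integral>x. (?p x)\<^sup>2 \<partial>cell_measure) / (2 * pi) ^ 3 * nrm2 ?\<phi>"
    unfolding ip_self of_real_mult[symmetric] of_real_eq_iff .
qed

text \<open>The weight \<open>core\<close> is as large as \<open>B\<close>, of order
  \<open>N^2 / (- ln \<rho> * \<rho>^2)\<close>, but it lives on the tubes. Through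
  \<open>core^2 \<le> B core\<close> one factor is absorbed by the bounded integral of
  \<open>core\<close>; the other is left to be balanced by the smallness of \<open>f\<close> on the
  tubes.\<close>

lemma ip_core_bound:
  assumes f: "f \<in> cell_L2" and M: "nrm2 (\<lambda>x. of_real (indicator {x. sig (N n) x \<le> (\<rho> n)\<^sup>2} x) * f x) \<le> M"
    and h: "h \<in> borel_measurable borel" "\<And>x. cmod (h x) \<le> H"
  shows "(cmod (ip f (\<lambda>x. of_real (core (N n) (\<rho> n) x) * h x)))\<^sup>2 \<le>
    M * (H\<^sup>2 * (2 * ((real (N n))\<^sup>2 / - ln (\<rho> n)) / (\<rho> n)\<^sup>2 * (\<integral>x. core (N n) (\<rho> n) x \<partial>cell_measure)))"
proof -
  define u where "u = (indicator {x. sig (N n) x \<le> (\<rho> n)\<^sup>2} :: real^3 \<Rightarrow> real)"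
  define q where "q = core (N n) (\<rho> n)"
  define B where "B = 2 * ((real (N n))\<^sup>2 / - ln (\<rho> n)) / (\<rho> n)\<^sup>2"
  have q: "0 \<le> q x" "q x \<le> B" for x
    using core_bounds[OF seq_geo, of n x] by (auto simp: q_def B_def)
  have q_abs: "\<bar>q x\<bar> \<le> B" for x using q[of x] by simp
  have [measurable]: "q \<in> borel_measurable borel" "u \<in> borel_measurable borel"
    using core_measurable[OF seq_geo] by (auto simp: q_def u_def)
  have uq: "u x * q x = q x" for x by (simp add: u_def q_def core_def)
  have u: "\<bar>u x\<bar> \<le> 1" for x by (simp add: u_def indicator_def)
  have "ip f (\<lambda>x. of_real (q x) * h x) = ip f (\<lambda>x. of_real (u x) * (of_real (q x) * h x))"
    by (simp only: mult.assoc[symmetric] of_real_mult[symmetric] uq)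
  also have "\<dots> = ip (\<lambda>x. of_real (u x) * f x) (\<lambda>x. of_real (q x) * h x)" by (rule ip_weight_swap)
  finally have eq: "ip f (\<lambda>x. of_real (q x) * h x) = ip (\<lambda>x. of_real (u x) * f x) (\<lambda>x. of_real (q x) * h x)" .
  have "cmod (ip f (\<lambda>x. of_real (q x) * h x)) \<le> sqrt (nrm2 (\<lambda>x. of_real (u x) * f x)) * sqrt (nrm2 (\<lambda>x. of_real (q x) * h x))"
  proof -
    show ?thesis unfolding eq
    proof (rule Cauchy_Schwarz_ip)
      show "(\<lambda>x. of_real (u x) * f x) \<in> cell_L2" by (rule cell_L2_mult_bounded[OF f, where B=1]) (use u in auto)
      show "(\<lambda>x. of_real (q x) * h x) \<in> cell_L2"
        by (rule cell_L2_mult_bounded[OF cell_L2_bounded[OF h], where B=B]) (use q_abs in auto)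
    qed
  qed
  from power_mono[OF this, of 2]
  have "(cmod (ip f (\<lambda>x. of_real (q x) * h x)))\<^sup>2 \<le> nrm2 (\<lambda>x. of_real (u x) * f x) * nrm2 (\<lambda>x. of_real (q x) * h x)"
    by (simp add: power_mult_distrib)
  also have "\<dots> \<le> M * (H\<^sup>2 * (B * (\<integral>x. q x \<partial>cell_measure)))"
  proof (rule mult_mono)
    have "nrm2 (\<lambda>x. of_real (q x) * h x) \<le> H\<^sup>2 * (\<integral>x. (q x)\<^sup>2 \<partial>cell_measure)"
      by (rule nrm2_weighted_le[OF _ q_abs h]) simp
    also have "(\<integral>x. (q x)\<^sup>2 \<partial>cell_measure) \<le> (\<integral>x. B * q x \<partial>cell_measure)"
    proof (rule integral_mono)
      have "\<bar>(q x)\<^sup>2\<bar> \<le> B\<^sup>2" for x using power_mono[OF q_abs[of x], of 2] by simp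
      then show "integrable cell_measure (\<lambda>x. (q x)\<^sup>2)"
        by (intro bounded_integrable[OF seq_geo, where B="B\<^sup>2"]) auto
      show "integrable cell_measure (\<lambda>x. B * q x)"
        unfolding q_def by (intro Bochner_Integration.integrable_mult_right core_integrable[OF seq_geo])
      show "(q x)\<^sup>2 \<le> B * q x" for x unfolding power2_eq_square by (rule mult_right_mono[OF q(2) q(1)])
    qed
    finally show "nrm2 (\<lambda>x. of_real (q x) * h x) \<le> H\<^sup>2 * (B * (\<integral>x. q x \<partial>cell_measure))"
      by (simp add: mult_left_mono)
    show "nrm2 (\<lambda>x. of_real (u x) * f x) \<le> M" using M by (simp add: u_def)
    show "0 \<le> M" using M nrm2_nonneg[of "\<lambda>x. of_real (u x) * f x"] unfolding u_def by linarith
  qed simp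
  finally show ?thesis by (simp add: q_def B_def)
qed

end

lemma homogenized_lower_bound:
  fixes N :: "nat \<Rightarrow> nat" and r b :: "nat \<Rightarrow> real" and f :: "nat \<Rightarrow> real^3 \<Rightarrow> complex"
  assumes N: "\<And>n. N n \<ge> 1" and N_lim: "filterlim N at_top sequentially"
    and r: "\<And>n. 0 < r n" "\<And>n. r n \<le> 1" "r \<longlonglongrightarrow> 0" and b: "\<And>n. b n \<ge> 1"
    and br: "filterlim (\<lambda>n. b n * (r n)\<^sup>2) at_top sequentially"
    and q: "(\<lambda>n. (real (N n))\<^sup>2 / - ln (r n)) \<longlonglongrightarrow> c"
    and fg: "\<And>n. fgrad \<eta> (f n) (g n)"
    and E: "\<And>n. energy (conductivity (1 / real (N n)) (r n) (b n)) (g n) \<le> C"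
    and F: "F \<in> cell_L2" and lim: "(\<lambda>n. nrm2 (\<lambda>x. f n x - F x)) \<longlonglongrightarrow> 0"
    and \<eta>3: "\<eta> $ 3 \<notin> \<int>" and k0: "\<And>k. norm (\<eta> + ivec k0) \<le> norm (\<eta> + ivec k)"
  shows "((norm (\<eta> + ivec k0))\<^sup>2 + c / (2 * pi)) * nrm2 F \<le> C"
proof -
  \<comment> \<open>Below \<open>r n / 3\<close> the tubes lie inside the fibers; above
    \<open>r n / 4\<close> the logarithm and \<open>b n * (\<rho> n)^2\<close> remain comparable
    with those of \<open>r n\<close>.\<close>
  have "\<forall>n. \<exists>\<rho>. r n / 4 < \<rho> \<and> \<rho> < r n / 3 \<and> (AE x in lborel. sig (N n) x \<noteq> \<rho>\<^sup>2)"
  proof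
    fix n
    show "\<exists>\<rho>. r n / 4 < \<rho> \<and> \<rho> < r n / 3 \<and> (AE x in lborel. sig (N n) x \<noteq> \<rho>\<^sup>2)"
      by (rule generic_level[of "r n / 4" "r n / 3" "N n"]) (use r(1)[of n] in auto)
  qed
  from choice[OF this] obtain \<rho> where \<rho>: "\<And>n. r n / 4 < \<rho> n" "\<And>n. \<rho> n < r n / 3" and level: "\<And>n. AE x in lborel. sig (N n) x \<noteq> (\<rho> n)\<^sup>2"
    by auto
  have \<rho>0: "\<rho> n > 0" for n using \<rho>(1)[of n] r(1)[of n] by linarith
  have \<rho>2: "\<rho> n \<le> 1 / 2" for n using \<rho>(2)[of n] r(2)[of n] by linarith
  have \<rho>1: "\<rho> n < 1" for n using \<rho>2[of n] by linarith
  have \<rho>': "r n / 4 \<le> \<rho> n" "\<rho> n \<le> 2 * r n" "\<rho> n \<le> r n / 3" for n using \<rho>(1)[of n] \<rho>(2)[of n] r(1)[of n] by linarith+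
  note lims = tendsto_scaled_log[OF r(1) r(3) \<rho>'(1) \<rho>'(2) q]
  note sq = N N_lim \<rho>0 \<rho>2 level lims
  note geo = N \<rho>0 \<rho>1 level
  define d where "d = \<bar>\<eta> $ 3 - of_int (round (\<eta> $ 3))\<bar>"
  have d0: "d > 0"
  proof -
    have "\<eta> $ 3 \<noteq> of_int (round (\<eta> $ 3))" using \<eta>3 by (metis Ints_of_int)
    then show ?thesis by (simp add: d_def)
  qed
  have d: "d \<le> \<bar>\<eta> $ 3 + of_int k\<bar>" for k :: int
    using round_diff_minimal[of "\<eta> $ 3" "- k"] by (simp add: d_def)
  have f: "f n \<in> cell_L2" for n by (rule fgradD(1)[OF fg])
  have g: "g n j \<in> cell_L2" for n j by (rule fgradD(2)[OF fg])
  have b0: "b n > 0" for n using b[of n] by linarith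
  have nrm_g: "(\<Sum>j\<in>UNIV. nrm2 (g n j)) \<le> C" for n
  proof -
    have "energy (\<lambda>_. 1) (g n) \<le> energy (conductivity (1 / real (N n)) (r n) (b n)) (g n)"
    proof (rule energy_mono[OF _ _ conductivity_measurable conductivity_abs_bound[OF b0]])
      show "1 \<le> conductivity (1 / real (N n)) (r n) (b n) x" for x
        using conductivity_bounds(1)[OF b0[of n], of "1 / real (N n)" "r n" x] b[of n] by simp
    qed (auto simp: g)
    then show ?thesis using E[of n] by (simp add: energy_const)
  qed
  have C0: "C \<ge> 0"
    by (rule order_trans[OF _ nrm_g[of 0]]) (intro sum_nonneg, simp)
  have K: "((norm (\<eta> + ivec k0))\<^sup>2 + c / (2 * pi)) * (\<Sum>k\<in>ibox K. (cmod (fc \<eta> F k))\<^sup>2) \<le> C" for K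
  proof -
    define a where "a = fc \<eta> F"
    define \<phi> where "\<phi> = ftrig \<eta> (ibox K) a"
    define \<phi>' where "\<phi>' j = ftrig \<eta> (ibox K) (fgradc \<eta> a j)" for j
    define p where "p n j = flux (N n) (\<rho> n) j" for n j
    define s where "s n = spread (N n) (\<rho> n)" for n
    define q where "q n = core (N n) (\<rho> n)" for n
    have \<phi>_L2 [simp]: "\<phi> \<in> cell_L2" "\<phi>' j \<in> cell_L2" for j by (simp_all add: \<phi>_def \<phi>'_def)
    have nrm_\<phi>: "nrm2 \<phi> = (\<Sum>k\<in>ibox K. (cmod (a k))\<^sup>2)" by (simp add: \<phi>_def nrm2_ftrig)
    \<comment> \<open>\<open>\<phi>\<close> is the orthogonal projection of \<open>F\<close> onto
      finitely many frequencies.\<close>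
    have ip_F: "ip F \<phi> = of_real (nrm2 \<phi>)"
      unfolding nrm_\<phi> unfolding \<phi>_def
      by (subst ip_ftrig) (simp_all add: F a_def complex_norm_square mult.commute del: of_real_power)
    have p_L2 [simp]: "(\<lambda>x. of_real (p n j x) * h x) \<in> cell_L2" if "h \<in> cell_L2" for n j h
      unfolding p_def
      by (rule cell_L2_mult_bounded[OF that, where B="2 * real (N n) * (1 / (2 * - ln (\<rho> n) * (\<rho> n)\<^sup>2))"])
        (use flux_measurable[OF geo] flux_bound[OF geo] in \<open>auto simp del: abs_divide\<close>)
    have s_L2: "(\<lambda>x. of_real (s n x) * \<phi> x) \<in> cell_L2" for n
      unfolding s_def
      by (rule cell_L2_mult_bounded[OF \<phi>_L2(1), where B="(real (N n))\<^sup>2 / (4 * - ln (\<rho> n))"])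
        (use spread_measurable[OF geo] spread_bounds[OF geo] in auto)
    have q_L2: "(\<lambda>x. of_real (q n x) * \<phi> x) \<in> cell_L2" for n
      unfolding q_def
      by (rule cell_L2_mult_bounded[OF \<phi>_L2(1), where B="(real (N n))\<^sup>2 * 4 / (2 * - ln (\<rho> n) * (\<rho> n)\<^sup>2)"])
        (use core_measurable[OF geo] core_bounds[OF geo] in auto)
    obtain U where U: "U \<longlonglongrightarrow> 4 * pi\<^sup>2 * c" "\<And>n. (\<Sum>j\<in>UNIV. \<integral>x. (flux (N n) (\<rho> n) j x)\<^sup>2 \<partial>cell_measure) \<le> U n"
      by (rule integral_flux_sq_limit[OF sq]) blast
    \<comment> \<open>The tangent inequality summed over the components, with the product of
      \<open>g n\<close> and the flux rewritten by \<open>div\<close> and the squared flux replaced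
      by its bound \<open>U\<close>; every remaining term has a limit.\<close>
    define Y where "Y n = (\<Sum>j\<in>UNIV. 2 * Re (ip (g n j) (\<phi>' j)) - nrm2 (\<phi>' j) - 2 * Re (ip (\<phi>' j) (\<lambda>x. of_real (p n j x) * \<phi> x)))
      + 2 * (Re (ip (f n) (\<lambda>x. of_real (s n x) * \<phi> x)) - Re (ip (f n) (\<lambda>x. of_real (q n x) * \<phi> x))
        - (\<Sum>j\<in>UNIV. Re (ip (f n) (\<lambda>x. of_real (p n j x) * \<phi>' j x)))) - U n / (2 * pi) ^ 3 * nrm2 \<phi>" for n
    \<comment> \<open>Integration by parts moves the derivative onto the flux, where it gives
      \<open>core - spread\<close>, and onto \<open>\<phi>\<close>. It thereby removes the gradient
      of \<open>f n\<close>, for which no strong convergence is available, from its product with an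
      oscillating factor.\<close>
    have div: "(\<Sum>j\<in>UNIV. Re (ip (g n j) (\<lambda>x. of_real (p n j x) * \<phi> x))) =
      Re (ip (f n) (\<lambda>x. of_real (s n x) * \<phi> x)) - Re (ip (f n) (\<lambda>x. of_real (q n x) * \<phi> x))
        - (\<Sum>j\<in>UNIV. Re (ip (f n) (\<lambda>x. of_real (p n j x) * \<phi>' j x)))" for n
    proof -
      define dp where "dp j = dflux (N n) (\<rho> n) j j" for j
      have dp_L2: "(\<lambda>x. of_real (dp j x) * \<phi> x) \<in> cell_L2" for j
        unfolding dp_def
      proof (rule cell_L2_mult_bounded[OF \<phi>_L2(1)])
        show "(\<lambda>x. complex_of_real (dflux (N n) (\<rho> n) j j x)) \<in> borel_measurable borel"
          using dflux_measurable[OF geo, of n j j] by simp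
        show "cmod (of_real (dflux (N n) (\<rho> n) j j x)) \<le> 2 * (real (N n))\<^sup>2 * (1 / (2 * - ln (\<rho> n) * (\<rho> n)\<^sup>2)) + 2 * real (N n) * (2 * real (N n)) / (2 * - ln (\<rho> n) * ((\<rho> n)\<^sup>2)\<^sup>2)" for x
          unfolding norm_of_real by (rule dflux_bound[OF geo])
      qed
      have "ip (g n j) (\<lambda>x. of_real (p n j x) * \<phi> x) = - ip (f n) (\<lambda>x. of_real (dp j x) * \<phi> x + of_real (p n j x) * \<phi>' j x)" for j
        unfolding p_def \<phi>_def \<phi>'_def dp_def by (rule ip_fgrad[OF fg per_lip_ftrig[OF per_lip_flux[OF geo]]])
      also have "- ip (f n) (\<lambda>x. of_real (dp j x) * \<phi> x + of_real (p n j x) * \<phi>' j x) =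
          - ip (f n) (\<lambda>x. of_real (dp j x) * \<phi> x) - ip (f n) (\<lambda>x. of_real (p n j x) * \<phi>' j x)" for j
        by (simp add: ip_add_right f dp_L2)
      finally have *: "ip (g n j) (\<lambda>x. of_real (p n j x) * \<phi> x) =
          - ip (f n) (\<lambda>x. of_real (dp j x) * \<phi> x) - ip (f n) (\<lambda>x. of_real (p n j x) * \<phi>' j x)" for j .
      have "(\<Sum>j\<in>UNIV. ip (f n) (\<lambda>x. of_real (dp j x) * \<phi> x)) = ip (f n) (\<lambda>x. \<Sum>j\<in>UNIV. of_real (dp j x) * \<phi> x)"
        by (rule ip_sum_right[symmetric]) (simp_all add: dp_L2 f)
      also have "(\<lambda>x. \<Sum>j\<in>UNIV. of_real (dp j x) * \<phi> x) = (\<lambda>x. of_real (q n x) * \<phi> x - of_real (s n x) * \<phi> x)"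
        using div_flux[OF geo, of n] unfolding sum_distrib_right[symmetric] of_real_sum[symmetric] dp_def q_def s_def
        by (simp add: left_diff_distrib)
      also have "ip (f n) \<dots> = ip (f n) (\<lambda>x. of_real (q n x) * \<phi> x) - ip (f n) (\<lambda>x. of_real (s n x) * \<phi> x)"
        by (rule ip_diff_right) (simp_all add: q_L2 s_L2 f)
      finally have "Re (\<Sum>j\<in>UNIV. ip (f n) (\<lambda>x. of_real (dp j x) * \<phi> x)) =
          Re (ip (f n) (\<lambda>x. of_real (q n x) * \<phi> x)) - Re (ip (f n) (\<lambda>x. of_real (s n x) * \<phi> x))" by simp
      then show ?thesis unfolding * by (simp add: sum_subtractf sum_negf)
    qed
    have "Y n \<le> C" if n: "2 * K + 1 \<le> N n" for n
    proof -
      \<comment> \<open>Expanded nonnegativity of the squared distance between \<open>g n j\<close>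
        and the tangent point \<open>\<phi>' j + p n j \<phi>\<close>.\<close>
      have 1: "2 * Re (ip (g n j) (\<phi>' j)) + 2 * Re (ip (g n j) (\<lambda>x. of_real (p n j x) * \<phi> x))
          - nrm2 (\<phi>' j) - 2 * Re (ip (\<phi>' j) (\<lambda>x. of_real (p n j x) * \<phi> x)) - nrm2 (\<lambda>x. of_real (p n j x) * \<phi> x) \<le> nrm2 (g n j)" for j
      proof -
        define h where "h = (\<lambda>x. \<phi>' j x + of_real (p n j x) * \<phi> x)"
        have h: "h \<in> cell_L2" unfolding h_def by (rule cell_L2_add) simp_all
        have "0 \<le> nrm2 (\<lambda>x. g n j x - h x)" by simp
        also have "\<dots> = nrm2 (g n j) - 2 * Re (ip (g n j) h) + nrm2 h" by (rule nrm2_diff[OF g h])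
        also have "ip (g n j) h = ip (g n j) (\<phi>' j) + ip (g n j) (\<lambda>x. of_real (p n j x) * \<phi> x)"
          unfolding h_def by (rule ip_add_right) (simp_all add: g)
        also have "nrm2 h = nrm2 (\<phi>' j) + 2 * Re (ip (\<phi>' j) (\<lambda>x. of_real (p n j x) * \<phi> x)) + nrm2 (\<lambda>x. of_real (p n j x) * \<phi> x)"
          unfolding h_def by (rule nrm2_add) simp_all
        finally show ?thesis by simp
      qed
      have "(\<Sum>j\<in>UNIV. 2 * Re (ip (g n j) (\<phi>' j)) + 2 * Re (ip (g n j) (\<lambda>x. of_real (p n j x) * \<phi> x))
          - nrm2 (\<phi>' j) - 2 * Re (ip (\<phi>' j) (\<lambda>x. of_real (p n j x) * \<phi> x)) - nrm2 (\<lambda>x. of_real (p n j x) * \<phi> x)) \<le> C"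
        by (rule order_trans[OF sum_mono[OF 1] nrm_g])
      moreover have "(\<Sum>j\<in>UNIV. nrm2 (\<lambda>x. of_real (p n j x) * \<phi> x)) \<le> U n / (2 * pi) ^ 3 * nrm2 \<phi>"
      proof -
        have "(\<Sum>j\<in>UNIV. nrm2 (\<lambda>x. of_real (p n j x) * \<phi> x)) = (\<Sum>j\<in>UNIV. \<integral>x. (flux (N n) (\<rho> n) j x)\<^sup>2 \<partial>cell_measure) / (2 * pi) ^ 3 * nrm2 \<phi>"
          unfolding p_def \<phi>_def by (rule nrm2_flux_ftrig[OF sq]) (use n in simp)
        also have "\<dots> \<le> U n / (2 * pi) ^ 3 * nrm2 \<phi>"
          by (intro mult_right_mono divide_right_mono U(2)) simp_all
        finally show ?thesis .
      qed
      ultimately show ?thesis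
        unfolding Y_def div[symmetric] by (simp add: sum.distrib sum_subtractf sum_distrib_left[symmetric])
    qed
    moreover have "\<forall>\<^sub>F n in sequentially. 2 * K + 1 \<le> N n"
      using N_lim unfolding filterlim_at_top by simp
    ultimately have Y_le: "\<forall>\<^sub>F n in sequentially. Y n \<le> C" by (rule eventually_mono[rotated])
    \<comment> \<open>The product involves finitely many coefficients of \<open>g n j\<close>, each
      a multiple of a coefficient of \<open>f n\<close>, and these converge.\<close>
    have lim_g: "(\<lambda>n. ip (g n j) (\<phi>' j)) \<longlonglongrightarrow> of_real (nrm2 (\<phi>' j))" for j
    proof -
      have eq: "ip (g n j) (\<phi>' j) = (\<Sum>k\<in>ibox K. cnj (fgradc \<eta> a j k) * (\<i> * of_real ((\<eta> + ivec k) $ j) * ip (f n) (ek \<eta> k)))" for n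
        unfolding \<phi>'_def ip_ftrig[OF finite_ibox g] fgradD(3)[OF fg] unfolding fc_def by (rule refl)
      have "(\<lambda>n. \<Sum>k\<in>ibox K. cnj (fgradc \<eta> a j k) * (\<i> * of_real ((\<eta> + ivec k) $ j) * ip (f n) (ek \<eta> k)))
          \<longlonglongrightarrow> (\<Sum>k\<in>ibox K. cnj (fgradc \<eta> a j k) * (\<i> * of_real ((\<eta> + ivec k) $ j) * ip F (ek \<eta> k)))"
        by (intro tendsto_sum tendsto_mult tendsto_const ip_tendsto_left[OF f F ek_L2 lim])
      also have "(\<Sum>k\<in>ibox K. cnj (fgradc \<eta> a j k) * (\<i> * of_real ((\<eta> + ivec k) $ j) * ip F (ek \<eta> k))) = (\<Sum>k\<in>ibox K. of_real ((cmod (fgradc \<eta> a j k))\<^sup>2))"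
        unfolding complex_norm_square by (intro sum.cong refl) (simp add: fgradc_def a_def fc_def mult_ac)
      also have "\<dots> = of_real (nrm2 (\<phi>' j))" by (simp add: \<phi>'_def nrm2_ftrig)
      finally show ?thesis unfolding eq .
    qed
    have lim_p: "(\<lambda>n. ip (\<phi>' j) (\<lambda>x. of_real (p n j x) * \<phi> x)) \<longlonglongrightarrow> 0" for j
      unfolding p_def \<phi>_def by (rule ip_flux_tendsto[OF sq, where h="\<lambda>_. \<phi>' j" and H="\<phi>' j"]) (simp_all add: nrm2_def)
    have lim_fp: "(\<lambda>n. ip (f n) (\<lambda>x. of_real (p n j x) * \<phi>' j x)) \<longlonglongrightarrow> 0" for j
      unfolding p_def \<phi>'_def by (rule ip_flux_tendsto[OF sq f F lim])
    have lim_s: "(\<lambda>n. ip (f n) (\<lambda>x. of_real (s n x) * \<phi> x)) \<longlonglongrightarrow> of_real (c / (2 * pi)) * of_real (nrm2 \<phi>)"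
      unfolding s_def ip_F[symmetric] unfolding \<phi>_def by (rule ip_spread_tendsto[OF sq f F lim])
    have lim_q: "(\<lambda>n. ip (f n) (\<lambda>x. of_real (q n x) * \<phi> x)) \<longlonglongrightarrow> 0"
    proof -
      define H where "H = (\<Sum>k\<in>ibox K. cmod (a k * of_real (1 / sqrt ((2 * pi) ^ 3))))"
      have H: "cmod (\<phi> x) \<le> H" for x unfolding \<phi>_def H_def by (rule ftrig_bounded)
      define Q where "Q n = (real (N n))\<^sup>2 / - ln (\<rho> n)" for n
      define I where "I n = (\<integral>x. core (N n) (\<rho> n) x \<partial>cell_measure)" for n
      have Q0: "Q n \<ge> 0" for n unfolding Q_def using minus_ln_pos[OF geo, of n] by (intro divide_nonneg_nonneg) simp_all
      have I0: "I n \<ge> 0" for n unfolding I_def using core_bounds(1)[OF geo] by (rule Bochner_Integration.integral_nonneg)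
      \<comment> \<open>The size \<open>1 / \<rho>^2\<close> of \<open>core\<close> meets the factor
        \<open>1 / b\<close> from the energy estimate; what remains is \<open>1 / (b * r^2)\<close>,
        which tends to zero by hypothesis.\<close>
      have bound: "(cmod (ip (f n) (\<lambda>x. of_real (q n x) * \<phi> x)))\<^sup>2 \<le> (C / d\<^sup>2 * H\<^sup>2 * 2 * Q n * I n) * (16 * inverse (b n * (r n)\<^sup>2))" for n
      proof -
        have "b n * (d\<^sup>2 * nrm2 (\<lambda>x. of_real (indicator {x. sig (N n) x \<le> (\<rho> n)\<^sup>2} x) * f n x)) \<le> C"
          by (rule core_energy_estimate[OF N r(1) \<rho>0 \<rho>'(3) b fg d _ E]) (use d0 in simp)
        then have M: "nrm2 (\<lambda>x. of_real (indicator {x. sig (N n) x \<le> (\<rho> n)\<^sup>2} x) * f n x) \<le> C / (b n * d\<^sup>2)"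
          using b0[of n] d0 by (subst pos_le_divide_eq) (simp_all add: mult_ac)
        have "(cmod (ip (f n) (\<lambda>x. of_real (q n x) * \<phi> x)))\<^sup>2 \<le> C / (b n * d\<^sup>2) * (H\<^sup>2 * (2 * Q n / (\<rho> n)\<^sup>2 * I n))"
          unfolding q_def Q_def I_def
          by (rule ip_core_bound[OF sq f M cell_L2_measurable[OF \<phi>_L2(1)] H])
        also have "\<dots> = (C / d\<^sup>2 * H\<^sup>2 * 2 * Q n * I n) * inverse (b n * (\<rho> n)\<^sup>2)"
          by (simp add: divide_inverse inverse_mult_distrib mult_ac)
        also have "\<dots> \<le> (C / d\<^sup>2 * H\<^sup>2 * 2 * Q n * I n) * (16 * inverse (b n * (r n)\<^sup>2))"
        proof (rule mult_left_mono)
          have "(r n / 4)\<^sup>2 \<le> (\<rho> n)\<^sup>2" using \<rho>'(1)[of n] r(1)[of n] by (intro power_mono) simp_all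
          then have "b n * ((r n)\<^sup>2 / 16) \<le> b n * (\<rho> n)\<^sup>2" using b0[of n] by (intro mult_left_mono) (simp_all add: power_divide)
          moreover have "b n * ((r n)\<^sup>2 / 16) > 0" using b0[of n] r(1)[of n] by simp
          ultimately have "inverse (b n * (\<rho> n)\<^sup>2) \<le> inverse (b n * ((r n)\<^sup>2 / 16))" by (rule le_imp_inverse_le)
          also have "inverse (b n * ((r n)\<^sup>2 / 16)) = 16 * inverse (b n * (r n)\<^sup>2)"
            using b0[of n] r(1)[of n] by (simp add: field_simps)
          finally show "inverse (b n * (\<rho> n)\<^sup>2) \<le> 16 * inverse (b n * (r n)\<^sup>2)" .
          show "0 \<le> C / d\<^sup>2 * H\<^sup>2 * 2 * Q n * I n"
            by (intro mult_nonneg_nonneg divide_nonneg_nonneg Q0 I0 C0) simp_all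
        qed
        finally show ?thesis .
      qed
      have "(\<lambda>n. (C / d\<^sup>2 * H\<^sup>2 * 2 * Q n * I n) * (16 * inverse (b n * (r n)\<^sup>2))) \<longlonglongrightarrow> (C / d\<^sup>2 * H\<^sup>2 * 2 * c * (4 * pi\<^sup>2 * c)) * (16 * 0)"
        unfolding Q_def I_def
        by (intro tendsto_mult tendsto_const lims(3) integral_core_tendsto[OF sq] tendsto_inverse_0_at_top[OF br])
      then have lim0: "(\<lambda>n. (C / d\<^sup>2 * H\<^sup>2 * 2 * Q n * I n) * (16 * inverse (b n * (r n)\<^sup>2))) \<longlonglongrightarrow> 0" by simp
      have "(\<lambda>n. (cmod (ip (f n) (\<lambda>x. of_real (q n x) * \<phi> x)))\<^sup>2) \<longlonglongrightarrow> 0"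
        by (rule Lim_null_comparison[OF _ lim0]) (use bound in \<open>auto intro!: always_eventually\<close>)
      from tendsto_real_sqrt[OF this] show ?thesis by (simp add: tendsto_norm_zero_iff)
    qed
    \<comment> \<open>Twice the mean of \<open>spread\<close> minus once the limiting bound for the
      mean squared flux leaves a single \<open>c / (2 * pi)\<close>; likewise twice minus once the
      energy of \<open>\<phi>\<close> leaves it once.\<close>
    have "Y \<longlonglongrightarrow> (\<Sum>j\<in>UNIV. 2 * Re (of_real (nrm2 (\<phi>' j))) - nrm2 (\<phi>' j) - 2 * Re 0)
        + 2 * (Re (of_real (c / (2 * pi)) * of_real (nrm2 \<phi>)) - Re 0 - (\<Sum>j\<in>(UNIV :: 3 set). Re 0)) - 4 * pi\<^sup>2 * c / (2 * pi) ^ 3 * nrm2 \<phi>"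
      unfolding Y_def[abs_def]
      by (intro tendsto_diff tendsto_add tendsto_sum tendsto_mult tendsto_const tendsto_Re tendsto_divide lim_g lim_p lim_fp lim_s lim_q U(1)) simp
    from tendsto_upperbound[OF this Y_le]
    have "(\<Sum>j\<in>UNIV. nrm2 (\<phi>' j)) + c / (2 * pi) * nrm2 \<phi> \<le> C"
      by (simp add: power2_eq_square power3_eq_cube)
    moreover have "(norm (\<eta> + ivec k0))\<^sup>2 * nrm2 \<phi> \<le> (\<Sum>j\<in>UNIV. nrm2 (\<phi>' j))"
      unfolding \<phi>_def \<phi>'_def by (rule fgrad_lower_bound[OF fgrad_ftrig[OF finite_ibox] k0])
    ultimately show ?thesis unfolding nrm_\<phi> a_def by (simp add: ring_distribs)
  qed
  have "(\<lambda>K. ((norm (\<eta> + ivec k0))\<^sup>2 + c / (2 * pi)) * (\<Sum>k\<in>ibox K. (cmod (fc \<eta> F k))\<^sup>2)) \<longlonglongrightarrow> ((norm (\<eta> + ivec k0))\<^sup>2 + c / (2 * pi)) * nrm2 F"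
    by (intro tendsto_mult tendsto_const Parseval F)
  from LIMSEQ_le_const2[OF this] K show ?thesis by auto
qed

text \<open>By contradiction: if eigenvalues stay at most \<open>C\<close> along a subsequence,
  normalised minimisers have bounded gradients; compactness yields a limit of norm 1, which the
  homogenized lower bound excludes.\<close>

lemma Bloch_eigenvalue1_lower_limit:
  fixes N :: "nat \<Rightarrow> nat" and r b :: "nat \<Rightarrow> real"
  assumes N: "\<And>n. N n \<ge> 1" and N_lim: "filterlim N at_top sequentially"
    and r: "\<And>n. 0 < r n" "r \<longlonglongrightarrow> 0" and b: "\<And>n. b n > 0"
    and br: "filterlim (\<lambda>n. b n * (r n)\<^sup>2) at_top sequentially"
    and q: "(\<lambda>n. (real (N n))\<^sup>2 / - ln (r n)) \<longlonglongrightarrow> c"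
    and \<eta>3: "\<eta> $ 3 \<notin> \<int>" and k0: "\<And>k. norm (\<eta> + ivec k0) \<le> norm (\<eta> + ivec k)"
    and C: "C < (norm (\<eta> + ivec k0))\<^sup>2 + c / (2 * pi)"
  shows "\<forall>\<^sub>F n in sequentially. C < Bloch_eigenvalue1 (conductivity (1 / real (N n)) (r n) (b n)) \<eta>"
proof (rule ccontr)
  define A where "A n = conductivity (1 / real (N n)) (r n) (b n)" for n
  assume "\<not> (\<forall>\<^sub>F n in sequentially. C < Bloch_eigenvalue1 (conductivity (1 / real (N n)) (r n) (b n)) \<eta>)"
  then have freq: "\<exists>\<^sub>F n in sequentially. Bloch_eigenvalue1 (A n) \<eta> \<le> C"
    by (simp add: frequently_def not_le A_def)
  have r1: "\<forall>\<^sub>F n in sequentially. r n < 1" by (rule order_tendstoD(2)[OF r(2)]) simp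
  have br1: "\<forall>\<^sub>F n in sequentially. 1 \<le> b n * (r n)\<^sup>2" using br unfolding filterlim_at_top by simp
  \<comment> \<open>From \<open>b * r^2 \<ge> 1\<close> and \<open>r < 1\<close> follows
    \<open>b \<ge> 1\<close>, so that the energy dominates the Dirichlet integral and compactness
    applies.\<close>
  have good: "\<forall>\<^sub>F n in sequentially. r n \<le> 1 \<and> 1 \<le> b n"
    using r1 br1
  proof eventually_elim
    case (elim n)
    have "(r n)\<^sup>2 \<le> 1\<^sup>2" using elim r(1)[of n] by (intro power_mono) simp_all
    then have "b n * (r n)\<^sup>2 \<le> b n * 1" using b[of n] by (intro mult_left_mono) simp_all
    then show ?case using elim by linarith
  qed
  have "\<exists>\<^sub>F n in sequentially. Bloch_eigenvalue1 (A n) \<eta> \<le> C \<and> r n \<le> 1 \<and> 1 \<le> b n"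
    by (rule frequently_rev_mp[OF freq eventually_mono[OF good]]) simp
  then have "infinite {n. Bloch_eigenvalue1 (A n) \<eta> \<le> C \<and> r n \<le> 1 \<and> 1 \<le> b n}"
    unfolding cofinite_eq_sequentially[symmetric] frequently_cofinite .
  from infinite_enumerate[OF this] obtain s :: "nat \<Rightarrow> nat" where s: "strict_mono s"
    and s': "\<And>n. Bloch_eigenvalue1 (A (s n)) \<eta> \<le> C" "\<And>n. r (s n) \<le> 1" "\<And>n. 1 \<le> b (s n)" by auto
  have "\<forall>n. \<exists>p. fgrad \<eta> (fst p) (snd p) \<and> nrm2 (fst p) = 1 \<and> energy (A (s n)) (snd p) \<le> C"
  proof
    fix n
    have "min 1 (b (s n)) > 0" using b by simp
    from Bloch_minimizer[OF conductivity_measurable this conductivity_bounds(1)[OF b] conductivity_bounds(2)[OF b], of \<eta>]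
    obtain f g where "fgrad \<eta> f g" "nrm2 f = 1" "energy (A (s n)) g = Bloch_eigenvalue1 (A (s n)) \<eta>"
      unfolding A_def by metis
    then show "\<exists>p. fgrad \<eta> (fst p) (snd p) \<and> nrm2 (fst p) = 1 \<and> energy (A (s n)) (snd p) \<le> C"
      using s'(1)[of n] by (intro exI[of _ "(f, g)"]) simp
  qed
  from choice[OF this] obtain p where "\<forall>n. fgrad \<eta> (fst (p n)) (snd (p n)) \<and> nrm2 (fst (p n)) = 1 \<and> energy (A (s n)) (snd (p n)) \<le> C" ..
  then have fg: "\<And>n. fgrad \<eta> (fst (p n)) (snd (p n))" and f1: "\<And>n. nrm2 (fst (p n)) = 1" and E: "\<And>n. energy (A (s n)) (snd (p n)) \<le> C"
    by auto
  have nrm_g: "(\<Sum>j\<in>UNIV. nrm2 (snd (p n) j)) \<le> C" for n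
  proof -
    have "energy (\<lambda>_. 1) (snd (p n)) \<le> energy (A (s n)) (snd (p n))"
      unfolding A_def
    proof (rule energy_mono[OF _ _ conductivity_measurable conductivity_abs_bound[OF b]])
      show "1 \<le> conductivity (1 / real (N (s n))) (r (s n)) (b (s n)) x" for x
        using conductivity_bounds(1)[OF b[of "s n"], of "1 / real (N (s n))" "r (s n)" x] s'(3)[of n] by simp
    qed (auto simp: fgradD(2)[OF fg])
    then show ?thesis using E[of n] by (simp add: energy_const)
  qed
  have f1': "nrm2 (fst (p n)) \<le> 1" for n by (simp add: f1)
  obtain t F where t: "strict_mono t" and F: "F \<in> cell_L2" and lim: "(\<lambda>n. nrm2 (\<lambda>x. fst (p (t n)) x - F x)) \<longlonglongrightarrow> 0"
    by (rule Rellich_cell[OF fg f1' nrm_g])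
  have st: "strict_mono (\<lambda>n. s (t n))" using strict_mono_o[OF s t] by (simp add: comp_def)
  have "((norm (\<eta> + ivec k0))\<^sup>2 + c / (2 * pi)) * nrm2 F \<le> C"
  proof (rule homogenized_lower_bound[where N="\<lambda>n. N (s (t n))" and r="\<lambda>n. r (s (t n))" and b="\<lambda>n. b (s (t n))"
        and f="\<lambda>n. fst (p (t n))" and g="\<lambda>n. snd (p (t n))"])
    show "filterlim (\<lambda>n. N (s (t n))) at_top sequentially" by (rule filterlim_compose[OF N_lim filterlim_subseq[OF st]])
    show "(\<lambda>n. r (s (t n))) \<longlonglongrightarrow> 0" by (rule filterlim_compose[OF r(2) filterlim_subseq[OF st]])
    show "filterlim (\<lambda>n. b (s (t n)) * (r (s (t n)))\<^sup>2) at_top sequentially" by (rule filterlim_compose[OF br filterlim_subseq[OF st]])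
    show "(\<lambda>n. (real (N (s (t n))))\<^sup>2 / - ln (r (s (t n)))) \<longlonglongrightarrow> c" by (rule filterlim_compose[OF q filterlim_subseq[OF st]])
    show "energy (conductivity (1 / real (N (s (t n)))) (r (s (t n))) (b (s (t n)))) (snd (p (t n))) \<le> C" for n
      using E[of "t n"] by (simp add: A_def)
    show "norm (\<eta> + ivec k0) \<le> norm (\<eta> + ivec k)" for k by (rule k0)
  qed (fact N r(1) s'(2) s'(3) fg F lim \<eta>3)+
  moreover have "nrm2 F = 1"
  proof -
    have "(\<lambda>n. nrm2 (fst (p (t n)))) \<longlonglongrightarrow> nrm2 F" by (rule nrm2_tendsto[OF fgradD(1)[OF fg] F lim])
    then show ?thesis by (simp add: f1 LIMSEQ_const_iff)
  qed
  ultimately show False using C by simp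
qed

theorem Bloch_eigenvalue1_tendsto:
  fixes N :: "nat \<Rightarrow> nat" and r b :: "nat \<Rightarrow> real"
  assumes N: "\<And>n. N n \<ge> 1" and N_lim: "filterlim N at_top sequentially"
    and r: "\<And>n. 0 < r n" "r \<longlonglongrightarrow> 0" and b: "\<And>n. b n > 0"
    and br: "filterlim (\<lambda>n. b n * (r n)\<^sup>2) at_top sequentially"
    and q: "(\<lambda>n. (real (N n))\<^sup>2 / - ln (r n)) \<longlonglongrightarrow> c"
    and \<eta>3: "\<eta> $ 3 \<notin> \<int>" and k0: "\<And>k. norm (\<eta> + ivec k0) \<le> norm (\<eta> + ivec k)"
  shows "(\<lambda>n. Bloch_eigenvalue1 (conductivity (1 / real (N n)) (r n) (b n)) \<eta>) \<longlonglongrightarrow> (norm (\<eta> + ivec k0))\<^sup>2 + c / (2 * pi)"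
proof (rule order_tendstoI)
  fix y assume "y < (norm (\<eta> + ivec k0))\<^sup>2 + c / (2 * pi)"
  then show "\<forall>\<^sub>F n in sequentially. y < Bloch_eigenvalue1 (conductivity (1 / real (N n)) (r n) (b n)) \<eta>"
    by (rule Bloch_eigenvalue1_lower_limit[OF N N_lim r b br q \<eta>3 k0])
next
  fix y assume y: "(norm (\<eta> + ivec k0))\<^sup>2 + c / (2 * pi) < y"
  obtain U where U: "U \<longlonglongrightarrow> (norm (\<eta> + ivec k0))\<^sup>2 + c / (2 * pi)"
    "\<forall>\<^sub>F n in sequentially. Bloch_eigenvalue1 (conductivity (1 / real (N n)) (r n) (b n)) \<eta> \<le> U n"
    by (rule Bloch_eigenvalue1_upper_limit[OF N r b q, of \<eta> k0])
  show "\<forall>\<^sub>F n in sequentially. Bloch_eigenvalue1 (conductivity (1 / real (N n)) (r n) (b n)) \<eta> < y"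
    using U(2) order_tendstoD(2)[OF U(1) y] by eventually_elim (rule order.strict_trans1)
qed

theorem theorem3p1:
  fixes \<epsilon> :: "nat \<Rightarrow> real" and r \<beta> :: "real \<Rightarrow> real" and \<gamma> :: real
  assumes "\<And>n. \<epsilon> n > 0"
    and "\<epsilon> \<longlonglongrightarrow> 0"
    and "\<And>n. 1 / \<epsilon> n \<in> \<nat>"
    and "\<And>n. 0 < r (\<epsilon> n) \<and> r (\<epsilon> n) < pi"
    and "\<And>n. \<beta> (\<epsilon> n) > 0"
    and "filterlim (\<lambda>n. \<beta> (\<epsilon> n) * (r (\<epsilon> n))\<^sup>2) at_top sequentially"
    and "(\<lambda>n. 1 / (2 * pi * (\<epsilon> n)\<^sup>2 * \<bar>ln (r (\<epsilon> n))\<bar>)) \<longlonglongrightarrow> \<gamma>"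
    and "\<gamma> > 0"
  shows "(\<forall>\<eta> :: real^3. \<eta> $ 3 \<notin> \<int> \<longrightarrow>
            (\<lambda>n. Bloch_eigenvalue1 (conductivity (\<epsilon> n) (r (\<epsilon> n)) (\<beta> (\<epsilon> n))) \<eta>) \<longlonglongrightarrow>
            \<gamma> + (LEAST m. m \<in> {(LINT x:cell|lborel. (norm (g x))\<^sup>2) | \<psi> g.
                   \<psi> \<in> H1_Bloch \<eta> \<and> has_weak_gradient \<psi> g \<and>
                   (LINT x:cell|lborel. (cmod (\<psi> x))\<^sup>2) = 1})) \<and>
         (\<forall>\<eta> :: real^3. norm \<eta> \<le> 1 / 2 \<and> \<eta> $ 3 \<noteq> 0 \<longrightarrow>
            (\<lambda>n. Bloch_eigenvalue1 (conductivity (\<epsilon> n) (r (\<epsilon> n)) (\<beta> (\<epsilon> n))) \<eta>) \<longlonglongrightarrow>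
            \<gamma> + (norm \<eta>)\<^sup>2)"
proof -
  have "\<forall>n. \<exists>k :: nat. 1 / \<epsilon> n = real k" using assms(3) by (auto elim: Nats_cases)
  from choice[OF this] obtain N where N: "\<And>n. 1 / \<epsilon> n = real (N n)" by auto
  have \<epsilon>: "\<epsilon> n = 1 / real (N n)" for n unfolding N[symmetric] by simp
  have N1: "N n \<ge> 1" for n using assms(1)[of n] N[of n] by (cases "N n") auto
  define R where "R n = r (\<epsilon> n)" for n
  define b where "b n = \<beta> (\<epsilon> n)" for n
  define x where "x n = 1 / (2 * pi * (\<epsilon> n)\<^sup>2 * \<bar>ln (R n)\<bar>)" for n
  have R: "0 < R n" "R n < pi" for n using assms(4) by (auto simp: R_def)
  have x: "x \<longlonglongrightarrow> \<gamma>" unfolding x_def R_def by (rule assms(7))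
  have "filterlim (\<lambda>n. inverse (\<epsilon> n)) at_top sequentially"
    by (rule filterlim_inverse_at_top[OF assms(2)]) (simp add: assms(1))
  then have N_real: "filterlim (\<lambda>n. real (N n)) at_top sequentially" by (simp add: N[symmetric] inverse_eq_divide)
  have N_lim: "filterlim N at_top sequentially"
    unfolding filterlim_at_top
  proof
    fix Z
    have "\<forall>\<^sub>F n in sequentially. real Z \<le> real (N n)" using N_real unfolding filterlim_at_top by blast
    then show "\<forall>\<^sub>F n in sequentially. Z \<le> N n" by simp
  qed
  \<comment> \<open>If \<open>R n = 1\<close>, both sides are 0 by the convention for division by
    zero.\<close>
  have abs_ln: "\<bar>ln (R n)\<bar> = inverse (2 * pi * (\<epsilon> n)\<^sup>2 * x n)" for n
    using assms(1)[of n] by (simp add: x_def field_simps)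
  have "(\<lambda>n. 2 * pi * (\<epsilon> n)\<^sup>2 * x n) \<longlonglongrightarrow> 2 * pi * 0\<^sup>2 * \<gamma>" by (intro tendsto_intros assms(2) x)
  then have "(\<lambda>n. 2 * pi * (\<epsilon> n)\<^sup>2 * x n) \<longlonglongrightarrow> 0" by simp
  moreover have "\<forall>\<^sub>F n in sequentially. 0 < x n" by (rule order_tendstoD(1)[OF x assms(8)])
  then have "\<forall>\<^sub>F n in sequentially. 0 < 2 * pi * (\<epsilon> n)\<^sup>2 * x n"
  proof eventually_elim
    case (elim n)
    then show ?case using assms(1)[of n] by simp
  qed
  ultimately have abs_ln_lim: "filterlim (\<lambda>n. \<bar>ln (R n)\<bar>) at_top sequentially"
    unfolding abs_ln by (rule filterlim_inverse_at_top)
  then have "\<forall>\<^sub>F n in sequentially. pi < \<bar>ln (R n)\<bar>" unfolding filterlim_at_top_dense by blast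
  \<comment> \<open>As \<open>R n < pi\<close>, a positive logarithm stays below \<open>pi\<close>;
    hence a logarithm of larger modulus is negative.\<close>
  then have neg: "\<forall>\<^sub>F n in sequentially. \<bar>ln (R n)\<bar> = - ln (R n)"
  proof eventually_elim
    case (elim n)
    have "ln (R n) < pi" using ln_le_minus_one[OF R(1)[of n]] R(2)[of n] by linarith
    then show ?case using elim by linarith
  qed
  have "filterlim (\<lambda>n. - ln (R n)) at_top sequentially"
    by (rule filterlim_cong[OF refl refl neg, THEN iffD1, OF abs_ln_lim])
  then have "filterlim (\<lambda>n. ln (R n)) at_bot sequentially" by (simp add: filterlim_uminus_at_top)
  from filterlim_compose[OF exp_at_bot this] have R_lim: "R \<longlonglongrightarrow> 0" by (simp add: R(1))
  \<comment> \<open>The constant of the limit theorem is \<open>c = 2 * pi * \<gamma>\<close>, so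
    that \<open>c / (2 * pi) = \<gamma>\<close>.\<close>
  have "(\<lambda>n. 2 * pi * x n) \<longlonglongrightarrow> 2 * pi * \<gamma>" by (intro tendsto_intros x)
  moreover have "\<forall>\<^sub>F n in sequentially. 2 * pi * x n = (real (N n))\<^sup>2 / - ln (R n)"
    using neg
  proof eventually_elim
    case (elim n)
    show ?case unfolding elim[symmetric] by (simp add: x_def \<epsilon> power_divide)
  qed
  ultimately have q: "(\<lambda>n. (real (N n))\<^sup>2 / - ln (R n)) \<longlonglongrightarrow> 2 * pi * \<gamma>" by (rule Lim_transform_eventually)
  have b: "b n > 0" for n using assms(5) by (simp add: b_def)
  have br: "filterlim (\<lambda>n. b n * (R n)\<^sup>2) at_top sequentially" unfolding b_def R_def by (rule assms(6))
  have lim: "(\<lambda>n. Bloch_eigenvalue1 (conductivity (\<epsilon> n) (r (\<epsilon> n)) (\<beta> (\<epsilon> n))) \<eta>) \<longlonglongrightarrow> \<gamma> + (norm (\<eta> + ivec k0))\<^sup>2"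
    if "\<eta> $ 3 \<notin> \<int>" "\<And>k. norm (\<eta> + ivec k0) \<le> norm (\<eta> + ivec k)" for \<eta> :: "real^3" and k0
    using Bloch_eigenvalue1_tendsto[OF N1 N_lim R(1) R_lim b br q that]
    unfolding \<epsilon>[symmetric] R_def b_def by (simp add: add.commute)
  show ?thesis
  proof (intro conjI allI impI)
    fix \<eta> :: "real^3" assume \<eta>: "\<eta> $ 3 \<notin> \<int>"
    obtain k0 where k0: "\<And>k. norm (\<eta> + ivec k0) \<le> norm (\<eta> + ivec k)" by (rule nearest_lattice_point[of \<eta>]) blast
    have "(LEAST m. m \<in> {(LINT x:cell|lborel. (norm (g x))\<^sup>2) | \<psi> g.
        \<psi> \<in> H1_Bloch \<eta> \<and> has_weak_gradient \<psi> g \<and> (LINT x:cell|lborel. (cmod (\<psi> x))\<^sup>2) = 1}) = (norm (\<eta> + ivec k0))\<^sup>2"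
      using Bloch_eigenvalue1_homogeneous[OF k0] unfolding Bloch_eigenvalue1_def mult_1 .
    then show "(\<lambda>n. Bloch_eigenvalue1 (conductivity (\<epsilon> n) (r (\<epsilon> n)) (\<beta> (\<epsilon> n))) \<eta>) \<longlonglongrightarrow>
            \<gamma> + (LEAST m. m \<in> {(LINT x:cell|lborel. (norm (g x))\<^sup>2) | \<psi> g.
                   \<psi> \<in> H1_Bloch \<eta> \<and> has_weak_gradient \<psi> g \<and>
                   (LINT x:cell|lborel. (cmod (\<psi> x))\<^sup>2) = 1})"
      using lim[OF \<eta> k0] by (simp only:)
  next
    fix \<eta> :: "real^3" assume \<eta>: "norm \<eta> \<le> 1 / 2 \<and> \<eta> $ 3 \<noteq> 0"
    have small: "\<bar>\<eta> $ i\<bar> \<le> 1 / 2" for i using component_le_norm_cart[of \<eta> i] \<eta> by linarith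
    have iv0: "\<eta> + ivec 0 = \<eta>" by (simp add: vec_eq_iff)
    \<comment> \<open>Componentwise: adding a nonzero integer to a coordinate of modulus at most
      \<open>1 / 2\<close> cannot bring it closer to zero, so the zero lattice vector is
      optimal.\<close>
    have "norm (\<eta> + ivec 0) \<le> norm (\<eta> + ivec k)" for k
      unfolding iv0
    proof (rule norm_le_componentwise_cart)
      fix i
      show "norm (\<eta> $ i) \<le> norm ((\<eta> + ivec k) $ i)"
      proof (cases "k $ i = 0")
        case False
        then have "1 \<le> \<bar>k $ i\<bar>" by linarith
        then have "1 \<le> \<bar>real_of_int (k $ i)\<bar>" by linarith
        then show ?thesis using small[of i] by simp
      qed simp
    qed
    moreover have "\<eta> $ 3 \<notin> \<int>"
    proof
      assume "\<eta> $ 3 \<in> \<int>"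
      then obtain m :: int where m: "\<eta> $ 3 = of_int m" by (auto elim: Ints_cases)
      then have "\<bar>m\<bar> < 1" using small[of 3] by simp
      then show False using \<eta> m by simp
    qed
    ultimately have "(\<lambda>n. Bloch_eigenvalue1 (conductivity (\<epsilon> n) (r (\<epsilon> n)) (\<beta> (\<epsilon> n))) \<eta>) \<longlonglongrightarrow> \<gamma> + (norm (\<eta> + ivec 0))\<^sup>2"
      by (intro lim)
    then show "(\<lambda>n. Bloch_eigenvalue1 (conductivity (\<epsilon> n) (r (\<epsilon> n)) (\<beta> (\<epsilon> n))) \<eta>) \<longlonglongrightarrow> \<gamma> + (norm \<eta>)\<^sup>2"
      unfolding iv0 .
  qed
qed

end
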